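(* In the setting of the context (rank one perturbation $H=\Omega+|g\rangle\langle h|$ of the multiplication operator $\Omega$), we have the orthogonality relations $$\kappa(x)\kappa(x')=\delta(x-x')\kappa(x),\qquad p(x)p(x')=\delta(x-x')p(x),$$ $$p(x)|\alpha(x')\rangle=0,\qquad\langle\alpha'(x)|p(x')=0,\qquad\langle\alpha'(x)|\alpha(x')\rangle=\delta(x-x').$$ These relations have to be understood in the sense of distributions; e.g. the first one signifies $$\Big(\int dx_1\,\varphi_1(x_1)\langle f_1|\kappa(x_1)\Big)\Big(\int dx_2\,\varphi_2(x_2)\kappa(x_2)|f_2\rangle\Big)=\int dx\,\varphi_1(x)\varphi_2(x)\langle f_1|\kappa(x)|f_2\rangle$$ for $f_1,f_2\in\mathcal{D}(G)$ and $\varphi_1,\varphi_2\in\mathcal{D}(P(G))$, and the expressions make sense.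
   Context: Setting. $G\subset\mathbb{R}^n$ is open and bounded, $P:G\to\mathbb{R}$ is $C^\infty$, bounded with all its derivatives, with $\nabla P(y)\ne0$ for all $y\in G$ (so $P(G)\subset\mathbb{R}$ is open). $V=L^2(G)$, $\langle f_1|f_2\rangle=\int\overline{f_1}f_2\,dy$, $(\Omega f)(y)=P(y)f(y)$, $R_\Omega(z)=1/(z-\Omega)$. $\mathcal{D}(\cdot)$ denotes $C^\infty$ functions with compact support in the indicated open set. $S(x)=\{y\in G:P(y)=x\}$, $d\sigma_x$ is its Euclidean surface element, $d\tau_x(y)=d\sigma_x(y)/|\nabla P(y)|$. For $f_1,f_2\in\mathcal{D}(G)$, $x\in\mathbb{R}$: $$\langle f_1|\delta(x-\Omega)|f_2\rangle=\int_{S(x)}\overline{f_1(y)}f_2(y)\,d\tau_x(y),\qquad \langle f_1|\tfrac{\mathcal{P}}{x-\Omega}|f_2\rangle=\int d\omega\,\tfrac{\mathcal{P}}{x-\omega}\int_{S(\omega)}\overline{f_1(y)}f_2(y)\,d\tau_\omega(y)$$ ($\mathcal{P}$ = principal value). Ket-vectors are functionals $f\mapsto\langle f|\cdots\rangle$ on $\mathcal{D}(G)$ and bra-vectors functionals $f\mapsto\langle\cdots|f\rangle$; a product ket$\cdot$bra is the corresponding sesquilinear form. Let $g,h\in\mathcal{D}(G)$ be real, $H=\Omega+|g\rangle\langle h|$, with resolvent $R(z)=R_\Omega(z)+R_\Omega(z)|g\rangle\langle h|R_\Omega(z)/C(z)$, $C(z)=1-\langle h|R_\Omega(z)|g\rangle$.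 Let $K\subset G$ be compact containing the supports of $g,h$. Standing assumption: there are an open $G_1\subset\mathbb{R}$ containing $P(K)$ and an open interval $I\ni0$ such that, with $G_0=\{x+iu:x\in G_1,u\in I\}$, $C(z)$ is holomorphic and $\ne0$ in $G_0\setminus P(K)$ and $C(x\pm i0)=C_1(x)\pm i\pi C_2(x)\ne0$ for $x\in G_0\cap\mathbb{R}$, where $C_1(x)=1-\langle h|\frac{\mathcal{P}}{x-\Omega}|g\rangle$, $C_2(x)=\langle h|\delta(x-\Omega)|g\rangle$. It is also assumed that $C_2(x)=0$ implies $\delta(x-\Omega)|g\rangle=0$ and $\langle h|\delta(x-\Omega)=0$. For $f_1,f_2\in\mathcal{D}(G)$, $\langle f_1|\kappa(x)|f_2\rangle=\frac1{2\pi i}\big(\lim_{u\to0-}\langle f_1|R(x+iu)|f_2\rangle-\lim_{u\to0+}\langle f_1|R(x+iu)|f_2\rangle\big)$; $\langle f_1|\kappa(x)$ and $\kappa(x)|f_2\rangle$ denote the functionals on $\mathcal{D}(G)$ obtained by fixing one argument; after integration against a test function of $x$ they are elements of $L^2(G)$, and the product in the explicit form of the first relation is the $L^2(G)$ scalar product. One has $\kappa(x)=p(x)+|\alpha(x)\rangle\langle\alpha'(x)|$ if $C_2(x)\ne0$ and $\kappa(x)=\delta(x-\Omega)$ if $C_2(x)=0$, with $$p(x)=\delta(x-\Omega)-\frac{\delta(x-\Omega)|g\rangle\langle h|\delta(x-\Omega)}{\langle h|\delta(x-\Omega)|g\rangle},$$ $$|\alpha(x)\rangle=N(x)\Big(C_1(x)\delta(x-\Omega)|g\rangle+C_2(x)\tfrac{\mathcal{P}}{x-\Omega}|g\rangle\Big),\quad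 \langle\alpha'(x)|=N(x)\Big(C_1(x)\langle h|\delta(x-\Omega)+C_2(x)\langle h|\tfrac{\mathcal{P}}{x-\Omega}\Big),$$ and $N(x)^2=1/((C_1^2+\pi^2C_2^2)C_2)$. *)

theory Defs
  imports "HOL-Complex_Analysis.Complex_Analysis"
begin

subsection \<open>Smooth functions and test functions\<close>

primrec iter_pderiv ::
    "'a::euclidean_space list \<Rightarrow> ('a \<Rightarrow> 'b::real_normed_vector) \<Rightarrow> 'a \<Rightarrow> 'b" where
  "iter_pderiv [] f = f"
| "iter_pderiv (b # bs) f = (\<lambda>y. frechet_derivative (iter_pderiv bs f) (at y) b)"

text \<open>\<open>C\<^sup>\<infinity>\<close> on an open set \<open>U\<close>; values outside \<open>U\<close> are irrelevant.\<close>
definition smooth_on ::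
    "'a::euclidean_space set \<Rightarrow> ('a \<Rightarrow> 'b::real_normed_vector) \<Rightarrow> bool" where
  "smooth_on U f \<longleftrightarrow> (\<forall>bs\<in>lists Basis. \<forall>y\<in>U. iter_pderiv bs f differentiable at y)"

definition support :: "('a::topological_space \<Rightarrow> 'b::zero) \<Rightarrow> 'a set" where
  "support f = closure {y. f y \<noteq> 0}"

text \<open>A test function on \<open>U\<close> is represented by its extension by \<open>0\<close> to the whole space.\<close>
definition test_functions :: "'a::euclidean_space set \<Rightarrow> ('a \<Rightarrow> complex) set" where
  "test_functions U = {f. smooth_on UNIV f \<and> compact (support f) \<and> support f \<subseteq> U}"

definition grad :: "('a::euclidean_space \<Rightarrow> real) \<Rightarrow> 'a \<Rightarrow> 'a" where
  "grad P y = (\<Sum>b\<in>Basis. frechet_derivative P (at y) b *\<^sub>R b)"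

subsection \<open>Euclidean surface measure of a hypersurface\<close>

text \<open>Lebesgue measure on the coordinate hyperplane orthogonal to the basis vector \<open>b\<close>
  (the unit point mass at \<open>0\<close> if the space is one-dimensional).\<close>
definition hyperplane_lborel :: "'a::euclidean_space \<Rightarrow> 'a measure" where
  "hyperplane_lborel b =
     distr (\<Pi>\<^sub>M c\<in>Basis - {b}. lborel) borel (\<lambda>t. \<Sum>c\<in>Basis - {b}. t c *\<^sub>R c)"

definition C1_on :: "'a::euclidean_space set \<Rightarrow> ('a \<Rightarrow> real) \<Rightarrow> bool" where
  "C1_on U \<psi> \<longleftrightarrow> open U \<and> (\<forall>y\<in>U. \<psi> differentiable at y) \<and>
     (\<forall>c\<in>Basis. continuous_on U (\<lambda>y. frechet_derivative \<psi> (at y) c))"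

text \<open>Graph over a relatively open part of the hyperplane orthogonal to \<open>b\<close>. Only the
  restriction of \<open>\<psi>\<close> to that hyperplane matters; a function defined on the hyperplane alone
  is extended constantly in direction \<open>b\<close>.\<close>
definition graph_patch ::
    "'a::euclidean_space \<Rightarrow> 'a set \<Rightarrow> ('a \<Rightarrow> real) \<Rightarrow> 'a set" where
  "graph_patch b U \<psi> = (\<lambda>y. y + \<psi> y *\<^sub>R b) ` {y\<in>U. y \<bullet> b = 0}"

text \<open>The classical surface element: \<open>d\<sigma> = sqrt (1 + |\<nabla>\<psi>|\<^sup>2) dy\<close> on every piece of \<open>S\<close> which is
  the graph of a \<open>C\<^sup>1\<close> function \<open>\<psi>\<close> of all but one of the coordinates.\<close>
definition is_surface_measure :: "'a::euclidean_space set \<Rightarrow> 'a measure \<Rightarrow> bool" where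
  "is_surface_measure S \<sigma> \<longleftrightarrow> sets \<sigma> = sets borel \<and> emeasure \<sigma> (- S) = 0 \<and>
     (\<forall>b\<in>Basis. \<forall>U \<psi>. C1_on U \<psi> \<and> graph_patch b U \<psi> \<subseteq> S \<longrightarrow>
       (\<forall>A\<in>sets borel. A \<subseteq> graph_patch b U \<psi> \<longrightarrow>
          emeasure \<sigma> A =
            (\<integral>\<^sup>+ y. ennreal (sqrt (1 + (\<Sum>c\<in>Basis - {b}. (frechet_derivative \<psi> (at y) c)\<^sup>2)))
                  * indicator U y * indicator A (y + \<psi> y *\<^sub>R b) \<partial>hyperplane_lborel b)))"

text \<open>Such a measure is unique if \<open>S\<close> is a \<open>C\<^sup>1\<close> hypersurface, since \<open>S\<close> is then covered by
  countably many graph patches.\<close>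
definition surface_measure :: "'a::euclidean_space set \<Rightarrow> 'a measure" where
  "surface_measure S = (THE \<sigma>. is_surface_measure S \<sigma>)"

definition level_set ::
    "'a::euclidean_space set \<Rightarrow> ('a \<Rightarrow> real) \<Rightarrow> real \<Rightarrow> 'a set" where
  "level_set G P x = {y\<in>G. P y = x}"

subsection \<open>The space \<open>L\<^sup>2(G)\<close>, the operators and their resolvents\<close>

text \<open>Elements of \<open>L\<^sup>2(G)\<close> are represented by functions, determined up to equality almost
  everywhere.\<close>
definition L2 :: "'a::euclidean_space set \<Rightarrow> ('a \<Rightarrow> complex) set" where
  "L2 G = {f \<in> borel_measurable (lebesgue_on G).
             integrable (lebesgue_on G) (\<lambda>y. (cmod (f y))\<^sup>2)}"

definition inner_L2 ::
    "'a::euclidean_space set \<Rightarrow> ('a \<Rightarrow> complex) \<Rightarrow> ('a \<Rightarrow> complex) \<Rightarrow> complex" where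
  "inner_L2 G f1 f2 = (LINT y|lebesgue_on G. cnj (f1 y) * f2 y)"

definition Omega ::
    "('a \<Rightarrow> real) \<Rightarrow> ('a \<Rightarrow> complex) \<Rightarrow> 'a \<Rightarrow> complex" where
  "Omega P f = (\<lambda>y. of_real (P y) * f y)"

definition res_Omega ::
    "('a \<Rightarrow> real) \<Rightarrow> complex \<Rightarrow> ('a \<Rightarrow> complex) \<Rightarrow> 'a \<Rightarrow> complex" where
  "res_Omega P z f = (\<lambda>y. f y / (z - of_real (P y)))"

definition Ham ::
    "'a::euclidean_space set \<Rightarrow> ('a \<Rightarrow> real) \<Rightarrow> ('a \<Rightarrow> complex) \<Rightarrow> ('a \<Rightarrow> complex) \<Rightarrow>
     ('a \<Rightarrow> complex) \<Rightarrow> 'a \<Rightarrow> complex" where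
  "Ham G P g h f = (\<lambda>y. Omega P f y + g y * inner_L2 G h f)"

text \<open>\<open>(z - H)\<^sup>-\<^sup>1 f\<close>. For \<open>z\<close> in the resolvent set all admissible choices agree almost
  everywhere.\<close>
definition res_Ham ::
    "'a::euclidean_space set \<Rightarrow> ('a \<Rightarrow> real) \<Rightarrow> ('a \<Rightarrow> complex) \<Rightarrow> ('a \<Rightarrow> complex) \<Rightarrow>
     complex \<Rightarrow> ('a \<Rightarrow> complex) \<Rightarrow> 'a \<Rightarrow> complex" where
  "res_Ham G P g h z f =
     (SOME u. u \<in> L2 G \<and> (AE y in lebesgue_on G. z * u y - Ham G P g h u y = f y))"

definition C_fun ::
    "'a::euclidean_space set \<Rightarrow> ('a \<Rightarrow> real) \<Rightarrow> ('a \<Rightarrow> complex) \<Rightarrow> ('a \<Rightarrow> complex) \<Rightarrow>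
     complex \<Rightarrow> complex" where
  "C_fun G P g h z = 1 - inner_L2 G h (res_Omega P z g)"

subsection \<open>The sesquilinear forms\<close>

text \<open>The density \<open>1 / |\<nabla>P|\<close> of \<open>d\<tau>\<^sub>x\<close> with respect to \<open>d\<sigma>\<^sub>x\<close> is put into the integrand.\<close>
definition delta_form ::
    "'a::euclidean_space set \<Rightarrow> ('a \<Rightarrow> real) \<Rightarrow> real \<Rightarrow>
     ('a \<Rightarrow> complex) \<Rightarrow> ('a \<Rightarrow> complex) \<Rightarrow> complex" where
  "delta_form G P x f1 f2 =
     (LINT y|surface_measure (level_set G P x). cnj (f1 y) * f2 y / of_real (norm (grad P y)))"

definition pv_truncated :: "(real \<Rightarrow> complex) \<Rightarrow> real \<Rightarrow> real \<Rightarrow> complex" where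
  "pv_truncated F x \<epsilon> = (LINT \<omega>:{\<omega>. \<epsilon> < \<bar>x - \<omega>\<bar>}|lborel. F \<omega> / of_real (x - \<omega>))"

definition pv_form ::
    "'a::euclidean_space set \<Rightarrow> ('a \<Rightarrow> real) \<Rightarrow> real \<Rightarrow>
     ('a \<Rightarrow> complex) \<Rightarrow> ('a \<Rightarrow> complex) \<Rightarrow> complex" where
  "pv_form G P x f1 f2 =
     Lim (at_right 0) (pv_truncated (\<lambda>\<omega>. delta_form G P \<omega> f1 f2) x)"

definition C1_fun ::
    "'a::euclidean_space set \<Rightarrow> ('a \<Rightarrow> real) \<Rightarrow> ('a \<Rightarrow> complex) \<Rightarrow> ('a \<Rightarrow> complex) \<Rightarrow>
     real \<Rightarrow> complex" where
  "C1_fun G P g h x = 1 - pv_form G P x h g"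

definition C2_fun ::
    "'a::euclidean_space set \<Rightarrow> ('a \<Rightarrow> real) \<Rightarrow> ('a \<Rightarrow> complex) \<Rightarrow> ('a \<Rightarrow> complex) \<Rightarrow>
     real \<Rightarrow> complex" where
  "C2_fun G P g h x = delta_form G P x h g"

definition kappa ::
    "'a::euclidean_space set \<Rightarrow> ('a \<Rightarrow> real) \<Rightarrow> ('a \<Rightarrow> complex) \<Rightarrow> ('a \<Rightarrow> complex) \<Rightarrow>
     real \<Rightarrow> ('a \<Rightarrow> complex) \<Rightarrow> ('a \<Rightarrow> complex) \<Rightarrow> complex" where
  "kappa G P g h x f1 f2 =
     (Lim (at_left 0) (\<lambda>u. inner_L2 G f1 (res_Ham G P g h (Complex x u) f2)) -
      Lim (at_right 0) (\<lambda>u. inner_L2 G f1 (res_Ham G P g h (Complex x u) f2)))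
     / (2 * of_real pi * \<i>)"

text \<open>Meaningful only for \<open>C\<^sub>2(x) \<noteq> 0\<close>.\<close>
definition p_form ::
    "'a::euclidean_space set \<Rightarrow> ('a \<Rightarrow> real) \<Rightarrow> ('a \<Rightarrow> complex) \<Rightarrow> ('a \<Rightarrow> complex) \<Rightarrow>
     real \<Rightarrow> ('a \<Rightarrow> complex) \<Rightarrow> ('a \<Rightarrow> complex) \<Rightarrow> complex" where
  "p_form G P g h x f1 f2 =
     delta_form G P x f1 f2 -
     delta_form G P x f1 g * delta_form G P x h f2 / delta_form G P x h g"

text \<open>\<open>f \<mapsto> \<langle>f|\<alpha>(x)\<rangle>\<close> and \<open>f \<mapsto> \<langle>\<alpha>'(x)|f\<rangle>\<close>, for a given choice \<open>N\<close> of the square root.\<close>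
definition alpha_ket ::
    "'a::euclidean_space set \<Rightarrow> ('a \<Rightarrow> real) \<Rightarrow> ('a \<Rightarrow> complex) \<Rightarrow> ('a \<Rightarrow> complex) \<Rightarrow>
     (real \<Rightarrow> complex) \<Rightarrow> real \<Rightarrow> ('a \<Rightarrow> complex) \<Rightarrow> complex" where
  "alpha_ket G P g h N x f =
     N x * (C1_fun G P g h x * delta_form G P x f g + C2_fun G P g h x * pv_form G P x f g)"

definition alpha_bra ::
    "'a::euclidean_space set \<Rightarrow> ('a \<Rightarrow> real) \<Rightarrow> ('a \<Rightarrow> complex) \<Rightarrow> ('a \<Rightarrow> complex) \<Rightarrow>
     (real \<Rightarrow> complex) \<Rightarrow> real \<Rightarrow> ('a \<Rightarrow> complex) \<Rightarrow> complex" where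
  "alpha_bra G P g h N x f =
     N x * (C1_fun G P g h x * delta_form G P x h f + C2_fun G P g h x * pv_form G P x h f)"

subsection \<open>Products of distributional bra- and ket-vectors\<close>

text \<open>\<open>T x f\<close> is the value of an \<open>x\<close>-dependent functional at the test function \<open>f\<close>.\<close>
definition smear ::
    "(real \<Rightarrow> complex) \<Rightarrow> (real \<Rightarrow> ('a \<Rightarrow> complex) \<Rightarrow> complex) \<Rightarrow> ('a \<Rightarrow> complex) \<Rightarrow> complex" where
  "smear \<phi> T f = (LINT x|lborel. \<phi> x * T x f)"

definition smearable ::
    "'a::euclidean_space set \<Rightarrow> (real \<Rightarrow> complex) \<Rightarrow> (real \<Rightarrow> ('a \<Rightarrow> complex) \<Rightarrow> complex) \<Rightarrow> bool" where
  "smearable G \<phi> T \<longleftrightarrow> (\<forall>f\<in>test_functions G. integrable lborel (\<lambda>x. \<phi> x * T x f))"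

definition is_bra ::
    "'a::euclidean_space set \<Rightarrow> (('a \<Rightarrow> complex) \<Rightarrow> complex) \<Rightarrow> ('a \<Rightarrow> complex) \<Rightarrow> bool" where
  "is_bra G L u \<longleftrightarrow> u \<in> L2 G \<and> (\<forall>f\<in>test_functions G. L f = inner_L2 G u f)"

definition is_ket ::
    "'a::euclidean_space set \<Rightarrow> (('a \<Rightarrow> complex) \<Rightarrow> complex) \<Rightarrow> ('a \<Rightarrow> complex) \<Rightarrow> bool" where
  "is_ket G M v \<longleftrightarrow> v \<in> L2 G \<and> (\<forall>f\<in>test_functions G. M f = inner_L2 G f v)"

text \<open>The product \<open>(\<integral> \<phi>\<^sub>1(x) B(x) dx) (\<integral> \<phi>\<^sub>2(x) K(x) dx)\<close> of a smeared bra and a smeared ket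
  makes sense and has the value \<open>c\<close>: the integrals converge, both functionals are given by
  elements of \<open>L\<^sup>2(G)\<close>, and \<open>c\<close> is the scalar product of these elements.\<close>
definition has_product ::
    "'a::euclidean_space set \<Rightarrow>
     (real \<Rightarrow> complex) \<Rightarrow> (real \<Rightarrow> ('a \<Rightarrow> complex) \<Rightarrow> complex) \<Rightarrow>
     (real \<Rightarrow> complex) \<Rightarrow> (real \<Rightarrow> ('a \<Rightarrow> complex) \<Rightarrow> complex) \<Rightarrow> complex \<Rightarrow> bool" where
  "has_product G \<phi>1 B \<phi>2 K c \<longleftrightarrow>
     smearable G \<phi>1 B \<and> smearable G \<phi>2 K \<and>
     (\<exists>u. is_bra G (smear \<phi>1 B) u) \<and> (\<exists>v. is_ket G (smear \<phi>2 K) v) \<and>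
     (\<forall>u v. is_bra G (smear \<phi>1 B) u \<longrightarrow> is_ket G (smear \<phi>2 K) v \<longrightarrow> inner_L2 G u v = c)"

end

(* With F_ab(x) = <a|delta(x - Omega)|b> and H the Hilbert transform, Plemelj's formula gives the
   boundary values H F_ab(x) -+ i pi F_ab(x) of <a|R_Omega(z)|b>, provided F_ab is regular enough.

   Regularity: let X = grad P / |grad P|^2, so that X P = 1.  The integral F_f(x) of f over the level
   set of x, with respect to dsigma / |grad P|, is the integral of div (f X) over {P < x}.  Hence
   F_f(b) - F_f(a) is at most a constant times the integral of F_eta over [a, b] for a cutoff
   function eta, and F_eta is bounded, so F_f is Lipschitz continuous.  The identity of F_f with the
   surface integral is local; the graph patches cover the level set and agree on their overlaps, so
   they glue to the surface measure.

   Every smeared bra of the theorem has the form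
   phi <a|delta + alpha <h|delta + beta <h|P/(x - Omega)  with  phi F_ag + alpha F_hg = (1 - H F_hg) beta,
   and the kets have the mirror image of this form.  H is antisymmetric and satisfies Tricomi's
   identity H(u Hv + v Hu) = Hu Hv - pi^2 u v.  This turns the product of a smeared bra and a smeared
   ket into one integral over x, the linear condition being exactly what cancels the terms with a
   single Hilbert transform of beta_1 or beta_2.  What remains is an algebraic identity at each x. *)
theory Submission
  imports Defs "HOL-Probability.Sinc_Integral"
begin

subsection \<open>Locally Hoelder continuous functions of a real variable\<close>

text \<open>The regularity class is dictated by the coefficients of the smeared functionals. The
  densities are Lipschitz, but H costs a logarithm on Lipschitz functions, and the coefficients
  contain H F_hg, quotients by C1^2 + \<pi>^2 C2^2 and the square root N. Local Hoelder continuity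
  of exponent 1/2 survives all of this and still suffices for H and for Plemelj's formula; of H
  applied to such functions only continuity is used. The identities for H enter in integrated form,
  so that Cauchy's theorem for products of two or three Cauchy transforms is enough. C is assumed to
  be nonzero over G1, whereas \<kappa> is tested on all of P(G). Off P(K) the denominator may
  vanish, but there C continues holomorphically across the real axis, so this happens at countably
  many points only, which no integral sees. The surface measure is a definite description, so
  existence and uniqueness must be shown before any surface integral can be evaluated. The densities
  are therefore constructed without it.\<close>

definition lhold :: "(real \<Rightarrow> complex) \<Rightarrow> bool" where
  "lhold f \<longleftrightarrow> (\<forall>L. \<exists>C. \<forall>x y. \<bar>x\<bar> \<le> L \<longrightarrow> \<bar>y\<bar> \<le> L \<longrightarrow> cmod (f x - f y) \<le> C * sqrt \<bar>x - y\<bar>)"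

definition csupp :: "(real \<Rightarrow> 'a::zero) \<Rightarrow> bool" where
  "csupp f \<longleftrightarrow> (\<exists>R. \<forall>x. \<bar>x\<bar> > R \<longrightarrow> f x = 0)"

lemma lholdE:
  assumes "lhold f"
  obtains C where "C \<ge> 0" "\<And>x y. \<bar>x\<bar> \<le> L \<Longrightarrow> \<bar>y\<bar> \<le> L \<Longrightarrow> cmod (f x - f y) \<le> C * sqrt \<bar>x - y\<bar>"
proof -
  obtain C where C: "\<And>x y. \<bar>x\<bar> \<le> L \<Longrightarrow> \<bar>y\<bar> \<le> L \<Longrightarrow> cmod (f x - f y) \<le> C * sqrt \<bar>x - y\<bar>"
    using assms unfolding lhold_def by meson
  have "cmod (f x - f y) \<le> \<bar>C\<bar> * sqrt \<bar>x - y\<bar>" if "\<bar>x\<bar> \<le> L" "\<bar>y\<bar> \<le> L" for x y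
    using C[OF that] by (smt (verit) mult_right_mono real_sqrt_ge_zero abs_ge_zero)
  then show ?thesis using that[of "\<bar>C\<bar>"] by auto
qed

lemma lhold_isCont: "lhold f \<Longrightarrow> isCont f x"
proof -
  assume f: "lhold f"
  obtain C where C: "C \<ge> 0" "\<And>y z. \<bar>y\<bar> \<le> \<bar>x\<bar> + 1 \<Longrightarrow> \<bar>z\<bar> \<le> \<bar>x\<bar> + 1 \<Longrightarrow> cmod (f y - f z) \<le> C * sqrt \<bar>y - z\<bar>"
    using lholdE[OF f] by metis
  have "((\<lambda>y. f y - f x) \<longlongrightarrow> 0) (at x)"
  proof (rule tendsto_norm_zero_cancel, rule tendsto_sandwich[where f = "\<lambda>_. 0"])
    show "((\<lambda>y. C * sqrt \<bar>y - x\<bar>) \<longlongrightarrow> 0) (at x)"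
      by (auto intro!: tendsto_eq_intros)
    have "\<forall>\<^sub>F y in at x. \<bar>y - x\<bar> < 1"
      using eventually_at[of "\<lambda>y. \<bar>y - x\<bar> < 1" x UNIV] by (auto simp: dist_real_def intro!: exI[of _ 1])
    then show "\<forall>\<^sub>F y in at x. norm (f y - f x) \<le> C * sqrt \<bar>y - x\<bar>"
      by eventually_elim (intro C, auto)
  qed (auto intro!: always_eventually)
  then show ?thesis by (simp add: isCont_def LIM_zero_iff)
qed

lemma lhold_continuous: "lhold f \<Longrightarrow> continuous_on S f"
  by (intro continuous_at_imp_continuous_on ballI lhold_isCont)

lemma lhold_const [simp]: "lhold (\<lambda>x. c)"
  by (auto simp: lhold_def intro: exI[of _ 0])

text \<open>On [-L, L] one of the two factors sqrt |x - y| of |x - y| is at most sqrt (2 |L|). On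
  the whole line a Lipschitz function need not be Hoelder of exponent 1/2, hence the bound L in
  \<open>lhold\<close>.\<close>

lemma lhold_lipschitz:
  assumes "\<And>L. \<exists>C. \<forall>x y. \<bar>x\<bar> \<le> L \<longrightarrow> \<bar>y\<bar> \<le> L \<longrightarrow> cmod (f x - f y) \<le> C * \<bar>x - y\<bar>"
  shows "lhold f"
  unfolding lhold_def
proof
  fix L
  obtain C where C: "\<And>x y. \<bar>x\<bar> \<le> L \<Longrightarrow> \<bar>y\<bar> \<le> L \<Longrightarrow> cmod (f x - f y) \<le> C * \<bar>x - y\<bar>"
    using assms[of L] by blast
  have "cmod (f x - f y) \<le> (\<bar>C\<bar> * sqrt (2 * \<bar>L\<bar>)) * sqrt \<bar>x - y\<bar>" if "\<bar>x\<bar> \<le> L" "\<bar>y\<bar> \<le> L" for x y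
  proof -
    have "cmod (f x - f y) \<le> C * \<bar>x - y\<bar>" by (rule C[OF that])
    also have "\<dots> \<le> \<bar>C\<bar> * \<bar>x - y\<bar>" by (intro mult_right_mono) auto
    also have "\<dots> = \<bar>C\<bar> * (sqrt \<bar>x - y\<bar> * sqrt \<bar>x - y\<bar>)" by simp
    also have "\<dots> \<le> \<bar>C\<bar> * (sqrt (2 * \<bar>L\<bar>) * sqrt \<bar>x - y\<bar>)"
      using that by (intro mult_left_mono mult_right_mono real_sqrt_le_mono) auto
    finally show ?thesis by (simp add: mult.assoc)
  qed
  then show "\<exists>C. \<forall>x y. \<bar>x\<bar> \<le> L \<longrightarrow> \<bar>y\<bar> \<le> L \<longrightarrow> cmod (f x - f y) \<le> C * sqrt \<bar>x - y\<bar>" by blast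
qed

lemma lhold_bound:
  assumes "lhold f"
  obtains M where "M > 0" "\<And>x. \<bar>x\<bar> \<le> L \<Longrightarrow> cmod (f x) \<le> M"
proof -
  have "compact (f ` {-L..L})"
    by (intro compact_continuous_image lhold_continuous assms) auto
  then have "bounded (f ` {-L..L})" by (rule compact_imp_bounded)
  then obtain M where "M > 0" "\<forall>x\<in>f ` {-L..L}. norm x \<le> M" by (auto simp: bounded_pos)
  then show ?thesis using that[of M] by (auto simp: abs_le_iff)
qed

lemma lhold_add:
  assumes "lhold f" "lhold g" shows "lhold (\<lambda>x. f x + g x)"
  unfolding lhold_def
proof
  fix L
  obtain C where C: "C \<ge> 0" "\<And>x y. \<bar>x\<bar> \<le> L \<Longrightarrow> \<bar>y\<bar> \<le> L \<Longrightarrow> cmod (f x - f y) \<le> C * sqrt \<bar>x - y\<bar>"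
    using lholdE[OF assms(1)] by metis
  obtain D where D: "D \<ge> 0" "\<And>x y. \<bar>x\<bar> \<le> L \<Longrightarrow> \<bar>y\<bar> \<le> L \<Longrightarrow> cmod (g x - g y) \<le> D * sqrt \<bar>x - y\<bar>"
    using lholdE[OF assms(2)] by metis
  have "cmod ((f x + g x) - (f y + g y)) \<le> (C + D) * sqrt \<bar>x - y\<bar>" if "\<bar>x\<bar> \<le> L" "\<bar>y\<bar> \<le> L" for x y
    using norm_triangle_ineq[of "f x - f y" "g x - g y"] C(2)[OF that] D(2)[OF that]
    by (simp add: algebra_simps)
  then show "\<exists>C. \<forall>x y. \<bar>x\<bar> \<le> L \<longrightarrow> \<bar>y\<bar> \<le> L \<longrightarrow> cmod ((f x + g x) - (f y + g y)) \<le> C * sqrt \<bar>x - y\<bar>" by blast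
qed

lemma lhold_mult:
  assumes "lhold f" "lhold g" shows "lhold (\<lambda>x. f x * g x)"
  unfolding lhold_def
proof
  fix L
  obtain C where C: "C \<ge> 0" "\<And>x y. \<bar>x\<bar> \<le> L \<Longrightarrow> \<bar>y\<bar> \<le> L \<Longrightarrow> cmod (f x - f y) \<le> C * sqrt \<bar>x - y\<bar>"
    using lholdE[OF assms(1)] by metis
  obtain D where D: "D \<ge> 0" "\<And>x y. \<bar>x\<bar> \<le> L \<Longrightarrow> \<bar>y\<bar> \<le> L \<Longrightarrow> cmod (g x - g y) \<le> D * sqrt \<bar>x - y\<bar>"
    using lholdE[OF assms(2)] by metis
  obtain M where M: "M > 0" "\<And>x. \<bar>x\<bar> \<le> L \<Longrightarrow> cmod (f x) \<le> M" using lhold_bound[OF assms(1)] by metis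
  obtain N where N: "N > 0" "\<And>x. \<bar>x\<bar> \<le> L \<Longrightarrow> cmod (g x) \<le> N" using lhold_bound[OF assms(2)] by metis
  have "cmod (f x * g x - f y * g y) \<le> (C * N + M * D) * sqrt \<bar>x - y\<bar>" if "\<bar>x\<bar> \<le> L" "\<bar>y\<bar> \<le> L" for x y
  proof -
    have "f x * g x - f y * g y = (f x - f y) * g x + f y * (g x - g y)" by (simp add: algebra_simps)
    then have "cmod (f x * g x - f y * g y) \<le> cmod (f x - f y) * cmod (g x) + cmod (f y) * cmod (g x - g y)"
      by (metis norm_mult norm_triangle_ineq)
    also have "\<dots> \<le> (C * sqrt \<bar>x - y\<bar>) * N + M * (D * sqrt \<bar>x - y\<bar>)"
      using C D M N that by (intro add_mono mult_mono) auto
    finally show ?thesis by (simp add: algebra_simps)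
  qed
  then show "\<exists>C. \<forall>x y. \<bar>x\<bar> \<le> L \<longrightarrow> \<bar>y\<bar> \<le> L \<longrightarrow> cmod (f x * g x - f y * g y) \<le> C * sqrt \<bar>x - y\<bar>" by blast
qed

lemma lhold_cmult: "lhold f \<Longrightarrow> lhold (\<lambda>x. c * f x)"
  by (intro lhold_mult) auto

lemma lhold_minus: "lhold f \<Longrightarrow> lhold (\<lambda>x. - f x)"
  using lhold_cmult[of f "-1"] by simp

lemma lhold_diff: "lhold f \<Longrightarrow> lhold g \<Longrightarrow> lhold (\<lambda>x. f x - g x)"
  using lhold_add[of f "\<lambda>x. - g x"] by (simp add: lhold_minus)

lemma lhold_cnj: "lhold f \<Longrightarrow> lhold (\<lambda>x. cnj (f x))"
  unfolding lhold_def by (simp flip: complex_cnj_diff)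

lemma lhold_power: "lhold f \<Longrightarrow> lhold (\<lambda>x. f x ^ n)"
  by (induction n) (auto intro: lhold_mult)

text \<open>Outside \<open>E\<close> the quotient is \<open>0\<close>, whatever \<open>d\<close> is there.\<close>
lemma lhold_divide:
  assumes n: "lhold n" and d: "lhold d" and "m > 0"
    and dE: "\<And>x. x \<in> E \<Longrightarrow> cmod (d x) \<ge> m" and nE: "\<And>x. x \<notin> E \<Longrightarrow> n x = 0"
  shows "lhold (\<lambda>x. n x / d x)"
  unfolding lhold_def
proof
  fix L
  obtain C where C: "C \<ge> 0" "\<And>x y. \<bar>x\<bar> \<le> L \<Longrightarrow> \<bar>y\<bar> \<le> L \<Longrightarrow> cmod (n x - n y) \<le> C * sqrt \<bar>x - y\<bar>"
    using lholdE[OF n] by metis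
  obtain D where D: "D \<ge> 0" "\<And>x y. \<bar>x\<bar> \<le> L \<Longrightarrow> \<bar>y\<bar> \<le> L \<Longrightarrow> cmod (d x - d y) \<le> D * sqrt \<bar>x - y\<bar>"
    using lholdE[OF d] by metis
  obtain M where M: "M > 0" "\<And>x. \<bar>x\<bar> \<le> L \<Longrightarrow> cmod (n x) \<le> M" using lhold_bound[OF n] by metis
  define B where "B = C / m + M * D / (m * m)"
  have B1: "C / m \<le> B" using M(1) D(1) \<open>m > 0\<close> by (auto simp: B_def)
  have one: "cmod (n x / d x - n y / d y) \<le> B * sqrt \<bar>x - y\<bar>"
    if "\<bar>x\<bar> \<le> L" "\<bar>y\<bar> \<le> L" "x \<in> E" for x y
  proof (cases "y \<in> E")
    case True
    have nz: "d x \<noteq> 0" "d y \<noteq> 0" using dE[of x] dE[of y] True that \<open>m > 0\<close> by auto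
    have "n x / d x - n y / d y = (n x - n y) / d x - n y * (d x - d y) / (d x * d y)"
      using nz by (simp add: field_simps)
    then have "cmod (n x / d x - n y / d y) \<le> cmod (n x - n y) / cmod (d x)
        + cmod (n y) * cmod (d x - d y) / (cmod (d x) * cmod (d y))"
      by (metis norm_divide norm_mult norm_triangle_ineq4)
    also have "\<dots> \<le> (C * sqrt \<bar>x - y\<bar>) / m + M * (D * sqrt \<bar>x - y\<bar>) / (m * m)"
      using C D M dE[of x] dE[of y] True that \<open>m > 0\<close>
      by (intro add_mono frac_le mult_mono) auto
    finally show ?thesis by (simp add: B_def algebra_simps add_divide_distrib)
  next
    case False
    then have "cmod (n x / d x - n y / d y) = cmod (n x - n y) / cmod (d x)"
      using nE[of y] by (simp add: norm_divide)
    also have "\<dots> \<le> (C * sqrt \<bar>x - y\<bar>) / m"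
      using C dE[of x] that \<open>m > 0\<close> by (intro frac_le) auto
    also have "\<dots> = C / m * sqrt \<bar>x - y\<bar>" by simp
    also have "\<dots> \<le> B * sqrt \<bar>x - y\<bar>" using B1 by (intro mult_right_mono) auto
    finally show ?thesis .
  qed
  have "cmod (n x / d x - n y / d y) \<le> B * sqrt \<bar>x - y\<bar>" if "\<bar>x\<bar> \<le> L" "\<bar>y\<bar> \<le> L" for x y
  proof -
    consider "x \<in> E" | "y \<in> E" | "x \<notin> E" "y \<notin> E" by blast
    then show ?thesis
    proof cases
      case 2
      then show ?thesis using one[of y x] that by (simp add: norm_minus_commute abs_minus_commute)
    next
      case 3
      have "0 \<le> B" using B1 C(1) \<open>m > 0\<close> by (meson divide_nonneg_pos order_trans)
      then show ?thesis using 3 nE by simp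
    qed (use one that in blast)
  qed
  then show "\<exists>C. \<forall>x y. \<bar>x\<bar> \<le> L \<longrightarrow> \<bar>y\<bar> \<le> L \<longrightarrow> cmod (n x / d x - n y / d y) \<le> C * sqrt \<bar>x - y\<bar>" by blast
qed

lemma csupp_mult1: "csupp f \<Longrightarrow> csupp (\<lambda>x. f x * g x :: complex)"
  and csupp_mult2: "csupp f \<Longrightarrow> csupp (\<lambda>x. g x * f x :: complex)"
  and csupp_cnj: "csupp f \<Longrightarrow> csupp (\<lambda>x. cnj (f x))"
  unfolding csupp_def by auto

lemma csupp_add: "csupp f \<Longrightarrow> csupp g \<Longrightarrow> csupp (\<lambda>x. f x + g x :: complex)"
  unfolding csupp_def by (metis add.right_neutral max_less_iff_conj)

lemma csupp_zero [simp]: "csupp (\<lambda>x. 0)"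
  by (simp add: csupp_def)

lemma csuppE:
  assumes "csupp f" obtains R where "R > 0" "\<And>x. \<bar>x\<bar> > R \<Longrightarrow> f x = 0"
proof -
  obtain R where "\<forall>x. \<bar>x\<bar> > R \<longrightarrow> f x = 0" using assms by (auto simp: csupp_def)
  then show ?thesis using that[of "\<bar>R\<bar> + 1"] by auto
qed

lemma integrable_continuous_csupp:
  fixes f :: "real \<Rightarrow> complex"
  assumes "continuous_on UNIV f" "csupp f"
  shows "integrable lborel f"
proof -
  obtain R where R: "\<And>x. \<bar>x\<bar> > R \<Longrightarrow> f x = 0" using csuppE[OF assms(2)] by metis
  have "integrable lborel (\<lambda>x. indicator {-R..R} x *\<^sub>R f x)"
    by (intro borel_integrable_compact continuous_on_subset[OF assms(1)]) auto
  also have "(\<lambda>x. indicator {-R..R} x *\<^sub>R f x) = f"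
    using R by (auto simp: indicator_def fun_eq_iff abs_le_iff not_le[symmetric])
  finally show ?thesis .
qed

text \<open>Limits along \<open>at a within S\<close> are tested on sequences. The set S is the
  range of parameters on which the majorant is valid: a half line for boundary values, a ball for
  continuity.\<close>

lemma dominated_convergence_within:
  fixes f :: "real \<Rightarrow> 'b \<Rightarrow> 'c::{banach, second_countable_topology}"
  assumes "\<And>u. u \<in> S \<Longrightarrow> u \<noteq> a \<Longrightarrow> f u \<in> borel_measurable M" "l \<in> borel_measurable M" "integrable M w"
    and "\<And>y. ((\<lambda>u. f u y) \<longlongrightarrow> l y) (at a within S)"
    and "\<And>u y. u \<in> S \<Longrightarrow> u \<noteq> a \<Longrightarrow> norm (f u y) \<le> w y"
  shows "((\<lambda>u. LINT y|M. f u y) \<longlongrightarrow> (LINT y|M. l y)) (at a within S)"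
  unfolding tendsto_at_iff_sequentially
proof (intro allI impI)
  fix X assume X: "\<forall>i. X i \<in> S - {a}" "X \<longlonglongrightarrow> a"
  show "((\<lambda>u. LINT y|M. f u y) \<circ> X) \<longlonglongrightarrow> (LINT y|M. l y)"
    unfolding o_def
  proof (rule integral_dominated_convergence[OF _ _ assms(3)])
    show "AE y in M. (\<lambda>i. f (X i) y) \<longlonglongrightarrow> l y"
      using assms(4) X unfolding tendsto_at_iff_sequentially o_def by auto
  qed (use assms X in auto)
qed

subsection \<open>The Hilbert transform and the boundary values of the Cauchy transform\<close>

text \<open>The factor \<open>1/2\<close> accounts for the integration over both signs of \<open>s\<close> of an even function.\<close>
definition hil :: "(real \<Rightarrow> complex) \<Rightarrow> real \<Rightarrow> complex" where
  "hil b x = (LINT s|lborel. (b (x - s) - b (x + s)) / of_real s) / 2"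

text \<open>The Cauchy transform. For the density of a pair of test functions it is the matrix
  element of the resolvent of \<Omega>, see \<open>inner_res_Omega\<close>.\<close>

definition ctr :: "(real \<Rightarrow> complex) \<Rightarrow> complex \<Rightarrow> complex" where
  "ctr b z = (LINT t|lborel. b t / (z - of_real t))"

lemma integrable_inv_sqrt: "integrable lborel (\<lambda>s::real. indicator {-R..R} s / sqrt \<bar>s\<bar>)"
proof (cases "R > 0")
  case True
  have "set_integrable lborel (einterval 0 (ereal R)) (\<lambda>s. 1 / sqrt s)"
  proof (rule interval_integral_FTC_nonneg)
    show "((\<lambda>s. 2 * sqrt s) has_real_derivative 1 / sqrt s) (at s)" if "0 < ereal s" for s
      using that by (auto intro!: derivative_eq_intros simp: field_simps)
    show "(((\<lambda>s. 2 * sqrt s) \<circ> real_of_ereal) \<longlongrightarrow> 0) (at_right 0)"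
      by (auto simp: zero_ereal_def ereal_tendsto_simps intro!: tendsto_eq_intros)
    show "(((\<lambda>s. 2 * sqrt s) \<circ> real_of_ereal) \<longlongrightarrow> 2 * sqrt R) (at_left (ereal R))"
      by (auto simp: ereal_tendsto_simps intro!: tendsto_eq_intros)
  qed (use True in \<open>auto intro!: continuous_intros\<close>)
  then have i: "integrable lborel (\<lambda>s. indicator {0<..<R} s / sqrt s)"
    by (simp add: set_integrable_def zero_ereal_def einterval_eq)
  have i': "integrable lborel (\<lambda>s. indicator {0<..<R} (0 + (-1) * s) / sqrt (0 + (-1) * s))"
    by (rule lborel_integrable_real_affine[OF i]) simp
  have "integrable lborel (\<lambda>s. indicator {0<..<R} s / sqrt s + indicator {0<..<R} (0 + (-1) * s) / sqrt (0 + (-1) * s))"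
    by (rule Bochner_Integration.integrable_add[OF i i'])
  then show ?thesis
  proof (rule integrable_discrete_difference[THEN iffD1, rotated -1])
    \<comment> \<open>The open half intervals miss at most these three points of [-R, R], and a
      countable set does not change an integral.\<close>
    show "countable {0, R, -R}" by simp
  qed (auto simp: indicator_def)
next
  case False
  then have "(\<lambda>s::real. indicator {-R..R} s / sqrt \<bar>s\<bar>) = (\<lambda>s. 0)"
    by (auto simp: indicator_def fun_eq_iff)
  then show ?thesis by (metis integrable_zero)
qed

lemma difference_bound:
  assumes "lhold b" "csupp b"
  obtains C R where "C \<ge> 0" "\<And>x s. \<bar>x\<bar> \<le> L \<Longrightarrow> cmod (b (x - s) - b (x + s)) \<le> C * (indicator {-R..R} s * sqrt \<bar>s\<bar>)"
proof -
  obtain R where R: "R > 0" "\<And>x. \<bar>x\<bar> > R \<Longrightarrow> b x = 0" using csuppE[OF assms(2)] by metis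
  \<comment> \<open>For |x| \<le> L and |s| > R' both x - s and x + s leave [-R, R]; for the other s
    they stay within R' + |L|, where the Hoelder bound is taken.\<close>
  define R' where "R' = R + \<bar>L\<bar>"
  obtain C where C: "C \<ge> 0" "\<And>x y. \<bar>x\<bar> \<le> R' + \<bar>L\<bar> \<Longrightarrow> \<bar>y\<bar> \<le> R' + \<bar>L\<bar> \<Longrightarrow> cmod (b x - b y) \<le> C * sqrt \<bar>x - y\<bar>"
    using lholdE[OF assms(1)] by metis
  show ?thesis
  proof
    fix x s assume x: "\<bar>x\<bar> \<le> L"
    show "cmod (b (x - s) - b (x + s)) \<le> (C * sqrt 2) * (indicator {-R'..R'} s * sqrt \<bar>s\<bar>)"
    proof (cases "s \<in> {-R'..R'}")
      case True
      then have "cmod (b (x - s) - b (x + s)) \<le> C * sqrt \<bar>(x - s) - (x + s)\<bar>"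
        using x by (intro C(2)) auto
      also have "\<bar>(x - s) - (x + s)\<bar> = 2 * \<bar>s\<bar>" by simp
      finally show ?thesis using True by (simp add: real_sqrt_mult)
    next
      case False
      then have "\<bar>x - s\<bar> > R" "\<bar>x + s\<bar> > R" using x R(1) by (auto simp: R'_def)
      then show ?thesis using R(2) C(1) by (simp add: False)
    qed
  qed (use C in simp)
qed

lemma lhold_measurable: "lhold b \<Longrightarrow> b \<in> borel_measurable borel"
  by (intro borel_measurable_continuous_onI lhold_continuous)

text \<open>Hoelder exponent 1/2 leaves a singularity |s|^(-1/2), which is integrable. The majorant
  is the same for all |x| \<le> L, so it serves for continuity in x, for removing the truncation of
  the principal value and for Plemelj's formula.\<close>

lemma hil_kernel_bound:
  assumes "lhold b" "csupp b"
  obtains w where "integrable lborel w"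
    "\<And>x s. \<bar>x\<bar> \<le> L \<Longrightarrow> cmod ((b (x - s) - b (x + s)) / of_real s) \<le> w s"
proof -
  obtain C R where C: "C \<ge> 0" "\<And>x s. \<bar>x\<bar> \<le> L \<Longrightarrow> cmod (b (x - s) - b (x + s)) \<le> C * (indicator {-R..R} s * sqrt \<bar>s\<bar>)"
    using difference_bound[OF assms] by metis
  show ?thesis
  proof
    show "integrable lborel (\<lambda>s. C * (indicator {-R..R} s / sqrt \<bar>s\<bar>))"
      by (intro integrable_mult_right integrable_inv_sqrt)
    show "cmod ((b (x - s) - b (x + s)) / of_real s) \<le> C * (indicator {-R..R} s / sqrt \<bar>s\<bar>)" if "\<bar>x\<bar> \<le> L" for x s
    proof -
      have "cmod ((b (x - s) - b (x + s)) / of_real s) \<le> C * (indicator {-R..R} s * sqrt \<bar>s\<bar>) / \<bar>s\<bar>"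
        unfolding norm_divide using C(2)[OF that, of s] by (simp add: divide_right_mono)
      also have "\<dots> = C * (indicator {-R..R} s / sqrt \<bar>s\<bar>)"
        by (cases "s = 0") (simp_all add: field_simps)
      finally show ?thesis .
    qed
  qed
qed

lemma hil_integrable:
  assumes "lhold b" "csupp b"
  shows "integrable lborel (\<lambda>s. (b (x - s) - b (x + s)) / of_real s)"
proof -
  note [measurable] = lhold_measurable[OF assms(1)]
  obtain w where w: "integrable lborel w" "\<And>y s. \<bar>y\<bar> \<le> \<bar>x\<bar> \<Longrightarrow> cmod ((b (y - s) - b (y + s)) / of_real s) \<le> w s"
    using hil_kernel_bound[OF assms] by metis
  show ?thesis
    by (rule Bochner_Integration.integrable_bound[OF w(1)]) (use w(2) in \<open>auto intro: order_trans[OF _ abs_ge_self]\<close>)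
qed

lemma hil_continuous:
  assumes "lhold b" "csupp b"
  shows "continuous_on S (hil b)"
proof (intro continuous_at_imp_continuous_on ballI)
  fix x
  note [measurable] = lhold_measurable[OF assms(1)]
  obtain w where w: "integrable lborel w" "\<And>y s. \<bar>y\<bar> \<le> \<bar>x\<bar> + 1 \<Longrightarrow> cmod ((b (y - s) - b (y + s)) / of_real s) \<le> w s"
    using hil_kernel_bound[OF assms] by metis
  \<comment> \<open>Within the unit ball about x the points satisfy |y| \<le> |x| + 1, so the
    majorant applies along the whole filter.\<close>
  have "(hil b \<longlongrightarrow> hil b x) (at x within ball x 1)"
    unfolding hil_def
  proof (rule tendsto_divide, rule dominated_convergence_within[OF _ _ w(1)])
    have "isCont (\<lambda>u. b (u + r)) x" for r
      using isCont_o2[OF _ lhold_isCont[OF assms(1)], of x "\<lambda>u. u + r"] by simp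
    from this[of "- s" for s] this have "isCont (\<lambda>u. (b (u - s) - b (u + s)) / of_real s) x" for s
      by (cases "s = 0") (auto intro!: continuous_intros)
    then show "((\<lambda>u. (b (u - s) - b (u + s)) / of_real s) \<longlongrightarrow> (b (x - s) - b (x + s)) / of_real s) (at x within ball x 1)" for s
      by (meson isCont_def tendsto_within_subset UNIV_I subsetI)
  qed (auto intro!: w(2) simp: dist_real_def)
  then show "isCont (hil b) x"
    by (simp add: isCont_def at_within_open[of x "ball x 1"])
qed

text \<open>This covers non-integrable f as well, whose integral is 0 by convention.\<close>

lemma norm_integral_le:
  fixes f :: "'a \<Rightarrow> 'b::{banach, second_countable_topology}"
  assumes "integrable M w" "\<And>x. norm (f x) \<le> w x"
  shows "norm (integral\<^sup>L M f) \<le> integral\<^sup>L M w"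
proof (cases "integrable M f")
  case True
  then show ?thesis using assms by (intro order_trans[OF integral_norm_bound integral_mono]) auto
next
  case False
  have "0 \<le> integral\<^sup>L M w"
    by (intro integral_nonneg_AE AE_I2 order_trans[OF norm_ge_zero assms(2)])
  then show ?thesis by (simp add: not_integrable_integral_eq[OF False])
qed

section \<open>Plemelj's formula\<close>

lemma poisson_kernel:
  "integrable lborel (\<lambda>s::real. 1 / (1 + s\<^sup>2))" "(LINT s|lborel. 1 / (1 + s\<^sup>2)) = pi"
  using LBINT_inverse_1_plus_square integrable_inverse_1_plus_square
  by (simp_all add: interval_lebesgue_integral_def set_integrable_def set_lebesgue_integral_def
      einterval_def inverse_eq_divide)

lemma lhold_global_bound:
  assumes "lhold b" "csupp b" obtains M where "M > 0" "\<And>x. cmod (b x) \<le> M"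
proof -
  obtain R where R: "R > 0" "\<And>x. \<bar>x\<bar> > R \<Longrightarrow> b x = 0" using csuppE[OF assms(2)] by metis
  obtain M where M: "M > 0" "\<And>x. \<bar>x\<bar> \<le> R \<Longrightarrow> cmod (b x) \<le> M" using lhold_bound[OF assms(1)] by metis
  have "cmod (b x) \<le> M" for x
    using M R by (cases "\<bar>x\<bar> \<le> R") (auto simp: not_le intro: less_imp_le)
  then show ?thesis using that M by blast
qed

lemma integrable_shift_div:
  assumes b: "lhold b" "csupp b" and k: "continuous_on UNIV k" and c: "\<bar>c\<bar> = 1"
  shows "integrable lborel (\<lambda>s. b (x + c * s) * k s)"
proof (rule integrable_continuous_csupp)
  show "continuous_on UNIV (\<lambda>s. b (x + c * s) * k s)"
    by (intro continuous_intros k continuous_on_compose2[OF lhold_continuous[OF b(1), of UNIV]]) auto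
  obtain R where R: "R > 0" "\<And>x. \<bar>x\<bar> > R \<Longrightarrow> b x = 0" using csuppE[OF b(2)] by metis
  have "b (x + c * s) = 0" if "\<bar>s\<bar> > R + \<bar>x\<bar>" for s
  proof (rule R)
    have "\<bar>c * s\<bar> = \<bar>s\<bar>" using c by (simp add: abs_mult)
    then show "R < \<bar>x + c * s\<bar>" using that by linarith
  qed
  then show "csupp (\<lambda>s. b (x + c * s) * k s)" unfolding csupp_def by (metis mult_zero_left)
qed

text \<open>The substitutions t = x - s and t = x + s are averaged. In 1 / (s + i u) the part odd in
  s then meets the difference of the two values of b and tends to the Hilbert kernel 1 / s, while
  the even part is the Poisson kernel and meets their sum.\<close>

lemma ctr_split:
  assumes b: "lhold b" "csupp b" and u: "u > 0"
  shows "ctr b (Complex x u) =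
     ((LINT s|lborel. (b (x - s) - b (x + s)) * of_real (s / (s\<^sup>2 + u\<^sup>2)))
      - \<i> * (LINT s|lborel. (b (x - u * s) + b (x + u * s)) * of_real (1 / (1 + s\<^sup>2)))) / 2"
proof -
  note [measurable] = lhold_measurable[OF b(1)]
  have su: "s\<^sup>2 + u\<^sup>2 \<noteq> 0" for s using u by (smt (verit) zero_le_power2 zero_less_power)
  have k1: "continuous_on UNIV (\<lambda>s. 1 / Complex s u)" "continuous_on UNIV (\<lambda>s. 1 / Complex (- s) u)"
    using u by (auto intro!: continuous_intros simp: Complex_eq complex_eq_iff)
  have e1: "ctr b (Complex x u) = (LINT s|lborel. b (x - s) * (1 / Complex s u))"
    unfolding ctr_def
    by (subst lborel_integral_real_affine[of "-1" _ x])
       (auto intro!: Bochner_Integration.integral_cong simp: Complex_eq add.commute)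
  have e2: "ctr b (Complex x u) = (LINT s|lborel. b (x + s) * (1 / Complex (- s) u))"
    unfolding ctr_def
    by (subst lborel_integral_real_affine[of 1 _ x])
       (auto intro!: Bochner_Integration.integral_cong simp: Complex_eq)
  have i1: "integrable lborel (\<lambda>s. b (x - s) * (1 / Complex s u))"
    using integrable_shift_div[OF b k1(1), of "-1" x] by simp
  have i2: "integrable lborel (\<lambda>s. b (x + s) * (1 / Complex (- s) u))"
    using integrable_shift_div[OF b k1(2), of 1 x] by simp
  have k2: "continuous_on UNIV (\<lambda>s. complex_of_real (s / (s\<^sup>2 + u\<^sup>2)))"
    "continuous_on UNIV (\<lambda>s. complex_of_real (u / (s\<^sup>2 + u\<^sup>2)))"
    by (intro continuous_intros; use su in blast)+
  have j1: "integrable lborel (\<lambda>s. (b (x - s) - b (x + s)) * of_real (s / (s\<^sup>2 + u\<^sup>2)))"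
    using Bochner_Integration.integrable_diff[OF integrable_shift_div[OF b k2(1), of "-1" x] integrable_shift_div[OF b k2(1), of 1 x]]
    by (simp add: left_diff_distrib del: of_real_divide)
  have j2: "integrable lborel (\<lambda>s. (b (x - s) + b (x + s)) * of_real (u / (s\<^sup>2 + u\<^sup>2)))"
    using Bochner_Integration.integrable_add[OF integrable_shift_div[OF b k2(2), of "-1" x] integrable_shift_div[OF b k2(2), of 1 x]]
    by (simp add: distrib_right del: of_real_divide)
  have inv: "1 / Complex s u = of_real (s / (s\<^sup>2 + u\<^sup>2)) - \<i> * of_real (u / (s\<^sup>2 + u\<^sup>2))" for s
    using su[of s] by (simp add: complex_eq_iff Re_divide Im_divide) (simp add: power2_eq_square)
  have "2 * ctr b (Complex x u) = (LINT s|lborel. b (x - s) * (1 / Complex s u) + b (x + s) * (1 / Complex (- s) u))"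
    using Bochner_Integration.integral_add[OF i1 i2] e1 e2 by (simp only:) simp
  also have "\<dots> = (LINT s|lborel. (b (x - s) - b (x + s)) * of_real (s / (s\<^sup>2 + u\<^sup>2))
                - \<i> * ((b (x - s) + b (x + s)) * of_real (u / (s\<^sup>2 + u\<^sup>2))))"
    by (intro Bochner_Integration.integral_cong refl, unfold inv) (simp add: algebra_simps del: of_real_divide)
  also have "\<dots> = (LINT s|lborel. (b (x - s) - b (x + s)) * of_real (s / (s\<^sup>2 + u\<^sup>2)))
      - \<i> * (LINT s|lborel. (b (x - s) + b (x + s)) * of_real (u / (s\<^sup>2 + u\<^sup>2)))"
    by (simp only: Bochner_Integration.integral_diff[OF j1 integrable_mult_right[OF j2]] integral_mult_right_zero)
  also have "(LINT s|lborel. (b (x - s) + b (x + s)) * of_real (u / (s\<^sup>2 + u\<^sup>2)))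
     = (LINT s|lborel. (b (x - u * s) + b (x + u * s)) * of_real (1 / (1 + s\<^sup>2)))"
  \<comment> \<open>The substitution s -> u s turns the Poisson kernel into the fixed weight 1 / (1
    + s^2) and moves the dependence on u into the argument of b.\<close>
  proof (subst lborel_integral_real_affine[of u _ 0], goal_cases)
    case 2
    have k: "\<bar>u\<bar> * (u / ((0 + u * s)\<^sup>2 + u\<^sup>2)) = 1 / (1 + s\<^sup>2)" for s
      using u by (simp add: divide_simps power2_eq_square add_nonneg_eq_0_iff) (simp add: algebra_simps)
    show ?case
      unfolding integral_scaleR_right[symmetric]
      by (intro Bochner_Integration.integral_cong refl, unfold k[symmetric])
         (simp add: scaleR_conv_of_real)
  qed (use u in simp)
  finally show ?thesis by (simp add: field_simps)
qed

text \<open>The regularized kernel lies below the singular one, so the majorant of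
  \<open>hil_kernel_bound\<close> is valid for all u at once.\<close>

lemma hil_kernel_mono:
  fixes a :: complex
  shows "norm (a * of_real (s / (s\<^sup>2 + u\<^sup>2))) \<le> norm (a / of_real s)"
proof (cases "s = 0")
  case False
  have "norm (a * of_real (s / (s\<^sup>2 + u\<^sup>2))) = cmod a * (\<bar>s\<bar> / (s\<^sup>2 + u\<^sup>2))"
    by (simp only: norm_mult norm_of_real) (simp add: abs_divide add_nonneg_nonneg)
  also have "\<dots> \<le> cmod a * (\<bar>s\<bar> / (s\<^sup>2))"
    using False by (intro mult_left_mono divide_left_mono mult_pos_pos) (auto intro: add_pos_nonneg)
  also have "\<dots> = cmod (a / of_real s)"
    using False by (simp add: norm_divide field_simps power2_eq_square)
  finally show ?thesis .
qed simp

lemma poisson_part_bound: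
  assumes "\<And>x. cmod (b x) \<le> M"
  shows "norm ((b (x - u * s) + b (x + u * s)) * of_real (1 / (1 + s\<^sup>2))) \<le> 2 * M * (1 / (1 + s\<^sup>2))"
proof -
  have "cmod (b (x - u * s) + b (x + u * s)) \<le> 2 * M"
    using norm_triangle_ineq[of "b (x - u * s)" "b (x + u * s)"] assms[of "x - u * s"] assms[of "x + u * s"] by simp
  moreover have "cmod (of_real (1 / (1 + s\<^sup>2))) = 1 / (1 + s\<^sup>2)"
    by (simp only: norm_of_real) simp
  ultimately show ?thesis by (simp only: norm_mult) (intro mult_right_mono, auto)
qed

text \<open>An approximate identity in rescaled form: both values of b converge to b x, b is
  bounded, and the weight has total mass \<pi>.\<close>

lemma poisson_part_limit:
  assumes b: "lhold b" "csupp b"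
  shows "((\<lambda>u. LINT s|lborel. (b (x - u * s) + b (x + u * s)) * of_real (1 / (1 + s\<^sup>2)))
           \<longlongrightarrow> 2 * of_real pi * b x) (at_right 0)"
proof -
  note [measurable] = lhold_measurable[OF b(1)]
  obtain M where M: "M > 0" "\<And>x. cmod (b x) \<le> M" using lhold_global_bound[OF b] by metis
  have "((\<lambda>u. LINT s|lborel. (b (x - u * s) + b (x + u * s)) * of_real (1 / (1 + s\<^sup>2)))
      \<longlongrightarrow> (LINT s|lborel. (b x + b x) * of_real (1 / (1 + s\<^sup>2)))) (at_right 0)"
  proof (rule dominated_convergence_within)
    show "integrable lborel (\<lambda>s. 2 * M * (1 / (1 + s\<^sup>2)))"
      by (intro integrable_mult_right poisson_kernel)
    have c: "isCont (\<lambda>u. b (x + c * u)) 0" for c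
      using isCont_o2[OF _ lhold_isCont[OF b(1)], of 0 "\<lambda>u. x + c * u"] by simp
    have "isCont (\<lambda>u. (b (x - u * s) + b (x + u * s)) * of_real (1 / (1 + s\<^sup>2))) 0" for s
      using c[of s] c[of "-s"] by (intro continuous_intros) (simp_all add: mult.commute)
    then show "((\<lambda>u. (b (x - u * s) + b (x + u * s)) * of_real (1 / (1 + s\<^sup>2)))
       \<longlongrightarrow> (b x + b x) * of_real (1 / (1 + s\<^sup>2))) (at_right 0)" for s
      unfolding isCont_def by (rule tendsto_within_subset[THEN tendsto_eq_rhs]) auto
  qed (use poisson_part_bound[of b M] M in auto)
  moreover have "(LINT s|lborel. (b x + b x) * of_real (1 / (1 + s\<^sup>2))) = 2 * of_real pi * b x"
    using poisson_kernel(2) by (simp only: integral_mult_right_zero integral_complex_of_real) simp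
  ultimately show ?thesis by simp
qed

lemma plemelj_right:
  assumes b: "lhold b" "csupp b"
  shows "((\<lambda>u. ctr b (Complex x u)) \<longlongrightarrow> hil b x - \<i> * of_real pi * b x) (at_right 0)"
proof -
  note [measurable] = lhold_measurable[OF b(1)]
  obtain w where w: "integrable lborel w" "\<And>y s. \<bar>y\<bar> \<le> \<bar>x\<bar> \<Longrightarrow> cmod ((b (y - s) - b (y + s)) / of_real s) \<le> w s"
    using hil_kernel_bound[OF b] by metis
  have "((\<lambda>u. LINT s|lborel. (b (x - s) - b (x + s)) * of_real (s / (s\<^sup>2 + u\<^sup>2)))
      \<longlongrightarrow> (LINT s|lborel. (b (x - s) - b (x + s)) / of_real s)) (at_right 0)"
  proof (rule dominated_convergence_within[OF _ _ w(1)])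
    show "((\<lambda>u. (b (x - s) - b (x + s)) * of_real (s / (s\<^sup>2 + u\<^sup>2)))
        \<longlongrightarrow> (b (x - s) - b (x + s)) / of_real s) (at_right 0)" for s
      by (cases "s = 0") (auto intro!: tendsto_eq_intros simp: power2_eq_square)
    show "norm ((b (x - s) - b (x + s)) * of_real (s / (s\<^sup>2 + u\<^sup>2))) \<le> w s" for u s
      by (rule order_trans[OF hil_kernel_mono w(2)]) simp
  qed auto
  from tendsto_divide[OF tendsto_diff[OF this tendsto_mult_left[OF poisson_part_limit[OF b, of x], of \<i>]] tendsto_const[of 2]]
  have "((\<lambda>u. ((LINT s|lborel. (b (x - s) - b (x + s)) * of_real (s / (s\<^sup>2 + u\<^sup>2)))
      - \<i> * (LINT s|lborel. (b (x - u * s) + b (x + u * s)) * of_real (1 / (1 + s\<^sup>2)))) / 2)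
      \<longlongrightarrow> ((LINT s|lborel. (b (x - s) - b (x + s)) / of_real s) - \<i> * (2 * of_real pi * b x)) / 2) (at_right 0)"
    by simp
  moreover have "\<forall>\<^sub>F u in at_right 0. ((LINT s|lborel. (b (x - s) - b (x + s)) * of_real (s / (s\<^sup>2 + u\<^sup>2)))
      - \<i> * (LINT s|lborel. (b (x - u * s) + b (x + u * s)) * of_real (1 / (1 + s\<^sup>2)))) / 2 = ctr b (Complex x u)"
    using eventually_at_right_less[of 0] by eventually_elim (simp add: ctr_split[OF b])
  ultimately have "((\<lambda>u. ctr b (Complex x u)) \<longlongrightarrow>
     ((LINT s|lborel. (b (x - s) - b (x + s)) / of_real s) - \<i> * (2 * of_real pi * b x)) / 2) (at_right 0)"
    by (rule Lim_transform_eventually)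
  then show ?thesis by (simp add: hil_def field_simps)
qed

lemma ctr_cnj: "ctr b (cnj z) = cnj (ctr (\<lambda>x. cnj (b x)) z)"
  unfolding ctr_def Bochner_Integration.integral_cnj[symmetric] by simp

lemma hil_cnj: "hil (\<lambda>x. cnj (b x)) x = cnj (hil b x)"
  unfolding hil_def by (simp flip: Bochner_Integration.integral_cnj)

text \<open>Complex conjugation exchanges the two half planes and turns the Cauchy transform of b
  into that of its conjugate.\<close>

lemma plemelj_left:
  assumes b: "lhold b" "csupp b"
  shows "((\<lambda>u. ctr b (Complex x u)) \<longlongrightarrow> hil b x + \<i> * of_real pi * b x) (at_left 0)"
proof -
  have "((\<lambda>u. cnj (ctr (\<lambda>x. cnj (b x)) (Complex x u)))
      \<longlongrightarrow> cnj (hil (\<lambda>x. cnj (b x)) x - \<i> * of_real pi * cnj (b x))) (at_right 0)"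
    by (intro tendsto_cnj plemelj_right lhold_cnj csupp_cnj b)
  then have "((\<lambda>u. ctr b (Complex x (- u))) \<longlongrightarrow> hil b x + \<i> * of_real pi * b x) (at_right 0)"
    by (simp add: hil_cnj ctr_cnj[symmetric] complex_cnj)
  then show ?thesis
    unfolding at_left_minus[of 0] filterlim_filtermap by simp
qed

text \<open>The bound is uniform up to the real axis; it supplies the majorant when the path of
  integration is moved to the axis in \<open>boundary_integral_bound\<close>.\<close>

lemma ctr_bounded:
  assumes b: "lhold b" "csupp b"
  obtains M where "\<And>x u. \<bar>x\<bar> \<le> L \<Longrightarrow> u > 0 \<Longrightarrow> cmod (ctr b (Complex x u)) \<le> M"
proof -
  note [measurable] = lhold_measurable[OF b(1)]
  obtain w where w: "integrable lborel w" "\<And>x s. \<bar>x\<bar> \<le> L \<Longrightarrow> cmod ((b (x - s) - b (x + s)) / of_real s) \<le> w s"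
    using hil_kernel_bound[OF b] by metis
  obtain M where M: "M > 0" "\<And>x. cmod (b x) \<le> M" using lhold_global_bound[OF b] by metis
  show ?thesis
  proof
    fix x u assume x: "\<bar>x\<bar> \<le> L" and u: "u > (0::real)"
    have "cmod (LINT s|lborel. (b (x - s) - b (x + s)) * of_real (s / (s\<^sup>2 + u\<^sup>2))) \<le> (LINT s|lborel. w s)"
      by (intro norm_integral_le w order_trans[OF hil_kernel_mono] x)
    moreover have "cmod (LINT s|lborel. (b (x - u * s) + b (x + u * s)) * of_real (1 / (1 + s\<^sup>2)))
       \<le> (LINT s|lborel. 2 * M * (1 / (1 + s\<^sup>2)))"
      by (intro norm_integral_le integrable_mult_right poisson_kernel poisson_part_bound M)
    ultimately show "cmod (ctr b (Complex x u)) \<le> ((LINT s|lborel. w s) + (LINT s|lborel. 2 * M * (1 / (1 + s\<^sup>2)))) / 2"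
      unfolding ctr_split[OF b u] norm_divide norm_numeral
      by (intro divide_right_mono order_trans[OF norm_triangle_ineq4] add_mono) (simp_all add: norm_mult)
  qed
qed

section \<open>Contour integration in the upper half plane\<close>

lemma ctr_holomorphic:
  assumes b: "lhold b" "csupp b"
  shows "ctr b holomorphic_on {z. Im z > 0}"
proof -
  obtain R where R: "R > 0" "\<And>x. \<bar>x\<bar> > R \<Longrightarrow> b x = 0" using csuppE[OF b(2)] by metis
  have cont: "continuous_on (cbox (-R) R) (\<lambda>t. b t / (z - of_real t))" if "Im z > 0" for z
    using that by (intro continuous_intros lhold_continuous b) auto
  have eq: "ctr b z = integral (cbox (-R) R) (\<lambda>t. b t / (z - of_real t))" if "Im z > 0" for z
  proof -
    have si: "set_integrable lborel (cbox (-R) R) (\<lambda>t. b t / (z - of_real t))"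
      unfolding set_integrable_def by (intro borel_integrable_compact cont that) auto
    have "ctr b z = (LINT t:cbox (-R) R|lborel. b t / (z - of_real t))"
      unfolding ctr_def set_lebesgue_integral_def
      using R by (intro Bochner_Integration.integral_cong) (auto simp: indicator_def not_le abs_if split: if_splits)
    then show ?thesis using set_borel_integral_eq_integral(2)[OF si] by simp
  qed
  have "(\<lambda>z. integral (cbox (-R) R) (\<lambda>t. b t / (z - of_real t))) holomorphic_on {z. Im z > 0}"
  proof (rule leibniz_rule_holomorphic)
    show "((\<lambda>z. b t / (z - of_real t)) has_field_derivative - b t / (z - of_real t)^2) (at z within {z. Im z > 0})"
      if "z \<in> {z. Im z > 0}" for z t
    proof -
      have "z - of_real t \<noteq> 0" using that by auto
      then show ?thesis by (auto intro!: derivative_eq_intros simp: power2_eq_square)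
    qed
    show "(\<lambda>t. b t / (z - of_real t)) integrable_on cbox (-R) R" if "z \<in> {z. Im z > 0}" for z
      using that by (intro integrable_continuous cont) auto
    show "continuous_on ({z. 0 < Im z} \<times> cbox (- R) R) (\<lambda>(z, t). - b t / (z - of_real t)^2)"
      unfolding case_prod_beta
      by (intro continuous_intros continuous_on_compose2[OF lhold_continuous[OF b(1), of UNIV]]) auto
    show "convex {z. 0 < Im z}" by (rule convex_halfspace_Im_gt)
  qed
  then show ?thesis
    by (rule holomorphic_transform) (simp add: eq)
qed

text \<open>If |z| is at least twice the radius of the support, then |z - t| \<ge> |z| / 2 for every
  t that contributes.\<close>

lemma ctr_decay:
  assumes b: "lhold b" "csupp b"
  obtains B R where "B \<ge> 0" "R > 0" "\<And>z. cmod z \<ge> R \<Longrightarrow> cmod (ctr b z) \<le> B / cmod z"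
proof -
  obtain R where R: "R > 0" "\<And>x. \<bar>x\<bar> > R \<Longrightarrow> b x = 0" using csuppE[OF b(2)] by metis
  have ib: "integrable lborel (\<lambda>t. cmod (b t))"
    by (intro integrable_norm integrable_continuous_csupp lhold_continuous b)
  show ?thesis
  proof
    show "0 \<le> 2 * (LINT t|lborel. cmod (b t))" by simp
    show "2 * R > 0" using R by simp
    fix z assume z: "cmod z \<ge> 2 * R"
    have "cmod (ctr b z) \<le> (LINT t|lborel. cmod (b t) * (2 / cmod z))"
      unfolding ctr_def
    proof (rule norm_integral_le)
      show "integrable lborel (\<lambda>t. cmod (b t) * (2 / cmod z))" by (intro integrable_mult_left ib)
      show "cmod (b t / (z - of_real t)) \<le> cmod (b t) * (2 / cmod z)" for t
      proof (cases "\<bar>t\<bar> \<le> R")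
        case True
        have "cmod z \<le> cmod (z - of_real t) + \<bar>t\<bar>"
          using norm_triangle_ineq[of "z - of_real t" "of_real t"] by simp
        then have "cmod z / 2 \<le> cmod (z - of_real t)" using True z by linarith
        then have "cmod (b t) / cmod (z - of_real t) \<le> cmod (b t) / (cmod z / 2)"
          using R(1) z by (intro frac_le) auto
        then show ?thesis by (simp add: norm_divide)
      qed (use R in simp)
    qed
    then show "cmod (ctr b z) \<le> 2 * (LINT t|lborel. cmod (b t)) / cmod z"
      by (simp add: mult.commute)
  qed
qed

text \<open>Cauchy's theorem in terms of a primitive: the integral over a segment
  parallel to the real axis is compared with the other three sides of a rectangle.\<close>
lemma boundary_integral_bound:
  assumes hol: "f holomorphic_on {z. Im z > 0}" and "L > 0" "C \<ge> 0"
    and decay: "\<And>z. Im z > 0 \<Longrightarrow> cmod z \<ge> L \<Longrightarrow> cmod (f z) \<le> C / (cmod z)\<^sup>2"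
    and bdd: "\<And>x u. \<bar>x\<bar> \<le> L \<Longrightarrow> u > 0 \<Longrightarrow> cmod (f (Complex x u)) \<le> M"
    and lim: "\<And>x. ((\<lambda>u. f (Complex x u)) \<longlongrightarrow> f0 x) (at_right 0)"
    and [measurable]: "f0 \<in> borel_measurable borel"
  shows "cmod (LINT x|lborel. indicator {-L..L} x *\<^sub>R f0 x) \<le> 4 * C / L"
proof -
  obtain F where F: "\<And>z. Im z > 0 \<Longrightarrow> (F has_field_derivative f z) (at z)"
  proof -
    obtain F where "\<And>z. z \<in> {z. Im z > 0} \<Longrightarrow> (F has_field_derivative f z) (at z within {z. Im z > 0})"
      using holomorphic_convex_primitive'[OF convex_halfspace_Im_gt[of 0] open_halfspace_Im_gt[of 0] hol] by metis
    then show ?thesis using that by (auto simp: at_within_open[OF _ open_halfspace_Im_gt])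
  qed
  have contf: "continuous_on {-L..L} (\<lambda>x. f (Complex x u))" if "u > 0" for u
    using that
    by (intro continuous_on_compose2[OF holomorphic_on_imp_continuous_on[OF hol]])
       (auto simp: Complex_eq intro!: continuous_intros)
  have int: "(LINT x|lborel. indicator {-L..L} x *\<^sub>R f (Complex x u)) = F (Complex L u) - F (Complex (-L) u)"
    if u: "u > 0" for u
  proof (rule has_bochner_integral_integral_eq, rule has_bochner_integral_FTC_Icc)
    show "((\<lambda>x. F (Complex x u)) has_vector_derivative f (Complex x u)) (at x within {- L..L})" for x
    proof -
      have "((\<lambda>x. of_real x + \<i> * of_real u) has_vector_derivative 1) (at x within {-L..L})"
        by (auto intro!: derivative_eq_intros)
      from field_vector_diff_chain_within[OF this, of F "f (Complex x u)"] F[of "Complex x u"] u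
      show ?thesis by (simp add: o_def Complex_eq has_field_derivative_at_within)
    qed
  qed (use contf[OF u] \<open>L > 0\<close> in auto)
  have step: "cmod (F a - F b) \<le> C / L\<^sup>2 * cmod (a - b)"
    if "\<And>z. z \<in> closed_segment b a \<Longrightarrow> Im z > 0 \<and> cmod z \<ge> L" for a b
  proof (rule field_differentiable_bound[of "closed_segment b a" F f])
    fix z assume z: "z \<in> closed_segment b a"
    show "(F has_field_derivative f z) (at z within closed_segment b a)"
      using F that[OF z] by (simp add: has_field_derivative_at_within)
    have "cmod (f z) \<le> C / (cmod z)\<^sup>2" using decay that[OF z] by simp
    also have "\<dots> \<le> C / L\<^sup>2" using that[OF z] \<open>L > 0\<close> \<open>C \<ge> 0\<close> by (intro divide_left_mono power_mono mult_pos_pos) auto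
    finally show "cmod (f z) \<le> C / L\<^sup>2" .
  qed auto
  have bound: "cmod (LINT x|lborel. indicator {-L..L} x *\<^sub>R f (Complex x u)) \<le> 4 * C / L" if u: "0 < u" "u \<le> L" for u
  proof -
    have v: "cmod (F (Complex x L) - F (Complex x u)) \<le> C / L\<^sup>2 * L" if "\<bar>x\<bar> = L" for x
    proof -
      have "cmod (F (Complex x L) - F (Complex x u)) \<le> C / L\<^sup>2 * cmod (Complex x L - Complex x u)"
      proof (rule step)
        fix z assume "z \<in> closed_segment (Complex x u) (Complex x L)"
        then have "Re z = x" "u \<le> Im z"
          using u by (auto simp: closed_segment_same_Re closed_segment_eq_real_ivl)
        then show "Im z > 0 \<and> cmod z \<ge> L" using abs_Re_le_cmod[of z] that u by auto
      qed
      also have "\<dots> \<le> C / L\<^sup>2 * L"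
        using u \<open>C \<ge> 0\<close> by (intro mult_left_mono) (auto simp: cmod_def)
      finally show ?thesis .
    qed
    have h: "cmod (F (Complex L L) - F (Complex (-L) L)) \<le> C / L\<^sup>2 * (2 * L)"
    proof -
      have e: "Complex L L - Complex (-L) L = of_real (2 * L)" by (simp add: complex_eq_iff)
      have e2: "cmod (Complex L L - Complex (-L) L) = 2 * L"
        unfolding e norm_of_real using \<open>L > 0\<close> by simp
      show ?thesis
        unfolding e2[symmetric]
      proof (rule step)
        fix z assume "z \<in> closed_segment (Complex (-L) L) (Complex L L)"
        then have "Im z = L"
          by (auto simp: closed_segment_same_Im)
        then show "Im z > 0 \<and> cmod z \<ge> L" using abs_Im_le_cmod[of z] \<open>L > 0\<close> by auto
      qed
    qed
    have tri: "cmod (x - y + z) \<le> cmod x + cmod y + cmod z" for x y z :: complex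
      using norm_triangle_ineq[of "x - y" z] norm_triangle_ineq4[of x y] by linarith
    have "cmod (F (Complex L u) - F (Complex (-L) u)) = cmod ((F (Complex L L) - F (Complex (-L) L))
        - (F (Complex L L) - F (Complex L u)) + (F (Complex (-L) L) - F (Complex (-L) u)))" by simp
    \<comment> \<open>The upper side has length 2 L, the vertical sides have length at most L, and
      |z| \<ge> L on all three.\<close>
    also have "\<dots> \<le> C / L\<^sup>2 * (2 * L) + C / L\<^sup>2 * L + C / L\<^sup>2 * L"
      by (rule order_trans[OF tri]) (intro add_mono h v; use \<open>L > 0\<close> in simp)
    also have "\<dots> = 4 * C / L" using \<open>L > 0\<close> by (simp add: field_simps power2_eq_square)
    finally show ?thesis using int[OF u(1)] by simp
  qed
  have "((\<lambda>u. LINT x|lborel. indicator {-L..L} x *\<^sub>R f (Complex x u)) \<longlongrightarrow> (LINT x|lborel. indicator {-L..L} x *\<^sub>R f0 x)) (at_right 0)"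
  proof (rule dominated_convergence_within[where w = "\<lambda>x. indicator {-L..L} x *\<^sub>R \<bar>M\<bar>"])
    show "integrable lborel (\<lambda>x. indicator {-L..L} x *\<^sub>R \<bar>M\<bar>)" by (intro borel_integrable_compact) auto
    show "(\<lambda>x. indicator {-L..L} x *\<^sub>R f (Complex x u)) \<in> borel_measurable lborel" if "u \<in> {0<..}" for u
      using contf[of u] that by (simp add: borel_measurable_continuous_on_indicator)
    show "norm (indicator {-L..L} x *\<^sub>R f (Complex x u)) \<le> indicator {-L..L} x *\<^sub>R \<bar>M\<bar>" if "u \<in> {0<..}" for u x
      using bdd[of x u] that by (auto simp: indicator_def intro: order_trans[OF _ abs_ge_self])
  qed (auto intro!: tendsto_intros lim)
  moreover have "\<forall>\<^sub>F u in at_right 0. cmod (LINT x|lborel. indicator {-L..L} x *\<^sub>R f (Complex x u)) \<le> 4 * C / L"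
    using eventually_at_right_real[OF \<open>L > 0\<close>] by eventually_elim (auto intro!: bound)
  ultimately show ?thesis
    using tendsto_upperbound[OF tendsto_norm] by fastforce
qed

lemma hil_measurable:
  assumes "lhold b" "csupp b" shows "hil b \<in> borel_measurable borel"
  by (intro borel_measurable_continuous_onI hil_continuous assms)

text \<open>A single Cauchy transform decays like 1 / |z|, which does not make the remote sides of a
  rectangle of size L negligible. Two factors give 1 / |z|^2 and hence a contribution of order 1 /
  L.\<close>

lemma ctr_product_decay:
  assumes b1: "lhold b1" "csupp b1" and b2: "lhold b2" "csupp b2"
  obtains C R where "C \<ge> 0" "R > 0" "\<And>z. cmod z \<ge> R \<Longrightarrow> cmod (ctr b1 z * ctr b2 z) \<le> C / (cmod z)\<^sup>2"
proof -
  obtain B1 R1 where 1: "B1 \<ge> 0" "R1 > 0" "\<And>z. cmod z \<ge> R1 \<Longrightarrow> cmod (ctr b1 z) \<le> B1 / cmod z"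
    using ctr_decay[OF b1] by metis
  obtain B2 R2 where 2: "B2 \<ge> 0" "R2 > 0" "\<And>z. cmod z \<ge> R2 \<Longrightarrow> cmod (ctr b2 z) \<le> B2 / cmod z"
    using ctr_decay[OF b2] by metis
  show ?thesis
  proof
    fix z assume z: "max R1 R2 \<le> cmod z"
    have "cmod (ctr b1 z * ctr b2 z) \<le> (B1 / cmod z) * (B2 / cmod z)"
      unfolding norm_mult using 1 2 z by (intro mult_mono) (auto simp: zero_le_divide_iff)
    then show "cmod (ctr b1 z * ctr b2 z) \<le> (B1 * B2) / (cmod z)\<^sup>2" by (simp add: power2_eq_square)
  qed (use 1 2 in auto)
qed

lemma boundary_integral_tendsto_0:
  assumes hol: "f holomorphic_on {z. Im z > 0}" and "C \<ge> 0"
    and decay: "\<And>z. cmod z \<ge> R \<Longrightarrow> cmod (f z) \<le> C / (cmod z)\<^sup>2"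
    and bdd: "\<And>L. \<exists>M. \<forall>x u. \<bar>x\<bar> \<le> L \<longrightarrow> u > 0 \<longrightarrow> cmod (f (Complex x u)) \<le> M"
    and lim: "\<And>x. ((\<lambda>u. f (Complex x u)) \<longlongrightarrow> f0 x) (at_right 0)"
    and meas: "f0 \<in> borel_measurable borel"
  shows "((\<lambda>L. LINT x|lborel. indicator {-L..L} x *\<^sub>R f0 x) \<longlongrightarrow> 0) at_top"
proof (rule Lim_null_comparison)
  show "((\<lambda>L::real. 4 * C / L) \<longlongrightarrow> 0) at_top"
    by (intro tendsto_divide_0[OF tendsto_const] filterlim_at_top_imp_at_infinity filterlim_ident)
  show "\<forall>\<^sub>F L in at_top. cmod (LINT x|lborel. indicator {-L..L} x *\<^sub>R f0 x) \<le> 4 * C / L"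
    using eventually_ge_at_top[of R] eventually_gt_at_top[of 0]
  proof eventually_elim
    case (elim L)
    obtain M where "\<And>x u. \<bar>x\<bar> \<le> L \<Longrightarrow> u > 0 \<Longrightarrow> cmod (f (Complex x u)) \<le> M" using bdd[of L] by blast
    then show ?case
      using elim by (intro boundary_integral_bound[OF hol _ \<open>C \<ge> 0\<close> _ _ lim meas]) (auto intro: decay)
  qed
qed

lemma boundary_product_2:
  assumes b1: "lhold b1" "csupp b1" and b2: "lhold b2" "csupp b2"
  shows "((\<lambda>L. LINT x|lborel. indicator {-L..L} x *\<^sub>R
     ((hil b1 x - \<i> * of_real pi * b1 x) * (hil b2 x - \<i> * of_real pi * b2 x))) \<longlongrightarrow> 0) at_top"
proof -
  note [measurable] = lhold_measurable[OF b1(1)] lhold_measurable[OF b2(1)] hil_measurable[OF b1] hil_measurable[OF b2]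
  obtain C R where C: "C \<ge> 0" "\<And>z. cmod z \<ge> R \<Longrightarrow> cmod (ctr b1 z * ctr b2 z) \<le> C / (cmod z)\<^sup>2"
    using ctr_product_decay[OF b1 b2] by metis
  show ?thesis
  proof (rule boundary_integral_tendsto_0[OF _ C])
    show "(\<lambda>z. ctr b1 z * ctr b2 z) holomorphic_on {z. 0 < Im z}"
      by (intro holomorphic_intros ctr_holomorphic b1 b2)
    show "\<exists>M. \<forall>x u. \<bar>x\<bar> \<le> L \<longrightarrow> u > 0 \<longrightarrow> cmod (ctr b1 (Complex x u) * ctr b2 (Complex x u)) \<le> M" for L
    proof -
      obtain M1 where M1: "\<And>x u. \<bar>x\<bar> \<le> L \<Longrightarrow> u > 0 \<Longrightarrow> cmod (ctr b1 (Complex x u)) \<le> M1" using ctr_bounded[OF b1] by metis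
      obtain M2 where M2: "\<And>x u. \<bar>x\<bar> \<le> L \<Longrightarrow> u > 0 \<Longrightarrow> cmod (ctr b2 (Complex x u)) \<le> M2" using ctr_bounded[OF b2] by metis
      have "cmod (ctr b1 (Complex x u) * ctr b2 (Complex x u)) \<le> M1 * M2" if "\<bar>x\<bar> \<le> L" "u > 0" for x u
        unfolding norm_mult using that by (intro mult_mono M1 M2 order_trans[OF norm_ge_zero M1]) auto
      then show ?thesis by blast
    qed
    show "((\<lambda>u. ctr b1 (Complex x u) * ctr b2 (Complex x u)) \<longlongrightarrow>
        (hil b1 x - \<i> * of_real pi * b1 x) * (hil b2 x - \<i> * of_real pi * b2 x)) (at_right 0)" for x
      by (intro tendsto_mult plemelj_right b1 b2)
  qed measurable
qed

lemma boundary_product_3: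
  assumes b1: "lhold b1" "csupp b1" and b2: "lhold b2" "csupp b2" and b3: "lhold b3" "csupp b3"
  shows "((\<lambda>L. LINT x|lborel. indicator {-L..L} x *\<^sub>R
     ((hil b1 x - \<i> * of_real pi * b1 x) * (hil b2 x - \<i> * of_real pi * b2 x)
       * (hil b3 x - \<i> * of_real pi * b3 x))) \<longlongrightarrow> 0) at_top"
proof -
  note [measurable] = lhold_measurable[OF b1(1)] lhold_measurable[OF b2(1)] lhold_measurable[OF b3(1)]
    hil_measurable[OF b1] hil_measurable[OF b2] hil_measurable[OF b3]
  obtain C R where C: "C \<ge> 0" "R > 0" "\<And>z. cmod z \<ge> R \<Longrightarrow> cmod (ctr b1 z * ctr b2 z) \<le> C / (cmod z)\<^sup>2"
    using ctr_product_decay[OF b1 b2] by metis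
  obtain B Q where B: "B \<ge> 0" "Q > 0" "\<And>z. cmod z \<ge> Q \<Longrightarrow> cmod (ctr b3 z) \<le> B / cmod z"
    using ctr_decay[OF b3] by metis
  show ?thesis
  proof (rule boundary_integral_tendsto_0)
    show "(\<lambda>z. ctr b1 z * ctr b2 z * ctr b3 z) holomorphic_on {z. 0 < Im z}"
      by (intro holomorphic_intros ctr_holomorphic b1 b2 b3)
    \<comment> \<open>The third factor is merely bounded by B / Q for |z| \<ge> Q; the decay comes
      from the first two.\<close>
    show "C * (B / Q) \<ge> 0" using B C by auto
    show "cmod (ctr b1 z * ctr b2 z * ctr b3 z) \<le> C * (B / Q) / (cmod z)\<^sup>2" if "max R Q \<le> cmod z" for z
    proof -
      have "cmod (ctr b3 z) \<le> B / cmod z" using that by (intro B) auto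
      also have "\<dots> \<le> B / Q" using that B by (intro frac_le) auto
      finally have "cmod (ctr b1 z * ctr b2 z) * cmod (ctr b3 z) \<le> C / (cmod z)\<^sup>2 * (B / Q)"
        using that B(1,2) C(1) by (intro mult_mono C) auto
      then show ?thesis by (simp only: norm_mult times_divide_eq_left)
    qed
    show "\<exists>M. \<forall>x u. \<bar>x\<bar> \<le> L \<longrightarrow> u > 0 \<longrightarrow> cmod (ctr b1 (Complex x u) * ctr b2 (Complex x u) * ctr b3 (Complex x u)) \<le> M" for L
    proof -
      obtain M1 where M1: "\<And>x u. \<bar>x\<bar> \<le> L \<Longrightarrow> u > 0 \<Longrightarrow> cmod (ctr b1 (Complex x u)) \<le> M1" using ctr_bounded[OF b1] by metis
      obtain M2 where M2: "\<And>x u. \<bar>x\<bar> \<le> L \<Longrightarrow> u > 0 \<Longrightarrow> cmod (ctr b2 (Complex x u)) \<le> M2" using ctr_bounded[OF b2] by metis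
      obtain M3 where M3: "\<And>x u. \<bar>x\<bar> \<le> L \<Longrightarrow> u > 0 \<Longrightarrow> cmod (ctr b3 (Complex x u)) \<le> M3" using ctr_bounded[OF b3] by metis
      have "cmod (ctr b1 (Complex x u) * ctr b2 (Complex x u) * ctr b3 (Complex x u)) \<le> M1 * M2 * M3" if "\<bar>x\<bar> \<le> L" "u > 0" for x u
        unfolding norm_mult using that
        by (intro mult_mono M1 M2 M3 order_trans[OF norm_ge_zero M1] mult_nonneg_nonneg order_trans[OF norm_ge_zero M2]) auto
      then show ?thesis by blast
    qed
    show "((\<lambda>u. ctr b1 (Complex x u) * ctr b2 (Complex x u) * ctr b3 (Complex x u)) \<longlongrightarrow>
        (hil b1 x - \<i> * of_real pi * b1 x) * (hil b2 x - \<i> * of_real pi * b2 x) * (hil b3 x - \<i> * of_real pi * b3 x)) (at_right 0)" for x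
      by (intro tendsto_mult plemelj_right b1 b2 b3)
  qed measurable
qed

text \<open>In its applications p is a product of boundary values from above and q the corresponding
  product from below, obtained by conjugation. Each is controlled only through symmetric
  truncations, but their difference has compact support, so its truncated integrals are eventually
  the full integral.\<close>

lemma integral_zero_of_truncated_difference:
  fixes p q k :: "real \<Rightarrow> complex"
  assumes p: "((\<lambda>L. LINT x|lborel. indicator {-L..L} x *\<^sub>R p x) \<longlongrightarrow> 0) at_top"
    and q: "((\<lambda>L. LINT x|lborel. indicator {-L..L} x *\<^sub>R q x) \<longlongrightarrow> 0) at_top"
    and cp: "continuous_on UNIV p" and cq: "continuous_on UNIV q"
    and k: "\<And>x. p x - q x = c * k x" and c: "c \<noteq> 0" and ks: "csupp k"
  shows "(LINT x|lborel. k x) = 0"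
proof -
  obtain R where R: "R > 0" "\<And>x. \<bar>x\<bar> > R \<Longrightarrow> k x = 0" using csuppE[OF ks] by metis
  have i: "integrable lborel (\<lambda>x. indicator {-L..L} x *\<^sub>R p x)" "integrable lborel (\<lambda>x. indicator {-L..L} x *\<^sub>R q x)" for L
    by (intro borel_integrable_compact continuous_on_subset[OF cp] continuous_on_subset[OF cq]; simp)+
  have "((\<lambda>L. (LINT x|lborel. indicator {-L..L} x *\<^sub>R p x) - (LINT x|lborel. indicator {-L..L} x *\<^sub>R q x)) \<longlongrightarrow> 0 - 0) at_top"
    by (intro tendsto_diff p q)
  moreover have "\<forall>\<^sub>F L in at_top. (LINT x|lborel. indicator {-L..L} x *\<^sub>R p x) - (LINT x|lborel. indicator {-L..L} x *\<^sub>R q x)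
     = c * (LINT x|lborel. k x)"
    using eventually_ge_at_top[of R]
  proof eventually_elim
    case (elim L)
    have "(LINT x|lborel. indicator {-L..L} x *\<^sub>R p x) - (LINT x|lborel. indicator {-L..L} x *\<^sub>R q x)
       = (LINT x|lborel. indicator {-L..L} x *\<^sub>R p x - indicator {-L..L} x *\<^sub>R q x)"
      using i by simp
    also have "\<dots> = (LINT x|lborel. c * k x)"
    proof (intro Bochner_Integration.integral_cong refl)
      fix x
      show "indicator {-L..L} x *\<^sub>R p x - indicator {-L..L} x *\<^sub>R q x = c * k x"
      proof (cases "x \<in> {-L..L}")
        case False
        then have "k x = 0" using elim by (intro R(2)) auto
        then show ?thesis using False by simp
      next
        case True
        then show ?thesis using k[of x] by simp
      qed
    qed
    finally show ?case by simp
  qed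
  ultimately have "((\<lambda>L::real. c * (LINT x|lborel. k x)) \<longlongrightarrow> 0) at_top"
    using Lim_transform_eventually by fastforce
  then show ?thesis using c by (simp add: tendsto_const_iff)
qed

lemma cnj_truncated_tendsto_0:
  fixes p :: "real \<Rightarrow> complex"
  assumes "((\<lambda>L. LINT x|lborel. indicator {-L..L} x *\<^sub>R p x) \<longlongrightarrow> 0) at_top"
  shows "((\<lambda>L. LINT x|lborel. indicator {-L..L} x *\<^sub>R cnj (p x)) \<longlongrightarrow> 0) at_top"
  using tendsto_cnj[OF assms] by (simp flip: Bochner_Integration.integral_cnj add: scaleR_conv_of_real)

lemma hil_antisymmetric:
  assumes b1: "lhold b1" "csupp b1" and b2: "lhold b2" "csupp b2"
  shows "(LINT x|lborel. b1 x * hil b2 x) = - (LINT x|lborel. b2 x * hil b1 x)"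
proof -
  note c = lhold_continuous[OF b1(1)] lhold_continuous[OF b2(1)] hil_continuous[OF b1] hil_continuous[OF b2]
  have "(LINT x|lborel. b1 x * hil b2 x + b2 x * hil b1 x) = 0"
  proof (rule integral_zero_of_truncated_difference[OF boundary_product_2[OF b1 b2]
        cnj_truncated_tendsto_0[OF boundary_product_2[OF lhold_cnj[OF b1(1)] csupp_cnj[OF b1(2)] lhold_cnj[OF b2(1)] csupp_cnj[OF b2(2)]]]])
    show "csupp (\<lambda>x. b1 x * hil b2 x + b2 x * hil b1 x)" by (intro csupp_add csupp_mult1 b1 b2)
    \<comment> \<open>This constant arises from (Hb1 - i \<pi> b1)(Hb2 - i \<pi> b2) - (Hb1 + i
      \<pi> b1)(Hb2 + i \<pi> b2) = - 2 i \<pi> (b1 Hb2 + b2 Hb1).\<close>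
    show "- 2 * \<i> * of_real pi \<noteq> 0" by simp
  qed (auto simp: hil_cnj algebra_simps intro!: continuous_intros c)
  moreover have "integrable lborel (\<lambda>x. b1 x * hil b2 x)" "integrable lborel (\<lambda>x. b2 x * hil b1 x)"
    by (intro integrable_continuous_csupp continuous_intros c csupp_mult1 b1 b2)+
  ultimately show ?thesis by (simp add: eq_neg_iff_add_eq_0)
qed

text \<open>A weak form of Tricomi's identity \<open>H(b\<^sub>1 H b\<^sub>2 + b\<^sub>2 H b\<^sub>1) = H b\<^sub>1 H b\<^sub>2 - \<pi>\<^sup>2 b\<^sub>1 b\<^sub>2\<close>.\<close>
lemma hil_trilinear:
  assumes b1: "lhold b1" "csupp b1" and b2: "lhold b2" "csupp b2" and b3: "lhold b3" "csupp b3"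
  shows "(LINT x|lborel. b1 x * hil b2 x * hil b3 x + b2 x * hil b1 x * hil b3 x + b3 x * hil b1 x * hil b2 x
       - of_real (pi\<^sup>2) * b1 x * b2 x * b3 x) = 0"
proof -
  note c = lhold_continuous[OF b1(1)] lhold_continuous[OF b2(1)] lhold_continuous[OF b3(1)]
    hil_continuous[OF b1] hil_continuous[OF b2] hil_continuous[OF b3]
  show ?thesis
  proof (rule integral_zero_of_truncated_difference[OF boundary_product_3[OF b1 b2 b3]
        cnj_truncated_tendsto_0[OF boundary_product_3[OF lhold_cnj[OF b1(1)] csupp_cnj[OF b1(2)]
         lhold_cnj[OF b2(1)] csupp_cnj[OF b2(2)] lhold_cnj[OF b3(1)] csupp_cnj[OF b3(2)]]]])
    have "csupp (\<lambda>x. b1 x * hil b2 x * hil b3 x + b2 x * hil b1 x * hil b3 x + b3 x * hil b1 x * hil b2 x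
       + (- of_real (pi\<^sup>2)) * b1 x * b2 x * b3 x)"
      by (intro csupp_add csupp_mult1 csupp_mult2[of b3] b1 b2 b3)
    then show "csupp (\<lambda>x. b1 x * hil b2 x * hil b3 x + b2 x * hil b1 x * hil b3 x + b3 x * hil b1 x * hil b2 x
       - of_real (pi\<^sup>2) * b1 x * b2 x * b3 x)" by simp
    \<comment> \<open>Only odd powers of i \<pi> survive in the difference of the two triple
      products; the cubic one produces the term with \<pi>^2.\<close>
    show "- 2 * \<i> * of_real pi \<noteq> 0" by simp
  qed (auto simp: hil_cnj algebra_simps power2_eq_square intro!: continuous_intros c)
qed

text \<open>The truncation is symmetric about x, so the integral may be averaged over the reflection
  s -> - s. The symmetrized integrand is integrable up to s = 0, and dominated convergence removes
  the truncation.\<close>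

lemma pv_truncated_tendsto_hil:
  assumes b: "lhold b" "csupp b"
  shows "(pv_truncated b x \<longlongrightarrow> hil b x) (at_right 0)"
proof -
  note [measurable] = lhold_measurable[OF b(1)]
  obtain w where w: "integrable lborel w" "\<And>y s. \<bar>y\<bar> \<le> \<bar>x\<bar> \<Longrightarrow> cmod ((b (y - s) - b (y + s)) / of_real s) \<le> w s"
    using hil_kernel_bound[OF b] by metis
  define k where "k \<epsilon> s = indicator {s. \<epsilon> < \<bar>s\<bar>} s *\<^sub>R ((b (x - s) - b (x + s)) / of_real s)" for \<epsilon> s
  have eq: "pv_truncated b x \<epsilon> = (LINT s|lborel. k \<epsilon> s) / 2" if "\<epsilon> > 0" for \<epsilon>
  proof -
    let ?f = "\<lambda>c s. indicator {s. \<epsilon> < \<bar>s\<bar>} s *\<^sub>R (b (x + c * s) / of_real s)"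
    have i: "integrable lborel (?f c)" if c: "\<bar>c\<bar> = 1" for c
    proof (rule Bochner_Integration.integrable_bound)
      show "integrable lborel (\<lambda>s. b (x + c * s) * of_real (1 / \<epsilon>))"
        by (rule integrable_shift_div[OF b _ c]) simp
      show "AE s in lborel. norm (?f c s) \<le> norm (b (x + c * s) * of_real (1 / \<epsilon>))"
        using \<open>\<epsilon> > 0\<close> by (intro AE_I2) (auto simp: indicator_def norm_divide norm_mult field_simps intro!: mult_right_mono)
    qed measurable
    have e: "pv_truncated b x \<epsilon> = - (LINT s|lborel. c *\<^sub>R ?f c s)" if c: "\<bar>c\<bar> = 1" for c
    proof -
      have "c = 1 \<or> c = -1" using c by auto
      then show ?thesis
        unfolding pv_truncated_def set_lebesgue_integral_def
        by (subst lborel_integral_real_affine[of c _ x])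
           (auto simp: indicator_def intro!: Bochner_Integration.integral_cong simp flip: Bochner_Integration.integral_minus)
    qed
    have "2 * pv_truncated b x \<epsilon> = (LINT s|lborel. ?f (-1) s) - (LINT s|lborel. ?f 1 s)"
      using e[of 1] e[of "-1"] by simp
    also have "\<dots> = (LINT s|lborel. ?f (-1) s - ?f 1 s)" using i[of 1] i[of "-1"] by simp
    also have "\<dots> = (LINT s|lborel. k \<epsilon> s)"
      by (intro Bochner_Integration.integral_cong) (auto simp: k_def indicator_def diff_divide_distrib)
    finally show ?thesis by (metis nonzero_mult_div_cancel_left zero_neq_numeral)
  qed
  have "((\<lambda>\<epsilon>. LINT s|lborel. k \<epsilon> s) \<longlongrightarrow> (LINT s|lborel. (b (x - s) - b (x + s)) / of_real s)) (at_right 0)"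
  proof (rule dominated_convergence_within[OF _ _ w(1)])
    show "((\<lambda>\<epsilon>. k \<epsilon> s) \<longlongrightarrow> (b (x - s) - b (x + s)) / of_real s) (at_right 0)" for s
    proof (cases "s = 0")
      case False
      then have "\<forall>\<^sub>F \<epsilon> in at_right 0. \<epsilon> < \<bar>s\<bar>" by (intro eventually_at_right_real[THEN eventually_mono]) auto
      then have "\<forall>\<^sub>F \<epsilon> in at_right 0. (b (x - s) - b (x + s)) / of_real s = k \<epsilon> s"
        by eventually_elim (simp add: k_def)
      then show ?thesis by (rule Lim_transform_eventually[OF tendsto_const])
    qed (simp add: k_def)
    show "norm (k \<epsilon> s) \<le> w s" for \<epsilon> s
      using w(2)[of x s] order_trans[OF norm_ge_zero w(2)[of x s]] by (auto simp: k_def indicator_def)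
  qed (auto simp: k_def)
  then have "((\<lambda>\<epsilon>. (LINT s|lborel. k \<epsilon> s) / 2) \<longlongrightarrow> hil b x) (at_right 0)"
    unfolding hil_def by (intro tendsto_divide tendsto_const) auto
  moreover have "\<forall>\<^sub>F \<epsilon> in at_right 0. (LINT s|lborel. k \<epsilon> s) / 2 = pv_truncated b x \<epsilon>"
    using eventually_at_right_less[of 0] by eventually_elim (simp add: eq)
  ultimately show ?thesis by (rule Lim_transform_eventually)
qed

text \<open>The second difference of b has two Lipschitz bounds, one proportional to |s| and one to
  |x - y|. Their geometric mean, divided by |s|, is sqrt |x - y| times the integrable function
  |s|^(-1/2).\<close>

lemma hil_lhold:
  assumes lip: "\<And>x y. cmod (b x - b y) \<le> K * \<bar>x - y\<bar>" and supp: "csupp b"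
  shows "lhold (hil b)"
  unfolding lhold_def
proof
  fix L
  have b: "lhold b" using lip by (intro lhold_lipschitz) blast
  have K: "K \<ge> 0" using order_trans[OF norm_ge_zero lip[of 1 0]] by simp
  obtain R where R: "R > 0" "\<And>x. \<bar>x\<bar> > R \<Longrightarrow> b x = 0" using csuppE[OF supp] by metis
  define w where "w s = indicator {-(R + \<bar>L\<bar>)..R + \<bar>L\<bar>} s / sqrt \<bar>s\<bar>" for s
  have w: "integrable lborel w" unfolding w_def by (rule integrable_inv_sqrt)
  have "cmod (hil b x - hil b y) \<le> (2 * K * (LINT s|lborel. w s)) * sqrt \<bar>x - y\<bar>" if L: "\<bar>x\<bar> \<le> L" "\<bar>y\<bar> \<le> L" for x y
  proof -
    have "hil b x - hil b y = (LINT s|lborel. (b (x - s) - b (x + s)) / of_real s - (b (y - s) - b (y + s)) / of_real s) / 2"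
      using hil_integrable[OF b supp] by (simp add: hil_def diff_divide_distrib)
    also have "cmod \<dots> \<le> (LINT s|lborel. (4 * K * sqrt \<bar>x - y\<bar>) * w s) / 2"
      unfolding norm_divide norm_numeral
    proof (intro divide_right_mono norm_integral_le integrable_mult_right w)
      fix s
      show "cmod ((b (x - s) - b (x + s)) / of_real s - (b (y - s) - b (y + s)) / of_real s) \<le> (4 * K * sqrt \<bar>x - y\<bar>) * w s"
      proof (cases "\<bar>s\<bar> > R + \<bar>L\<bar>")
        case True
        then have "b (x - s) = 0" "b (x + s) = 0" "b (y - s) = 0" "b (y + s) = 0" using L by (auto intro!: R(2))
        then show ?thesis using K by (simp add: w_def)
      next
        case False
        define d where "d = cmod ((b (x - s) - b (x + s)) - (b (y - s) - b (y + s)))"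
        have d1: "d \<le> 4 * K * \<bar>s\<bar>"
          using norm_triangle_ineq4[of "b (x - s) - b (x + s)" "b (y - s) - b (y + s)"] lip[of "x - s" "x + s"] lip[of "y - s" "y + s"]
          by (simp add: d_def)
        have "d = cmod ((b (x - s) - b (y - s)) - (b (x + s) - b (y + s)))" by (simp add: d_def algebra_simps)
        then have d2: "d \<le> 2 * K * \<bar>x - y\<bar>"
          using norm_triangle_ineq4[of "b (x - s) - b (y - s)" "b (x + s) - b (y + s)"] lip[of "x - s" "y - s"] lip[of "x + s" "y + s"]
          by simp
        have "d = sqrt (d * d)" by (simp add: d_def)
        also have "\<dots> \<le> sqrt ((4 * K * \<bar>s\<bar>) * (2 * K * \<bar>x - y\<bar>))"
          using d1 d2 K by (intro real_sqrt_le_mono mult_mono) (auto simp: d_def)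
        also have "\<dots> \<le> sqrt ((4 * K)\<^sup>2 * (\<bar>s\<bar> * \<bar>x - y\<bar>))"
          using K by (intro real_sqrt_le_mono) (simp add: power2_eq_square mult_ac)
        also have "\<dots> = 4 * K * (sqrt \<bar>s\<bar> * sqrt \<bar>x - y\<bar>)" using K by (simp add: real_sqrt_mult)
        finally have "d / \<bar>s\<bar> \<le> 4 * K * (sqrt \<bar>s\<bar> * sqrt \<bar>x - y\<bar>) / \<bar>s\<bar>" by (simp add: divide_right_mono)
        also have "\<dots> = (4 * K * sqrt \<bar>x - y\<bar>) * w s"
        proof -
          have "s \<in> {-(R + \<bar>L\<bar>)..R + \<bar>L\<bar>}" using False by auto
          then show ?thesis by (cases "s = 0") (simp_all add: w_def field_simps)
        qed
        finally show ?thesis by (simp add: d_def norm_divide flip: diff_divide_distrib)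
      qed
    qed auto
    finally show ?thesis by (simp add: mult_ac)
  qed
  then show "\<exists>C. \<forall>x y. \<bar>x\<bar> \<le> L \<longrightarrow> \<bar>y\<bar> \<le> L \<longrightarrow> cmod (hil b x - hil b y) \<le> C * sqrt \<bar>x - y\<bar>" by blast
qed

subsection \<open>Smooth bump functions\<close>

text \<open>The powers of t in the denominator make the family closed under differentiation: the
  derivative of \<open>rexp k\<close> is a combination of \<open>rexp (k + 2)\<close> and
  \<open>rexp (k + 1)\<close>.\<close>

definition rexp :: "nat \<Rightarrow> real \<Rightarrow> real" where
  "rexp k t = (if t > 0 then exp (- 1 / t) / t ^ k else 0)"

lemma rexp_tendsto_0: "(rexp k \<longlongrightarrow> 0) (at_right 0)"
proof -
  have "((\<lambda>t::real. inverse t ^ k / exp (inverse t)) \<longlongrightarrow> 0) (at_right 0)"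
    by (rule filterlim_compose[OF tendsto_power_div_exp_0 filterlim_inverse_at_top_right])
  moreover have "\<forall>\<^sub>F t in at_right (0::real). inverse t ^ k / exp (inverse t) = rexp k t"
    using eventually_at_right_less[of 0]
    by eventually_elim (auto simp: rexp_def exp_minus field_simps power_divide)
  ultimately show ?thesis by (rule Lim_transform_eventually)
qed

lemma rexp_has_derivative: "(rexp k has_real_derivative rexp (k + 2) t - real k * rexp (k + 1) t) (at t)"
proof -
  consider "t > 0" | "t < 0" | "t = 0" by linarith
  then show ?thesis
  proof cases
    case 1
    have "((\<lambda>t. exp (- 1 / t) / t ^ k) has_real_derivative rexp (k + 2) t - real k * rexp (k + 1) t) (at t)"
    proof -
      have "((\<lambda>t. exp (- 1 / t)) has_real_derivative exp (- 1 / t) / t\<^sup>2) (at t)"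
        using 1 by (auto intro!: derivative_eq_intros simp: power2_eq_square)
      from DERIV_divide[OF this DERIV_pow[of k t]] 1
      have "((\<lambda>t. exp (- 1 / t) / t ^ k) has_real_derivative
          (exp (- 1 / t) / t\<^sup>2 * t ^ k - exp (- 1 / t) * (real k * t ^ (k - 1))) / (t ^ k * t ^ k)) (at t)"
        by simp
      also have "(exp (- 1 / t) / t\<^sup>2 * t ^ k - exp (- 1 / t) * (real k * t ^ (k - 1))) / (t ^ k * t ^ k)
          = rexp (k + 2) t - real k * rexp (k + 1) t"
        using 1 by (cases k) (simp_all add: rexp_def field_simps power2_eq_square)
      finally show ?thesis .
    qed
    then show ?thesis
      by (rule has_field_derivative_transform_within_open[of _ _ _ "{0<..}"]) (use 1 in \<open>auto simp: rexp_def\<close>)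
  next
    case 2
    have "((\<lambda>t. 0) has_real_derivative rexp (k + 2) t - real k * rexp (k + 1) t) (at t)"
      using 2 by (simp add: rexp_def)
    then show ?thesis
      by (rule has_field_derivative_transform_within_open[of _ _ _ "{..<0}"]) (use 2 in \<open>auto simp: rexp_def\<close>)
  next
    case 3
    \<comment> \<open>For h > 0 the difference quotient at 0 is
      \<open>rexp (Suc k) h\<close>.\<close>
    have r: "((\<lambda>h. rexp k h / h) \<longlongrightarrow> 0) (at_right 0)"
      by (rule Lim_transform_eventually[OF rexp_tendsto_0[of "Suc k"]])
         (use eventually_at_right_less[of 0] in \<open>eventually_elim, auto simp: rexp_def\<close>)
    have l: "((\<lambda>h. rexp k h / h) \<longlongrightarrow> 0) (at_left 0)"
      by (rule Lim_transform_eventually[OF tendsto_const])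
         (auto simp: rexp_def eventually_at_filter)
    show ?thesis
      using filterlim_split_at[OF l r] by (simp add: DERIV_def 3 rexp_def)
  qed
qed

lemma rexp_pos_iff: "rexp k t > 0 \<longleftrightarrow> t > 0" and rexp_nonneg: "rexp k t \<ge> 0" and rexp_0_le_1: "rexp 0 t \<le> 1"
  by (auto simp: rexp_def)

text \<open>An algebra of smooth functions which is closed under partial derivatives and contains bump
  functions of all balls.\<close>
inductive bump_alg :: "('a::euclidean_space \<Rightarrow> real) \<Rightarrow> bool" where
  const: "bump_alg (\<lambda>y. c)"
| coord: "bump_alg (\<lambda>y. y \<bullet> b)"
| bump: "bump_alg (\<lambda>y. rexp k (r - (y - a) \<bullet> (y - a)))"
| add: "bump_alg f \<Longrightarrow> bump_alg g \<Longrightarrow> bump_alg (\<lambda>y. f y + g y)"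
| mult: "bump_alg f \<Longrightarrow> bump_alg g \<Longrightarrow> bump_alg (\<lambda>y. f y * g y)"

lemma bump_alg_diff: "bump_alg f \<Longrightarrow> bump_alg g \<Longrightarrow> bump_alg (\<lambda>y. f y - g y)"
  using bump_alg.add[OF _ bump_alg.mult[OF bump_alg.const[of "-1"]], of f g] by simp

lemma bump_alg_sum: "(\<And>i. i \<in> I \<Longrightarrow> bump_alg (f i)) \<Longrightarrow> bump_alg (\<lambda>y. \<Sum>i\<in>I. f i y)"
  by (induction I rule: infinite_finite_induct) (auto intro: bump_alg.intros)

lemma bump_alg_power: "bump_alg f \<Longrightarrow> bump_alg (\<lambda>y. f y ^ n)"
  by (induction n) (auto intro: bump_alg.intros)

lemma bump_alg_derivative:
  "bump_alg f \<Longrightarrow> \<exists>f'. (\<forall>y. (f has_derivative f' y) (at y)) \<and> (\<forall>b. bump_alg (\<lambda>y. f' y b))"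
proof (induction rule: bump_alg.induct)
  case (const c)
  then show ?case by (intro exI[of _ "\<lambda>y v. 0"]) (auto intro: bump_alg.intros)
next
  case (coord b)
  then show ?case
    by (intro exI[of _ "\<lambda>y v. v \<bullet> b"]) (auto intro!: bump_alg.intros derivative_eq_intros)
next
  case (bump k r a)
  \<comment> \<open>Spelled with sums, products and constant factors only, so that the introduction
    rules of \<open>bump_alg\<close> apply to it literally.\<close>
  define D where "D y v = (rexp (k + 2) (r - (y - a) \<bullet> (y - a)) + (- real k) * rexp (k + 1) (r - (y - a) \<bullet> (y - a)))
      * ((-2) * (y \<bullet> v + (- (a \<bullet> v))))" for y v
  have "((\<lambda>y. rexp k (r - (y - a) \<bullet> (y - a))) has_derivative D y) (at y)" for y
  proof -
    have "((\<lambda>y. r - (y - a) \<bullet> (y - a)) has_derivative (\<lambda>v. (-2) * (y \<bullet> v + (- (a \<bullet> v))))) (at y)"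
      by (auto intro!: derivative_eq_intros simp: inner_diff inner_commute algebra_simps)
    from has_derivative_compose[OF this rexp_has_derivative[of k, unfolded has_field_derivative_def]]
    show ?thesis by (rule has_derivative_eq_rhs) (auto simp: D_def fun_eq_iff)
  qed
  moreover have "bump_alg (\<lambda>y. D y b)" for b
    unfolding D_def by (intro bump_alg.intros)
  ultimately show ?case by blast
next
  case (add f g)
  then obtain f' g' where "\<forall>y. (f has_derivative f' y) (at y)" "\<forall>y. (g has_derivative g' y) (at y)"
    "\<forall>b. bump_alg (\<lambda>y. f' y b)" "\<forall>b. bump_alg (\<lambda>y. g' y b)" by blast
  then show ?case
    by (intro exI[of _ "\<lambda>y v. f' y v + g' y v"]) (auto intro!: bump_alg.intros derivative_eq_intros)
next
  case (mult f g)
  then obtain f' g' where "\<forall>y. (f has_derivative f' y) (at y)" "\<forall>y. (g has_derivative g' y) (at y)"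
    "\<forall>b. bump_alg (\<lambda>y. f' y b)" "\<forall>b. bump_alg (\<lambda>y. g' y b)" by blast
  then show ?case
    by (intro exI[of _ "\<lambda>y v. f y * g' y v + f' y v * g y"])
       (auto intro!: bump_alg.intros has_derivative_mult mult)
qed

lemma bump_alg_has_derivative:
  assumes "bump_alg f"
  shows "(f has_derivative frechet_derivative f (at y)) (at y)" "bump_alg (\<lambda>y. frechet_derivative f (at y) b)"
proof -
  obtain f' where f': "\<And>y. (f has_derivative f' y) (at y)" "\<And>b. bump_alg (\<lambda>y. f' y b)"
    using bump_alg_derivative[OF assms] by blast
  have "f' y = frechet_derivative f (at y)" for y by (rule frechet_derivative_at[OF f'(1)])
  then show "(f has_derivative frechet_derivative f (at y)) (at y)" "bump_alg (\<lambda>y. frechet_derivative f (at y) b)"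
    using f'(1)[of y] f'(2)[of b] by auto
qed

lemma bump_alg_iter_pderiv:
  assumes "bump_alg f"
  shows "bump_alg (iter_pderiv bs f) \<and>
     iter_pderiv bs (\<lambda>y. complex_of_real (f y)) = (\<lambda>y. complex_of_real (iter_pderiv bs f y))"
proof (induction bs)
  case Nil
  then show ?case using assms by simp
next
  case (Cons b bs)
  then have IH: "bump_alg (iter_pderiv bs f)"
     "iter_pderiv bs (\<lambda>y. complex_of_real (f y)) = (\<lambda>y. complex_of_real (iter_pderiv bs f y))" by auto
  have "frechet_derivative (\<lambda>y. complex_of_real (iter_pderiv bs f y)) (at y)
     = (\<lambda>v. complex_of_real (frechet_derivative (iter_pderiv bs f) (at y) v))" for y
    by (rule frechet_derivative_at[symmetric])
       (intro has_derivative_of_real bump_alg_has_derivative(1) IH(1))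
  then show ?case using IH bump_alg_has_derivative(2)[OF IH(1)] by simp
qed

lemma bump_alg_smooth: "bump_alg f \<Longrightarrow> smooth_on UNIV (\<lambda>y. complex_of_real (f y))"
  unfolding smooth_on_def
  using bump_alg_iter_pderiv[of f] bump_alg_has_derivative(1)[THEN has_derivative_of_real]
  by (auto simp: differentiable_def)

lemma bump_alg_continuous: "bump_alg f \<Longrightarrow> continuous_on S f"
  by (meson bump_alg_has_derivative(1) continuous_at_imp_continuous_on has_derivative_continuous)

section \<open>Bump functions and the measures determined by them\<close>

lemma support_subset: "closed S \<Longrightarrow> (\<And>y. y \<notin> S \<Longrightarrow> f y = 0) \<Longrightarrow> support f \<subseteq> S"
  unfolding support_def by (rule closure_minimal) auto

lemma not_in_support: "y \<notin> support f \<Longrightarrow> f y = 0"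
  unfolding support_def using closure_subset[of "{y. f y \<noteq> 0}"] by auto

lemma closed_support [simp]: "closed (support f)"
  by (simp add: support_def)

lemma support_mono: "(\<And>y. f y = 0 \<Longrightarrow> g y = 0) \<Longrightarrow> support g \<subseteq> support f"
  by (rule support_subset) (auto simp: not_in_support)

lemma compact_support_mono: "compact (support f) \<Longrightarrow> (\<And>y. f y = 0 \<Longrightarrow> g y = 0) \<Longrightarrow> compact (support g)"
  using support_mono[of f g] compact_Int_closed[of "support f" "support g"] by (simp add: Int_absorb1)

text \<open>Values in [0, 1] make \<open>1 - (1 - w y) ^ n\<close> increase with n to the indicator
  of the set where w is positive.\<close>

definition bumps :: "'a::euclidean_space set \<Rightarrow> ('a \<Rightarrow> real) set" where
  "bumps W = {w. bump_alg w \<and> (\<forall>y. 0 \<le> w y \<and> w y \<le> 1) \<and> compact (support w) \<and> support w \<subseteq> W}"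

definition ball_bump :: "'a::euclidean_space \<Rightarrow> real \<Rightarrow> 'a \<Rightarrow> real" where
  "ball_bump a r y = rexp 0 (r\<^sup>2 - (y - a) \<bullet> (y - a))"

lemma ball_bump_pos_iff: "r > 0 \<Longrightarrow> ball_bump a r y > 0 \<longleftrightarrow> y \<in> ball a r"
proof -
  assume "r > 0"
  have "r\<^sup>2 - (y - a) \<bullet> (y - a) > 0 \<longleftrightarrow> (norm (y - a))\<^sup>2 < r\<^sup>2" by (simp add: power2_norm_eq_inner)
  also have "\<dots> \<longleftrightarrow> norm (y - a) < r" using \<open>r > 0\<close>
    by (metis abs_norm_cancel abs_of_pos real_sqrt_abs real_sqrt_less_iff)
  finally show ?thesis by (simp add: ball_bump_def rexp_pos_iff dist_norm norm_minus_commute)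
qed

lemma ball_bump_in_bumps:
  assumes "r > 0" "cball a r \<subseteq> W" shows "ball_bump a r \<in> bumps W"
proof -
  have s: "support (ball_bump a r) \<subseteq> cball a r"
  proof (rule support_subset)
    fix y assume "y \<notin> cball a r"
    then have "\<not> ball_bump a r y > 0"
      using ball_bump_pos_iff[OF assms(1)] by (metis less_imp_le mem_ball mem_cball)
    then show "ball_bump a r y = 0" using rexp_nonneg by (metis ball_bump_def less_eq_real_def)
  qed auto
  moreover have "compact (support (ball_bump a r))"
    using s compact_Int_closed[of "cball a r" "support (ball_bump a r)"] by (simp add: Int_absorb1)
  moreover have "bump_alg (ball_bump a r)" unfolding ball_bump_def by (rule bump_alg.bump)
  ultimately show ?thesis
    using assms by (auto simp: bumps_def ball_bump_def rexp_nonneg rexp_0_le_1)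
qed

lemma bumps_mult: "v \<in> bumps W \<Longrightarrow> w \<in> bumps W \<Longrightarrow> (\<lambda>y. v y * w y) \<in> bumps W"
  using support_mono[of v "\<lambda>y. v y * w y"] compact_support_mono[of v "\<lambda>y. v y * w y"]
  by (auto simp: bumps_def intro: bump_alg.intros mult_le_one)

lemma bumps_power:
  assumes "w \<in> bumps W" shows "(\<lambda>y. 1 - (1 - w y) ^ n) \<in> bumps W"
proof -
  have "bump_alg (\<lambda>y. 1 - (1 - w y) ^ n)"
    using assms by (intro bump_alg_diff bump_alg_power bump_alg.const) (auto simp: bumps_def)
  then show ?thesis
    using assms support_mono[of w "\<lambda>y. 1 - (1 - w y) ^ n"] compact_support_mono[of w "\<lambda>y. 1 - (1 - w y) ^ n"]
    by (auto simp: bumps_def intro: power_le_one)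
qed

lemma bumps_integrable_measurable [measurable_dest]: "w \<in> bumps W \<Longrightarrow> w \<in> borel_measurable borel"
  by (auto simp: bumps_def intro!: borel_measurable_continuous_onI bump_alg_continuous)

text \<open>Monotone convergence recovers the measure of an open set from integrals of bumps alone,
  since the functions under the supremum again belong to \<open>bumps W\<close> by
  \<open>bumps_power\<close>.\<close>

lemma emeasure_bump_positive:
  assumes \<mu>: "sets \<mu> = sets borel" and w: "w \<in> bumps W"
  shows "emeasure \<mu> {y. w y > 0} = (SUP n. \<integral>\<^sup>+ y. ennreal (1 - (1 - w y) ^ n) \<partial>\<mu>)"
proof -
  note [measurable_cong] = \<mu>
  note [measurable] = bumps_integrable_measurable[OF w]
  have w01: "0 \<le> w y" "w y \<le> 1" for y using w by (auto simp: bumps_def)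
  have sp: "space \<mu> = UNIV" using sets_eq_imp_space_eq[OF \<mu>] by simp
  have "(SUP n. \<integral>\<^sup>+ y. ennreal (1 - (1 - w y) ^ n) \<partial>\<mu>) = (\<integral>\<^sup>+ y. (SUP n. ennreal (1 - (1 - w y) ^ n)) \<partial>\<mu>)"
    by (rule nn_integral_monotone_convergence_SUP[symmetric])
       (use w01 in \<open>auto intro!: monoI le_funI ennreal_leI power_decreasing simp: incseq_def\<close>)
  also have "\<dots> = (\<integral>\<^sup>+ y. indicator {y. w y > 0} y \<partial>\<mu>)"
  proof (intro nn_integral_cong)
    fix y
    have "(\<lambda>n. ennreal (1 - (1 - w y) ^ n)) \<longlonglongrightarrow> indicator {y. w y > 0} y"
    proof (cases "w y > 0")
      case True
      then have "(\<lambda>n. ennreal (1 - (1 - w y) ^ n)) \<longlonglongrightarrow> ennreal (1 - 0)"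
        using w01[of y] by (intro tendsto_ennrealI tendsto_diff tendsto_const LIMSEQ_power_zero) auto
      then show ?thesis using True by simp
    next
      case False
      then have "w y = 0" using w01[of y] by auto
      then show ?thesis by simp
    qed
    moreover have "incseq (\<lambda>n. ennreal (1 - (1 - w y) ^ n))"
      using w01[of y] by (auto intro!: ennreal_leI power_decreasing simp: incseq_def)
    ultimately show "(SUP n. ennreal (1 - (1 - w y) ^ n)) = indicator {y. w y > 0} y"
      using LIMSEQ_unique LIMSEQ_SUP by blast
  qed
  also have "\<dots> = emeasure \<mu> {y. w y > 0}"
    by (rule nn_integral_indicator) measurable
  finally show ?thesis by simp
qed

text \<open>The factor c keeps an enlarged concentric ball inside S. With c = 2 there is room for a
  bump that is bounded below on the small ball, which makes the measure of that ball finite.\<close>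

lemma open_countable_union_balls:
  fixes S :: "'a::euclidean_space set"
  assumes "open S" "c \<ge> 1"
  obtains I where "countable I" "I \<subseteq> {(a, r). r > 0 \<and> cball a (c * r) \<subseteq> S}" "(\<Union>(a, r)\<in>I. ball a r) = S"
proof -
  let ?J = "{(a, r). r > 0 \<and> cball a (c * r) \<subseteq> S}"
  have "open X" if "X \<in> (\<lambda>(a, r). ball a r) ` ?J" for X using that by auto
  then obtain F' where F': "F' \<subseteq> (\<lambda>(a, r). ball a r) ` ?J" "countable F'" "\<Union>F' = (\<Union>(a, r)\<in>?J. ball a r)"
    by (rule Lindelof)
  obtain I where I: "I \<subseteq> ?J" "countable I" "F' = (\<lambda>(a, r). ball a r) ` I"
    using countable_subset_image[of F' "\<lambda>(a, r). ball a r" ?J] F' by blast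
  have "(\<Union>(a, r)\<in>?J. ball a r) = S"
  proof (intro equalityI subsetI)
    fix y assume "y \<in> S"
    then obtain e where "e > 0" "cball y e \<subseteq> S" using \<open>open S\<close> open_contains_cball by blast
    then have "(y, e / c) \<in> ?J" "y \<in> ball y (e / c)" using \<open>c \<ge> 1\<close> by auto
    then show "y \<in> (\<Union>(a, r)\<in>?J. ball a r)" by blast
  next
    fix y assume "y \<in> (\<Union>(a, r)\<in>?J. ball a r)"
    then obtain a r where ar: "r > 0" "cball a (c * r) \<subseteq> S" "y \<in> ball a r" by blast
    have "r \<le> c * r" using ar(1) \<open>c \<ge> 1\<close> by simp
    then have "y \<in> cball a (c * r)" using ar(3) by auto
    then show "y \<in> S" using ar(2) by blast
  qed
  then show ?thesis using I F' that[of I] by auto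
qed

text \<open>The positivity sets of bumps are stable under intersection, because products of bumps
  are bumps, and they generate the Borel sets of W, because they include small balls. Together with
  a countable cover by balls of finite measure this is the uniqueness theorem for measures.\<close>

lemma measure_eq_of_bumps:
  fixes \<mu> \<nu> :: "'a::euclidean_space measure"
  assumes \<mu>: "sets \<mu> = sets borel" and \<nu>: "sets \<nu> = sets borel" and W: "open W"
    and eq: "\<And>w. w \<in> bumps W \<Longrightarrow> (\<integral>\<^sup>+ y. ennreal (w y) \<partial>\<mu>) = (\<integral>\<^sup>+ y. ennreal (w y) \<partial>\<nu>)"
    and fin: "\<And>w. w \<in> bumps W \<Longrightarrow> (\<integral>\<^sup>+ y. ennreal (w y) \<partial>\<mu>) < \<infinity>"
    and A: "A \<in> sets borel" "A \<subseteq> W"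
  shows "emeasure \<mu> A = emeasure \<nu> A"
proof -
  define E where "E = (\<lambda>w. {y. w y > 0}) ` bumps W"
  have EW: "E \<subseteq> Pow W"
    unfolding E_def by (auto simp: bumps_def) (metis less_irrefl not_in_support subsetD)
  have EB: "ball a r \<in> E" if "r > 0" "cball a r \<subseteq> W" for a r
  proof -
    have "ball a r = {y. ball_bump a r y > 0}" using ball_bump_pos_iff[OF that(1)] by blast
    then show ?thesis using ball_bump_in_bumps[OF that] by (auto simp: E_def)
  qed
  have Eo: "open X" if "X \<in> E" for X
    using that by (auto simp: E_def bumps_def intro!: open_Collect_less bump_alg_continuous continuous_on_const)
  have int: "Int_stable E"
  proof (rule Int_stableI)
    fix a b assume "a \<in> E" "b \<in> E"
    then obtain v w where vw: "v \<in> bumps W" "w \<in> bumps W" "a = {y. v y > 0}" "b = {y. w y > 0}" by (auto simp: E_def)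
    have "a \<inter> b = {y. v y * w y > 0}" 
      unfolding vw(3,4) using vw(1,2) by (auto simp: bumps_def zero_less_mult_iff not_less[symmetric])
    then show "a \<inter> b \<in> E" using bumps_mult[OF vw(1,2)] by (auto simp: E_def)
  qed
  have sets_eq: "sets (restrict_space M W) = sigma_sets W E" if M: "sets M = sets borel" for M :: "'a measure"
  proof -
    have "sets (restrict_space M W) = (\<inter>) W ` sets borel" by (simp add: sets_restrict_space M)
    also have "\<dots> = (\<inter>) W ` sigma_sets UNIV {S. open S}" by (simp add: borel_def)
    also have "\<dots> = sigma_sets W ((\<inter>) W ` {S. open S})"
      using W by (intro sigma_sets_Int) auto
    also have "\<dots> = sigma_sets W E"
    proof (rule sigma_sets_eqI)
      fix S assume "S \<in> (\<inter>) W ` {S. open S}"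
      then have S: "open S" "S \<subseteq> W" using W by auto
      obtain I where I: "countable I" "I \<subseteq> {(a, r). r > 0 \<and> cball a (1 * r) \<subseteq> S}" "(\<Union>(a, r)\<in>I. ball a r) = S"
        using open_countable_union_balls[OF S(1), of 1] by auto
      have "(\<Union>p\<in>I. case p of (a, r) \<Rightarrow> ball a r) \<in> sigma_sets W E"
        using I(2) S(2) by (intro sigma_sets_UNION[OF countable_image[OF I(1)]]) (auto intro!: sigma_sets.Basic EB)
      then show "S \<in> sigma_sets W E" using I(3) by simp
    next
      fix X assume "X \<in> E"
      then show "X \<in> sigma_sets W ((\<inter>) W ` {S. open S})"
        using Eo EW by (intro sigma_sets.Basic) (auto intro!: image_eqI[of _ _ X])
    qed
    finally show ?thesis .
  qed
  have er: "emeasure (restrict_space M W) X = emeasure M X" if "sets M = sets borel" "X \<subseteq> W" for M :: "'a measure" and X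
    using that W by (intro emeasure_restrict_space) (auto simp: sets_eq_imp_space_eq[OF that(1)])
  have eqE: "emeasure \<mu> X = emeasure \<nu> X" if "X \<in> E" for X
    using that eq[OF bumps_power] by (auto simp: E_def emeasure_bump_positive[OF \<mu>] emeasure_bump_positive[OF \<nu>])
  obtain I where I: "countable I" "I \<subseteq> {(a, r). r > 0 \<and> cball a (2 * r) \<subseteq> W}" "(\<Union>(a, r)\<in>I. ball a r) = W"
    using open_countable_union_balls[OF W, of 2] by auto
  have "restrict_space \<mu> W = restrict_space \<nu> W"
  proof (rule measure_eqI_generator_eq_countable[OF int EW])
    show "emeasure (restrict_space \<mu> W) X = emeasure (restrict_space \<nu> W) X" if "X \<in> E" for X
      using that EW eqE er[OF \<mu>] er[OF \<nu>] by auto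
    let ?A = "(\<lambda>(a, r). ball a r) ` I"
    show "?A \<subseteq> E"
    proof safe
      fix a r assume "(a, r) \<in> I"
      then have r: "r > 0" "cball a (2 * r) \<subseteq> W" using I(2) by auto
      then have "cball a r \<subseteq> W" using subset_cball[of r "2 * r" a] by auto
      then show "ball a r \<in> E" using r by (intro EB)
    qed
    show "\<Union>?A = W" "countable ?A" using I by auto
    fix B assume "B \<in> ?A"
    then obtain a r where B: "B = ball a r" and r: "r > 0" "cball a (2 * r) \<subseteq> W" using I(2) by auto
    define w where "w = ball_bump a (2 * r)"
    have w: "w \<in> bumps W" unfolding w_def using r by (intro ball_bump_in_bumps) auto
    \<comment> \<open>On B the argument of the bump of radius 2 r exceeds (2 r)^2 - r^2 = 3
      r^2.\<close>
    define c where "c = exp (- 1 / (3 * r\<^sup>2))"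
    have wc: "c \<le> w y" if "y \<in> B" for y
    proof -
      have "(y - a) \<bullet> (y - a) < r\<^sup>2"
        using that ball_bump_pos_iff[OF r(1), of a y] by (simp add: B ball_bump_def rexp_pos_iff)
      moreover define t where "t = (2 * r)\<^sup>2 - (y - a) \<bullet> (y - a)"
      ultimately have "3 * r\<^sup>2 \<le> t" by (simp add: power_mult_distrib)
      moreover have r2: "0 < 3 * r\<^sup>2" using r by simp
      ultimately have "t > 0" by linarith
      moreover have "1 / t \<le> 1 / (3 * r\<^sup>2)" using r2 \<open>3 * r\<^sup>2 \<le> t\<close> by (intro frac_le) auto
      ultimately show ?thesis
        unfolding w_def ball_bump_def t_def[symmetric] by (simp add: rexp_def c_def)
    qed
    have "ennreal c * emeasure \<mu> B = (\<integral>\<^sup>+ y. ennreal c * indicator B y \<partial>\<mu>)"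
      using \<mu> by (intro nn_integral_cmult_indicator[symmetric]) (auto simp: B)
    also have "\<dots> \<le> (\<integral>\<^sup>+ y. ennreal (w y) \<partial>\<mu>)"
      by (intro nn_integral_mono) (auto simp: indicator_def intro!: ennreal_leI wc)
    also have "\<dots> < \<infinity>" by (rule fin[OF w])
    finally have "emeasure \<mu> B < \<infinity>"
      by (auto simp: ennreal_mult_less_top c_def)
    moreover have "B \<subseteq> W" using \<open>\<Union>?A = W\<close> \<open>B \<in> ?A\<close> by auto
    ultimately show "emeasure (restrict_space \<mu> W) B \<noteq> \<infinity>"
      using er[OF \<mu>] by auto
  qed (rule sets_eq; fact)+
  then show ?thesis using er[OF \<mu> A(2)] er[OF \<nu> A(2)] by metis
qed

subsection \<open>Continuously differentiable functions\<close>

abbreviation pd :: "('a::euclidean_space \<Rightarrow> real) \<Rightarrow> 'a \<Rightarrow> 'a \<Rightarrow> real" where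
  "pd f b y \<equiv> frechet_derivative f (at y) b"

lemma C1_on_has_derivative: "C1_on W f \<Longrightarrow> y \<in> W \<Longrightarrow> (f has_derivative frechet_derivative f (at y)) (at y)"
  by (simp add: C1_on_def frechet_derivative_works)

lemma C1_on_open: "C1_on W f \<Longrightarrow> open W"
  by (simp add: C1_on_def)

lemma C1_on_pd_continuous: "C1_on W f \<Longrightarrow> b \<in> Basis \<Longrightarrow> continuous_on W (pd f b)"
  by (simp add: C1_on_def)

lemma C1_on_continuous: "C1_on W f \<Longrightarrow> continuous_on W f"
  by (meson C1_on_has_derivative continuous_at_imp_continuous_on has_derivative_continuous)

lemma C1_onI:
  assumes "open W" "\<And>y. y \<in> W \<Longrightarrow> (f has_derivative D y) (at y)"
    and "\<And>c. c \<in> Basis \<Longrightarrow> continuous_on W (\<lambda>y. D y c)"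
  shows "C1_on W f"
proof -
  have "D y = frechet_derivative f (at y)" if "y \<in> W" for y
    using frechet_derivative_at[OF assms(2)[OF that]] .
  then have "continuous_on W (pd f c)" if "c \<in> Basis" for c
    using continuous_on_eq[OF assms(3)[OF that], of "pd f c"] by auto
  then show ?thesis using assms(1,2) by (auto simp: C1_on_def differentiable_def)
qed

lemma pd_eqI: "(f has_derivative D) (at y) \<Longrightarrow> pd f b y = D b"
  by (metis frechet_derivative_at)

lemma C1_on_subset: "C1_on W f \<Longrightarrow> open V \<Longrightarrow> V \<subseteq> W \<Longrightarrow> C1_on V f"
  unfolding C1_on_def by (meson continuous_on_subset subsetD)

lemma C1_on_const [simp]: "open W \<Longrightarrow> C1_on W (\<lambda>y. c)"
  by (rule C1_onI) (auto intro!: derivative_eq_intros)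

lemma
  assumes f: "C1_on W f" and g: "C1_on W g"
  shows C1_on_add: "C1_on W (\<lambda>y. f y + g y)"
    and C1_on_mult: "C1_on W (\<lambda>y. f y * g y)"
    and pd_mult: "y \<in> W \<Longrightarrow> pd (\<lambda>y. f y * g y) b y = f y * pd g b y + pd f b y * g y"
proof -
  note c = C1_on_pd_continuous[OF f] C1_on_pd_continuous[OF g] C1_on_continuous[OF f] C1_on_continuous[OF g]
  have da: "((\<lambda>y. f y + g y) has_derivative (\<lambda>v. pd f v y + pd g v y)) (at y)" if "y \<in> W" for y
    using that by (intro has_derivative_add C1_on_has_derivative[OF f] C1_on_has_derivative[OF g])
  have dm: "((\<lambda>y. f y * g y) has_derivative (\<lambda>v. f y * pd g v y + pd f v y * g y)) (at y)" if "y \<in> W" for y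
    using that by (intro has_derivative_mult C1_on_has_derivative[OF f] C1_on_has_derivative[OF g])
  show "C1_on W (\<lambda>y. f y + g y)" by (rule C1_onI[OF C1_on_open[OF f] da]) (auto intro!: continuous_intros c)
  show "C1_on W (\<lambda>y. f y * g y)" by (rule C1_onI[OF C1_on_open[OF f] dm]) (auto intro!: continuous_intros c)
  show "y \<in> W \<Longrightarrow> pd (\<lambda>y. f y * g y) b y = f y * pd g b y + pd f b y * g y" using pd_eqI[OF dm] .
qed

lemma C1_on_sum: "open W \<Longrightarrow> (\<And>i. i \<in> I \<Longrightarrow> C1_on W (f i)) \<Longrightarrow> C1_on W (\<lambda>y. \<Sum>i\<in>I. f i y)"
  by (induction I rule: infinite_finite_induct) (auto intro: C1_on_add)

lemma
  assumes f: "C1_on W f" and d: "\<And>y. y \<in> W \<Longrightarrow> (\<phi> has_real_derivative \<phi>' (f y)) (at (f y))"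
    and c: "continuous_on (f ` W) \<phi>'"
  shows C1_on_compose: "C1_on W (\<lambda>y. \<phi> (f y))"
    and pd_compose: "y \<in> W \<Longrightarrow> pd (\<lambda>y. \<phi> (f y)) b y = \<phi>' (f y) * pd f b y"
proof -
  have D: "((\<lambda>y. \<phi> (f y)) has_derivative (\<lambda>v. \<phi>' (f y) * pd f v y)) (at y)" if "y \<in> W" for y
    using has_derivative_compose[OF C1_on_has_derivative[OF f that] d[OF that, unfolded has_field_derivative_def]]
    by simp
  show "C1_on W (\<lambda>y. \<phi> (f y))"
    by (rule C1_onI[OF C1_on_open[OF f] D])
       (auto intro!: continuous_intros C1_on_pd_continuous[OF f] continuous_on_compose2[OF c C1_on_continuous[OF f]])
  show "y \<in> W \<Longrightarrow> pd (\<lambda>y. \<phi> (f y)) b y = \<phi>' (f y) * pd f b y" using pd_eqI[OF D] .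
qed

lemma C1_on_inverse: "C1_on W f \<Longrightarrow> (\<And>y. y \<in> W \<Longrightarrow> f y \<noteq> 0) \<Longrightarrow> C1_on W (\<lambda>y. inverse (f y))"
  by (rule C1_on_compose[where \<phi>' = "\<lambda>t. - (inverse t ^ 2)"])
     (auto intro!: derivative_eq_intros continuous_intros simp: power2_eq_square)

lemma C1_on_divide: "C1_on W f \<Longrightarrow> C1_on W g \<Longrightarrow> (\<And>y. y \<in> W \<Longrightarrow> g y \<noteq> 0) \<Longrightarrow> C1_on W (\<lambda>y. f y / g y)"
  unfolding divide_inverse by (intro C1_on_mult C1_on_inverse)

lemma C1_on_sqrt: "C1_on W f \<Longrightarrow> (\<And>y. y \<in> W \<Longrightarrow> f y > 0) \<Longrightarrow> C1_on W (\<lambda>y. sqrt (f y))"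
  by (rule C1_on_compose[where \<phi>' = "\<lambda>t. inverse (sqrt t) / 2"])
     (force intro!: DERIV_real_sqrt continuous_intros)+

definition Cc1 :: "'a::euclidean_space set \<Rightarrow> ('a \<Rightarrow> real) set" where
  "Cc1 W = {f. C1_on UNIV f \<and> compact (support f) \<and> support f \<subseteq> W}"

lemma Cc1_mono: "f \<in> Cc1 V \<Longrightarrow> V \<subseteq> W \<Longrightarrow> f \<in> Cc1 W"
  by (auto simp: Cc1_def)

lemma bumps_Cc1: "w \<in> bumps W \<Longrightarrow> w \<in> Cc1 W"
  unfolding bumps_def Cc1_def
  using bump_alg_has_derivative[of w]
  by (auto intro!: C1_onI[of UNIV w] bump_alg_continuous)

lemma Cc1_zero_outside: "f \<in> Cc1 W \<Longrightarrow> y \<notin> W \<Longrightarrow> f y = 0"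
  by (auto simp: Cc1_def intro: not_in_support)

text \<open>W and the complement of the support of f form an open cover, and the product is 0 on the
  second set whatever q is there. The same cover serves in \<open>Cc1_mult\<close>.\<close>

lemma continuous_mult_supported:
  fixes f :: "'a::t2_space \<Rightarrow> 'b::{real_normed_algebra}"
  assumes f: "continuous_on UNIV f" "support f \<subseteq> W" and q: "open W" "continuous_on W q"
  shows "continuous_on UNIV (\<lambda>y. f y * q y)"
proof -
  have "continuous_on (W \<union> - support f) (\<lambda>y. f y * q y)"
  proof (rule continuous_on_open_Un)
    show "continuous_on W (\<lambda>y. f y * q y)"
      by (intro continuous_intros q continuous_on_subset[OF f(1)]) auto
    have "continuous_on (- support f) (\<lambda>y. 0::'b)" by simp
    then show "continuous_on (- support f) (\<lambda>y. f y * q y)"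
      by (rule continuous_on_eq) (auto simp: not_in_support)
  qed (auto simp: q support_def)
  moreover have "W \<union> - support f = UNIV" using f(2) by auto
  ultimately show ?thesis by simp
qed

lemma pd_outside_support:
  assumes "y \<notin> support f" shows "(f has_derivative (\<lambda>v. 0)) (at y)" "pd f b y = 0"
proof -
  have "((\<lambda>y. 0::real) has_derivative (\<lambda>v. 0)) (at y)" by simp
  then show 1: "(f has_derivative (\<lambda>v. 0)) (at y)"
    by (rule has_derivative_transform_within_open[of _ _ _ _ "- support f"]) (use assms in \<open>auto simp: not_in_support\<close>)
  show "pd f b y = 0" by (rule pd_eqI[OF 1])
qed

lemma Cc1_mult:
  assumes f: "f \<in> Cc1 W" and q: "C1_on W q"
  shows "(\<lambda>y. f y * q y) \<in> Cc1 W"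
proof -
  have f': "C1_on UNIV f" "compact (support f)" "support f \<subseteq> W" using f by (auto simp: Cc1_def)
  have fW: "C1_on W f" using C1_on_subset[OF f'(1)] C1_on_open[OF q] by blast
  define h where "h y = f y * q y" for y
  have hs: "support h \<subseteq> support f" by (rule support_mono) (simp add: h_def)
  have hW: "C1_on W h" unfolding h_def by (intro C1_on_mult fW q)
  have hc: "C1_on (- support f) h"
  proof (rule C1_onI)
    show "(h has_derivative (\<lambda>v. 0)) (at y)" if "y \<in> - support f" for y
      using that hs by (intro pd_outside_support) auto
  qed auto
  have "C1_on UNIV h"
  proof -
    have "continuous_on (W \<union> - support f) (pd h c)" if "c \<in> Basis" for c
      by (intro continuous_on_open_Un C1_on_open[OF hW] C1_on_open[OF hc] C1_on_pd_continuous[OF hW] C1_on_pd_continuous[OF hc] that)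
    moreover have "W \<union> - support f = UNIV" using f'(3) by auto
    moreover have "h differentiable at y" for y
      using hW hc f'(3) by (cases "y \<in> W") (auto simp: C1_on_def)
    ultimately show ?thesis by (auto simp: C1_on_def)
  qed
  then show ?thesis
    using hs f' compact_support_mono[OF f'(2), of h] unfolding Cc1_def h_def by auto
qed

lemma Cc1_add: "f \<in> Cc1 W \<Longrightarrow> g \<in> Cc1 W \<Longrightarrow> (\<lambda>y. f y + g y) \<in> Cc1 W"
proof -
  assume a: "f \<in> Cc1 W" "g \<in> Cc1 W"
  have "support (\<lambda>y. f y + g y) \<subseteq> support f \<union> support g"
    by (rule support_subset) (auto simp: not_in_support)
  moreover have "compact (support f \<union> support g)" using a by (auto simp: Cc1_def)
  ultimately have "compact (support (\<lambda>y. f y + g y))"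
    using compact_Int_closed[of "support f \<union> support g" "support (\<lambda>y. f y + g y)"] by (simp add: Int_absorb1)
  then show ?thesis
    using a \<open>support _ \<subseteq> _\<close> by (auto simp: Cc1_def intro!: C1_on_add)
qed

lemma Cc1_cmult: "f \<in> Cc1 W \<Longrightarrow> open W \<Longrightarrow> (\<lambda>y. c * f y) \<in> Cc1 W"
  using Cc1_mult[of f W "\<lambda>y. c"] by (simp add: mult.commute)

lemma Cc1_sum:
  fixes f :: "'i \<Rightarrow> 'a::euclidean_space \<Rightarrow> real"
  shows "finite I \<Longrightarrow> (\<And>i. i \<in> I \<Longrightarrow> f i \<in> Cc1 W) \<Longrightarrow> (\<lambda>y. \<Sum>i\<in>I. f i y) \<in> Cc1 W"
proof (induction I rule: finite_induct)
  case empty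
  have "support (\<lambda>y::'a. 0::real) = {}" by (simp add: support_def)
  then show ?case by (simp add: Cc1_def)
qed (auto intro: Cc1_add)

lemma integrable_continuous_compact_support:
  fixes f :: "'a::euclidean_space \<Rightarrow> 'b::{banach, second_countable_topology}"
  assumes "continuous_on UNIV f" "compact K" "\<And>y. y \<notin> K \<Longrightarrow> f y = 0"
  shows "integrable lborel f"
proof -
  have "integrable lborel (\<lambda>x. indicator K x *\<^sub>R f x)"
    by (intro borel_integrable_compact continuous_on_subset[OF assms(1)] assms(2)) auto
  also have "(\<lambda>x. indicator K x *\<^sub>R f x) = f"
    using assms(3) by (auto simp: indicator_def fun_eq_iff)
  finally show ?thesis .
qed

lemma Cc1_pd_integrable: "f \<in> Cc1 W \<Longrightarrow> b \<in> Basis \<Longrightarrow> integrable lborel (pd f b)"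
  by (rule integrable_continuous_compact_support[of _ "support f"])
     (auto simp: Cc1_def C1_on_pd_continuous pd_outside_support)

subsection \<open>Integration along the lines in a coordinate direction\<close>

lemma product_sigma_finite_lborel: "product_sigma_finite (\<lambda>_::'a. lborel::real measure)"
  by (simp add: product_sigma_finite_def lborel.sigma_finite_measure_axioms)

lemma basis_insert_sum:
  fixes b :: "'a::euclidean_space"
  assumes "b \<in> Basis"
  shows "(\<Sum>c\<in>Basis. (x(b := t)) c *\<^sub>R c) = (\<Sum>c\<in>Basis - {b}. x c *\<^sub>R c) + t *\<^sub>R b"
proof -
  have "(\<Sum>c\<in>Basis. (x(b := t)) c *\<^sub>R c) = t *\<^sub>R b + (\<Sum>c\<in>Basis - {b}. (x(b := t)) c *\<^sub>R c)"
    using assms by (subst sum.remove[of _ b]) auto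
  also have "(\<Sum>c\<in>Basis - {b}. (x(b := t)) c *\<^sub>R c) = (\<Sum>c\<in>Basis - {b}. x c *\<^sub>R c)"
    by (intro sum.cong) auto
  finally show ?thesis by (simp add: add.commute)
qed

lemma sets_hyperplane_lborel [simp, measurable_cong]: "sets (hyperplane_lborel b) = sets borel"
  and space_hyperplane_lborel [simp]: "space (hyperplane_lborel b) = UNIV"
  by (simp_all add: hyperplane_lborel_def)

lemma AE_hyperplane_lborel:
  fixes b :: "'a::euclidean_space"
  assumes "b \<in> Basis" shows "AE y in hyperplane_lborel b. y \<bullet> b = 0"
  unfolding hyperplane_lborel_def
proof (subst AE_distr_iff)
  have "(\<Sum>c\<in>Basis - {b}. t c *\<^sub>R c) \<bullet> b = 0" for t :: "'a \<Rightarrow> real"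
    using assms by (auto simp: inner_sum_left inner_Basis intro!: sum.neutral)
  then show "AE t in \<Pi>\<^sub>M c\<in>Basis - {b}. lborel. (\<Sum>c\<in>Basis - {b}. t c *\<^sub>R c) \<bullet> b = 0" by simp
qed measurable

text \<open>Lebesgue measure is the image of the product measure over all coordinates; Fubini's
  theorem splits off the coordinate b and leaves \<open>hyperplane_lborel b\<close>.\<close>

lemma
  fixes f :: "'a::euclidean_space \<Rightarrow> real"
  assumes b: "b \<in> Basis" and f: "integrable lborel f"
  shows integral_lines: "(LINT y|lborel. f y) = (LINT y|hyperplane_lborel b. LINT t|lborel. f (y + t *\<^sub>R b))"
    and integrable_lines: "integrable (hyperplane_lborel b) (\<lambda>y. LINT t|lborel. f (y + t *\<^sub>R b))"
proof -
  interpret product_sigma_finite "\<lambda>_::'a. lborel::real measure" by (rule product_sigma_finite_lborel)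
  have [measurable]: "f \<in> borel_measurable borel" using f by auto
  let ?\<Phi> = "\<lambda>x. \<Sum>c\<in>Basis. x c *\<^sub>R (c::'a)"
  have ins: "insert b (Basis - {b}) = Basis" using b by auto
  have mB [measurable]: "?\<Phi> \<in> (\<Pi>\<^sub>M c\<in>Basis. lborel) \<rightarrow>\<^sub>M borel"
    by (intro borel_measurable_sum borel_measurable_scaleR) (auto intro: measurable_component_singleton)
  have lb: "lborel = distr (\<Pi>\<^sub>M c\<in>Basis. lborel) borel ?\<Phi>" by (rule lborel_eq)
  have i: "integrable (\<Pi>\<^sub>M c\<in>Basis. lborel) (\<lambda>x. f (?\<Phi> x))"
    using f by (subst (asm) lb) (simp add: integrable_distr_eq)
  have m1: "(\<lambda>y. LINT t|lborel. f (y + t *\<^sub>R b)) \<in> borel_measurable borel" by measurable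
  have e: "f (?\<Phi> (x(b := t))) = f ((\<Sum>c\<in>Basis - {b}. x c *\<^sub>R c) + t *\<^sub>R b)" for x t
    by (simp only: basis_insert_sum[OF b])
  have "(LINT y|lborel. f y) = (LINT x|(\<Pi>\<^sub>M c\<in>Basis. lborel). f (?\<Phi> x))"
    by (subst lb) (simp add: integral_distr)
  also have "\<dots> = (LINT x|(\<Pi>\<^sub>M c\<in>Basis - {b}. lborel). LINT t|lborel. f (?\<Phi> (x(b := t))))"
    using product_integral_insert[of "Basis - {b}" b "\<lambda>x. f (?\<Phi> x)"] i ins by simp
  also have "\<dots> = (LINT y|hyperplane_lborel b. LINT t|lborel. f (y + t *\<^sub>R b))"
    unfolding e hyperplane_lborel_def by (subst integral_distr) (auto intro: m1)
  finally show "(LINT y|lborel. f y) = (LINT y|hyperplane_lborel b. LINT t|lborel. f (y + t *\<^sub>R b))" .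
  show "integrable (hyperplane_lborel b) (\<lambda>y. LINT t|lborel. f (y + t *\<^sub>R b))"
  proof (rule integrableI_bounded)
    have "(\<integral>\<^sup>+ y. ennreal (norm (LINT t|lborel. f (y + t *\<^sub>R b))) \<partial>hyperplane_lborel b)
        \<le> (\<integral>\<^sup>+ y. \<integral>\<^sup>+ t. ennreal (norm (f (y + t *\<^sub>R b))) \<partial>lborel \<partial>hyperplane_lborel b)"
    proof (intro nn_integral_mono)
      fix y
      show "ennreal (norm (LINT t|lborel. f (y + t *\<^sub>R b))) \<le> (\<integral>\<^sup>+ t. ennreal (norm (f (y + t *\<^sub>R b))) \<partial>lborel)"
        by (cases "integrable lborel (\<lambda>t. f (y + t *\<^sub>R b))")
           (auto intro: integral_norm_bound_ennreal simp: not_integrable_integral_eq simp del: real_norm_def)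
    qed
    also have "\<dots> = (\<integral>\<^sup>+ x. \<integral>\<^sup>+ t. ennreal (norm (f (?\<Phi> (x(b := t))))) \<partial>lborel \<partial>(\<Pi>\<^sub>M c\<in>Basis - {b}. lborel))"
      unfolding e hyperplane_lborel_def by (subst nn_integral_distr) auto
    also have "\<dots> = (\<integral>\<^sup>+ x. ennreal (norm (f (?\<Phi> x))) \<partial>(\<Pi>\<^sub>M c\<in>Basis. lborel))"
      using product_nn_integral_insert[of "Basis - {b}" b "\<lambda>x. ennreal (norm (f (?\<Phi> x)))"] ins by simp
    also have "\<dots> < \<infinity>" using i by (simp add: integrable_iff_bounded)
    finally show "(\<integral>\<^sup>+ y. ennreal (norm (LINT t|lborel. f (y + t *\<^sub>R b))) \<partial>hyperplane_lborel b) < \<infinity>" .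
  qed (use m1 in simp)
qed

lemma
  assumes f: "f \<in> Cc1 UNIV" and b: "b \<in> Basis"
  shows line_integral_below: "(LINT t|lborel. indicator {..<s} t * pd f b (y + t *\<^sub>R b)) = f (y + s *\<^sub>R b)" (is ?A)
    and line_integral_above: "(LINT t|lborel. indicator {s<..} t * pd f b (y + t *\<^sub>R b)) = - f (y + s *\<^sub>R b)" (is ?B)
proof -
  have f': "C1_on UNIV f" "compact (support f)" using f by (auto simp: Cc1_def)
  obtain M where M: "\<And>z. z \<in> support f \<Longrightarrow> norm z \<le> M" using compact_imp_bounded[OF f'(2)] by (auto simp: bounded_iff)
  define T where "T = \<bar>M\<bar> + norm y + \<bar>s\<bar> + 1"
  have T: "- T \<le> s" "s \<le> T" "T \<ge> 0" using norm_ge_zero[of y] unfolding T_def by linarith+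
  have out: "y + t *\<^sub>R b \<notin> support f" if "\<bar>t\<bar> \<ge> T" for t
  proof
    assume "y + t *\<^sub>R b \<in> support f"
    then have "norm (y + t *\<^sub>R b) \<le> M" by (rule M)
    moreover have "\<bar>t\<bar> \<le> norm (y + t *\<^sub>R b) + norm y"
      using norm_triangle_ineq4[of "y + t *\<^sub>R b" y] b by simp
    ultimately show False using that by (simp add: T_def)
  qed
  have d: "((\<lambda>t. f (y + t *\<^sub>R b)) has_vector_derivative pd f b (y + t *\<^sub>R b)) (at t within S)" for t S
  proof -
    have "((\<lambda>t. y + t *\<^sub>R b) has_vector_derivative b) (at t within S)"
      by (auto intro!: derivative_eq_intros)
    from vector_derivative_diff_chain_within[OF this has_derivative_at_withinI[OF C1_on_has_derivative[OF f'(1)]]]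
    show ?thesis by (simp add: o_def)
  qed
  have c: "continuous_on S (\<lambda>t. pd f b (y + t *\<^sub>R b))" for S
    by (intro continuous_on_compose2[OF C1_on_pd_continuous[OF f'(1) b]] continuous_intros) auto
  have I: "(LINT t|lborel. indicator {p..q} t *\<^sub>R pd f b (y + t *\<^sub>R b)) = f (y + q *\<^sub>R b) - f (y + p *\<^sub>R b)" if "p \<le> q" for p q
    by (rule has_bochner_integral_integral_eq, rule has_bochner_integral_FTC_Icc[OF that d c])
  have "(LINT t|lborel. indicator {..<s} t * pd f b (y + t *\<^sub>R b)) = (LINT t|lborel. indicator {-T..s} t *\<^sub>R pd f b (y + t *\<^sub>R b))"
  \<comment> \<open>Within [-T, T] the indicators differ at s at most; beyond it the line has left
    the support and the derivative vanishes.\<close>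
  proof (rule integral_discrete_difference[of "{s}"])
    fix t assume "t \<notin> {s}"
    then show "indicator {..<s} t * pd f b (y + t *\<^sub>R b) = indicator {-T..s} t *\<^sub>R pd f b (y + t *\<^sub>R b)"
      using pd_outside_support(2)[OF out, of t b] by (cases "\<bar>t\<bar> \<ge> T") (auto simp: indicator_def)
  qed auto
  also have "\<dots> = f (y + s *\<^sub>R b)"
    using I[OF T(1)] not_in_support[OF out, of "-T"] T(3) by simp
  finally show ?A .
  have "(LINT t|lborel. indicator {s<..} t * pd f b (y + t *\<^sub>R b)) = (LINT t|lborel. indicator {s..T} t *\<^sub>R pd f b (y + t *\<^sub>R b))"
  proof (rule integral_discrete_difference[of "{s}"])
    fix t assume "t \<notin> {s}"
    then show "indicator {s<..} t * pd f b (y + t *\<^sub>R b) = indicator {s..T} t *\<^sub>R pd f b (y + t *\<^sub>R b)"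
      using pd_outside_support(2)[OF out, of t b] by (cases "\<bar>t\<bar> \<ge> T") (auto simp: indicator_def)
  qed auto
  also have "\<dots> = - f (y + s *\<^sub>R b)"
    using I[OF T(2)] not_in_support[OF out, of T] T(3) by simp
  finally show ?B .
qed

lemma integral_pd_eq_0:
  assumes f: "f \<in> Cc1 W" and b: "b \<in> Basis"
  shows "(LINT y|lborel. pd f b y) = 0"
proof -
  have f': "f \<in> Cc1 UNIV" using Cc1_mono[OF f] by simp
  obtain M where M: "\<And>z. z \<in> support f \<Longrightarrow> norm z \<le> M"
    using compact_imp_bounded[of "support f"] f by (auto simp: bounded_iff Cc1_def)
  have "(LINT t|lborel. pd f b (y + t *\<^sub>R b)) = 0" for y
  proof -
    define s where "s = \<bar>M\<bar> + norm y + 1"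
    have out: "y + t *\<^sub>R b \<notin> support f" if "t \<ge> s" for t
    proof
      assume "y + t *\<^sub>R b \<in> support f"
      then have "norm (y + t *\<^sub>R b) \<le> M" by (rule M)
      moreover have "\<bar>t\<bar> \<le> norm (y + t *\<^sub>R b) + norm y"
        using norm_triangle_ineq4[of "y + t *\<^sub>R b" y] b by simp
      ultimately show False using that by (simp add: s_def)
    qed
    have "(LINT t|lborel. pd f b (y + t *\<^sub>R b)) = (LINT t|lborel. indicator {..<s} t * pd f b (y + t *\<^sub>R b))"
      using pd_outside_support(2)[OF out] by (intro Bochner_Integration.integral_cong) (auto simp: indicator_def)
    also have "\<dots> = 0" using line_integral_below[OF f' b] not_in_support[OF out[of s]] by simp
    finally show ?thesis .
  qed
  then show ?thesis by (simp add: integral_lines[OF b Cc1_pd_integrable[OF f b]])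
qed

subsection \<open>Densities of the images of smooth measures under \<open>P\<close>\<close>

text \<open>A positive lower bound of the sum on K is enough: division by m yields cutoff functions,
  division by the sum itself yields the partition in \<open>nn_integral_surface\<close>.\<close>

lemma finite_ball_bump_cover:
  fixes K :: "'a::euclidean_space set"
  assumes K: "compact K" and r: "\<And>y. y \<in> K \<Longrightarrow> r y > 0"
  obtains I m where "finite I" "I \<subseteq> K" "m > 0" "\<And>y. y \<in> K \<Longrightarrow> m \<le> (\<Sum>a\<in>I. ball_bump a (r a) y)"
proof -
  have "K \<subseteq> (\<Union>a\<in>K. ball a (r a))" using r by auto
  then obtain I where I: "I \<subseteq> K" "finite I" "K \<subseteq> (\<Union>a\<in>I. ball a (r a))"
    using compactE_image[OF K, of K "\<lambda>a. ball a (r a)"] by auto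
  let ?w = "\<lambda>y. \<Sum>a\<in>I. ball_bump a (r a) y"
  have pos: "?w y > 0" if y: "y \<in> K" for y
  proof -
    obtain a where a: "a \<in> I" "y \<in> ball a (r a)" using I y by blast
    then have "ball_bump a (r a) y > 0" using ball_bump_pos_iff I(1) r by blast
    then show ?thesis using a(1) I(2)
      by (intro sum_pos2[of I a]) (auto simp: ball_bump_def rexp_nonneg)
  qed
  have cont: "continuous_on K ?w"
    by (intro bump_alg_continuous bump_alg_sum) (auto simp: ball_bump_def intro: bump_alg.bump)
  have "\<exists>m>0. \<forall>y\<in>K. m \<le> ?w y"
  proof (cases "K = {}")
    case False
    then obtain y0 where "y0 \<in> K" "\<forall>y\<in>K. ?w y0 \<le> ?w y"
      using continuous_attains_inf[OF K _ cont] by blast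
    then show ?thesis using pos by blast
  qed (auto intro: exI[of _ 1])
  then show ?thesis using that I by blast
qed

lemma cutoff_exists:
  fixes K :: "'a::euclidean_space set"
  assumes K: "compact K" "K \<subseteq> W" and W: "open W"
  obtains \<eta> where "\<eta> \<in> Cc1 W" "\<And>y. \<eta> y \<ge> 0" "\<And>y. y \<in> K \<Longrightarrow> \<eta> y \<ge> 1"
proof -
  have "\<exists>r>0. cball y r \<subseteq> W" if "y \<in> K" for y using that K(2) W open_contains_cball by blast
  then obtain r where r: "\<And>y. y \<in> K \<Longrightarrow> r y > 0" "\<And>y. y \<in> K \<Longrightarrow> cball y (r y) \<subseteq> W" by metis
  obtain I m where I: "finite I" "I \<subseteq> K" "m > 0" "\<And>y. y \<in> K \<Longrightarrow> m \<le> (\<Sum>a\<in>I. ball_bump a (r a) y)"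
    using finite_ball_bump_cover[OF K(1), of r] r(1) by metis
  show ?thesis
  proof
    have "(\<lambda>y. \<Sum>a\<in>I. ball_bump a (r a) y) \<in> Cc1 W"
      using I(1,2) r by (intro Cc1_sum bumps_Cc1 ball_bump_in_bumps) (blast dest: subsetD)+
    then show "(\<lambda>y. (1 / m) * (\<Sum>a\<in>I. ball_bump a (r a) y)) \<in> Cc1 W"
      by (rule Cc1_cmult[OF _ W])
    show "(1 / m) * (\<Sum>a\<in>I. ball_bump a (r a) y) \<ge> 0" for y
      using I(3) by (intro mult_nonneg_nonneg sum_nonneg) (auto simp: ball_bump_def rexp_nonneg)
    show "(1 / m) * (\<Sum>a\<in>I. ball_bump a (r a) y) \<ge> 1" if "y \<in> K" for y
      using I(3) I(4)[OF that] by (simp add: field_simps)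
  qed
qed

section \<open>Continuous densities of image measures\<close>

lemma continuous_integral_zero:
  fixes g :: "real \<Rightarrow> real"
  assumes g: "continuous_on UNIV g" "\<And>x. g x \<ge> 0" "integrable lborel g" "(LINT x|lborel. g x) = 0"
  shows "g x = 0"
proof (rule ccontr)
  assume "g x \<noteq> 0"
  then have gx: "g x > 0" using g(2)[of x] by simp
  have "isCont g x" using g(1) by (simp add: continuous_on_eq_continuous_at)
  then obtain d where d: "d > 0" "\<And>y. dist y x < d \<Longrightarrow> dist (g y) (g x) < g x / 2"
    using gx unfolding continuous_at_eps_delta by (metis half_gt_zero)
  have "(LINT y|lborel. (g x / 2) * indicator {x - d/2..x + d/2} y) \<le> (LINT y|lborel. g y)"
  proof (rule integral_mono[OF _ g(3)])
    show "(g x / 2) * indicator {x - d/2..x + d/2} y \<le> g y" for y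
    proof (cases "y \<in> {x - d/2..x + d/2}")
      case True
      then have "\<bar>y - x\<bar> \<le> d / 2" unfolding atLeastAtMost_iff by linarith
      then have "\<bar>g y - g x\<bar> < g x / 2" using d(2)[of y] d(1) by (simp add: dist_real_def)
      then have "g x / 2 \<le> g y" by linarith
      then show ?thesis using True by simp
    qed (use g(2) in simp)
    show "integrable lborel (\<lambda>y. (g x / 2) * indicator {x - d/2..x + d/2} y)"
      by (intro integrable_mult_right integrable_real_indicator) (auto simp: emeasure_lborel_Icc_eq)
  qed
  moreover have "g x * d > 0" using gx d(1) by simp
  ultimately show False using g(4) d(1) by simp
qed

text \<open>F is the density of the image under P of the signed measure f dy. Continuity makes it
  unique at every point instead of almost everywhere, so densities found by different constructions
  can be compared on a single level set.\<close>

definition is_dens :: "('a::euclidean_space \<Rightarrow> real) \<Rightarrow> ('a \<Rightarrow> real) \<Rightarrow> (real \<Rightarrow> real) \<Rightarrow> bool" where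
  "is_dens P f F \<longleftrightarrow> continuous_on UNIV F \<and> csupp F \<and>
     (\<forall>\<phi>. continuous_on UNIV \<phi> \<longrightarrow> (LINT y|lborel. \<phi> (P y) * f y) = (LINT x|lborel. \<phi> x * F x))"

lemma is_densD:
  "is_dens P f F \<Longrightarrow> continuous_on UNIV \<phi> \<Longrightarrow> (LINT y|lborel. \<phi> (P y) * f y) = (LINT x|lborel. \<phi> x * F x)"
  by (simp add: is_dens_def)

lemma integrable_mult_csupp:
  fixes F :: "real \<Rightarrow> real"
  assumes "continuous_on UNIV \<phi>" "continuous_on UNIV F" "csupp F"
  shows "integrable lborel (\<lambda>x. \<phi> x * F x)"
proof -
  obtain R where R: "\<And>x. \<bar>x\<bar> > R \<Longrightarrow> F x = 0" using csuppE[OF assms(3)] by metis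
  show ?thesis
    by (rule integrable_continuous_compact_support[of _ "{-R..R}"])
       (use R in \<open>auto intro!: continuous_intros assms simp: abs_if not_le split: if_splits\<close>)
qed

text \<open>The difference of the two densities is itself an admissible test function, and testing
  with it gives an integral of a square.\<close>

lemma is_dens_unique:
  assumes F: "is_dens P f F" and F': "is_dens P f F'"
  shows "F x = F' x"
proof -
  have c: "continuous_on UNIV (\<lambda>x. F x - F' x)"
    using F F' by (intro continuous_intros) (auto simp: is_dens_def)
  have cF: "continuous_on UNIV F" "csupp F" "continuous_on UNIV F'" "csupp F'" using F F' by (auto simp: is_dens_def)
  note i = integrable_mult_csupp[OF c cF(1,2)] integrable_mult_csupp[OF c cF(3,4)]
  have "(LINT x|lborel. (F x - F' x) * F x) = (LINT x|lborel. (F x - F' x) * F' x)"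
    using F F' c unfolding is_dens_def by metis
  then have "(LINT x|lborel. (F x - F' x) * F x - (F x - F' x) * F' x) = 0" using i by simp
  then have z: "(LINT x|lborel. (F x - F' x)\<^sup>2) = 0" by (simp add: power2_eq_square algebra_simps)
  have "integrable lborel (\<lambda>x. (F x - F' x) * F x - (F x - F' x) * F' x)" using i by simp
  then have "integrable lborel (\<lambda>x. (F x - F' x)\<^sup>2)" by (simp add: power2_eq_square algebra_simps)
  from continuous_integral_zero[OF continuous_on_power[OF c] _ this z, of x] show ?thesis by simp
qed

text \<open>The test function is F times a tent t about x whose support misses P(K); it turns the
  right-hand side into the integral of t F^2.\<close>

lemma is_dens_outside:
  assumes F: "is_dens P f F" and "compact K" "\<And>y. y \<notin> K \<Longrightarrow> f y = 0" "continuous_on K P" and x: "x \<notin> P ` K"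
  shows "F x = 0"
proof -
  have "compact (P ` K)" by (intro compact_continuous_image assms)
  then have "open (- P ` K)" by (simp add: compact_imp_closed open_Compl)
  then obtain d where d: "d > 0" "ball x d \<subseteq> - P ` K" using x open_contains_ball by blast
  define t where "t \<omega> = max 0 (d - \<bar>\<omega> - x\<bar>)" for \<omega> :: real
  have ct: "continuous_on UNIV t" unfolding t_def by (intro continuous_intros)
  have cF: "continuous_on UNIV F" "csupp F" using F by (auto simp: is_dens_def)
  have c: "continuous_on UNIV (\<lambda>\<omega>. t \<omega> * F \<omega>)" by (intro continuous_intros ct cF)
  have "t (P y) * F (P y) * f y = 0" for y
  proof (cases "y \<in> K")
    case True
    then have "\<not> \<bar>P y - x\<bar> < d" using d(2) by (force simp: dist_real_def abs_minus_commute)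
    then show ?thesis by (simp add: t_def)
  qed (simp add: assms)
  then have "(LINT y|lborel. t (P y) * F (P y) * f y) = 0" by (simp only: Bochner_Integration.integral_zero)
  moreover have "(LINT y|lborel. t (P y) * F (P y) * f y) = (LINT \<omega>|lborel. t \<omega> * F \<omega> * F \<omega>)"
    using is_densD[OF F c] .
  ultimately have z: "(LINT \<omega>|lborel. t \<omega> * F \<omega> * F \<omega>) = 0" by simp
  have "t x * F x * F x = 0"
  proof (rule continuous_integral_zero[OF _ _ integrable_mult_csupp[OF c cF] z])
    show "continuous_on UNIV (\<lambda>\<omega>. t \<omega> * F \<omega> * F \<omega>)" by (intro continuous_intros ct cF)
    show "t \<omega> * F \<omega> * F \<omega> \<ge> 0" for \<omega>
      by (simp add: t_def mult.assoc)
  qed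
  then show ?thesis using d(1) by (simp add: t_def)
qed

text \<open>Two vector fields are used: \<nabla>P / |\<nabla>P|^2 on all of G, and e_b /
  \<partial>_b P locally. Both lead to the same density, although their divergences differ.\<close>

locale transversal_field =
  fixes P :: "'a::euclidean_space \<Rightarrow> real" and W :: "'a set" and X :: "'a \<Rightarrow> 'a \<Rightarrow> real"
  assumes P: "C1_on W P"
    and X: "\<And>b. b \<in> Basis \<Longrightarrow> C1_on W (X b)"
    and XP: "\<And>y. y \<in> W \<Longrightarrow> (\<Sum>b\<in>Basis. X b y * pd P b y) = 1"
begin

text \<open>The divergence of the vector field f X.\<close>

definition Dv :: "('a \<Rightarrow> real) \<Rightarrow> 'a \<Rightarrow> real" where
  "Dv f y = (\<Sum>b\<in>Basis. pd (\<lambda>z. f z * X b z) b y)"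

text \<open>By the divergence theorem this is the integral of \<open>f\<close> over the level set of \<open>x\<close>, with respect
  to \<open>d\<sigma> / |\<nabla>P|\<close>, but no surface measure is needed to write it down.\<close>
definition dens :: "('a \<Rightarrow> real) \<Rightarrow> real \<Rightarrow> real" where
  "dens f x = (LINT y|lborel. indicator {y \<in> W. P y < x} y * Dv f y)"

lemma open_W: "open W"
  using P by (rule C1_on_open)

context
  fixes f assumes f: "f \<in> Cc1 W"
begin

lemma f_props: "C1_on UNIV f" "compact (support f)" "support f \<subseteq> W"
  using f by (auto simp: Cc1_def)

lemma Dv_outside: "y \<notin> support f \<Longrightarrow> Dv f y = 0"
proof -
  assume y: "y \<notin> support f"
  have "y \<notin> support (\<lambda>z. f z * X b z)" for b using support_mono[of f "\<lambda>z. f z * X b z"] y by auto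
  then show ?thesis by (simp add: Dv_def pd_outside_support)
qed

lemma Dv_continuous: "continuous_on S (Dv f)"
  unfolding Dv_def
  using Cc1_mult[OF f X]
  by (intro continuous_intros) (auto simp: Cc1_def intro: continuous_on_subset[OF C1_on_pd_continuous])

lemma Dv_integrable: "integrable lborel (Dv f)"
  by (rule integrable_continuous_compact_support[OF Dv_continuous f_props(2) Dv_outside])

lemma comp_continuous:
  assumes "continuous_on UNIV \<phi>"
  shows "continuous_on UNIV (\<lambda>y. \<phi> (P y) * f y)"
  using continuous_mult_supported[OF C1_on_continuous[OF f_props(1)] f_props(3) open_W
      continuous_on_compose2[OF assms C1_on_continuous[OF P]]]
  by (simp add: mult.commute)

lemma comp_integrable:
  assumes "continuous_on UNIV \<phi>"
  shows "integrable lborel (\<lambda>y. \<phi> (P y) * f y)"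
  by (rule integrable_continuous_compact_support[OF comp_continuous[OF assms] f_props(2)])
     (simp add: not_in_support)

lemma comp_Dv_integrable:
  assumes "continuous_on UNIV \<phi>"
  shows "integrable lborel (\<lambda>y. \<phi> (P y) * Dv f y)"
proof -
  have "continuous_on UNIV (\<lambda>y. Dv f y * \<phi> (P y))"
    by (rule continuous_mult_supported[OF Dv_continuous _ open_W
      continuous_on_compose2[OF assms C1_on_continuous[OF P]]])
       (use f_props(3) support_subset[of "support f" "Dv f"] Dv_outside in auto)
  then have "integrable lborel (\<lambda>y. Dv f y * \<phi> (P y))"
    by (rule integrable_continuous_compact_support[OF _ f_props(2)]) (simp add: Dv_outside)
  then show ?thesis by (simp add: mult.commute)
qed

text \<open>The compactly supported field \<phi>(P) f X has divergence \<phi>'(P) f + \<phi>(P) div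
  (f X), since X P = 1, and a divergence integrates to 0.\<close>

lemma div_identity:
  assumes \<phi>: "\<And>t. (\<phi> has_real_derivative \<phi>' t) (at t)" "continuous_on UNIV \<phi>'"
  shows "(LINT y|lborel. \<phi>' (P y) * f y) = - (LINT y|lborel. \<phi> (P y) * Dv f y)"
proof -
  have c\<phi>: "continuous_on UNIV \<phi>" using \<phi>(1) by (meson DERIV_continuous_on has_field_derivative_at_within)
  have c\<phi>': "continuous_on S \<phi>'" for S using \<phi>(2) by (rule continuous_on_subset) simp
  have C: "C1_on W (\<lambda>y. \<phi> (P y))" by (rule C1_on_compose[OF P \<phi>(1) c\<phi>'])
  have fX: "(\<lambda>y. f y * X b y) \<in> Cc1 W" if "b \<in> Basis" for b by (rule Cc1_mult[OF f X[OF that]])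
  have h: "(\<lambda>y. f y * X b y * \<phi> (P y)) \<in> Cc1 W" if "b \<in> Basis" for b by (rule Cc1_mult[OF fX[OF that] C])
  have point: "(\<Sum>b\<in>Basis. pd (\<lambda>y. f y * X b y * \<phi> (P y)) b y) = \<phi>' (P y) * f y + \<phi> (P y) * Dv f y" for y
  proof (cases "y \<in> support f")
    case True
    then have y: "y \<in> W" using f_props(3) by auto
    have "(\<Sum>b\<in>Basis. pd (\<lambda>y. f y * X b y * \<phi> (P y)) b y)
       = (\<Sum>b\<in>Basis. f y * X b y * (\<phi>' (P y) * pd P b y) + pd (\<lambda>y. f y * X b y) b y * \<phi> (P y))"
    proof (rule sum.cong[OF refl])
      fix b :: 'a assume b: "b \<in> Basis"
      have "C1_on W (\<lambda>y. f y * X b y)" using fX[OF b] C1_on_subset[OF _ open_W] by (auto simp: Cc1_def)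
      from pd_mult[OF this C y, of b] pd_compose[OF P \<phi>(1) c\<phi>' y, of b]
      show "pd (\<lambda>y. f y * X b y * \<phi> (P y)) b y = f y * X b y * (\<phi>' (P y) * pd P b y) + pd (\<lambda>y. f y * X b y) b y * \<phi> (P y)"
        by simp
    qed
    also have "\<dots> = \<phi>' (P y) * f y * (\<Sum>b\<in>Basis. X b y * pd P b y) + \<phi> (P y) * Dv f y"
      by (simp add: Dv_def sum.distrib sum_distrib_left mult_ac)
    finally show ?thesis using XP[OF y] by simp
  next
    case False
    have "y \<notin> support (\<lambda>y. f y * X b y * \<phi> (P y))" for b
      using support_mono[of f "\<lambda>y. f y * X b y * \<phi> (P y)"] False by auto
    then show ?thesis using False by (simp add: pd_outside_support Dv_outside not_in_support)
  qed
  have "(LINT y|lborel. \<phi>' (P y) * f y + \<phi> (P y) * Dv f y) = (LINT y|lborel. (\<Sum>b\<in>Basis. pd (\<lambda>y. f y * X b y * \<phi> (P y)) b y))"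
    by (simp add: point)
  also have "\<dots> = (\<Sum>b\<in>Basis. (LINT y|lborel. pd (\<lambda>y. f y * X b y * \<phi> (P y)) b y))"
    by (rule Bochner_Integration.integral_sum) (rule Cc1_pd_integrable[OF h])
  also have "\<dots> = 0" by (simp add: integral_pd_eq_0[OF h])
  finally show ?thesis
    using comp_integrable[OF \<phi>(2)] comp_Dv_integrable[OF c\<phi>] by simp
qed

lemma integral_Dv: "(LINT y|lborel. Dv f y) = 0"
  using div_identity[of "\<lambda>_. 1" "\<lambda>_. 0"] by simp

text \<open>With a primitive \<Phi> of \<phi>, Fubini's theorem turns the integral of \<phi> times
  the density into that of (\<Phi>(R) - \<Phi>(P)) div (f X). The constant drops out, because div (f
  X) has integral 0, and \<open>div_identity\<close> rewrites the rest. The same vanishing integral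
  makes the density 0 above the values of P on the support.\<close>

lemma coarea:
  assumes \<phi>: "continuous_on UNIV \<phi>"
  shows "(LINT y|lborel. \<phi> (P y) * f y) = (LINT x|lborel. \<phi> x * dens f x)"
  and dens_csupp: "csupp (dens f)"
proof -
  have "compact (P ` support f)"
    by (intro compact_continuous_image f_props continuous_on_subset[OF C1_on_continuous[OF P] f_props(3)])
  then obtain R where R: "R > 0" "\<And>y. y \<in> support f \<Longrightarrow> \<bar>P y\<bar> < R"
    using compact_imp_bounded bounded_pos_less by (metis (no_types, lifting) image_eqI real_norm_def)
  obtain \<Phi> where \<Phi>: "\<And>t. (\<Phi> has_real_derivative \<phi> t) (at t)"
  proof -
    have "\<And>x. isCont \<phi> x" using \<phi> by (simp add: continuous_on_eq_continuous_at)
    then obtain F where "\<And>x. (F has_vector_derivative \<phi> x) (at x)"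
      using einterval_antiderivative[of "-\<infinity>" "\<infinity>" \<phi>] by auto
    then show ?thesis using that[of F] by (simp add: has_real_derivative_iff_has_vector_derivative)
  qed
  \<comment> \<open>P is unspecified outside W; Q is a Borel function that agrees with it wherever
    div (f X) can be nonzero.\<close>
  define Q where "Q y = (if y \<in> W then P y else 0)" for y
  have [measurable]: "W \<in> sets borel" using open_W by simp
  have "Q = (\<lambda>y. indicator W y *\<^sub>R P y)" by (auto simp: Q_def indicator_def)
  then have [measurable]: "Q \<in> borel_measurable borel"
    using borel_measurable_continuous_on_indicator[OF \<open>W \<in> sets borel\<close> C1_on_continuous[OF P]] by simp
  have [measurable]: "Dv f \<in> borel_measurable borel" "\<phi> \<in> borel_measurable borel"
    by (intro borel_measurable_continuous_onI Dv_continuous \<phi>)+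
  have M: "dens f x = (LINT y|lborel. indicator {y. Q y < x} y * Dv f y)" for x
    unfolding dens_def using Dv_outside f_props(3)
    by (intro Bochner_Integration.integral_cong) (auto simp: indicator_def Q_def)
  have Mbelow: "dens f x = 0" if "x < -R" for x
  proof -
    have "indicator {y \<in> W. P y < x} y * Dv f y = 0" for y
      using R(2)[of y] that Dv_outside[of y] by (cases "y \<in> support f") (auto simp: indicator_def)
    then show ?thesis by (simp only: dens_def Bochner_Integration.integral_zero)
  qed
  have Mabove: "dens f x = 0" if "x > R" for x
  proof -
    have "indicator {y \<in> W. P y < x} y * Dv f y = Dv f y" for y
      using R(2)[of y] that Dv_outside[of y] f_props(3) by (cases "y \<in> support f") (auto simp: indicator_def)
    then show ?thesis by (simp only: dens_def integral_Dv)
  qed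
  show "csupp (dens f)"
    unfolding csupp_def using Mabove Mbelow by (intro exI[of _ R]) (auto simp: abs_if split: if_splits)
  define k where "k x y = indicator {-R..R} x * \<phi> x * (indicator {y. Q y < x} y * Dv f y)" for x y
  have mk [measurable]: "case_prod k \<in> borel_measurable (lborel \<Otimes>\<^sub>M lborel)"
    unfolding k_def case_prod_beta indicator_def by measurable
  obtain B where B: "B \<ge> 0" "\<And>x. x \<in> {-R..R} \<Longrightarrow> \<bar>\<phi> x\<bar> \<le> B"
  proof -
    have "compact (\<phi> ` {-R..R})" by (intro compact_continuous_image continuous_on_subset[OF \<phi>]) auto
    then obtain B where "B > 0" "\<forall>x\<in>\<phi> ` {-R..R}. norm x \<le> B" using compact_imp_bounded bounded_pos by metis
    then show ?thesis using that[of B] by auto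
  qed
  have ik: "integrable (lborel \<Otimes>\<^sub>M lborel) (case_prod k)"
  proof (rule lborel_pair.Fubini_integrable[OF mk])
    have le: "(LINT y|lborel. norm (k x y)) \<le> indicator {-R..R} x * (B * (LINT y|lborel. \<bar>Dv f y\<bar>))" for x
    proof -
      have "(LINT y|lborel. norm (k x y)) \<le> (LINT y|lborel. indicator {-R..R} x * B * \<bar>Dv f y\<bar>)"
      proof (rule order_trans[OF abs_ge_self], unfold real_norm_def[symmetric], rule norm_integral_le)
        show "integrable lborel (\<lambda>y. indicator {-R..R} x * B * norm (Dv f y))"
          using Dv_integrable by (intro integrable_mult_right integrable_norm)
        show "norm (norm (k x y)) \<le> indicator {-R..R} x * B * norm (Dv f y)" for y
          using B(1) B(2)[of x]
          by (cases "x \<in> {-R..R}"; cases "Q y < x") (auto simp: k_def abs_mult intro: mult_right_mono)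
      qed
      then show ?thesis by (simp add: mult.assoc)
    qed
    show "integrable lborel (\<lambda>x. LINT y|lborel. norm (case_prod k (x, y)))"
    proof (rule Bochner_Integration.integrable_bound)
      show "integrable lborel (\<lambda>x. indicator {-R..R} x * (B * (LINT y|lborel. \<bar>Dv f y\<bar>)))"
        by (intro integrable_mult_left integrable_real_indicator) (auto simp: emeasure_lborel_Icc_eq)
      show "AE x in lborel. norm (LINT y|lborel. norm (case_prod k (x, y))) \<le> norm (indicator {-R..R} x * (B * (LINT y|lborel. \<bar>Dv f y\<bar>)))"
        using le by (intro AE_I2) (auto intro: order_trans[OF _ abs_ge_self])
    qed measurable
    show "AE x in lborel. integrable lborel (\<lambda>y. case_prod k (x, y))"
    proof (intro AE_I2)
      fix x
      show "integrable lborel (\<lambda>y. case_prod k (x, y))"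
        by (rule Bochner_Integration.integrable_bound[OF integrable_mult_right[OF Dv_integrable, of "\<phi> x"]])
           (auto simp: k_def abs_mult indicator_def)
    qed
  qed
  have "(LINT x|lborel. \<phi> x * dens f x) = (LINT x|lborel. LINT y|lborel. k x y)"
  proof (intro Bochner_Integration.integral_cong refl)
    fix x
    have "(LINT y|lborel. k x y) = indicator {-R..R} x * \<phi> x * dens f x"
      by (simp add: k_def M)
    then show "\<phi> x * dens f x = (LINT y|lborel. k x y)"
      using Mabove[of x] Mbelow[of x] by (cases "x \<in> {-R..R}") (auto simp: not_le)
  qed
  also have "\<dots> = (LINT y|lborel. LINT x|lborel. k x y)"
    using lborel_pair.Fubini_integral[OF ik] by simp
  also have "\<dots> = (LINT y|lborel. (\<Phi> R - \<Phi> (P y)) * Dv f y)"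
  proof (intro Bochner_Integration.integral_cong refl)
    fix y
    show "(LINT x|lborel. k x y) = (\<Phi> R - \<Phi> (P y)) * Dv f y"
    proof (cases "y \<in> support f")
      case True
      then have y: "y \<in> W" "\<bar>P y\<bar> < R" using f_props(3) R(2) by auto
      have "(LINT x|lborel. k x y) = (LINT x|lborel. (indicator {P y..R} x *\<^sub>R \<phi> x) * Dv f y)"
        by (rule integral_discrete_difference[of "{P y}"]) (use y in \<open>auto simp: k_def indicator_def Q_def\<close>)
      also have "\<dots> = (LINT x|lborel. indicator {P y..R} x *\<^sub>R \<phi> x) * Dv f y"
        by simp
      also have "(LINT x|lborel. indicator {P y..R} x *\<^sub>R \<phi> x) = \<Phi> R - \<Phi> (P y)"
        by (rule has_bochner_integral_integral_eq, rule has_bochner_integral_FTC_Icc)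
           (use y \<Phi> \<phi> in \<open>auto simp flip: has_real_derivative_iff_has_vector_derivative
             intro: has_field_derivative_at_within continuous_on_subset\<close>)
      finally show ?thesis .
    qed (simp add: k_def Dv_outside)
  qed
  also have "\<dots> = \<Phi> R * (LINT y|lborel. Dv f y) - (LINT y|lborel. \<Phi> (P y) * Dv f y)"
  proof -
    have "continuous_on UNIV \<Phi>" using \<Phi> by (meson DERIV_continuous_on has_field_derivative_at_within)
    then show ?thesis using Dv_integrable comp_Dv_integrable[of \<Phi>] by (simp add: left_diff_distrib)
  qed
  also have "\<dots> = (LINT y|lborel. \<phi> (P y) * f y)"
    using div_identity[OF \<Phi> \<phi>] by (simp add: integral_Dv)
  finally show "(LINT y|lborel. \<phi> (P y) * f y) = (LINT x|lborel. \<phi> x * dens f x)" by simp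
qed

lemma dens_le: "\<bar>dens f x\<bar> \<le> (LINT y|lborel. \<bar>Dv f y\<bar>)"
  unfolding dens_def
  using norm_integral_le[of lborel "\<lambda>y. \<bar>Dv f y\<bar>" "\<lambda>y. indicator {y \<in> W. P y < x} y * Dv f y"] Dv_integrable
  by (auto simp: indicator_def)

end

lemma dens_lipschitz:
  assumes f: "f \<in> Cc1 W"
  obtains L where "\<And>a b. \<bar>dens f a - dens f b\<bar> \<le> L * \<bar>a - b\<bar>"
proof -
  note fp = f_props[OF f]
  have mset: "{y \<in> W. P y < x} \<in> sets borel" for x
    using continuous_open_preimage[OF C1_on_continuous[OF P] open_W, of "{..<x}"]
    by (auto simp: vimage_def Int_def conj_commute intro!: borel_open)
  obtain \<eta> where \<eta>: "\<eta> \<in> Cc1 W" "\<And>y. \<eta> y \<ge> 0" "\<And>y. y \<in> support f \<Longrightarrow> \<eta> y \<ge> 1"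
    using cutoff_exists[OF fp(2,3) open_W] by metis
  have "compact (Dv f ` support f)" by (intro compact_continuous_image Dv_continuous f fp)
  then obtain B where B: "B > 0" "\<forall>t\<in>Dv f ` support f. norm t \<le> B" using compact_imp_bounded bounded_pos by metis
  have Db: "\<bar>Dv f y\<bar> \<le> B * \<eta> y" for y
  proof (cases "y \<in> support f")
    case True
    then have "\<bar>Dv f y\<bar> \<le> B * 1" using B by auto
    also have "\<dots> \<le> B * \<eta> y" using B \<eta>(3)[OF True] by (intro mult_left_mono) auto
    finally show ?thesis .
  qed (use B \<eta>(2) Dv_outside[OF f] in auto)
  define S where "S = (LINT y|lborel. \<bar>Dv \<eta> y\<bar>)"
  have S: "\<bar>dens \<eta> x\<bar> \<le> S" "S \<ge> 0" for x using dens_le[OF \<eta>(1)] by (auto simp: S_def)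
  have main: "\<bar>dens f b - dens f a\<bar> \<le> (3 * B * S) * (b - a)" if ab: "a < b" for a b
  proof -
    \<comment> \<open>A trapezoid equal to 1 on [a, b], with ramps of width b - a. Its support has
      length 3 (b - a), which is the factor 3 in the Lipschitz constant.\<close>
    define \<phi> where "\<phi> t = max 0 (1 - max 0 (max (a - t) (t - b)) / (b - a))" for t
    have c\<phi>: "continuous_on UNIV \<phi>" unfolding \<phi>_def using ab by (intro continuous_intros) auto
    have \<phi>01: "0 \<le> \<phi> t" "\<phi> t \<le> 1" for t using ab by (auto simp: \<phi>_def)
    have \<phi>1: "\<phi> t = 1" if "a \<le> t" "t \<le> b" for t using that by (auto simp: \<phi>_def)
    have \<phi>0: "\<phi> t = 0" if "t \<notin> {a - (b - a)..b + (b - a)}" for t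
      using that ab by (auto simp: \<phi>_def field_simps max_def)
    have i: "integrable lborel (\<lambda>y. indicator {y \<in> W. P y < x} y * Dv f y)" for x
      using integrable_mult_indicator[OF _ Dv_integrable[OF f], of "{y \<in> W. P y < x}"] mset by simp
    have "\<bar>dens f b - dens f a\<bar> = \<bar>LINT y|lborel. indicator {y \<in> W. P y < b} y * Dv f y - indicator {y \<in> W. P y < a} y * Dv f y\<bar>"
      using i by (simp add: dens_def)
    also have "\<dots> \<le> (LINT y|lborel. B * (\<phi> (P y) * \<eta> y))"
      unfolding real_norm_def[symmetric]
    proof (rule norm_integral_le)
      show "integrable lborel (\<lambda>y. B * (\<phi> (P y) * \<eta> y))"
        by (intro integrable_mult_right comp_integrable \<eta> c\<phi>)
      fix y
      have "0 \<le> B * (\<phi> (P y) * \<eta> y)" using B(1) \<phi>01 \<eta>(2) by simp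
      then show "norm (indicator {y \<in> W. P y < b} y * Dv f y - indicator {y \<in> W. P y < a} y * Dv f y) \<le> B * (\<phi> (P y) * \<eta> y)"
        using \<phi>1[of "P y"] Db[of y] ab by (auto simp: indicator_def not_less)
    qed
    also have "\<dots> = B * (LINT x|lborel. \<phi> x * dens \<eta> x)" by (simp add: coarea[OF \<eta>(1) c\<phi>])
    also have "(LINT x|lborel. \<phi> x * dens \<eta> x) \<le> (LINT x|lborel. S * indicator {a - (b - a)..b + (b - a)} x)"
    proof -
      have "norm (LINT x|lborel. \<phi> x * dens \<eta> x) \<le> (LINT x|lborel. S * indicator {a - (b - a)..b + (b - a)} x)"
      proof (rule norm_integral_le)
        show "norm (\<phi> x * dens \<eta> x) \<le> S * indicator {a - (b - a)..b + (b - a)} x" for x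
          using \<phi>0[of x] mult_mono[OF \<phi>01(2)[of x] S(1)[of x]] \<phi>01[of x] S(2)
          by (auto simp: abs_mult indicator_def)
        show "integrable lborel (\<lambda>x. S * indicator {a - (b - a)..b + (b - a)} x)"
          by (intro integrable_mult_right integrable_real_indicator) (auto simp: emeasure_lborel_Icc_eq)
      qed
      then show ?thesis by simp
    qed
    also have "(LINT x|lborel. S * indicator {a - (b - a)..b + (b - a)} x) = S * (3 * (b - a))"
      using ab by simp
    finally show ?thesis using B(1) by (simp add: mult_ac)
  qed
  have "\<bar>dens f a - dens f b\<bar> \<le> (3 * B * S) * \<bar>a - b\<bar>" for a b
    using main[of a b] main[of b a] by (cases a b rule: linorder_cases) (auto simp: abs_minus_commute)
  then show ?thesis using that by blast
qed

lemma is_dens_dens: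
  assumes f: "f \<in> Cc1 W" shows "is_dens P f (dens f)"
proof -
  obtain L where L: "\<And>a b. \<bar>dens f a - dens f b\<bar> \<le> L * \<bar>a - b\<bar>" using dens_lipschitz[OF f] by metis
  have "continuous_on UNIV (dens f)"
  proof (rule lipschitz_on_continuous_on)
    show "(max L 0)-lipschitz_on UNIV (dens f)"
      by (rule lipschitz_onI)
         (auto simp: dist_real_def intro!: order_trans[OF L] mult_right_mono)
  qed
  then show ?thesis using coarea[OF f] dens_csupp[OF f] by (auto simp: is_dens_def)
qed

end

subsection \<open>Graph patches of level sets\<close>

definition proj :: "'a::euclidean_space \<Rightarrow> 'a \<Rightarrow> 'a" where
  "proj b y = y - (y \<bullet> b) *\<^sub>R b"

lemma proj_decomp: "y = proj b y + (y \<bullet> b) *\<^sub>R b"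
  by (simp add: proj_def)

lemma proj_inner: "b \<in> Basis \<Longrightarrow> proj b y \<bullet> b = 0"
  by (simp add: proj_def inner_diff_left)

lemma proj_eq: "y \<bullet> b = 0 \<Longrightarrow> proj b y = y"
  by (simp add: proj_def)

lemma proj_line: "b \<in> Basis \<Longrightarrow> y \<bullet> b = 0 \<Longrightarrow> proj b (y + t *\<^sub>R b) = y"
  by (simp add: proj_def inner_add_left)

lemma proj_linear: "bounded_linear (proj b)"
  unfolding proj_def
  by (intro bounded_linear_sub bounded_linear_ident bounded_linear_scaleR_const bounded_linear_inner_left)

lemma proj_continuous [continuous_intros]: "continuous_on S f \<Longrightarrow> continuous_on S (\<lambda>y. proj b (f y))"
  unfolding proj_def by (intro continuous_intros)

definition patch_area :: "'a::euclidean_space \<Rightarrow> ('a \<Rightarrow> real) \<Rightarrow> 'a \<Rightarrow> real" where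
  "patch_area b \<psi> y = sqrt (1 + (\<Sum>c\<in>Basis - {b}. (pd \<psi> c y)\<^sup>2))"

text \<open>Outside U the parametrization is sent to 0 to make it Borel measurable on the whole
  space; the density puts no mass there.\<close>

definition patch_measure :: "'a::euclidean_space \<Rightarrow> 'a set \<Rightarrow> ('a \<Rightarrow> real) \<Rightarrow> 'a measure" where
  "patch_measure b U \<psi> = distr (density (hyperplane_lborel b) (\<lambda>y. ennreal (patch_area b \<psi> y) * indicator U y))
     borel (\<lambda>y. indicator U y *\<^sub>R (y + \<psi> y *\<^sub>R b))"

lemma sets_patch_measure [simp]: "sets (patch_measure b U \<psi>) = sets borel"
  by (simp add: patch_measure_def)

lemma
  fixes b :: "'a::euclidean_space"
  assumes \<psi>: "C1_on U \<psi>"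
  shows patch_map_measurable: "(\<lambda>y. indicator U y *\<^sub>R (y + \<psi> y *\<^sub>R b)) \<in> borel_measurable borel"
    and patch_area_measurable: "(\<lambda>y. ennreal (patch_area b \<psi> y) * indicator U y) \<in> borel_measurable borel"
proof -
  have U: "U \<in> sets borel" using C1_on_open[OF \<psi>] by simp
  show "(\<lambda>y. indicator U y *\<^sub>R (y + \<psi> y *\<^sub>R b)) \<in> borel_measurable borel"
    by (intro borel_measurable_continuous_on_indicator U continuous_intros C1_on_continuous[OF \<psi>])
  have "(\<lambda>y. indicator U y *\<^sub>R patch_area b \<psi> y) \<in> borel_measurable borel"
    unfolding patch_area_def
    by (intro borel_measurable_continuous_on_indicator U continuous_intros C1_on_pd_continuous[OF \<psi>]) auto
  then have "(\<lambda>y. ennreal (indicator U y *\<^sub>R patch_area b \<psi> y)) \<in> borel_measurable borel" by measurable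
  also have "(\<lambda>y. ennreal (indicator U y *\<^sub>R patch_area b \<psi> y)) = (\<lambda>y. ennreal (patch_area b \<psi> y) * indicator U y)"
    by (auto simp: indicator_def)
  finally show "(\<lambda>y. ennreal (patch_area b \<psi> y) * indicator U y) \<in> borel_measurable borel" .
qed

lemma nn_integral_patch_measure:
  assumes \<psi>: "C1_on U \<psi>" and f [measurable]: "f \<in> borel_measurable borel"
  shows "(\<integral>\<^sup>+ y. f y \<partial>patch_measure b U \<psi>) =
    (\<integral>\<^sup>+ y. ennreal (patch_area b \<psi> y) * indicator U y * f (y + \<psi> y *\<^sub>R b) \<partial>hyperplane_lborel b)"
proof -
  note [measurable] = patch_map_measurable[OF \<psi>, of b] patch_area_measurable[OF \<psi>, of b]
  have "(\<integral>\<^sup>+ y. f y \<partial>patch_measure b U \<psi>) =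
    (\<integral>\<^sup>+ y. ennreal (patch_area b \<psi> y) * indicator U y * f (indicator U y *\<^sub>R (y + \<psi> y *\<^sub>R b)) \<partial>hyperplane_lborel b)"
    unfolding patch_measure_def by (simp add: nn_integral_distr nn_integral_density)
  also have "\<dots> = (\<integral>\<^sup>+ y. ennreal (patch_area b \<psi> y) * indicator U y * f (y + \<psi> y *\<^sub>R b) \<partial>hyperplane_lborel b)"
    by (intro nn_integral_cong) (auto simp: indicator_def)
  finally show ?thesis .
qed

lemma emeasure_patch_measure:
  assumes \<psi>: "C1_on U \<psi>" and A: "A \<in> sets borel"
  shows "emeasure (patch_measure b U \<psi>) A =
    (\<integral>\<^sup>+ y. ennreal (patch_area b \<psi> y) * indicator U y * indicator A (y + \<psi> y *\<^sub>R b) \<partial>hyperplane_lborel b)"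
  using nn_integral_patch_measure[OF \<psi>, of "indicator A" b] A by simp

lemma norm_grad: "norm (grad P y) = sqrt (\<Sum>c\<in>Basis. (pd P c y)\<^sup>2)"
proof -
  have "(norm (grad P y))\<^sup>2 = (\<Sum>c\<in>Basis. (grad P y \<bullet> c)\<^sup>2)"
    unfolding power2_norm_eq_inner by (subst euclidean_inner) (simp only: power2_eq_square)
  also have "\<dots> = (\<Sum>c\<in>Basis. (pd P c y)\<^sup>2)"
    by (intro sum.cong) (auto simp: grad_def inner_sum_left inner_Basis if_distrib cong: if_cong)
  finally show ?thesis by (metis norm_ge_zero real_sqrt_unique)
qed

section \<open>Level sets of a function without critical points\<close>

locale level_family =
  fixes G :: "'a::euclidean_space set" and P :: "'a \<Rightarrow> real"
  assumes C1P: "C1_on G P"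
    and C2P: "\<And>b. b \<in> Basis \<Longrightarrow> C1_on G (pd P b)"
    and grad_nz: "\<And>y. y \<in> G \<Longrightarrow> grad P y \<noteq> 0"
begin

lemma open_G: "open G"
  using C1P by (rule C1_on_open)

lemma sum_pd_pos: "y \<in> G \<Longrightarrow> (\<Sum>c\<in>Basis. (pd P c y)\<^sup>2) > 0"
proof -
  assume "y \<in> G"
  then have "sqrt (\<Sum>c\<in>Basis. (pd P c y)\<^sup>2) > 0"
    using grad_nz[of y] norm_grad[of P y] by (metis zero_less_norm_iff)
  then show ?thesis by simp
qed

lemma C1_norm_grad: "C1_on G (\<lambda>y. norm (grad P y))"
  unfolding norm_grad power2_eq_square
  by (intro C1_on_sqrt C1_on_sum open_G C1_on_mult C2P) (use sum_pd_pos in \<open>auto simp: power2_eq_square\<close>)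

definition XG :: "'a \<Rightarrow> 'a \<Rightarrow> real" where
  "XG b y = pd P b y / (\<Sum>c\<in>Basis. pd P c y * pd P c y)"

sublocale transversal_field P G XG
proof
  show "C1_on G (XG b)" if "b \<in> Basis" for b
    unfolding XG_def
    by (intro C1_on_divide C1_on_sum open_G C1_on_mult C2P that) (use sum_pd_pos in \<open>force simp: power2_eq_square\<close>)+
  show "(\<Sum>b\<in>Basis. XG b y * pd P b y) = 1" if "y \<in> G" for y
    using sum_pd_pos[OF that] by (simp add: XG_def power2_eq_square flip: sum_divide_distrib)
qed (rule C1P)

lemma pd_P_neighbourhood:
  assumes "p \<in> G" "b \<in> Basis" "pd P b p \<noteq> 0"
  obtains r where "r > 0" "ball p r \<subseteq> G" "\<And>y. y \<in> ball p r \<Longrightarrow> pd P b y * sgn (pd P b p) > 0"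
proof -
  have "open (G \<inter> (\<lambda>y. pd P b y * sgn (pd P b p)) -` {0<..})"
    by (intro continuous_open_preimage continuous_intros C1_on_pd_continuous[OF C1P] assms open_G open_greaterThan)
  moreover have "p \<in> G \<inter> (\<lambda>y. pd P b y * sgn (pd P b p)) -` {0<..}"
    using assms by (auto simp: sgn_if)
  ultimately obtain r where "r > 0" "ball p r \<subseteq> G \<inter> (\<lambda>y. pd P b y * sgn (pd P b p)) -` {0<..}"
    using open_contains_ball by blast
  then show ?thesis by (intro that[of r]) auto
qed

text \<open>The mean value theorem on a segment that convexity keeps inside V. The factor s treats
  both signs of the partial derivative together.\<close>

lemma P_strict_on_line:
  assumes V: "convex V" "V \<subseteq> G" "\<And>z. z \<in> V \<Longrightarrow> pd P b z * s > 0"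
    and "y + t1 *\<^sub>R b \<in> V" "y + t2 *\<^sub>R b \<in> V" "t1 < t2"
  shows "(P (y + t2 *\<^sub>R b) - P (y + t1 *\<^sub>R b)) * s > 0"
proof -
  have "\<exists>z. z > t1 \<and> z < t2 \<and> (P (y + t2 *\<^sub>R b) * s - P (y + t1 *\<^sub>R b) * s) = (t2 - t1) * (pd P b (y + z *\<^sub>R b) * s)
      \<and> y + z *\<^sub>R b \<in> V"
  proof -
    have inV: "y + t *\<^sub>R b \<in> V" if "t1 \<le> t" "t \<le> t2" for t
    proof -
      define u where "u = (t - t1) / (t2 - t1)"
      have u: "0 \<le> u" "u \<le> 1" "t = (1 - u) * t1 + u * t2"
      proof -
        have "u * (t2 - t1) = t - t1" using assms(6) by (simp add: u_def)
        then show "t = (1 - u) * t1 + u * t2" by (simp add: algebra_simps)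
      qed (use that assms(6) in \<open>auto simp: u_def\<close>)
      have "(1 - u) *\<^sub>R (y + t1 *\<^sub>R b) + u *\<^sub>R (y + t2 *\<^sub>R b) \<in> V"
        using V(1) assms(4,5) u by (auto simp: convex_alt)
      also have "(1 - u) *\<^sub>R (y + t1 *\<^sub>R b) + u *\<^sub>R (y + t2 *\<^sub>R b) = y + t *\<^sub>R b"
        by (simp add: u(3) algebra_simps)
      finally show ?thesis .
    qed
    have d: "((\<lambda>t. P (y + t *\<^sub>R b) * s) has_real_derivative (pd P b (y + t *\<^sub>R b) * s)) (at t)"
      if t: "t1 \<le> t" "t \<le> t2" for t
    proof -
      have D: "(P has_derivative frechet_derivative P (at (y + t *\<^sub>R b))) (at (y + t *\<^sub>R b))"
        using C1_on_has_derivative[OF C1P] inV[OF t] V(2) by blast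
      have "((\<lambda>t. y + t *\<^sub>R b) has_vector_derivative b) (at t)"
        by (auto intro!: derivative_eq_intros)
      from vector_derivative_diff_chain_within[OF this has_derivative_at_withinI[OF D]]
      have "((\<lambda>t. P (y + t *\<^sub>R b)) has_real_derivative pd P b (y + t *\<^sub>R b)) (at t)"
        by (simp add: o_def has_real_derivative_iff_has_vector_derivative)
      then show ?thesis by (intro DERIV_cmult_right)
    qed
    from MVT2[OF assms(6), of "\<lambda>t. P (y + t *\<^sub>R b) * s" "\<lambda>t. pd P b (y + t *\<^sub>R b) * s"] d
    obtain z where "z > t1" "z < t2" "P (y + t2 *\<^sub>R b) * s - P (y + t1 *\<^sub>R b) * s = (t2 - t1) * (pd P b (y + z *\<^sub>R b) * s)"
      by blast
    then show ?thesis using inV[of z] by auto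
  qed
  then obtain z where "(P (y + t2 *\<^sub>R b) * s - P (y + t1 *\<^sub>R b) * s) = (t2 - t1) * (pd P b (y + z *\<^sub>R b) * s)"
      "y + z *\<^sub>R b \<in> V" by blast
  moreover have "(t2 - t1) * (pd P b (y + z *\<^sub>R b) * s) > 0"
    using V(3)[OF \<open>y + z *\<^sub>R b \<in> V\<close>] assms(6) by simp
  ultimately show ?thesis by (simp add: left_diff_distrib)
qed

text \<open>For the field e_b / \<partial>_b P the divergence is a single partial derivative, which
  can be integrated along lines in direction b. Uniqueness of the continuous density allows this
  change of field.\<close>

lemma dens_local:
  assumes b: "b \<in> Basis" and V: "open V" "V \<subseteq> G" "\<And>y. y \<in> V \<Longrightarrow> pd P b y \<noteq> 0" and f: "f \<in> Cc1 V"
  shows "dens f x = (LINT y|lborel. indicator {y \<in> V. P y < x} y * pd (\<lambda>z. f z / pd P b z) b y)"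
proof -
  define X where "X c y = (if c = b then 1 / pd P b y else 0)" for c y
  interpret loc: transversal_field P V X
  proof
    show "C1_on V P" by (rule C1_on_subset[OF C1P V(1,2)])
    show "C1_on V (X c)" if "c \<in> Basis" for c
      unfolding X_def using V C1_on_subset[OF C2P[OF b] V(1,2)]
      by (cases "c = b") (auto intro!: C1_on_divide[of V "\<lambda>_. 1", simplified])
    show "(\<Sum>c\<in>Basis. X c y * pd P c y) = 1" if "y \<in> V" for y
      using V(3)[OF that] b by (simp add: X_def if_distrib[of "\<lambda>t. t * _"] sum.delta cong: if_cong)
  qed
  have "loc.Dv f y = pd (\<lambda>z. f z / pd P b z) b y" for y
  proof -
    have "loc.Dv f y = (\<Sum>c\<in>Basis. if c = b then pd (\<lambda>z. f z / pd P b z) b y else 0)"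
      unfolding loc.Dv_def
    proof (rule sum.cong[OF refl])
      fix c :: 'a
      show "pd (\<lambda>z. f z * X c z) c y = (if c = b then pd (\<lambda>z. f z / pd P b z) b y else 0)"
        by (cases "c = b") (auto simp: X_def)
    qed
    then show ?thesis using b by simp
  qed
  moreover have "dens f x = loc.dens f x"
    using is_dens_unique[OF is_dens_dens[OF Cc1_mono[OF f V(2)]] loc.is_dens_dens[OF f]] .
  ultimately show ?thesis by (simp add: loc.dens_def)
qed

context
  fixes b U \<psi> x
  assumes b: "b \<in> Basis" and \<psi>: "C1_on U \<psi>" and patch: "graph_patch b U \<psi> \<subseteq> level_set G P x"
begin

lemma patch_point: "y \<in> U \<Longrightarrow> y \<bullet> b = 0 \<Longrightarrow> y + \<psi> y *\<^sub>R b \<in> G \<and> P (y + \<psi> y *\<^sub>R b) = x"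
  using patch by (auto simp: graph_patch_def level_set_def)

text \<open>P is constant along t -> y + t c + \<psi>(y + t c) b, and c \<noteq> b keeps the base
  point of this curve in the hyperplane, where the patch is known to lie in the level set.\<close>

lemma patch_derivative:
  assumes y: "y \<in> U" "y \<bullet> b = 0" and c: "c \<in> Basis - {b}"
  shows "pd P c (y + \<psi> y *\<^sub>R b) + pd P b (y + \<psi> y *\<^sub>R b) * pd \<psi> c y = 0"
proof -
  let ?p = "y + \<psi> y *\<^sub>R b"
  let ?\<gamma> = "\<lambda>t. (y + t *\<^sub>R c) + \<psi> (y + t *\<^sub>R c) *\<^sub>R b"
  have DP: "(P has_derivative frechet_derivative P (at ?p)) (at ?p)"
    using C1_on_has_derivative[OF C1P] patch_point[OF y] by blast
  have l: "((\<lambda>t. y + t *\<^sub>R c) has_vector_derivative c) (at 0)"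
    by (auto intro!: derivative_eq_intros)
  have "(\<psi> has_derivative frechet_derivative \<psi> (at (y + 0 *\<^sub>R c))) (at (y + 0 *\<^sub>R c))"
    using C1_on_has_derivative[OF \<psi>] y by simp
  from vector_derivative_diff_chain_within[OF l has_derivative_at_withinI[OF this]]
  have d\<psi>: "((\<lambda>t. \<psi> (y + t *\<^sub>R c)) has_real_derivative pd \<psi> c y) (at 0)"
    by (simp add: o_def has_real_derivative_iff_has_vector_derivative)
  then have "(?\<gamma> has_vector_derivative c + pd \<psi> c y *\<^sub>R b) (at 0)"
    by (intro has_vector_derivative_add l) (auto intro!: derivative_eq_intros)
  from vector_derivative_diff_chain_within[OF this, of P "frechet_derivative P (at ?p)" ] DP
  have A: "((\<lambda>t. P (?\<gamma> t)) has_vector_derivative frechet_derivative P (at ?p) (c + pd \<psi> c y *\<^sub>R b)) (at 0)"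
    by (simp add: o_def has_derivative_at_withinI)
  have B: "((\<lambda>t. P (?\<gamma> t)) has_vector_derivative 0) (at 0)"
  proof (rule has_vector_derivative_transform_within_open)
    show "((\<lambda>t. x) has_vector_derivative 0) (at 0)" by simp
    show "open ((\<lambda>t. y + t *\<^sub>R c) -` U)"
      by (intro continuous_open_vimage C1_on_open[OF \<psi>] continuous_intros)
    show "0 \<in> (\<lambda>t. y + t *\<^sub>R c) -` U" using y by simp
    fix t assume "t \<in> (\<lambda>t. y + t *\<^sub>R c) -` U"
    then show "x = P (?\<gamma> t)"
      using patch_point[of "y + t *\<^sub>R c"] y c b by (auto simp: inner_add_left inner_Basis)
  qed
  have "frechet_derivative P (at ?p) (c + pd \<psi> c y *\<^sub>R b) = 0"
    by (rule vector_derivative_unique_at[OF A B])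
  then show ?thesis
    using has_derivative_linear[OF DP] by (simp add: linear_add linear_scale mult.commute)
qed

lemma patch_pd_nz:
  assumes y: "y \<in> U" "y \<bullet> b = 0"
  shows "pd P b (y + \<psi> y *\<^sub>R b) \<noteq> 0"
proof
  assume 0: "pd P b (y + \<psi> y *\<^sub>R b) = 0"
  have "pd P c (y + \<psi> y *\<^sub>R b) = 0" if "c \<in> Basis" for c
    using patch_derivative[OF y, of c] 0 that by (cases "c = b") auto
  then have "grad P (y + \<psi> y *\<^sub>R b) = 0" by (simp add: grad_def)
  then show False using grad_nz patch_point[OF y] by blast
qed

text \<open>Inserting \<partial>_c \<psi> = - \<partial>_c P / \<partial>_b P gives 1 +
  |\<nabla>\<psi>|^2 = |\<nabla>P|^2 / (\<partial>_b P)^2. So d\<sigma> / |\<nabla>P| becomes dy /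
  |\<partial>_b P| in the coordinates of the patch.\<close>

lemma patch_area_eq:
  assumes y: "y \<in> U" "y \<bullet> b = 0"
  shows "patch_area b \<psi> y = norm (grad P (y + \<psi> y *\<^sub>R b)) / \<bar>pd P b (y + \<psi> y *\<^sub>R b)\<bar>"
proof -
  let ?p = "y + \<psi> y *\<^sub>R b"
  note nz = patch_pd_nz[OF y]
  have "(pd \<psi> c y)\<^sup>2 = (pd P c ?p)\<^sup>2 / (pd P b ?p)\<^sup>2" if "c \<in> Basis - {b}" for c
  proof -
    have "pd \<psi> c y = - pd P c ?p / pd P b ?p"
      using patch_derivative[OF y that] nz by (simp add: field_simps eq_neg_iff_add_eq_0)
    then show ?thesis by (simp add: power_divide)
  qed
  then have "1 + (\<Sum>c\<in>Basis - {b}. (pd \<psi> c y)\<^sup>2) = (pd P b ?p)\<^sup>2 / (pd P b ?p)\<^sup>2 + (\<Sum>c\<in>Basis - {b}. (pd P c ?p)\<^sup>2 / (pd P b ?p)\<^sup>2)"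
    using nz by simp
  also have "\<dots> = (\<Sum>c\<in>Basis. (pd P c ?p)\<^sup>2 / (pd P b ?p)\<^sup>2)"
    using b by (simp add: sum.remove[of Basis b])
  also have "\<dots> = (\<Sum>c\<in>Basis. (pd P c ?p)\<^sup>2) / (pd P b ?p)\<^sup>2" by (simp add: sum_divide_distrib)
  finally show ?thesis by (simp add: patch_area_def norm_grad real_sqrt_divide)
qed

text \<open>On every line in direction b that meets W, P is strictly monotone near the graph, so {P
  < x} is a half line ending at \<psi>. The fundamental theorem of calculus then evaluates the
  formula of \<open>dens_local\<close> at the point of the graph.\<close>

lemma patch_neighbourhood:
  assumes p: "p \<in> graph_patch b U \<psi>"
  obtains W where "open W" "p \<in> W" "W \<subseteq> G" "W \<inter> level_set G P x \<subseteq> graph_patch b U \<psi>"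
    "\<And>f. f \<in> Cc1 W \<Longrightarrow> has_bochner_integral (hyperplane_lborel b)
        (\<lambda>y. indicator U y * (f (y + \<psi> y *\<^sub>R b) / \<bar>pd P b (y + \<psi> y *\<^sub>R b)\<bar>)) (dens f x)"
proof -
  obtain y0 where y0: "y0 \<in> U" "y0 \<bullet> b = 0" "p = y0 + \<psi> y0 *\<^sub>R b" using p by (auto simp: graph_patch_def)
  have pG: "p \<in> G" using patch_point[OF y0(1,2)] y0(3) by simp
  have pnz: "pd P b p \<noteq> 0" using patch_pd_nz[OF y0(1,2)] y0(3) by simp
  define s where "s = sgn (pd P b p)"
  have s: "s = 1 \<or> s = -1" using pnz by (auto simp: s_def sgn_if)
  obtain r where r: "r > 0" "ball p r \<subseteq> G" "\<And>y. y \<in> ball p r \<Longrightarrow> pd P b y * s > 0"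
    using pd_P_neighbourhood[OF pG b pnz] unfolding s_def by metis
  define V where "V = ball p r"
  define lift where "lift y = proj b y + \<psi> (proj b y) *\<^sub>R b" for y
  have oU: "open U" using \<psi> by (rule C1_on_open)
  define U' where "U' = (\<lambda>y. proj b y) -` U"
  have oU': "open U'" unfolding U'_def by (intro continuous_open_vimage oU continuous_intros)
  have cl: "continuous_on U' lift"
    unfolding lift_def U'_def
    by (intro continuous_intros continuous_on_compose2[OF C1_on_continuous[OF \<psi>]]) auto
  \<comment> \<open>A point of W and the graph point over its projection both lie in the convex set
    V, hence so does the segment between them.\<close>
  define W where "W = V \<inter> (U' \<inter> lift -` V)"
  have pr: "proj b p = y0" using y0 b by (simp add: proj_line)
  have "open (U' \<inter> lift -` V)"
    by (rule continuous_open_preimage[OF cl oU']) (simp add: V_def)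
  then have W: "open W" "p \<in> W" "W \<subseteq> V"
    unfolding W_def using r(1) pr y0 by (auto simp: V_def U'_def lift_def)
  have V: "convex V" "V \<subseteq> G" "open V" "\<And>z. z \<in> V \<Longrightarrow> pd P b z * s > 0" using r by (auto simp: V_def)
  have Vnz: "pd P b z \<noteq> 0" if "z \<in> V" for z using V(4)[OF that] by auto
  have WG: "W \<subseteq> G" using W V by auto
  have Wl: "proj b z \<in> U" "proj b z + \<psi> (proj b z) *\<^sub>R b \<in> V" "P (proj b z + \<psi> (proj b z) *\<^sub>R b) = x" if "z \<in> W" for z
    using that patch_point[of "proj b z"] proj_inner[OF b] by (auto simp: W_def U'_def lift_def)
  have cmp: "P (y + t *\<^sub>R b) < x \<longleftrightarrow> (if s = 1 then t < \<psi> y else \<psi> y < t)"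
    if "y \<bullet> b = 0" "y + t *\<^sub>R b \<in> W" for y t
  proof -
    have l: "y + \<psi> y *\<^sub>R b \<in> V" "P (y + \<psi> y *\<^sub>R b) = x" using Wl[OF that(2)] proj_line[OF b that(1)] by auto
    have t: "y + t *\<^sub>R b \<in> V" using that(2) W(3) by auto
    show ?thesis
      using P_strict_on_line[OF V(1,2,4) l(1) t] P_strict_on_line[OF V(1,2,4) t l(1)] l(2) s
      by (cases t "\<psi> y" rule: linorder_cases) auto
  qed
  have sub: "W \<inter> level_set G P x \<subseteq> graph_patch b U \<psi>"
  proof
    fix z assume z: "z \<in> W \<inter> level_set G P x"
    define y where "y = proj b z"
    have y: "y \<bullet> b = 0" "z = y + (z \<bullet> b) *\<^sub>R b" using proj_inner[OF b] proj_decomp[of z b] by (auto simp: y_def)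
    have l: "y + \<psi> y *\<^sub>R b \<in> V" "P (y + \<psi> y *\<^sub>R b) = x" "y \<in> U" using Wl z by (auto simp: y_def)
    have zV: "y + (z \<bullet> b) *\<^sub>R b \<in> V" "P (y + (z \<bullet> b) *\<^sub>R b) = x" using z W(3) y(2) by (auto simp: level_set_def)
    have "z \<bullet> b = \<psi> y"
      using P_strict_on_line[OF V(1,2,4) l(1) zV(1)] P_strict_on_line[OF V(1,2,4) zV(1) l(1)] l(2) zV(2)
      by (cases "z \<bullet> b" "\<psi> y" rule: linorder_cases) auto
    then show "z \<in> graph_patch b U \<psi>" using y l(3) unfolding graph_patch_def by force
  qed
  have "has_bochner_integral (hyperplane_lborel b)
        (\<lambda>y. indicator U y * (f (y + \<psi> y *\<^sub>R b) / \<bar>pd P b (y + \<psi> y *\<^sub>R b)\<bar>)) (dens f x)" if f: "f \<in> Cc1 W" for f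
  proof -
    define q where "q z = f z / pd P b z" for z
    have WV: "W \<subseteq> G" "\<And>y. y \<in> W \<Longrightarrow> pd P b y \<noteq> 0" using WG Vnz W(3) by auto
    have "C1_on W (\<lambda>z. inverse (pd P b z))"
      using C1_on_subset[OF C2P[OF b] W(1) WG] WV by (intro C1_on_inverse) auto
    then have q: "q \<in> Cc1 W" unfolding q_def divide_inverse by (rule Cc1_mult[OF f])
    have qU: "q \<in> Cc1 UNIV" by (rule Cc1_mono[OF q]) simp
    have qs: "support q \<subseteq> W" using q by (auto simp: Cc1_def)
    let ?k = "\<lambda>y. indicator {y \<in> W. P y < x} y * pd q b y"
    have mW: "{y \<in> W. P y < x} \<in> sets borel"
      using continuous_open_preimage[OF C1_on_continuous[OF C1_on_subset[OF C1P W(1) WG]] W(1), of "{..<x}"]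
      by (auto simp: vimage_def Int_def conj_commute intro!: borel_open)
    have ik: "integrable lborel ?k"
      using integrable_mult_indicator[OF _ Cc1_pd_integrable[OF q b], of "{y \<in> W. P y < x}"] mW by simp
    have dk: "dens f x = (LINT y|lborel. ?k y)"
      unfolding q_def by (rule dens_local[OF b W(1) WV f])
    have line: "(LINT t|lborel. ?k (y + t *\<^sub>R b)) = indicator U y * (f (y + \<psi> y *\<^sub>R b) / \<bar>pd P b (y + \<psi> y *\<^sub>R b)\<bar>)"
      if y: "y \<bullet> b = 0" for y
    proof (cases "\<exists>t. y + t *\<^sub>R b \<in> W")
      case True
      then obtain t0 where t0: "y + t0 *\<^sub>R b \<in> W" by blast
      have l: "y + \<psi> y *\<^sub>R b \<in> V" "y \<in> U" using Wl[OF t0] proj_line[OF b y] by auto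
      have "?k (y + t *\<^sub>R b) = (if s = 1 then indicator {..<\<psi> y} t else indicator {\<psi> y<..} t) * pd q b (y + t *\<^sub>R b)" for t
        using cmp[OF y, of t] pd_outside_support(2)[of "y + t *\<^sub>R b" q b] qs
        by (cases "y + t *\<^sub>R b \<in> W") (auto simp: indicator_def)
      then have "(LINT t|lborel. ?k (y + t *\<^sub>R b))
         = (LINT t|lborel. (if s = 1 then indicator {..<\<psi> y} t else indicator {\<psi> y<..} t) * pd q b (y + t *\<^sub>R b))"
        by (intro Bochner_Integration.integral_cong refl)
      \<comment> \<open>The half line lies below the graph if P increases along b and above it
        otherwise; the resulting sign turns \<partial>_b P in the denominator of q into its absolute
        value.\<close>
      also have "\<dots> = (if s = 1 then q (y + \<psi> y *\<^sub>R b) else - q (y + \<psi> y *\<^sub>R b))"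
        using line_integral_below[OF qU b, of "\<psi> y" y] line_integral_above[OF qU b, of "\<psi> y" y] by auto
      also have "\<dots> = f (y + \<psi> y *\<^sub>R b) / \<bar>pd P b (y + \<psi> y *\<^sub>R b)\<bar>"
        using V(4)[OF l(1)] s by (auto simp: q_def abs_if)
      finally show ?thesis using l(2) by simp
    next
      case False
      then have "?k (y + t *\<^sub>R b) = 0" for t by (auto simp: indicator_def)
      then have "(LINT t|lborel. ?k (y + t *\<^sub>R b)) = 0" by (simp only: Bochner_Integration.integral_zero)
      moreover have "f (y + \<psi> y *\<^sub>R b) = 0" using False Cc1_zero_outside[OF f] by blast
      ultimately show ?thesis by simp
    qed
    have "has_bochner_integral (hyperplane_lborel b) (\<lambda>y. LINT t|lborel. ?k (y + t *\<^sub>R b)) (dens f x)"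
      unfolding dk integral_lines[OF b ik] by (intro has_bochner_integral_integrable integrable_lines[OF b ik])
    then show ?thesis
    proof (rule has_bochner_integralI_AE)
      show "(\<lambda>y. indicator U y * (f (y + \<psi> y *\<^sub>R b) / \<bar>pd P b (y + \<psi> y *\<^sub>R b)\<bar>)) \<in> borel_measurable (hyperplane_lborel b)"
      proof -
        \<comment> \<open>The quotient is continuous on W only. U1 collects the parameters whose
          graph points lie in W; at the others f vanishes.\<close>
        define U1 where "U1 = U \<inter> (\<lambda>y. y + \<psi> y *\<^sub>R b) -` W"
        have cm: "continuous_on U (\<lambda>y. y + \<psi> y *\<^sub>R b)"
          by (intro continuous_intros C1_on_continuous[OF \<psi>])
        have oU1: "open U1" unfolding U1_def by (intro continuous_open_preimage cm oU W(1))
        have cq: "continuous_on W (\<lambda>z. f z / \<bar>pd P b z\<bar>)"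
          using f WV C1_on_pd_continuous[OF C1_on_subset[OF C1P W(1) WG] b]
          by (intro continuous_intros) (auto simp: Cc1_def intro: continuous_on_subset[OF C1_on_continuous])
        have "(\<lambda>y. indicator U1 y *\<^sub>R (f (y + \<psi> y *\<^sub>R b) / \<bar>pd P b (y + \<psi> y *\<^sub>R b)\<bar>)) \<in> borel_measurable borel"
          using oU1 by (intro borel_measurable_continuous_on_indicator continuous_on_compose2[OF cq continuous_on_subset[OF cm]])
            (auto simp: U1_def)
        also have "(\<lambda>y. indicator U1 y *\<^sub>R (f (y + \<psi> y *\<^sub>R b) / \<bar>pd P b (y + \<psi> y *\<^sub>R b)\<bar>))
            = (\<lambda>y. indicator U y * (f (y + \<psi> y *\<^sub>R b) / \<bar>pd P b (y + \<psi> y *\<^sub>R b)\<bar>))"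
        proof
          fix y
          show "indicator U1 y *\<^sub>R (f (y + \<psi> y *\<^sub>R b) / \<bar>pd P b (y + \<psi> y *\<^sub>R b)\<bar>)
            = indicator U y * (f (y + \<psi> y *\<^sub>R b) / \<bar>pd P b (y + \<psi> y *\<^sub>R b)\<bar>)"
            using Cc1_zero_outside[OF f, of "y + \<psi> y *\<^sub>R b"]
            by (cases "y + \<psi> y *\<^sub>R b \<in> W") (auto simp: U1_def indicator_def)
        qed
        finally show ?thesis by (simp cong: measurable_cong_sets)
      qed
      show "AE y in hyperplane_lborel b. (LINT t|lborel. ?k (y + t *\<^sub>R b)) = indicator U y * (f (y + \<psi> y *\<^sub>R b) / \<bar>pd P b (y + \<psi> y *\<^sub>R b)\<bar>)"
        using AE_hyperplane_lborel[OF b] by eventually_elim (rule line)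
    qed
  qed
  then show ?thesis using that W WG sub by blast
qed

end

text \<open>The implicit function theorem, obtained by straightening: a map that replaces the
  coordinate along b by the value of P is inverted, and \<psi> is read off from the inverse on the
  hyperplane of height x.\<close>

lemma implicit_function_patch:
  assumes p: "p \<in> level_set G P x"
  obtains b U \<psi> where "b \<in> Basis" "C1_on U \<psi>" "graph_patch b U \<psi> \<subseteq> level_set G P x" "p \<in> graph_patch b U \<psi>"
proof -
  have pG: "p \<in> G" "P p = x" using p by (auto simp: level_set_def)
  have "\<exists>b\<in>Basis. pd P b p \<noteq> 0"
    using grad_nz[OF pG(1)] by (auto simp: grad_def intro!: sum.neutral)
  then obtain b where b: "b \<in> Basis" "pd P b p \<noteq> 0" by blast
  define s where "s = sgn (pd P b p)"
  obtain r where r: "r > 0" "ball p r \<subseteq> G" "\<And>y. y \<in> ball p r \<Longrightarrow> pd P b y * s > 0"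
    using pd_P_neighbourhood[OF pG(1) b] unfolding s_def by metis
  define V where "V = ball p r"
  have V: "convex V" "V \<subseteq> G" "open V" "\<And>z. z \<in> V \<Longrightarrow> pd P b z * s > 0" using r by (auto simp: V_def)
  have Vnz: "pd P b z \<noteq> 0" if "z \<in> V" for z using V(4)[OF that] by auto
  define \<Psi> where "\<Psi> y = y + (P y - y \<bullet> b) *\<^sub>R b" for y
  have \<Psi>: "proj b (\<Psi> y) = proj b y" "\<Psi> y \<bullet> b = P y" for y
    using b(1) by (auto simp: \<Psi>_def proj_def inner_add_left algebra_simps)
  have inj: "inj_on \<Psi> V"
  proof (rule inj_onI)
    fix y z assume yz: "y \<in> V" "z \<in> V" "\<Psi> y = \<Psi> z"
    define y' where "y' = proj b y"
    have e: "y = y' + (y \<bullet> b) *\<^sub>R b" "z = y' + (z \<bullet> b) *\<^sub>R b" "P y = P z"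
      using \<Psi>[of y] \<Psi>[of z] yz(3) proj_decomp[of y b] proj_decomp[of z b] by (auto simp: y'_def)
    have "y \<bullet> b = z \<bullet> b"
      using P_strict_on_line[OF V(1,2,4), of y' "y \<bullet> b" "z \<bullet> b"] P_strict_on_line[OF V(1,2,4), of y' "z \<bullet> b" "y \<bullet> b"]
        yz e by (cases "y \<bullet> b" "z \<bullet> b" rule: linorder_cases) auto
    then show "y = z" using e by metis
  qed
  have cP: "continuous_on V P" using C1_on_continuous[OF C1P] V(2) continuous_on_subset by blast
  have c\<Psi>: "continuous_on V \<Psi>" unfolding \<Psi>_def by (intro continuous_intros cP)
  \<comment> \<open>Strict monotonicity of P along b gives injectivity; invariance of domain then
    provides an open image and a continuous inverse before differentiability of the inverse is
    known.\<close>
  obtain g where "homeomorphism V (\<Psi> ` V) \<Psi> g"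
    using invariance_of_domain_homeomorphism[OF V(3) c\<Psi> _ inj] by auto
  then have g: "continuous_on (\<Psi> ` V) g" "\<And>w. w \<in> \<Psi> ` V \<Longrightarrow> g w \<in> V" "\<And>w. w \<in> \<Psi> ` V \<Longrightarrow> \<Psi> (g w) = w"
    "\<And>y. y \<in> V \<Longrightarrow> g (\<Psi> y) = y"
    by (auto simp: homeomorphism_def)
  have o\<Psi>: "open (\<Psi> ` V)" by (rule invariance_of_domain[OF c\<Psi> V(3) inj])
  define e where "e y = proj b y + x *\<^sub>R b" for y
  define U where "U = e -` \<Psi> ` V"
  define \<psi> where "\<psi> y = g (e y) \<bullet> b" for y
  have ce: "continuous_on S e" for S unfolding e_def by (intro continuous_intros)
  have oU: "open U" unfolding U_def by (rule open_vimage[OF o\<Psi> ce])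
  have de: "(e has_derivative proj b) (at y)" for y
    unfolding e_def using bounded_linear_imp_has_derivative[OF proj_linear] by (auto intro!: derivative_eq_intros)
  have ge: "g (e y) \<in> V" "\<Psi> (g (e y)) = e y" if "y \<in> U" for y using that g by (auto simp: U_def)
  have D\<psi>: "(\<psi> has_derivative (\<lambda>v. - frechet_derivative P (at (g (e y))) (proj b v) / pd P b (g (e y)))) (at y)" if y: "y \<in> U" for y
  proof -
    define q where "q = g (e y)"
    define P' where "P' = frechet_derivative P (at q)"
    have qV: "q \<in> V" using ge[OF y] by (simp add: q_def)
    have DP: "(P has_derivative P') (at q)" unfolding P'_def using C1_on_has_derivative[OF C1P] qV V(2) by blast
    then have linP: "linear P'" "bounded_linear P'" by (auto simp: has_derivative_linear has_derivative_bounded_linear)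
    have nz: "P' b \<noteq> 0" using Vnz[OF qV] by (simp add: P'_def)
    have D\<Psi>: "(\<Psi> has_derivative (\<lambda>v. v + (P' v - v \<bullet> b) *\<^sub>R b)) (at q)"
      unfolding \<Psi>_def using DP by (auto intro!: derivative_eq_intros)
    \<comment> \<open>The inverse of the differential of \<Psi>: the component along b is recovered
      from the increment of P, after the contribution of the other components has been
      subtracted.\<close>
    define g' where "g' u = proj b u + ((u \<bullet> b - P' (proj b u)) / P' b) *\<^sub>R b" for u
    have "(g has_derivative g') (at (e y))"
    proof (rule has_derivative_inverse_basic[where T = "\<Psi> ` V"])
      show "(\<Psi> has_derivative (\<lambda>v. v + (P' v - v \<bullet> b) *\<^sub>R b)) (at (g (e y)))" using D\<Psi> by (simp add: q_def)
      show "bounded_linear g'"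
      proof -
        have "bounded_linear (\<lambda>u. u \<bullet> b - P' (proj b u))"
          by (intro bounded_linear_sub bounded_linear_inner_left bounded_linear_compose[OF linP(2) proj_linear])
        from bounded_linear_compose[OF bounded_linear_divide this]
        show ?thesis unfolding g'_def by (intro bounded_linear_add proj_linear bounded_linear_scaleR_const)
      qed
      show "g' \<circ> (\<lambda>v. v + (P' v - v \<bullet> b) *\<^sub>R b) = id"
      proof
        fix v
        have 1: "proj b (v + (P' v - v \<bullet> b) *\<^sub>R b) = proj b v" "(v + (P' v - v \<bullet> b) *\<^sub>R b) \<bullet> b = P' v"
          using b(1) by (auto simp: proj_def inner_add_left algebra_simps)
        have "P' v = P' (proj b v + (v \<bullet> b) *\<^sub>R b)" using proj_decomp[of v b] by simp
        also have "\<dots> = P' (proj b v) + (v \<bullet> b) * P' b" using linP(1) by (simp add: linear_add linear_scale)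
        finally have "(P' v - P' (proj b v)) / P' b = v \<bullet> b" using nz by simp
        then show "(g' \<circ> (\<lambda>v. v + (P' v - v \<bullet> b) *\<^sub>R b)) v = id v"
          using proj_decomp[of v b] by (simp add: g'_def 1)
      qed
      show "continuous (at (e y)) g" using g(1) o\<Psi> y by (auto simp: U_def continuous_on_eq_continuous_at)
    qed (use o\<Psi> y g in \<open>auto simp: U_def\<close>)
    from has_derivative_compose[OF de this]
    have "((\<lambda>y. g (e y) \<bullet> b) has_derivative (\<lambda>v. g' (proj b v) \<bullet> b)) (at y)"
      by (auto intro!: derivative_eq_intros)
    moreover have "g' (proj b v) \<bullet> b = - P' (proj b v) / P' b" for v
      using b(1) by (simp add: g'_def inner_add_left inner_diff_left proj_inner proj_eq)
    ultimately show ?thesis by (simp add: \<psi>_def[abs_def] P'_def q_def)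
  qed
  have "C1_on U \<psi>"
  proof (rule C1_onI[OF oU D\<psi>])
    fix c :: 'a assume c: "c \<in> Basis"
    have cg: "continuous_on U (\<lambda>y. g (e y))" by (intro continuous_on_compose2[OF g(1) ce]) (auto simp: U_def)
    have cp: "continuous_on U (\<lambda>y. pd P a (g (e y)))" if "a \<in> Basis" for a
      using V(2) ge(1) by (intro continuous_on_compose2[OF C1_on_pd_continuous[OF C1P that] cg]) auto
    have "frechet_derivative P (at (g (e y))) (proj b c) = (if c = b then 0 else pd P c (g (e y)))" if "y \<in> U" for y
    proof -
      have "proj b c = (if c = b then 0 else c)" using b(1) c by (auto simp: proj_def inner_Basis)
      moreover have "linear (frechet_derivative P (at (g (e y))))"
        using C1_on_has_derivative[OF C1P] ge(1)[OF that] V(2) has_derivative_linear by blast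
      ultimately show ?thesis by (simp add: linear_0)
    qed
    moreover have "continuous_on U (\<lambda>y. - (if c = b then 0 else pd P c (g (e y))) / pd P b (g (e y)))"
    proof (intro continuous_on_divide continuous_on_minus cp b)
      show "continuous_on U (\<lambda>y. if c = b then 0 else pd P c (g (e y)))"
        using cp[OF c] by (cases "c = b") auto
    qed (use ge(1) Vnz in auto)
    ultimately show "continuous_on U (\<lambda>y. - frechet_derivative P (at (g (e y))) (proj b c) / pd P b (g (e y)))"
      by (simp cong: continuous_on_cong)
  qed
  moreover have pt: "y + \<psi> y *\<^sub>R b = g (e y) \<and> P (g (e y)) = x" if y: "y \<in> U" "y \<bullet> b = 0" for y
  proof -
    have "proj b (g (e y)) = proj b (e y)" "P (g (e y)) = e y \<bullet> b" using \<Psi>[of "g (e y)"] ge(2)[OF y(1)] by auto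
    moreover have "proj b (e y) = y" "e y \<bullet> b = x"
      using y b(1) by (auto simp: e_def proj_eq proj_line inner_add_left)
    ultimately show ?thesis using proj_decomp[of "g (e y)" b] by (simp add: \<psi>_def)
  qed
  moreover have "graph_patch b U \<psi> \<subseteq> level_set G P x"
    using pt ge(1) V(2) by (fastforce simp: graph_patch_def level_set_def)
  moreover have "p \<in> graph_patch b U \<psi>"
  proof -
    have pV: "p \<in> V" using r(1) by (simp add: V_def)
    have "e (proj b p) = \<Psi> p"
      using proj_decomp[of "\<Psi> p" b] \<Psi>[of p] pG proj_inner[OF b(1), of p] by (simp add: e_def proj_eq)
    then have "proj b p \<in> U" "g (e (proj b p)) = p" using pV g(4) by (auto simp: U_def)
    then show ?thesis
      using pt[of "proj b p"] proj_inner[OF b(1), of p] unfolding graph_patch_def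
      by (intro image_eqI[of _ _ "proj b p"]) auto
  qed
  ultimately show ?thesis using that[OF b(1)] by blast
qed

end

subsection \<open>Gluing the patch measures\<close>

text \<open>Lindelof's theorem leaves countably many neighbourhoods; made disjoint, they cut A into
  pieces on which the measures agree, and countable additivity reassembles them.\<close>

lemma measure_eq_locally:
  fixes \<mu> \<nu> :: "'a::euclidean_space measure"
  assumes \<mu>: "sets \<mu> = sets borel" and \<nu>: "sets \<nu> = sets borel" and A: "A \<in> sets borel"
    and loc: "\<And>y. y \<in> A \<Longrightarrow> \<exists>V. open V \<and> y \<in> V \<and> (\<forall>B\<in>sets borel. B \<subseteq> A \<inter> V \<longrightarrow> emeasure \<mu> B = emeasure \<nu> B)"
  shows "emeasure \<mu> A = emeasure \<nu> A"
proof (cases "A = {}")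
  case False
  define \<F> where "\<F> = {V. open V \<and> (\<forall>B\<in>sets borel. B \<subseteq> A \<inter> V \<longrightarrow> emeasure \<mu> B = emeasure \<nu> B)}"
  obtain \<F>' where F': "\<F>' \<subseteq> \<F>" "countable \<F>'" "\<Union>\<F>' = \<Union>\<F>"
    using Lindelof[of \<F>] by (auto simp: \<F>_def)
  have cov: "A \<subseteq> \<Union>\<F>'" unfolding F'(3) using loc unfolding \<F>_def by blast
  then have ne: "\<F>' \<noteq> {}" using False by auto
  define V where "V = from_nat_into \<F>'"
  have V: "V n \<in> \<F>" "(\<Union>n. V n) = \<Union>\<F>'" for n
    using subsetD[OF F'(1) from_nat_into[OF ne]] range_from_nat_into[OF ne F'(2)] by (simp_all add: V_def)
  have mV: "V n \<in> sets borel" for n using V(1)[of n] by (auto simp: \<F>_def)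
  define D where "D n = A \<inter> disjointed V n" for n
  have D: "range D \<subseteq> sets borel" unfolding D_def using A mV sets.range_disjointed_sets[of V borel] by auto
  have Dd: "disjoint_family D" using disjoint_family_disjointed[of V] by (auto simp: D_def disjoint_family_on_def)
  have DU: "(\<Union>n. D n) = A" using UN_disjointed_eq[of V] V(2) cov by (auto simp: D_def)
  have "emeasure \<mu> (D n) = emeasure \<nu> (D n)" for n
    using V(1)[of n] D disjointed_subset[of V n] by (auto simp: \<F>_def D_def)
  then have "(\<Sum>n. emeasure \<mu> (D n)) = (\<Sum>n. emeasure \<nu> (D n))" by simp
  then show ?thesis
    using suminf_emeasure[of D \<mu>] suminf_emeasure[of D \<nu>] D Dd DU \<mu> \<nu> by simp
qed simp

text \<open>A countable subcover is made disjoint and on each piece its own measure is used;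
  agreement on overlaps makes the result independent of this choice. The last clause also handles
  sets that reach outside G, where the glued measure has no mass.\<close>

lemma glue_measures:
  fixes \<F> :: "('a::euclidean_space set \<times> 'a measure) set"
  assumes op: "\<And>W \<sigma>. (W, \<sigma>) \<in> \<F> \<Longrightarrow> open W \<and> W \<subseteq> G \<and> sets \<sigma> = sets borel"
    and agree: "\<And>W \<sigma> W' \<sigma>' A. (W, \<sigma>) \<in> \<F> \<Longrightarrow> (W', \<sigma>') \<in> \<F> \<Longrightarrow> A \<in> sets borel \<Longrightarrow> A \<subseteq> W \<inter> W' \<Longrightarrow> emeasure \<sigma> A = emeasure \<sigma>' A"
    and cover: "\<And>p. p \<in> G \<Longrightarrow> \<exists>W \<sigma>. (W, \<sigma>) \<in> \<F> \<and> p \<in> W"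
    and ne: "\<F> \<noteq> {}"
  shows "\<exists>\<mu>. sets \<mu> = sets borel \<and>
    (\<forall>W \<sigma> A. (W, \<sigma>) \<in> \<F> \<longrightarrow> A \<in> sets borel \<longrightarrow> A \<subseteq> W \<longrightarrow> emeasure \<mu> A = emeasure \<sigma> A) \<and>
    (\<forall>Z\<in>sets borel. (\<forall>W \<sigma>. (W, \<sigma>) \<in> \<F> \<longrightarrow> emeasure \<sigma> Z = 0) \<longrightarrow> emeasure \<mu> Z = 0)"
proof -
  have "open X" if "X \<in> fst ` \<F>" for X using that op by force
  then obtain \<W> where W: "\<W> \<subseteq> fst ` \<F>" "countable \<W>" "\<Union>\<W> = \<Union>(fst ` \<F>)" by (rule Lindelof)
  obtain C where C: "C \<subseteq> \<F>" "countable C" "\<W> = fst ` C" using countable_subset_image[of \<W> fst \<F>] W by metis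
  \<comment> \<open>The countable subfamily may be empty if G is; one further member makes it
    enumerable by the natural numbers.\<close>
  define C' where "C' = insert (SOME q. q \<in> \<F>) C"
  have C': "C' \<subseteq> \<F>" "countable C'" "C' \<noteq> {}" using C ne some_in_eq[of \<F>] by (auto simp: C'_def)
  define V where "V n = fst (from_nat_into C' n)" for n
  define s where "s n = snd (from_nat_into C' n)" for n
  have Vs: "(V n, s n) \<in> \<F>" for n using from_nat_into[OF C'(3), of n] C'(1) by (auto simp: V_def s_def)
  have cov: "G \<subseteq> (\<Union>n. V n)"
  proof
    fix p assume "p \<in> G"
    then have "p \<in> \<Union>(fst ` \<F>)" using cover by force
    then have "p \<in> \<Union>(fst ` C)" using W(3) C(3) by simp
    then obtain c where "c \<in> C'" "p \<in> fst c" unfolding C'_def by blast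
    then show "p \<in> (\<Union>n. V n)"
      unfolding V_def using from_nat_into_surj[OF C'(2)] by (metis UN_I UNIV_I)
  qed
  have mV: "V n \<in> sets borel" for n using op[OF Vs[of n]] by auto
  have ss: "sets (s n) = sets borel" for n using op[OF Vs[of n]] by auto
  define D where "D = disjointed V"
  have D: "D n \<in> sets borel" for n unfolding D_def using mV sets.range_disjointed_sets[of V borel] by auto
  have Dd: "disjoint_family D" unfolding D_def by (rule disjoint_family_disjointed)
  have DV: "D n \<subseteq> V n" for n unfolding D_def by (rule disjointed_subset)
  have DU: "(\<Union>n. D n) = (\<Union>n. V n)" unfolding D_def by (rule UN_disjointed_eq)
  define m where "m A = (\<Sum>n. emeasure (s n) (A \<inter> D n))" for A
  define \<mu> where "\<mu> = measure_of UNIV (sets borel) m"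
  have s\<mu>: "sets \<mu> = sets borel"
    unfolding \<mu>_def by (metis sets_measure_of space_borel sets.space_closed sets.sigma_sets_eq)
  have e\<mu>: "emeasure \<mu> A = m A" if "A \<in> sets borel" for A
  proof (rule emeasure_measure_of[OF \<mu>_def])
    show "positive (sets \<mu>) m" by (simp add: positive_def m_def)
    show "countably_additive (sets \<mu>) m"
    proof (rule countably_additiveI)
      fix A :: "nat \<Rightarrow> 'a set" assume A: "range A \<subseteq> sets \<mu>" "disjoint_family A"
      have "(\<Sum>i. m (A i)) = (\<Sum>i. \<Sum>n. emeasure (s n) (A i \<inter> D n))" by (simp add: m_def)
      also have "\<dots> = (\<Sum>n. \<Sum>i. emeasure (s n) (A i \<inter> D n))" 
        using nn_integral_suminf[of "\<lambda>i n. emeasure (s n) (A i \<inter> D n)" "count_space UNIV"]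
        by (simp add: nn_integral_count_space_nat)
      also have "\<dots> = (\<Sum>n. emeasure (s n) (\<Union>i. A i \<inter> D n))"
      proof (intro suminf_cong suminf_emeasure)
        show "range (\<lambda>i. A i \<inter> D n) \<subseteq> sets (s n)" for n using A(1) D s\<mu> ss by auto
        show "disjoint_family (\<lambda>i. A i \<inter> D n)" for n using A(2) by (auto simp: disjoint_family_on_def)
      qed
      also have "\<dots> = m (\<Union>i. A i)" by (simp add: m_def)
      finally show "(\<Sum>i. m (A i)) = m (\<Union>i. A i)" .
    qed
  qed (use that s\<mu> in auto)
  show ?thesis
  proof (intro exI[of _ \<mu>] conjI allI ballI impI)
    show "sets \<mu> = sets borel" by (rule s\<mu>)
    show "emeasure \<mu> A = emeasure \<sigma> A" if W\<sigma>: "(W, \<sigma>) \<in> \<F>" and A: "A \<in> sets borel" "A \<subseteq> W" for W \<sigma> A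
    proof -
      have "emeasure (s n) (A \<inter> D n) = emeasure \<sigma> (A \<inter> D n)" for n
        by (rule agree[OF Vs W\<sigma>]) (use A D DV in auto)
      then have "emeasure \<mu> A = (\<Sum>n. emeasure \<sigma> (A \<inter> D n))" using e\<mu>[OF A(1)] by (simp add: m_def)
      also have "\<dots> = emeasure \<sigma> (\<Union>n. A \<inter> D n)"
      proof (rule suminf_emeasure)
        show "disjoint_family (\<lambda>n. A \<inter> D n)" using Dd unfolding disjoint_family_on_def by blast
      qed (use A D op[OF W\<sigma>] in auto)
      also have "(\<Union>n. A \<inter> D n) = A"
      proof -
        have "A \<subseteq> (\<Union>n. D n)" unfolding DU using A(2) op[OF W\<sigma>] cov by (meson order_trans)
        then show ?thesis unfolding Int_UN_distrib[symmetric] by (rule Int_absorb2)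
      qed
      finally show ?thesis .
    qed
    show "emeasure \<mu> Z = 0" if Z: "Z \<in> sets borel" "\<forall>W \<sigma>. (W, \<sigma>) \<in> \<F> \<longrightarrow> emeasure \<sigma> Z = 0" for Z
    proof -
      have "emeasure (s n) (Z \<inter> D n) = 0" for n
        by (rule emeasure_eq_0[of Z]) (use Z(2)[rule_format, OF Vs[of n]] Z(1) ss in auto)
      then show ?thesis using e\<mu>[OF Z(1)] by (simp add: m_def)
    qed
  qed
qed

lemma is_dens_add:
  assumes F: "is_dens P f F" "is_dens P f' F'"
    and i: "\<And>\<phi>. continuous_on UNIV \<phi> \<Longrightarrow> integrable lborel (\<lambda>y. \<phi> (P y) * f y)"
      "\<And>\<phi>. continuous_on UNIV \<phi> \<Longrightarrow> integrable lborel (\<lambda>y. \<phi> (P y) * f' y)"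
  shows "is_dens P (\<lambda>y. f y + f' y) (\<lambda>x. F x + F' x)"
  unfolding is_dens_def
proof (intro conjI allI impI)
  have c: "continuous_on UNIV F" "continuous_on UNIV F'" "csupp F" "csupp F'" using F by (auto simp: is_dens_def)
  then show "continuous_on UNIV (\<lambda>x. F x + F' x)" by (intro continuous_intros)
  show "csupp (\<lambda>x. F x + F' x)"
    using c(3,4) unfolding csupp_def by (metis add.right_neutral max_less_iff_conj)
  fix \<phi> :: "real \<Rightarrow> real" assume \<phi>: "continuous_on UNIV \<phi>"
  show "(LINT y|lborel. \<phi> (P y) * (f y + f' y)) = (LINT x|lborel. \<phi> x * (F x + F' x))"
    using i[OF \<phi>] is_densD[OF F(1) \<phi>] is_densD[OF F(2) \<phi>] integrable_mult_csupp[OF \<phi> c(1,3)] integrable_mult_csupp[OF \<phi> c(2,4)]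
    by (simp add: distrib_left)
qed

text \<open>Tested with the negative part of F, which is continuous: the left-hand side is
  nonnegative, the right-hand side is minus the integral of a square.\<close>

lemma is_dens_nonneg:
  assumes F: "is_dens P f F" and f: "\<And>y. f y \<ge> 0"
  shows "F x \<ge> 0"
proof -
  define \<phi> where "\<phi> x = max 0 (- F x)" for x
  have c: "continuous_on UNIV F" "csupp F" using F by (auto simp: is_dens_def)
  have c\<phi>: "continuous_on UNIV \<phi>" unfolding \<phi>_def by (intro continuous_intros c)
  have e: "\<phi> t * F t = - (\<phi> t)\<^sup>2" for t by (simp add: \<phi>_def max_def power2_eq_square)
  have i: "integrable lborel (\<lambda>t. (\<phi> t)\<^sup>2)"
    using integrable_mult_csupp[OF c\<phi> c] by (simp add: e)
  have "0 \<le> (LINT y|lborel. \<phi> (P y) * f y)"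
    using f by (intro integral_nonneg_AE AE_I2) (simp add: \<phi>_def)
  also have "\<dots> = - (LINT t|lborel. (\<phi> t)\<^sup>2)" using is_densD[OF F c\<phi>] by (simp add: e)
  finally have "(LINT t|lborel. (\<phi> t)\<^sup>2) = 0"
    using integral_nonneg_AE[of "\<lambda>t. (\<phi> t)\<^sup>2" lborel] by (simp add: antisym)
  from continuous_integral_zero[OF continuous_on_power[OF c\<phi>] _ i this, of x]
  have "\<phi> x = 0" by simp
  then show ?thesis by (simp add: \<phi>_def max_def split: if_splits)
qed

section \<open>The surface measure of a level set\<close>

context level_family
begin

lemma dens_add:
  assumes "f \<in> Cc1 G" "f' \<in> Cc1 G" shows "dens (\<lambda>y. f y + f' y) x = dens f x + dens f' x"
  using is_dens_unique[OF is_dens_dens[OF Cc1_add[OF assms]] is_dens_add[OF is_dens_dens[OF assms(1)] is_dens_dens[OF assms(2)]]]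
  by (simp add: comp_integrable assms)

lemma dens_zero: "dens (\<lambda>y. 0) x = 0"
proof -
  have "(\<lambda>y. 0) \<in> Cc1 G" using Cc1_sum[of "{}" "\<lambda>_::nat. undefined" G] by simp
  from dens_add[OF this this, of x] show ?thesis by simp
qed

lemma dens_sum:
  assumes "finite I" "\<And>i. i \<in> I \<Longrightarrow> f i \<in> Cc1 G"
  shows "dens (\<lambda>y. \<Sum>i\<in>I. f i y) x = (\<Sum>i\<in>I. dens (f i) x)"
  using assms
proof (induction I rule: finite_induct)
  case (insert i I)
  have "(\<lambda>y. \<Sum>i\<in>I. f i y) \<in> Cc1 G" using insert by (intro Cc1_sum) auto
  then show ?case using insert by (simp add: dens_add)
qed (simp add: dens_zero)

lemma dens_outside:
  assumes f: "f \<in> Cc1 G" and x: "x \<notin> P ` support f" shows "dens f x = 0"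
proof (rule is_dens_outside[of P f "dens f" "support f", OF is_dens_dens[OF f] _ _ _ x])
  show "\<And>y. y \<notin> support f \<Longrightarrow> f y = 0" by (rule not_in_support)
  show "compact (support f)" "continuous_on (support f) P"
    using f C1_on_continuous[OF C1P] by (auto simp: Cc1_def intro: continuous_on_subset)
qed

lemma level_set_measurable: "level_set G P x \<in> sets borel"
proof -
  have "level_set G P x = G \<inter> P -` {x}" by (auto simp: level_set_def)
  then have "closedin (top_of_set G) (level_set G P x)"
    using continuous_closedin_preimage[OF C1_on_continuous[OF C1P], of "{x}"] by simp
  then obtain T where "closed T" "level_set G P x = G \<inter> T" by (auto simp: closedin_closed)
  then show ?thesis using open_G by auto
qed

text \<open>The density \<open>1 / |\<nabla>P|\<close> in the definition of \<open>d\<tau>\<close> is moved into the test function.\<close>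
definition reps :: "real \<Rightarrow> ('a set \<times> 'a measure) set" where
  "reps x = {(W, \<sigma>). open W \<and> W \<subseteq> G \<and> sets \<sigma> = sets borel \<and> emeasure \<sigma> (- level_set G P x) = 0 \<and>
     (\<forall>w\<in>Cc1 W. (\<forall>y. w y \<ge> 0) \<longrightarrow> (\<integral>\<^sup>+ y. ennreal (w y) \<partial>\<sigma>) = ennreal (dens (\<lambda>y. w y * norm (grad P y)) x))}"

lemma reps_agree:
  assumes "(W, \<sigma>) \<in> reps x" "(W', \<sigma>') \<in> reps x" "A \<in> sets borel" "A \<subseteq> W \<inter> W'"
  shows "emeasure \<sigma> A = emeasure \<sigma>' A"
proof (rule measure_eq_of_bumps[of _ _ "W \<inter> W'"])
  fix w assume w: "w \<in> bumps (W \<inter> W')"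
  then have "w \<in> Cc1 W" "w \<in> Cc1 W'" using bumps_Cc1[OF w] Cc1_mono by blast+
  moreover have "w y \<ge> 0" for y using w by (auto simp: bumps_def)
  ultimately have "(\<integral>\<^sup>+ y. ennreal (w y) \<partial>\<sigma>) = ennreal (dens (\<lambda>y. w y * norm (grad P y)) x)"
     "(\<integral>\<^sup>+ y. ennreal (w y) \<partial>\<sigma>') = ennreal (dens (\<lambda>y. w y * norm (grad P y)) x)"
    using assms(1,2) by (auto simp: reps_def)
  then show "(\<integral>\<^sup>+ y. ennreal (w y) \<partial>\<sigma>) = (\<integral>\<^sup>+ y. ennreal (w y) \<partial>\<sigma>')" "(\<integral>\<^sup>+ y. ennreal (w y) \<partial>\<sigma>) < \<infinity>" by auto
qed (use assms in \<open>auto simp: reps_def\<close>)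

text \<open>Away from the level set the zero measure is a valid local piece, so the pieces cover all
  of G, as gluing demands.\<close>

lemma reps_null:
  assumes W: "open W" "W \<subseteq> G" "W \<inter> level_set G P x = {}"
  shows "(W, null_measure borel) \<in> reps x"
proof -
  have "dens (\<lambda>y. w y * norm (grad P y)) x = 0" if w: "w \<in> Cc1 W" for w
  proof (rule dens_outside)
    have w': "(\<lambda>y. w y * norm (grad P y)) \<in> Cc1 W"
      by (rule Cc1_mult[OF w C1_on_subset[OF C1_norm_grad W(1,2)]])
    then show "(\<lambda>y. w y * norm (grad P y)) \<in> Cc1 G" by (rule Cc1_mono[OF _ W(2)])
    show "x \<notin> P ` support (\<lambda>y. w y * norm (grad P y))"
      using w' W by (auto simp: Cc1_def level_set_def)
  qed
  then show ?thesis using W by (simp add: reps_def)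
qed

text \<open>By \<open>patch_area_eq\<close> the area element times w is w |\<nabla>P| /
  |\<partial>_b P|, which is the integrand of \<open>patch_neighbourhood\<close> for the function w
  |\<nabla>P|.\<close>

lemma patch_reps:
  assumes b: "b \<in> Basis" and \<psi>: "C1_on U \<psi>" and patch: "graph_patch b U \<psi> \<subseteq> level_set G P x"
    and p: "p \<in> graph_patch b U \<psi>"
  obtains W where "(W, patch_measure b U \<psi>) \<in> reps x" "p \<in> W" "W \<inter> level_set G P x \<subseteq> graph_patch b U \<psi>"
proof -
  have "\<exists>W. open W \<and> p \<in> W \<and> W \<subseteq> G \<and> W \<inter> level_set G P x \<subseteq> graph_patch b U \<psi> \<and>
      (\<forall>f\<in>Cc1 W. has_bochner_integral (hyperplane_lborel b)
        (\<lambda>y. indicator U y * (f (y + \<psi> y *\<^sub>R b) / \<bar>pd P b (y + \<psi> y *\<^sub>R b)\<bar>)) (dens f x))"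
    by (rule patch_neighbourhood[OF b \<psi> patch p]) blast
  then obtain W where W: "open W" "p \<in> W" "W \<subseteq> G" "W \<inter> level_set G P x \<subseteq> graph_patch b U \<psi>"
    "\<And>f. f \<in> Cc1 W \<Longrightarrow> has_bochner_integral (hyperplane_lborel b)
        (\<lambda>y. indicator U y * (f (y + \<psi> y *\<^sub>R b) / \<bar>pd P b (y + \<psi> y *\<^sub>R b)\<bar>)) (dens f x)"
    by blast
  have S: "- level_set G P x \<in> sets borel" using level_set_measurable by (simp add: borel_comp)
  have "emeasure (patch_measure b U \<psi>) (- level_set G P x) = 0"
  proof -
    have ae: "AE y in hyperplane_lborel b. ennreal (patch_area b \<psi> y) * indicator U y * indicator (- level_set G P x) (y + \<psi> y *\<^sub>R b) = 0"
      using AE_hyperplane_lborel[OF b]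
    proof eventually_elim
      case (elim y)
      then show ?case using patch by (auto simp: indicator_def graph_patch_def)
    qed
    show ?thesis unfolding emeasure_patch_measure[OF \<psi> S] nn_integral_cong_AE[OF ae] by simp
  qed
  moreover have "(\<integral>\<^sup>+ y. ennreal (w y) \<partial>patch_measure b U \<psi>) = ennreal (dens (\<lambda>y. w y * norm (grad P y)) x)"
    if w: "w \<in> Cc1 W" "\<forall>y. w y \<ge> 0" for w
  proof -
    have w': "(\<lambda>y. w y * norm (grad P y)) \<in> Cc1 W"
      by (rule Cc1_mult[OF w(1) C1_on_subset[OF C1_norm_grad W(1,3)]])
    have [measurable]: "w \<in> borel_measurable borel"
      using w(1) by (auto simp: Cc1_def intro!: borel_measurable_continuous_onI C1_on_continuous)
    have "(\<integral>\<^sup>+ y. ennreal (w y) \<partial>patch_measure b U \<psi>)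
       = (\<integral>\<^sup>+ y. ennreal (patch_area b \<psi> y) * indicator U y * ennreal (w (y + \<psi> y *\<^sub>R b)) \<partial>hyperplane_lborel b)"
      by (rule nn_integral_patch_measure[OF \<psi>]) measurable
    also have "\<dots> = (\<integral>\<^sup>+ y. ennreal (indicator U y * (w (y + \<psi> y *\<^sub>R b) * norm (grad P (y + \<psi> y *\<^sub>R b)) / \<bar>pd P b (y + \<psi> y *\<^sub>R b)\<bar>)) \<partial>hyperplane_lborel b)"
    proof (rule nn_integral_cong_AE)
      show "AE y in hyperplane_lborel b. ennreal (patch_area b \<psi> y) * indicator U y * ennreal (w (y + \<psi> y *\<^sub>R b))
         = ennreal (indicator U y * (w (y + \<psi> y *\<^sub>R b) * norm (grad P (y + \<psi> y *\<^sub>R b)) / \<bar>pd P b (y + \<psi> y *\<^sub>R b)\<bar>))"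
        using AE_hyperplane_lborel[OF b]
      proof eventually_elim
        case (elim y)
        then show ?case
          using patch_area_eq[OF b \<psi> patch, of y] w(2)
          by (cases "y \<in> U") (auto simp: mult.commute simp flip: ennreal_mult')
      qed
    qed
    also have "\<dots> = ennreal (dens (\<lambda>y. w y * norm (grad P y)) x)"
      using W(5)[OF w'] w(2)
      by (subst nn_integral_eq_integral) (auto simp: has_bochner_integral_iff)
    finally show ?thesis .
  qed
  ultimately show ?thesis using that[of W] W by (auto simp: reps_def)
qed

lemma reps_cover:
  assumes "p \<in> G" shows "\<exists>W \<sigma>. (W, \<sigma>) \<in> reps x \<and> p \<in> W"
proof (cases "p \<in> level_set G P x")
  case True
  then obtain b U \<psi> where "b \<in> Basis" "C1_on U \<psi>" "graph_patch b U \<psi> \<subseteq> level_set G P x" "p \<in> graph_patch b U \<psi>"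
    using implicit_function_patch by metis
  then show ?thesis using patch_reps by metis
next
  case False
  have "open (G \<inter> P -` (- {x}))" by (intro continuous_open_preimage C1_on_continuous[OF C1P] open_G) auto
  then have "(G \<inter> P -` (- {x}), null_measure borel) \<in> reps x"
    by (intro reps_null) (auto simp: level_set_def)
  moreover have "p \<in> G \<inter> P -` (- {x})" using False assms by (auto simp: level_set_def)
  ultimately show ?thesis by blast
qed

lemma is_surface_measureD:
  assumes "is_surface_measure S \<sigma>" "b \<in> Basis" "C1_on U \<psi>" "graph_patch b U \<psi> \<subseteq> S" "A \<in> sets borel" "A \<subseteq> graph_patch b U \<psi>"
  shows "emeasure \<sigma> A = emeasure (patch_measure b U \<psi>) A"
  using assms unfolding emeasure_patch_measure[OF assms(3,5)] is_surface_measure_def patch_area_def by blast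

text \<open>Gluing the members of \<open>reps x\<close> gives existence. For uniqueness, every
  competitor is prescribed on graph patches, and these cover the level set. The third clause carries
  the agreement with the local pieces over to the measure selected by
  \<open>surface_measure\<close>.\<close>

lemma ex1_surface_measure:
  "\<exists>\<mu>. is_surface_measure (level_set G P x) \<mu> \<and> (\<forall>\<nu>. is_surface_measure (level_set G P x) \<nu> \<longrightarrow> \<nu> = \<mu>) \<and>
     (\<forall>W \<sigma> A. (W, \<sigma>) \<in> reps x \<longrightarrow> A \<in> sets borel \<longrightarrow> A \<subseteq> W \<longrightarrow> emeasure \<mu> A = emeasure \<sigma> A)"
proof -
  let ?S = "level_set G P x"
  have op: "open W \<and> W \<subseteq> G \<and> sets \<sigma> = sets borel" if "(W, \<sigma>) \<in> reps x" for W \<sigma>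
    using that by (auto simp: reps_def)
  have ne: "reps x \<noteq> {}" using reps_null[of "{}" x] by auto
  obtain \<mu> where \<mu>': "sets \<mu> = sets borel \<and>
    (\<forall>W \<sigma> A. (W, \<sigma>) \<in> reps x \<longrightarrow> A \<in> sets borel \<longrightarrow> A \<subseteq> W \<longrightarrow> emeasure \<mu> A = emeasure \<sigma> A) \<and>
    (\<forall>Z\<in>sets borel. (\<forall>W \<sigma>. (W, \<sigma>) \<in> reps x \<longrightarrow> emeasure \<sigma> Z = 0) \<longrightarrow> emeasure \<mu> Z = 0)"
    using glue_measures[OF op reps_agree reps_cover ne] by (rule exE)
  then have \<mu>: "sets \<mu> = sets borel"
    "\<And>W \<sigma> A. (W, \<sigma>) \<in> reps x \<Longrightarrow> A \<in> sets borel \<Longrightarrow> A \<subseteq> W \<Longrightarrow> emeasure \<mu> A = emeasure \<sigma> A"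
    "\<And>Z. Z \<in> sets borel \<Longrightarrow> (\<And>W \<sigma>. (W, \<sigma>) \<in> reps x \<Longrightarrow> emeasure \<sigma> Z = 0) \<Longrightarrow> emeasure \<mu> Z = 0"
    by blast+
  have mS: "- ?S \<in> sets borel" using level_set_measurable by (simp add: borel_comp)
  have null: "emeasure \<mu> (- ?S) = 0" by (rule \<mu>(3)[OF mS]) (auto simp: reps_def)
  have patch: "emeasure \<mu> A = emeasure (patch_measure b U \<psi>) A"
    if b: "b \<in> Basis" and \<psi>: "C1_on U \<psi>" and gp: "graph_patch b U \<psi> \<subseteq> ?S" and A: "A \<in> sets borel" "A \<subseteq> graph_patch b U \<psi>" for b U \<psi> A
  proof (rule measure_eq_locally[OF \<mu>(1) _ A(1)])
    fix p assume "p \<in> A"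
    then obtain W where "(W, patch_measure b U \<psi>) \<in> reps x" "p \<in> W"
      using patch_reps[OF b \<psi> gp, of p] A(2) by blast
    then show "\<exists>V. open V \<and> p \<in> V \<and> (\<forall>B\<in>sets borel. B \<subseteq> A \<inter> V \<longrightarrow> emeasure \<mu> B = emeasure (patch_measure b U \<psi>) B)"
      using \<mu>(2) op by (intro exI[of _ W]) auto
  qed simp
  have surf: "is_surface_measure ?S \<mu>"
    unfolding is_surface_measure_def
  proof (intro conjI ballI allI impI)
    fix b U \<psi> A assume "b \<in> Basis" "C1_on U \<psi> \<and> graph_patch b U \<psi> \<subseteq> ?S" "A \<in> sets borel" "A \<subseteq> graph_patch b U \<psi>"
    then show "emeasure \<mu> A = (\<integral>\<^sup>+ y. ennreal (sqrt (1 + (\<Sum>c\<in>Basis - {b}. (frechet_derivative \<psi> (at y) c)\<^sup>2)))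
        * indicator U y * indicator A (y + \<psi> y *\<^sub>R b) \<partial>hyperplane_lborel b)"
      using patch[of b U \<psi> A] emeasure_patch_measure[of U \<psi> A b] by (simp add: patch_area_def)
  qed (use \<mu>(1) null in auto)
  have "\<nu> = \<mu>" if \<nu>: "is_surface_measure ?S \<nu>" for \<nu>
  proof (rule measure_eqI)
    have s\<nu>: "sets \<nu> = sets borel" "emeasure \<nu> (- ?S) = 0" using \<nu> by (auto simp: is_surface_measure_def)
    then show "sets \<nu> = sets \<mu>" using \<mu>(1) by simp
    fix A assume "A \<in> sets \<nu>"
    then have A: "A \<in> sets borel" using s\<nu> by simp
    have AS: "A \<inter> ?S \<in> sets borel" using A level_set_measurable by auto
    \<comment> \<open>Both measures vanish off the level set, so only Borel subsets of it remain to
      be compared.\<close>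
    have split: "emeasure M A = emeasure M (A \<inter> ?S)" if M: "sets M = sets borel" "emeasure M (- ?S) = 0" for M :: "'a measure"
    proof (rule emeasure_eq_AE)
      have "- ?S \<in> null_sets M" using M mS by (auto simp: null_sets_def)
      then show "AE y in M. y \<in> A \<longleftrightarrow> y \<in> A \<inter> ?S" by (rule AE_I') auto
    qed (use A AS M in auto)
    have "emeasure \<nu> (A \<inter> ?S) = emeasure \<mu> (A \<inter> ?S)"
    proof (rule measure_eq_locally[OF s\<nu>(1) \<mu>(1) AS])
      fix p assume "p \<in> A \<inter> ?S"
      then obtain b U \<psi> where bU: "b \<in> Basis" "C1_on U \<psi>" "graph_patch b U \<psi> \<subseteq> ?S" "p \<in> graph_patch b U \<psi>"
        using implicit_function_patch by (metis IntD2)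
      then obtain W where W: "(W, patch_measure b U \<psi>) \<in> reps x" "p \<in> W" "W \<inter> ?S \<subseteq> graph_patch b U \<psi>"
        using patch_reps by metis
      have "emeasure \<nu> B = emeasure \<mu> B" if B: "B \<in> sets borel" "B \<subseteq> A \<inter> ?S \<inter> W" for B
      proof -
        have "B \<subseteq> graph_patch b U \<psi>" using B(2) W(3) by blast
        then show ?thesis
          using is_surface_measureD[OF \<nu> bU(1-3) B(1)] is_surface_measureD[OF surf bU(1-3) B(1)] by simp
      qed
      then show "\<exists>V. open V \<and> p \<in> V \<and> (\<forall>B\<in>sets borel. B \<subseteq> A \<inter> ?S \<inter> V \<longrightarrow> emeasure \<nu> B = emeasure \<mu> B)"
        using W op by blast
    qed
    then show "emeasure \<nu> A = emeasure \<mu> A" using split[OF s\<nu>] split[OF \<mu>(1) null] by simp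
  qed
  then show ?thesis using surf \<mu>(2) by blast
qed

lemma ex1_is_surface_measure: "\<exists>!\<sigma>. is_surface_measure (level_set G P x) \<sigma>"
  using ex1_surface_measure[of x] by blast

lemma
  shows sets_surface_measure: "sets (surface_measure (level_set G P x)) = sets borel"
    and surface_measure_reps: "(W, \<sigma>) \<in> reps x \<Longrightarrow> A \<in> sets borel \<Longrightarrow> A \<subseteq> W \<Longrightarrow>
      emeasure (surface_measure (level_set G P x)) A = emeasure \<sigma> A"
proof -
  obtain \<mu> where \<mu>: "is_surface_measure (level_set G P x) \<mu>" "\<And>\<nu>. is_surface_measure (level_set G P x) \<nu> \<Longrightarrow> \<nu> = \<mu>"
     "\<And>W \<sigma> A. (W, \<sigma>) \<in> reps x \<Longrightarrow> A \<in> sets borel \<Longrightarrow> A \<subseteq> W \<Longrightarrow> emeasure \<mu> A = emeasure \<sigma> A"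
    using ex1_surface_measure[of x] by blast
  have eq: "surface_measure (level_set G P x) = \<mu>"
    unfolding surface_measure_def using \<mu>(1,2) by (rule the_equality)
  show "sets (surface_measure (level_set G P x)) = sets borel" using \<mu>(1) eq by (simp add: is_surface_measure_def)
  show "(W, \<sigma>) \<in> reps x \<Longrightarrow> A \<in> sets borel \<Longrightarrow> A \<subseteq> W \<Longrightarrow>
      emeasure (surface_measure (level_set G P x)) A = emeasure \<sigma> A"
    unfolding eq by (rule \<mu>(3))
qed

lemma nn_integral_surface_local:
  assumes W: "(W, \<sigma>) \<in> reps x" and w: "w \<in> Cc1 W" "\<And>y. w y \<ge> 0"
  shows "(\<integral>\<^sup>+ y. ennreal (w y) \<partial>surface_measure (level_set G P x)) = ennreal (dens (\<lambda>y. w y * norm (grad P y)) x)"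
proof -
  let ?\<mu> = "surface_measure (level_set G P x)"
  have WB: "W \<in> sets borel" "sets \<sigma> = sets borel" using W by (auto simp: reps_def)
  have r: "integral\<^sup>N M (\<lambda>y. ennreal (w y)) = integral\<^sup>N (restrict_space M W) (\<lambda>y. ennreal (w y))"
    if M: "sets M = sets borel" for M :: "'a measure"
  proof -
    have "integral\<^sup>N M (\<lambda>y. ennreal (w y)) = (\<integral>\<^sup>+ y. ennreal (w y) * indicator W y \<partial>M)"
      using Cc1_zero_outside[OF w(1)] by (intro nn_integral_cong) (auto simp: indicator_def)
    also have "\<dots> = integral\<^sup>N (restrict_space M W) (\<lambda>y. ennreal (w y))"
      using M WB sets_eq_imp_space_eq[OF M] by (subst nn_integral_restrict_space) auto
    finally show ?thesis .
  qed
  have "restrict_space ?\<mu> W = restrict_space \<sigma> W"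
  proof (rule measure_eqI)
    show "sets (restrict_space ?\<mu> W) = sets (restrict_space \<sigma> W)"
      by (simp add: sets_restrict_space sets_surface_measure WB)
    fix A assume "A \<in> sets (restrict_space ?\<mu> W)"
    then have A: "A \<in> sets borel" "A \<subseteq> W"
      using WB by (auto simp: sets_restrict_space sets_surface_measure)
    then show "emeasure (restrict_space ?\<mu> W) A = emeasure (restrict_space \<sigma> W) A"
      using WB surface_measure_reps[OF W A] sets_eq_imp_space_eq[OF WB(2)] sets_eq_imp_space_eq[OF sets_surface_measure]
      by (subst (1 2) emeasure_restrict_space) (auto simp: sets_surface_measure)
  qed
  then show ?thesis using r[OF sets_surface_measure] r[OF WB(2)] W w by (auto simp: reps_def)
qed

text \<open>A partition subordinate to the members of \<open>reps x\<close> writes f as a finite sum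
  of nonnegative pieces; each lives where the surface measure is known, and the densities add
  up.\<close>

lemma nn_integral_surface:
  assumes f: "f \<in> Cc1 G" "\<And>y. f y \<ge> 0"
  shows "dens (\<lambda>y. f y * norm (grad P y)) x \<ge> 0 \<and>
    (\<integral>\<^sup>+ y. ennreal (f y) \<partial>surface_measure (level_set G P x)) = ennreal (dens (\<lambda>y. f y * norm (grad P y)) x)"
proof -
  let ?\<mu> = "surface_measure (level_set G P x)"
  have fp: "compact (support f)" "support f \<subseteq> G" using f by (auto simp: Cc1_def)
  have "\<exists>r>0. \<exists>W \<sigma>. (W, \<sigma>) \<in> reps x \<and> cball y r \<subseteq> W" if y: "y \<in> support f" for y
  proof -
    obtain W \<sigma> where "(W, \<sigma>) \<in> reps x" "y \<in> W" using reps_cover[of y x] fp y by blast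
    moreover have "open W" using \<open>(W, \<sigma>) \<in> reps x\<close> by (simp add: reps_def)
    then obtain r where "r > 0" "cball y r \<subseteq> W" using open_contains_cball[of W] \<open>y \<in> W\<close> by blast
    ultimately show ?thesis by blast
  qed
  then obtain r W \<sigma> where r: "\<And>y. y \<in> support f \<Longrightarrow> r y > 0"
     "\<And>y. y \<in> support f \<Longrightarrow> (W y, \<sigma> y) \<in> reps x" "\<And>y. y \<in> support f \<Longrightarrow> cball y (r y) \<subseteq> W y"
    by metis
  obtain I m where I: "finite I" "I \<subseteq> support f" "m > 0" "\<And>y. y \<in> support f \<Longrightarrow> m \<le> (\<Sum>a\<in>I. ball_bump a (r a) y)"
    using finite_ball_bump_cover[OF fp(1), of r] r(1) by metis
  define Q where "Q y = (\<Sum>a\<in>I. ball_bump a (r a) y)" for y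
  have Qa: "bump_alg Q" unfolding Q_def by (intro bump_alg_sum) (auto simp: ball_bump_def intro: bump_alg.bump)
  have QC: "C1_on UNIV Q"
    using bump_alg_has_derivative[OF Qa] by (intro C1_onI) (auto intro: bump_alg_continuous)
  define O' where "O' = {y. Q y > 0}"
  have oO: "open O'" unfolding O'_def by (intro open_Collect_less continuous_on_const bump_alg_continuous[OF Qa])
  have fO: "support f \<subseteq> O'" using I(3,4) by (force simp: O'_def Q_def)
  have fQ: "(\<lambda>y. f y / Q y) \<in> Cc1 G"
  proof -
    have "f \<in> Cc1 (G \<inter> O')" using f fO by (auto simp: Cc1_def)
    moreover have "C1_on (G \<inter> O') (\<lambda>y. inverse (Q y))"
      using C1_on_subset[OF QC, of "G \<inter> O'"] oO open_G by (intro C1_on_inverse) (auto simp: O'_def)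
    ultimately have "(\<lambda>y. f y * inverse (Q y)) \<in> Cc1 (G \<inter> O')" by (rule Cc1_mult)
    then show ?thesis using Cc1_mono by (auto simp: divide_inverse)
  qed
  define h where "h a y = f y / Q y * ball_bump a (r a) y" for a y
  have bb0: "ball_bump a (r a) y \<ge> 0" for a y by (simp add: ball_bump_def rexp_nonneg)
  have Q0: "Q y \<ge> 0" for y unfolding Q_def by (intro sum_nonneg bb0)
  have h0: "h a y \<ge> 0" for a y using f(2) Q0 bb0 by (simp add: h_def)
  have hW: "h a \<in> Cc1 (W a)" if a: "a \<in> I" for a
  proof -
    have aS: "a \<in> support f" using a I(2) by auto
    have "ball_bump a (r a) \<in> Cc1 (W a)"
      by (intro bumps_Cc1 ball_bump_in_bumps r aS)
    moreover have "C1_on (W a) (\<lambda>y. f y / Q y)"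
      using fQ r(2)[OF aS] by (auto simp: Cc1_def reps_def intro: C1_on_subset)
    ultimately have "(\<lambda>y. ball_bump a (r a) y * (f y / Q y)) \<in> Cc1 (W a)" by (rule Cc1_mult)
    then show ?thesis by (simp add: h_def[abs_def] mult.commute)
  qed
  have fsum: "f y = (\<Sum>a\<in>I. h a y)" for y
  proof (cases "y \<in> support f")
    case True
    then have "Q y \<noteq> 0" using fO by (auto simp: O'_def)
    then show ?thesis unfolding h_def sum_distrib_left[symmetric] Q_def[symmetric] by simp
  qed (simp add: h_def not_in_support)
  have hg: "(\<lambda>y. h a y * norm (grad P y)) \<in> Cc1 G" if a: "a \<in> I" for a
  proof -
    have "W a \<subseteq> G" using r(2)[of a] a I(2) by (auto simp: reps_def)
    then show ?thesis by (intro Cc1_mult C1_norm_grad Cc1_mono[OF hW[OF a]])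
  qed
  have d: "dens (\<lambda>y. f y * norm (grad P y)) x = (\<Sum>a\<in>I. dens (\<lambda>y. h a y * norm (grad P y)) x)"
    using dens_sum[OF I(1) hg] by (simp add: fsum sum_distrib_right)
  have dpos: "dens (\<lambda>y. h a y * norm (grad P y)) x \<ge> 0" if a: "a \<in> I" for a
  proof (rule is_dens_nonneg[OF is_dens_dens[OF hg[OF a]]])
    show "h a y * norm (grad P y) \<ge> 0" for y using h0 by simp
  qed
  have hm: "h a \<in> borel_measurable borel" if "a \<in> I" for a
    using hW[OF that] by (auto simp: Cc1_def intro!: borel_measurable_continuous_onI C1_on_continuous)
  have "(\<integral>\<^sup>+ y. ennreal (f y) \<partial>?\<mu>) = (\<integral>\<^sup>+ y. (\<Sum>a\<in>I. ennreal (h a y)) \<partial>?\<mu>)"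
    using h0 by (intro nn_integral_cong) (simp add: fsum sum_ennreal)
  also have "\<dots> = (\<Sum>a\<in>I. \<integral>\<^sup>+ y. ennreal (h a y) \<partial>?\<mu>)"
    using hm by (intro nn_integral_sum) (auto simp: measurable_cong_sets[OF sets_surface_measure refl])
  also have "\<dots> = (\<Sum>a\<in>I. ennreal (dens (\<lambda>y. h a y * norm (grad P y)) x))"
    using I(2) r(2) hW h0 by (intro sum.cong refl nn_integral_surface_local) auto
  also have "\<dots> = ennreal (dens (\<lambda>y. f y * norm (grad P y)) x)"
    using dpos by (simp add: d sum_ennreal)
  finally show ?thesis using d dpos by (auto intro: sum_nonneg)
qed

text \<open>Positive and negative parts of a C1 function need not be C1. The signed function is
  instead written as a difference of two nonnegative ones by adding a multiple of a cutoff function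
  that dominates it.\<close>

lemma
  assumes f: "f \<in> Cc1 G"
  shows surface_integrable: "integrable (surface_measure (level_set G P x)) (\<lambda>y. f y / norm (grad P y))"
    and surface_integral: "(LINT y|surface_measure (level_set G P x). f y / norm (grad P y)) = dens f x"
proof -
  let ?\<mu> = "surface_measure (level_set G P x)"
  have pos: "has_bochner_integral ?\<mu> k (dens (\<lambda>y. k y * norm (grad P y)) x)"
    if k: "k \<in> Cc1 G" "\<And>y. k y \<ge> 0" for k
  proof (rule has_bochner_integral_nn_integral)
    show "k \<in> borel_measurable ?\<mu>"
      using k(1) by (auto simp: Cc1_def measurable_cong_sets[OF sets_surface_measure refl]
        intro!: borel_measurable_continuous_onI C1_on_continuous)
  qed (use nn_integral_surface[OF k, of x] k(2) in auto)
  have "C1_on G (\<lambda>y. inverse (norm (grad P y)))"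
    by (rule C1_on_inverse[OF C1_norm_grad]) (simp add: grad_nz)
  then have "(\<lambda>y. f y * inverse (norm (grad P y))) \<in> Cc1 G" by (rule Cc1_mult[OF f])
  then have k: "(\<lambda>y. f y / norm (grad P y)) \<in> Cc1 G" (is "?k \<in> _") by (simp add: divide_inverse)
  then have ks: "compact (support ?k)" "support ?k \<subseteq> G" "C1_on UNIV ?k" by (auto simp: Cc1_def)
  obtain \<eta> where \<eta>: "\<eta> \<in> Cc1 G" "\<And>y. \<eta> y \<ge> 0" "\<And>y. y \<in> support ?k \<Longrightarrow> \<eta> y \<ge> 1"
    using cutoff_exists[OF ks(1,2) open_G] by metis
  have "compact (?k ` support ?k)"
    by (intro compact_continuous_image continuous_on_subset[OF C1_on_continuous[OF ks(3)]] ks) auto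
  then obtain B where B: "B > 0" "\<forall>t\<in>?k ` support ?k. norm t \<le> B" using compact_imp_bounded bounded_pos by metis
  define e where "e y = B * \<eta> y" for y
  define k' where "k' y = ?k y + e y" for y
  have e: "e \<in> Cc1 G" unfolding e_def by (rule Cc1_cmult[OF \<eta>(1) open_G])
  have k': "k' \<in> Cc1 G" unfolding k'_def by (rule Cc1_add[OF k e])
  have e0: "e y \<ge> 0" for y using \<eta>(2) B(1) by (simp add: e_def)
  have k'0: "k' y \<ge> 0" for y
  proof (cases "y \<in> support ?k")
    case True
    then have "\<bar>?k y\<bar> \<le> B" using B(2) by auto
    also have "B \<le> e y" using \<eta>(3)[OF True] B(1) by (simp add: e_def)
    finally show ?thesis unfolding k'_def by linarith
  next
    case False
    from not_in_support[OF False] show ?thesis using e0[of y] unfolding k'_def by linarith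
  qed
  have g: "(\<lambda>y. k y * norm (grad P y)) \<in> Cc1 G" if "k \<in> Cc1 G" for k
    by (rule Cc1_mult[OF that C1_norm_grad])
  have kg: "?k y * norm (grad P y) = f y" for y
    using grad_nz[of y] Cc1_zero_outside[OF f, of y] by (cases "y \<in> G") auto
  have "dens (\<lambda>y. k' y * norm (grad P y)) x = dens (\<lambda>y. f y + e y * norm (grad P y)) x"
    unfolding k'_def distrib_right kg ..
  also have "\<dots> = dens f x + dens (\<lambda>y. e y * norm (grad P y)) x" by (rule dens_add[OF f g[OF e]])
  finally have d: "dens f x = dens (\<lambda>y. k' y * norm (grad P y)) x - dens (\<lambda>y. e y * norm (grad P y)) x" by simp
  have "has_bochner_integral ?\<mu> (\<lambda>y. k' y - e y) (dens f x)"
    unfolding d by (intro has_bochner_integral_diff pos e e0 k' k'0)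
  then have "has_bochner_integral ?\<mu> ?k (dens f x)" by (simp add: k'_def)
  then show "integrable ?\<mu> ?k" "(LINT y|?\<mu>. ?k y) = dens f x" by (auto simp: has_bochner_integral_iff)
qed

end

subsection \<open>Test functions and \<open>L\<^sup>2\<close>\<close>

lemma smooth_on_C1:
  fixes f :: "'a::euclidean_space \<Rightarrow> real"
  assumes f: "smooth_on W f" and W: "open W"
  shows "C1_on W f" "b \<in> Basis \<Longrightarrow> C1_on W (pd f b)"
proof -
  have d: "iter_pderiv bs f differentiable at y" if "bs \<in> lists Basis" "y \<in> W" for bs y
    using f that by (auto simp: smooth_on_def)
  have c: "continuous_on W (iter_pderiv bs f)" if "bs \<in> lists Basis" for bs
    using d[OF that] by (meson continuous_at_imp_continuous_on differentiable_imp_continuous_within)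
  show "C1_on W f" using d[of "[]"] c[of "[_]"] W by (auto simp: C1_on_def)
  show "C1_on W (pd f b)" if "b \<in> Basis" using d[of "[b]"] c[of "[_, b]"] W that by (auto simp: C1_on_def)
qed

lemma test_function_Cc1:
  fixes f :: "'a::euclidean_space \<Rightarrow> complex"
  assumes f: "f \<in> test_functions W"
  shows "(\<lambda>y. Re (f y)) \<in> Cc1 W" "(\<lambda>y. Im (f y)) \<in> Cc1 W"
proof -
  have s: "smooth_on UNIV f" "compact (support f)" "support f \<subseteq> W" using f by (auto simp: test_functions_def)
  have d: "iter_pderiv bs f differentiable at y" if "bs \<in> lists Basis" for bs y
    using s(1) that by (auto simp: smooth_on_def)
  have D: "(f has_derivative frechet_derivative f (at y)) (at y)" for y
    using d[of "[]" y] by (simp add: frechet_derivative_works)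
  have c: "continuous_on UNIV (\<lambda>y. frechet_derivative f (at y) b)" if "b \<in> Basis" for b
    using d[of "[b]"] that by (auto intro!: continuous_at_imp_continuous_on differentiable_imp_continuous_within)
  have "C1_on UNIV (\<lambda>y. Re (f y))"
    by (rule C1_onI[of _ _ "\<lambda>y v. Re (frechet_derivative f (at y) v)"])
       (auto intro!: D has_derivative_Re continuous_intros c)
  moreover have "C1_on UNIV (\<lambda>y. Im (f y))"
    by (rule C1_onI[of _ _ "\<lambda>y v. Im (frechet_derivative f (at y) v)"])
       (auto intro!: D has_derivative_Im continuous_intros c)
  ultimately show "(\<lambda>y. Re (f y)) \<in> Cc1 W" "(\<lambda>y. Im (f y)) \<in> Cc1 W"
    using s support_mono[of f "\<lambda>y. Re (f y)"] support_mono[of f "\<lambda>y. Im (f y)"]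
      compact_support_mono[of f "\<lambda>y. Re (f y)"] compact_support_mono[of f "\<lambda>y. Im (f y)"]
    by (auto simp: Cc1_def)
qed

lemma bumps_test_functions: "w \<in> bumps W \<Longrightarrow> (\<lambda>y. complex_of_real (w y)) \<in> test_functions W"
  using support_mono[of w "\<lambda>y. complex_of_real (w y)"] compact_support_mono[of w "\<lambda>y. complex_of_real (w y)"]
  by (auto simp: bumps_def test_functions_def intro: bump_alg_smooth)

text \<open>The vectors that represent smeared functionals are test functions multiplied by
  functions of P that are merely continuous, as they contain Hilbert transforms; they leave the
  space of test functions but stay in this one.\<close>

definition Cc :: "'a::euclidean_space set \<Rightarrow> ('a \<Rightarrow> complex) set" where
  "Cc W = {f. continuous_on UNIV f \<and> compact (support f) \<and> support f \<subseteq> W}"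

lemma test_function_Cc: "f \<in> test_functions W \<Longrightarrow> f \<in> Cc W"
proof -
  assume f: "f \<in> test_functions W"
  have "iter_pderiv [] f differentiable at y" for y
    using f unfolding test_functions_def smooth_on_def by blast
  then have "continuous_on UNIV f"
    by (auto intro!: continuous_at_imp_continuous_on differentiable_imp_continuous_within)
  then show ?thesis using f by (auto simp: Cc_def test_functions_def)
qed

lemma Cc_mult_continuous:
  assumes f: "f \<in> Cc W" and q: "open W" "continuous_on W q"
  shows "(\<lambda>y. f y * q y) \<in> Cc W"
  using f continuous_mult_supported[of f W q] q support_mono[of f "\<lambda>y. f y * q y"]
    compact_support_mono[of f "\<lambda>y. f y * q y"] by (auto simp: Cc_def)

lemma Cc_cnj: "f \<in> Cc W \<Longrightarrow> (\<lambda>y. cnj (f y)) \<in> Cc W"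
  using support_mono[of f "\<lambda>y. cnj (f y)"] compact_support_mono[of f "\<lambda>y. cnj (f y)"]
  by (auto simp: Cc_def intro: continuous_intros)

lemma Cc_add: "f \<in> Cc W \<Longrightarrow> g \<in> Cc W \<Longrightarrow> (\<lambda>y. f y + g y) \<in> Cc W"
proof -
  assume a: "f \<in> Cc W" "g \<in> Cc W"
  have s: "support (\<lambda>y. f y + g y) \<subseteq> support f \<union> support g"
    by (rule support_subset) (auto simp: not_in_support)
  moreover have "compact (support f \<union> support g)" using a by (auto simp: Cc_def)
  ultimately have "compact (support (\<lambda>y. f y + g y))"
    using compact_Int_closed[of "support f \<union> support g" "support (\<lambda>y. f y + g y)"] by (simp add: Int_absorb1)
  then show ?thesis using a s by (auto simp: Cc_def intro: continuous_intros)
qed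

lemma Cc_integrable: "f \<in> Cc W \<Longrightarrow> integrable lborel f"
  by (rule integrable_continuous_compact_support[of _ "support f"]) (auto simp: Cc_def not_in_support)

lemma
  fixes f :: "'a::euclidean_space \<Rightarrow> 'b::{banach, second_countable_topology}"
  assumes "open G" "f \<in> borel_measurable borel" "\<And>y. y \<notin> G \<Longrightarrow> f y = 0"
  shows integral_lebesgue_on_supported: "(LINT y|lebesgue_on G. f y) = (LINT y|lborel. f y)"
    and integrable_lebesgue_on_supported: "integrable (lebesgue_on G) f \<longleftrightarrow> integrable lborel f"
proof -
  have e: "(\<lambda>y. indicator G y *\<^sub>R f y) = f" using assms(3) by (auto simp: indicator_def)
  have G: "G \<inter> space lebesgue \<in> sets lebesgue" using assms(1) by simp
  have m: "f \<in> borel_measurable lborel" using assms(2) by simp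
  show "(LINT y|lebesgue_on G. f y) = (LINT y|lborel. f y)"
    by (simp only: integral_restrict_space[OF G] e integral_completion[OF m])
  show "integrable (lebesgue_on G) f \<longleftrightarrow> integrable lborel f"
    by (simp only: integrable_restrict_space[OF G] e integrable_completion[OF m])
qed

lemma Cc_measurable: "f \<in> Cc W \<Longrightarrow> f \<in> borel_measurable borel"
  by (auto simp: Cc_def intro: borel_measurable_continuous_onI)

lemma Cc_zero_outside: "f \<in> Cc W \<Longrightarrow> y \<notin> W \<Longrightarrow> f y = 0"
  by (auto simp: Cc_def intro: not_in_support)

lemma Cc_norm_square_integrable: "f \<in> Cc W \<Longrightarrow> integrable lborel (\<lambda>y. (cmod (f y))\<^sup>2)"
  by (rule integrable_continuous_compact_support[of _ "support f"])
     (auto simp: Cc_def not_in_support intro!: continuous_intros)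

lemma Cc_L2: "open G \<Longrightarrow> f \<in> Cc G \<Longrightarrow> f \<in> L2 G"
proof -
  assume G: "open G" and f: "f \<in> Cc G"
  note [measurable] = Cc_measurable[OF f]
  have "f \<in> borel_measurable (lebesgue_on G)"
    by (intro measurable_restrict_space1 measurable_completion) simp
  moreover have "integrable (lebesgue_on G) (\<lambda>y. (cmod (f y))\<^sup>2)"
    using Cc_norm_square_integrable[OF f] Cc_zero_outside[OF f]
    by (subst integrable_lebesgue_on_supported[OF G]) auto
  ultimately show "f \<in> L2 G" by (simp add: L2_def)
qed

lemma L2_product_integrable:
  assumes "u \<in> L2 G" "v \<in> L2 G" shows "integrable (lebesgue_on G) (\<lambda>y. cnj (u y) * v y)"
proof (rule Bochner_Integration.integrable_bound)
  have cm: "cnj \<in> borel_measurable borel" by (intro borel_measurable_continuous_onI continuous_intros)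
  show "integrable (lebesgue_on G) (\<lambda>y. (cmod (u y))\<^sup>2 + (cmod (v y))\<^sup>2)"
    using assms by (simp add: L2_def)
  show "(\<lambda>y. cnj (u y) * v y) \<in> borel_measurable (lebesgue_on G)"
    using assms by (auto simp: L2_def intro!: borel_measurable_times measurable_compose[OF _ cm])
  have "cmod (u y) * cmod (v y) \<le> (cmod (u y))\<^sup>2 + (cmod (v y))\<^sup>2" for y
  proof -
    have "0 \<le> cmod (u y) * cmod (v y)" by simp
    moreover have "2 * (cmod (u y) * cmod (v y)) \<le> (cmod (u y))\<^sup>2 + (cmod (v y))\<^sup>2"
      using sum_squares_bound[of "cmod (u y)" "cmod (v y)"] by (simp add: mult.assoc)
    ultimately show ?thesis by linarith
  qed
  then show "AE y in lebesgue_on G. norm (cnj (u y) * v y) \<le> norm ((cmod (u y))\<^sup>2 + (cmod (v y))\<^sup>2)"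
    by (simp add: norm_mult)
qed

text \<open>The positive and the negative part of r define measures with equal integrals of bumps,
  hence equal on Borel subsets of G. On the set where one part is positive the other one vanishes,
  so both are 0 almost everywhere in G.\<close>

lemma ae_zero_of_bumps:
  fixes r :: "'a::euclidean_space \<Rightarrow> real"
  assumes G: "open G" and r [measurable]: "r \<in> borel_measurable borel"
    and i: "\<And>w. w \<in> bumps G \<Longrightarrow> integrable lborel (\<lambda>y. r y * w y)"
    and z: "\<And>w. w \<in> bumps G \<Longrightarrow> (LINT y|lborel. r y * w y) = 0"
  shows "AE y in lborel. y \<in> G \<longrightarrow> r y = 0"
proof -
  have [measurable]: "G \<in> sets borel" using G by simp
  define p where "p s y = max 0 (s * r y)" for s y
  have [measurable]: "p s \<in> borel_measurable borel" for s unfolding p_def by measurable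
  have eq: "emeasure (density lborel (\<lambda>y. ennreal (p 1 y))) A = emeasure (density lborel (\<lambda>y. ennreal (p (-1) y))) A"
    if A: "A \<in> sets borel" "A \<subseteq> G" for A
  proof (rule measure_eq_of_bumps[OF _ _ G _ _ A])
    fix w assume w: "w \<in> bumps G"
    note [measurable] = bumps_integrable_measurable[OF w]
    have w0: "w y \<ge> 0" for y using w by (auto simp: bumps_def)
    have ip: "integrable lborel (\<lambda>y. p s y * w y)" if "s = 1 \<or> s = -1" for s
      by (rule Bochner_Integration.integrable_bound[OF i[OF w]]) (use that w0 in \<open>auto simp: p_def abs_mult intro!: mult_right_mono\<close>)
    have n: "(\<integral>\<^sup>+ y. ennreal (w y) \<partial>density lborel (\<lambda>y. ennreal (p s y))) = ennreal (LINT y|lborel. p s y * w y)"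
      if "s = 1 \<or> s = -1" for s
      using w0 nn_integral_eq_integral[OF ip[OF that]]
      by (simp add: nn_integral_density p_def ennreal_mult)
    have "(LINT y|lborel. p 1 y * w y) - (LINT y|lborel. p (-1) y * w y) = (LINT y|lborel. p 1 y * w y - p (-1) y * w y)"
      using ip[of 1] ip[of "-1"] by simp
    also have "\<dots> = (LINT y|lborel. r y * w y)"
      by (intro Bochner_Integration.integral_cong) (auto simp: p_def max_def algebra_simps)
    finally have "(LINT y|lborel. p 1 y * w y) = (LINT y|lborel. p (-1) y * w y)" using z[OF w] by simp
    then show "(\<integral>\<^sup>+ y. ennreal (w y) \<partial>density lborel (\<lambda>y. ennreal (p 1 y))) = (\<integral>\<^sup>+ y. ennreal (w y) \<partial>density lborel (\<lambda>y. ennreal (p (-1) y)))"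
      "(\<integral>\<^sup>+ y. ennreal (w y) \<partial>density lborel (\<lambda>y. ennreal (p 1 y))) < \<infinity>"
      using n[of 1] n[of "-1"] by auto
  qed auto
  have one: "AE y in lborel. y \<in> G \<longrightarrow> s * r y \<le> 0" if s: "s = 1 \<or> s = -1" for s
  proof -
    let ?A = "{y \<in> G. s * r y > 0}"
    have mA: "?A \<in> sets borel" by measurable
    have "(\<integral>\<^sup>+ y. ennreal (p s y) * indicator ?A y \<partial>lborel) = (\<integral>\<^sup>+ y. ennreal (p (- s) y) * indicator ?A y \<partial>lborel)"
      using eq[OF mA] s by (auto simp: emeasure_density)
    also have "\<dots> = (\<integral>\<^sup>+ y. 0 \<partial>(lborel :: 'a measure))"
      by (intro nn_integral_cong) (auto simp: p_def indicator_def)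
    finally have "(\<integral>\<^sup>+ y. ennreal (p s y) * indicator ?A y \<partial>lborel) = 0" by simp
    then have "AE y in lborel. ennreal (p s y) * indicator ?A y = 0"
      using mA by (subst (asm) nn_integral_0_iff_AE) auto
    then show ?thesis
      by eventually_elim (auto simp: p_def indicator_def split: if_splits)
  qed
  show ?thesis using one[OF disjI1[OF refl]] one[OF disjI2[OF refl]] by eventually_elim auto
qed

text \<open>Test functions are dense in L^2(G), in the form in which it is used: an element
  orthogonal to all of them is 0. Real test functions treat the real and imaginary part
  separately.\<close>

lemma L2_zero_of_test_functions:
  assumes G: "open G" and d: "d \<in> L2 G"
    and z: "\<And>f. f \<in> test_functions G \<Longrightarrow> inner_L2 G d f = 0"
  shows "AE y in lebesgue_on G. d y = 0"
proof -
  have Gl: "G \<inter> space lebesgue \<in> sets lebesgue" using G by simp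
  have dm: "d \<in> borel_measurable (lebesgue_on G)" using d by (simp add: L2_def)
  have part: "AE y in lborel. y \<in> G \<longrightarrow> q (d y) = 0" if q: "q = Re \<or> q = Im" for q :: "complex \<Rightarrow> real"
  proof -
    have "(\<lambda>y. q (d y)) \<in> borel_measurable (lebesgue_on G)"
      using q dm by (auto intro: borel_measurable_Re borel_measurable_Im)
    then have "(\<lambda>y. indicator G y *\<^sub>R q (d y)) \<in> borel_measurable lebesgue"
      by (simp only: borel_measurable_restrict_space_iff[OF Gl])
    then obtain r where r: "r \<in> borel_measurable lborel" "AE y in lborel. indicator G y *\<^sub>R q (d y) = r y"
      using completion_ex_borel_measurable_real by blast
    have ae: "AE y in lebesgue_on G. q (d y) = r y"
      unfolding AE_restrict_space_iff[OF Gl] AE_completion_iff using r(2) by eventually_elim (auto simp: indicator_def)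
    have rw: "integrable lborel (\<lambda>y. r y * w y) \<and> (LINT y|lborel. r y * w y) = 0" if w: "w \<in> bumps G" for w
    proof -
      note t = bumps_test_functions[OF w]
      note [measurable] = bumps_integrable_measurable[OF w] r(1)[simplified]
      have w0: "w y = 0" if "y \<notin> G" for y using w that by (auto simp: bumps_def intro: not_in_support)
      have ic: "integrable (lebesgue_on G) (\<lambda>y. cnj (d y) * complex_of_real (w y))"
        by (rule L2_product_integrable[OF d Cc_L2[OF G test_function_Cc[OF t]]])
      have zc: "(LINT y|lebesgue_on G. cnj (d y) * complex_of_real (w y)) = 0"
        using z[OF t] by (simp add: inner_L2_def)
      have iq: "integrable (lebesgue_on G) (\<lambda>y. q (d y) * w y) \<and> (LINT y|lebesgue_on G. q (d y) * w y) = 0"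
        using q integrable_Re[OF ic] integrable_Im[OF ic] integral_Re[OF ic] integral_Im[OF ic] zc by auto
      have aew: "AE y in lebesgue_on G. q (d y) * w y = r y * w y" using ae by eventually_elim simp
      have m: "(\<lambda>y. r y * w y) \<in> borel_measurable (lebesgue_on G)"
        by (intro measurable_restrict_space1 measurable_completion) simp
      have mb: "(\<lambda>y. r y * w y) \<in> borel_measurable borel" by measurable
      have "integrable (lebesgue_on G) (\<lambda>y. r y * w y)"
        by (rule integrable_cong_AE_imp[OF conjunct1[OF iq] m]) (use aew in eventually_elim, simp)
      moreover have "(LINT y|lebesgue_on G. r y * w y) = 0"
        using integral_cong_AE[OF _ m aew] iq by (simp add: borel_measurable_integrable)
      ultimately show ?thesis
        using integral_lebesgue_on_supported[OF G mb] integrable_lebesgue_on_supported[OF G mb] w0 by auto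
    qed
    have "AE y in lborel. y \<in> G \<longrightarrow> r y = 0"
      by (rule ae_zero_of_bumps[OF G]) (use r rw in auto)
    then show ?thesis using r(2) by eventually_elim (auto simp: indicator_def)
  qed
  show ?thesis
    unfolding AE_restrict_space_iff[OF Gl] AE_completion_iff
    using part[OF disjI1[OF refl]] part[OF disjI2[OF refl]] by eventually_elim (auto simp: complex_eq_iff)
qed

lemma L2_diff: "u \<in> L2 G \<Longrightarrow> v \<in> L2 G \<Longrightarrow> (\<lambda>y. u y - v y) \<in> L2 G"
proof -
  assume uv: "u \<in> L2 G" "v \<in> L2 G"
  then have m: "(\<lambda>y. u y - v y) \<in> borel_measurable (lebesgue_on G)" by (auto simp: L2_def)
  have "integrable (lebesgue_on G) (\<lambda>y. (cmod (u y - v y))\<^sup>2)"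
  proof (rule Bochner_Integration.integrable_bound)
    show "integrable (lebesgue_on G) (\<lambda>y. 2 * (cmod (u y))\<^sup>2 + 2 * (cmod (v y))\<^sup>2)" using uv by (simp add: L2_def)
    have "(cmod (a - b))\<^sup>2 \<le> 2 * (cmod a)\<^sup>2 + 2 * (cmod b)\<^sup>2" for a b
    proof -
      have "(cmod (a - b))\<^sup>2 \<le> (cmod a + cmod b)\<^sup>2" by (intro power_mono norm_triangle_ineq4) auto
      also have "\<dots> \<le> 2 * (cmod a)\<^sup>2 + 2 * (cmod b)\<^sup>2"
        using sum_squares_bound[of "cmod a" "cmod b"] by (simp add: power2_sum)
      finally show ?thesis .
    qed
    then show "AE y in lebesgue_on G. norm ((cmod (u y - v y))\<^sup>2) \<le> norm (2 * (cmod (u y))\<^sup>2 + 2 * (cmod (v y))\<^sup>2)"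
      by (intro AE_I2) simp
  qed (use m in measurable)
  then show ?thesis using m by (simp add: L2_def)
qed

lemma L2_eq_of_test_functions:
  assumes G: "open G" and u: "u \<in> L2 G" "u0 \<in> L2 G"
    and e: "\<And>f. f \<in> test_functions G \<Longrightarrow> inner_L2 G u f = inner_L2 G u0 f"
  shows "AE y in lebesgue_on G. u y = u0 y"
proof -
  have "AE y in lebesgue_on G. u y - u0 y = 0"
  proof (rule L2_zero_of_test_functions[OF G L2_diff[OF u]])
    fix f assume f: "f \<in> test_functions G"
    have f2: "f \<in> L2 G" by (rule Cc_L2[OF G test_function_Cc[OF f]])
    show "inner_L2 G (\<lambda>y. u y - u0 y) f = 0"
      using e[OF f] L2_product_integrable[OF u(1) f2] L2_product_integrable[OF u(2) f2]
      by (simp add: inner_L2_def left_diff_distrib)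
  qed
  then show ?thesis by simp
qed

lemma inner_L2_cnj: "inner_L2 G u v = cnj (inner_L2 G v u)"
  unfolding inner_L2_def by (simp add: mult.commute flip: Bochner_Integration.integral_cnj)

text \<open>The product refers to all elements of L^2(G) that represent the two functionals. Any two
  agree almost everywhere, since test functions separate them, so one explicit pair decides.\<close>

lemma has_productI:
  assumes G: "open G" and u0: "u0 \<in> L2 G" and v0: "v0 \<in> L2 G"
    and s: "smearable G \<phi>1 B" "smearable G \<phi>2 K"
    and B: "\<And>f. f \<in> test_functions G \<Longrightarrow> smear \<phi>1 B f = inner_L2 G u0 f"
    and K: "\<And>f. f \<in> test_functions G \<Longrightarrow> smear \<phi>2 K f = inner_L2 G f v0"
    and c: "inner_L2 G u0 v0 = c"
  shows "has_product G \<phi>1 B \<phi>2 K c"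
  unfolding has_product_def
proof (intro conjI allI impI s)
  show "\<exists>u. is_bra G (smear \<phi>1 B) u" using u0 B by (auto simp: is_bra_def)
  show "\<exists>v. is_ket G (smear \<phi>2 K) v" using v0 K by (auto simp: is_ket_def)
  fix u v assume u: "is_bra G (smear \<phi>1 B) u" and v: "is_ket G (smear \<phi>2 K) v"
  have uL: "u \<in> L2 G" "v \<in> L2 G" using u v by (auto simp: is_bra_def is_ket_def)
  have 1: "AE y in lebesgue_on G. u y = u0 y"
    by (rule L2_eq_of_test_functions[OF G uL(1) u0]) (use u B in \<open>auto simp: is_bra_def\<close>)
  have 2: "AE y in lebesgue_on G. v y = v0 y"
  proof (rule L2_eq_of_test_functions[OF G uL(2) v0])
    fix f assume "f \<in> test_functions G"
    then have "inner_L2 G f v = inner_L2 G f v0" using v K by (auto simp: is_ket_def)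
    then show "inner_L2 G v f = inner_L2 G v0 f" by (metis inner_L2_cnj)
  qed
  have "inner_L2 G u v = inner_L2 G u0 v0"
    unfolding inner_L2_def
  proof (rule integral_cong_AE)
    show "AE y in lebesgue_on G. cnj (u y) * v y = cnj (u0 y) * v0 y"
      using 1 2 by eventually_elim simp
  qed (use L2_product_integrable[OF uL] L2_product_integrable[OF u0 v0] in \<open>auto intro: borel_measurable_integrable\<close>)
  then show "inner_L2 G u v = c" using c by simp
qed

subsection \<open>The forms \<open>\<delta>(x - \<Omega>)\<close> and \<open>\<P> / (x - \<Omega>)\<close>\<close>

lemma Cc1_diff: "f \<in> Cc1 W \<Longrightarrow> g \<in> Cc1 W \<Longrightarrow> open W \<Longrightarrow> (\<lambda>y. f y - g y) \<in> Cc1 W"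
  using Cc1_add[of f W "\<lambda>y. - 1 * g y"] Cc1_cmult[of g W "- 1"] by simp

lemma Cc1_mult2: "f \<in> Cc1 W \<Longrightarrow> g \<in> Cc1 W \<Longrightarrow> open W \<Longrightarrow> (\<lambda>y. f y * g y) \<in> Cc1 W"
  by (rule Cc1_mult) (auto simp: Cc1_def intro: C1_on_subset)

lemma test_product_Cc1:
  assumes a: "a \<in> test_functions W" and b: "b \<in> test_functions W" and W: "open W"
  shows "(\<lambda>y. Re (cnj (a y) * b y)) \<in> Cc1 W" "(\<lambda>y. Im (cnj (a y) * b y)) \<in> Cc1 W"
  using test_function_Cc1[OF a] test_function_Cc1[OF b] W
  by (auto intro!: Cc1_add Cc1_diff Cc1_mult2)

lemma
  fixes T A B :: "real \<Rightarrow> complex"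
  assumes S: "integrable M (\<lambda>x. T x - A x + B x)" and A: "integrable M A" and B: "integrable M B"
    and z: "integral\<^sup>L M A = 0" "integral\<^sup>L M B = 0"
  shows integrable_up_to_null_integrals: "integrable M T" "(LINT x|M. T x - A x + B x) = integral\<^sup>L M T"
proof -
  have "integrable M (\<lambda>x. (T x - A x + B x) + A x - B x)"
    by (intro Bochner_Integration.integrable_add Bochner_Integration.integrable_diff S A B)
  then show T: "integrable M T" by simp
  show "(LINT x|M. T x - A x + B x) = integral\<^sup>L M T" using T A B z by simp
qed

context level_family
begin

abbreviation D :: "('a \<Rightarrow> complex) \<Rightarrow> ('a \<Rightarrow> complex) \<Rightarrow> real \<Rightarrow> complex" where
  "D a b \<equiv> \<lambda>x. delta_form G P x a b"

context
  fixes a b :: "'a \<Rightarrow> complex"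
  assumes a: "a \<in> test_functions G" and b: "b \<in> test_functions G"
begin

definition kr :: "'a \<Rightarrow> real" where "kr y = Re (cnj (a y) * b y)"
definition ki :: "'a \<Rightarrow> real" where "ki y = Im (cnj (a y) * b y)"

lemma kr: "kr \<in> Cc1 G" and ki: "ki \<in> Cc1 G"
  using test_product_Cc1[OF a b open_G] by (simp_all add: kr_def[abs_def] ki_def[abs_def])

lemma k_eq: "cnj (a y) * b y = complex_of_real (kr y) + \<i> * complex_of_real (ki y)"
  by (simp only: kr_def ki_def complex_eq[symmetric])

lemma
  shows delta_integrable: "integrable (surface_measure (level_set G P x)) (\<lambda>y. cnj (a y) * b y / of_real (norm (grad P y)))"
    and delta_eq: "D a b x = of_real (dens kr x) + \<i> * of_real (dens ki x)"
proof -
  let ?\<mu> = "surface_measure (level_set G P x)"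
  have e: "cnj (a y) * b y / of_real (norm (grad P y))
     = of_real (kr y / norm (grad P y)) + \<i> * of_real (ki y / norm (grad P y))" for y
    unfolding k_eq by (simp add: add_divide_distrib)
  have r: "has_bochner_integral ?\<mu> (\<lambda>y. complex_of_real (kr y / norm (grad P y))) (of_real (dens kr x))"
    using surface_integrable[OF kr, of x] surface_integral[OF kr, of x]
    by (intro has_bochner_integral_of_real) (auto simp: has_bochner_integral_iff)
  have i: "has_bochner_integral ?\<mu> (\<lambda>y. complex_of_real (ki y / norm (grad P y))) (of_real (dens ki x))"
    using surface_integrable[OF ki, of x] surface_integral[OF ki, of x]
    by (intro has_bochner_integral_of_real) (auto simp: has_bochner_integral_iff)
  have "has_bochner_integral ?\<mu> (\<lambda>y. cnj (a y) * b y / of_real (norm (grad P y))) (of_real (dens kr x) + \<i> * of_real (dens ki x))"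
    unfolding e by (intro has_bochner_integral_add r has_bochner_integral_mult_right i)
  then show "integrable ?\<mu> (\<lambda>y. cnj (a y) * b y / of_real (norm (grad P y)))"
    "D a b x = of_real (dens kr x) + \<i> * of_real (dens ki x)"
    by (auto simp: has_bochner_integral_iff delta_form_def)
qed

lemma delta_lipschitz: obtains L where "\<And>x y. cmod (D a b x - D a b y) \<le> L * \<bar>x - y\<bar>"
proof -
  obtain L1 where L1: "\<And>x y. \<bar>dens kr x - dens kr y\<bar> \<le> L1 * \<bar>x - y\<bar>" using dens_lipschitz[OF kr] by metis
  obtain L2 where L2: "\<And>x y. \<bar>dens ki x - dens ki y\<bar> \<le> L2 * \<bar>x - y\<bar>" using dens_lipschitz[OF ki] by metis
  have "cmod (D a b x - D a b y) \<le> (L1 + L2) * \<bar>x - y\<bar>" for x y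
  proof -
    have e: "D a b x - D a b y = of_real (dens kr x - dens kr y) + \<i> * of_real (dens ki x - dens ki y)"
      by (simp add: delta_eq algebra_simps)
    have "cmod (D a b x - D a b y) \<le> \<bar>dens kr x - dens kr y\<bar> + \<bar>dens ki x - dens ki y\<bar>"
      unfolding e by (rule order_trans[OF norm_triangle_ineq]) (simp only: norm_mult norm_of_real norm_ii, simp)
    also have "\<dots> \<le> (L1 + L2) * \<bar>x - y\<bar>" using L1[of x y] L2[of x y] by (simp add: distrib_right)
    finally show ?thesis .
  qed
  then show ?thesis using that by blast
qed

lemma delta_lhold: "lhold (D a b)"
  using delta_lipschitz by (intro lhold_lipschitz) metis

lemma delta_csupp: "csupp (D a b)"
proof -
  have "csupp (dens kr)" "csupp (dens ki)" using is_dens_dens[OF kr] is_dens_dens[OF ki] by (auto simp: is_dens_def)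
  then obtain R1 R2 where "\<And>x. \<bar>x\<bar> > R1 \<Longrightarrow> dens kr x = 0" "\<And>x. \<bar>x\<bar> > R2 \<Longrightarrow> dens ki x = 0"
    unfolding csupp_def by blast
  then show ?thesis
    unfolding csupp_def delta_eq by (intro exI[of _ "max R1 R2"]) auto
qed

lemma delta_zero: "x \<notin> P ` (support a \<inter> support b) \<Longrightarrow> D a b x = 0"
proof -
  assume x: "x \<notin> P ` (support a \<inter> support b)"
  have "support kr \<subseteq> support a \<inter> support b" "support ki \<subseteq> support a \<inter> support b"
    unfolding kr_def ki_def by (intro support_subset; auto simp: not_in_support)+
  then have "x \<notin> P ` support kr" "x \<notin> P ` support ki" using x by auto
  then show ?thesis by (simp add: delta_eq dens_outside kr ki)
qed

text \<open>The place where the Lipschitz continuity of the densities is spent: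
  \<open>hil_lhold\<close> starts from a Lipschitz bound.\<close>

lemma hil_delta_lhold: "lhold (hil (D a b))"
proof -
  obtain L where "\<And>x y. cmod (D a b x - D a b y) \<le> L * \<bar>x - y\<bar>" using delta_lipschitz by metis
  then show ?thesis by (rule hil_lhold[OF _ delta_csupp])
qed

lemma pv_tendsto: "(pv_truncated (D a b) x \<longlongrightarrow> hil (D a b) x) (at_right 0)"
  by (rule pv_truncated_tendsto_hil[OF delta_lhold delta_csupp])

lemma pv_form_eq: "pv_form G P x a b = hil (D a b) x"
  unfolding pv_form_def using pv_tendsto by (intro tendsto_Lim) auto

lemma product_comp_Cc:
  assumes "continuous_on UNIV \<phi>"
  shows "(\<lambda>y. cnj (a y) * b y * \<phi> (P y)) \<in> Cc G"
proof -
  have "(\<lambda>y. cnj (a y) * b y) \<in> Cc G"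
    using test_function_Cc[OF b] open_G
    by (intro Cc_mult_continuous Cc_cnj test_function_Cc[OF a]) (auto simp: Cc_def intro: continuous_on_subset)
  then show ?thesis
    by (rule Cc_mult_continuous[OF _ open_G continuous_on_compose2[OF assms C1_on_continuous[OF C1P]]]) simp
qed

text \<open>The spectral theorem for \<Omega> on test functions: \<open>D a b\<close> is the density
  of the spectral measure of the pair a, b.\<close>

lemma coarea_complex:
  fixes \<phi> :: "real \<Rightarrow> complex"
  assumes \<phi>: "continuous_on UNIV \<phi>"
  shows "(LINT y|lborel. \<phi> (P y) * (cnj (a y) * b y)) = (LINT x|lborel. \<phi> x * D a b x)"
proof -
  define r where "r x = Re (\<phi> x)" for x
  define i where "i x = Im (\<phi> x)" for x
  have \<phi>e: "\<phi> x = of_real (r x) + \<i> * of_real (i x)" for x by (simp only: r_def i_def complex_eq[symmetric])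
  have c: "continuous_on UNIV r" "continuous_on UNIV i" unfolding r_def i_def by (intro continuous_intros \<phi>)+
  have L: "has_bochner_integral lborel (\<lambda>y. complex_of_real (p (P y) * f y)) (of_real (LINT x|lborel. p x * dens f x))"
    if "continuous_on UNIV p" "f \<in> Cc1 G" for p f
    using comp_integrable[OF that(2,1)] coarea[OF that(2,1)]
    by (intro has_bochner_integral_of_real) (simp add: has_bochner_integral_iff)
  have R: "has_bochner_integral lborel (\<lambda>x. complex_of_real (p x * dens f x)) (of_real (LINT x|lborel. p x * dens f x))"
    if "continuous_on UNIV p" "f \<in> Cc1 G" for p f
    using integrable_mult_csupp[OF that(1), of "dens f"] is_dens_dens[OF that(2)]
    by (intro has_bochner_integral_of_real) (auto simp: has_bochner_integral_iff is_dens_def)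
  let ?I = "\<lambda>p f. complex_of_real (LINT x|lborel. p x * dens f x)"
  let ?T = "?I r kr + \<i> * ?I r ki + \<i> * ?I i kr - ?I i ki"
  have e1: "\<phi> (P y) * (cnj (a y) * b y) = of_real (r (P y) * kr y) + \<i> * of_real (r (P y) * ki y)
      + \<i> * of_real (i (P y) * kr y) - of_real (i (P y) * ki y)" for y
    unfolding k_eq \<phi>e by (simp add: algebra_simps)
  have e2: "\<phi> x * D a b x = of_real (r x * dens kr x) + \<i> * of_real (r x * dens ki x)
      + \<i> * of_real (i x * dens kr x) - of_real (i x * dens ki x)" for x
    unfolding delta_eq \<phi>e by (simp add: algebra_simps)
  have "has_bochner_integral lborel (\<lambda>y. \<phi> (P y) * (cnj (a y) * b y)) ?T"
    unfolding e1 by (intro has_bochner_integral_diff has_bochner_integral_add has_bochner_integral_mult_right L c kr ki; simp)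
  moreover have "has_bochner_integral lborel (\<lambda>x. \<phi> x * D a b x) ?T"
    unfolding e2 by (intro has_bochner_integral_diff has_bochner_integral_add has_bochner_integral_mult_right R c kr ki; simp)
  ultimately show ?thesis by (simp add: has_bochner_integral_iff)
qed

end

subsection \<open>Products of smeared functionals\<close>

text \<open>The bra is \<open>\<phi> \<langle>a|\<delta>(x-\<Omega>) + \<alpha> \<langle>h|\<delta>(x-\<Omega>) + \<beta> \<langle>h|\<P>/(x-\<Omega>)\<close>; since the principal value is a
  Hilbert transform, integration over \<open>x\<close> moves it onto \<open>\<beta>\<close>.\<close>
definition bra_rep :: "('a \<Rightarrow> complex) \<Rightarrow> ('a \<Rightarrow> complex) \<Rightarrow> (real \<Rightarrow> complex) \<Rightarrow> (real \<Rightarrow> complex) \<Rightarrow> (real \<Rightarrow> complex) \<Rightarrow> 'a \<Rightarrow> complex" where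
  "bra_rep a h \<phi> \<alpha> \<beta> y = cnj (\<phi> (P y)) * a y + cnj (\<alpha> (P y) - hil \<beta> (P y)) * h y"

definition ket_rep :: "('a \<Rightarrow> complex) \<Rightarrow> ('a \<Rightarrow> complex) \<Rightarrow> (real \<Rightarrow> complex) \<Rightarrow> (real \<Rightarrow> complex) \<Rightarrow> (real \<Rightarrow> complex) \<Rightarrow> 'a \<Rightarrow> complex" where
  "ket_rep b g \<phi> \<alpha> \<beta> y = \<phi> (P y) * b y + (\<alpha> (P y) - hil \<beta> (P y)) * g y"

text \<open>\<beta> has to possess a Hilbert transform, \<phi> and \<alpha> are only composed with
  P; compact support of the integrals over x comes from \<beta> or from the densities.\<close>

definition admissible :: "(real \<Rightarrow> complex) \<Rightarrow> (real \<Rightarrow> complex) \<Rightarrow> (real \<Rightarrow> complex) \<Rightarrow> bool" where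
  "admissible \<phi> \<alpha> \<beta> \<longleftrightarrow> continuous_on UNIV \<phi> \<and> continuous_on UNIV \<alpha> \<and> lhold \<beta> \<and> csupp \<beta>"

lemma ket_rep_Cc:
  assumes b: "b \<in> test_functions G" and g: "g \<in> test_functions G" and adm: "admissible \<phi> \<alpha> \<beta>"
  shows "ket_rep b g \<phi> \<alpha> \<beta> \<in> Cc G"
proof -
  have c: "continuous_on UNIV \<phi>" "continuous_on UNIV (\<lambda>x. \<alpha> x - hil \<beta> x)"
    using adm by (auto simp: admissible_def intro!: continuous_intros hil_continuous)
  have "(\<lambda>y. b y * \<phi> (P y)) \<in> Cc G" "(\<lambda>y. g y * (\<alpha> (P y) - hil \<beta> (P y))) \<in> Cc G"
    by (intro Cc_mult_continuous test_function_Cc b g open_G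
       continuous_on_compose2[OF c(1) C1_on_continuous[OF C1P]] continuous_on_compose2[OF c(2) C1_on_continuous[OF C1P]]; simp)+
  from Cc_add[OF this] show ?thesis by (simp add: ket_rep_def[abs_def] mult.commute)
qed

lemma bra_rep_eq: "bra_rep a h \<phi> \<alpha> \<beta> = ket_rep a h (\<lambda>x. cnj (\<phi> x)) (\<lambda>x. cnj (\<alpha> x)) (\<lambda>x. cnj (\<beta> x))"
  by (simp add: bra_rep_def ket_rep_def fun_eq_iff hil_cnj)

lemma admissible_cnj: "admissible \<phi> \<alpha> \<beta> \<Longrightarrow> admissible (\<lambda>x. cnj (\<phi> x)) (\<lambda>x. cnj (\<alpha> x)) (\<lambda>x. cnj (\<beta> x))"
  by (auto simp: admissible_def intro: continuous_intros lhold_cnj csupp_cnj)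

lemma bra_rep_Cc:
  assumes "a \<in> test_functions G" "h \<in> test_functions G" "admissible \<phi> \<alpha> \<beta>"
  shows "bra_rep a h \<phi> \<alpha> \<beta> \<in> Cc G"
  unfolding bra_rep_eq by (intro ket_rep_Cc admissible_cnj assms)

lemma inner_L2_Cc: "u \<in> Cc G \<Longrightarrow> v \<in> Cc G \<Longrightarrow> inner_L2 G u v = (LINT y|lborel. cnj (u y) * v y)"
  unfolding inner_L2_def
proof (rule integral_lebesgue_on_supported[OF open_G])
  assume u: "u \<in> Cc G" and v: "v \<in> Cc G"
  show "(\<lambda>y. cnj (u y) * v y) \<in> borel_measurable borel"
    using u v by (intro borel_measurable_continuous_onI continuous_intros) (auto simp: Cc_def)
qed (simp add: Cc_zero_outside)

lemma smear_bra:
  assumes a: "a \<in> test_functions G" and h: "h \<in> test_functions G" and f: "f \<in> test_functions G" and adm: "admissible \<phi> \<alpha> \<beta>"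
  shows "has_bochner_integral lborel (\<lambda>x. \<phi> x * D a f x + \<alpha> x * D h f x + \<beta> x * hil (D h f) x)
     (inner_L2 G (bra_rep a h \<phi> \<alpha> \<beta>) f)"
proof -
  have A: "continuous_on UNIV \<phi>" "continuous_on UNIV \<alpha>" "lhold \<beta>" "csupp \<beta>" using adm by (auto simp: admissible_def)
  have cH: "continuous_on UNIV (hil \<beta>)" by (rule hil_continuous[OF A(3,4)])
  note cs = delta_csupp[OF a f] delta_csupp[OF h f]
  note lh = delta_lhold[OF a f] delta_lhold[OF h f] hil_delta_lhold[OF h f]
  have i: "integrable lborel (\<lambda>x. \<phi> x * D a f x)" "integrable lborel (\<lambda>x. \<alpha> x * D h f x)"
     "integrable lborel (\<lambda>x. \<beta> x * hil (D h f) x)" "integrable lborel (\<lambda>x. hil \<beta> x * D h f x)"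
    by (intro integrable_continuous_csupp continuous_intros A(1,2) cH lhold_continuous[OF lh(1)] lhold_continuous[OF lh(2)]
         lhold_continuous[OF lh(3)] lhold_continuous[OF A(3)] csupp_mult2[OF cs(1)] csupp_mult2[OF cs(2)] csupp_mult1 A(4))+
  have "inner_L2 G (bra_rep a h \<phi> \<alpha> \<beta>) f
      = (LINT y|lborel. \<phi> (P y) * (cnj (a y) * f y) + (\<alpha> (P y) - hil \<beta> (P y)) * (cnj (h y) * f y))"
    unfolding inner_L2_Cc[OF bra_rep_Cc[OF a h adm] test_function_Cc[OF f]]
    by (intro Bochner_Integration.integral_cong refl) (simp add: bra_rep_def algebra_simps)
  also have "\<dots> = (LINT y|lborel. \<phi> (P y) * (cnj (a y) * f y)) + (LINT y|lborel. (\<alpha> (P y) - hil \<beta> (P y)) * (cnj (h y) * f y))"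
    using Cc_integrable[OF product_comp_Cc[OF a f A(1)]] Cc_integrable[OF product_comp_Cc[OF h f continuous_on_diff[OF A(2) cH]]]
    by (intro Bochner_Integration.integral_add) (simp_all add: mult.commute)
  also have "\<dots> = (LINT x|lborel. \<phi> x * D a f x) + (LINT x|lborel. (\<alpha> x - hil \<beta> x) * D h f x)"
    using coarea_complex[OF a f A(1)] coarea_complex[OF h f continuous_on_diff[OF A(2) cH]] by simp
  also have "\<dots> = (LINT x|lborel. \<phi> x * D a f x) + (LINT x|lborel. \<alpha> x * D h f x) - (LINT x|lborel. hil \<beta> x * D h f x)"
    using i by (simp add: left_diff_distrib)
  also have "(LINT x|lborel. hil \<beta> x * D h f x) = - (LINT x|lborel. \<beta> x * hil (D h f) x)"
    using hil_antisymmetric[OF lh(2) cs(2) A(3,4)] by (simp add: mult.commute)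
  finally show ?thesis using i by (simp add: has_bochner_integral_iff)
qed

lemma delta_cnj: "D a b x = cnj (D b a x)"
  unfolding delta_form_def by (simp add: mult.commute flip: Bochner_Integration.integral_cnj)

text \<open>Conjugation exchanges bras and kets and commutes with H.\<close>

lemma smear_ket:
  assumes b: "b \<in> test_functions G" and g: "g \<in> test_functions G" and f: "f \<in> test_functions G" and adm: "admissible \<phi> \<alpha> \<beta>"
  shows "has_bochner_integral lborel (\<lambda>x. \<phi> x * D f b x + \<alpha> x * D f g x + \<beta> x * hil (D f g) x)
     (inner_L2 G f (ket_rep b g \<phi> \<alpha> \<beta>))"
proof -
  have "hil (D f g) x = cnj (hil (D g f) x)" for x
    using hil_cnj[of "D g f" x] delta_cnj[where a = f and b = g] by (simp add: fun_eq_iff)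
  then have "\<phi> x * D f b x + \<alpha> x * D f g x + \<beta> x * hil (D f g) x =
     cnj (cnj (\<phi> x) * D b f x + cnj (\<alpha> x) * D g f x + cnj (\<beta> x) * hil (D g f) x)" for x
    using delta_cnj[where a = f and b = b and x = x] delta_cnj[where a = f and b = g and x = x] by simp
  moreover have "inner_L2 G f (ket_rep b g \<phi> \<alpha> \<beta>) = cnj (inner_L2 G (bra_rep b g (\<lambda>x. cnj (\<phi> x)) (\<lambda>x. cnj (\<alpha> x)) (\<lambda>x. cnj (\<beta> x))) f)"
    unfolding bra_rep_eq by (simp flip: inner_L2_cnj)
  ultimately show ?thesis
    using has_bochner_integral_cnj[OF smear_bra[OF b g f admissible_cnj[OF adm]]] by simp
qed

text \<open>The conditions \<open>c1\<close>, \<open>c2\<close> cancel all terms containing a single Hilbert transform of \<open>\<beta>\<^sub>1\<close> or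
  \<open>\<beta>\<^sub>2\<close>; the terms with two of them are evaluated by \<open>hil_trilinear\<close>.\<close>
lemma inner_reps:
  assumes a: "a \<in> test_functions G" and b: "b \<in> test_functions G"
    and g: "g \<in> test_functions G" and h: "h \<in> test_functions G"
    and adm1: "admissible \<phi>1 \<alpha>1 \<beta>1" and adm2: "admissible \<phi>2 \<alpha>2 \<beta>2"
    and c1: "\<And>x. \<phi>1 x * D a g x + D h g x * \<alpha>1 x = (1 - hil (D h g) x) * \<beta>1 x"
    and c2: "\<And>x. \<phi>2 x * D h b x + D h g x * \<alpha>2 x = (1 - hil (D h g) x) * \<beta>2 x"
  shows "integrable lborel (\<lambda>x. \<phi>1 x * \<phi>2 x * D a b x + \<phi>1 x * \<alpha>2 x * D a g x + \<phi>2 x * \<alpha>1 x * D h b x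
            + \<alpha>1 x * \<alpha>2 x * D h g x + of_real (pi\<^sup>2) * D h g x * \<beta>1 x * \<beta>2 x)"
    and "inner_L2 G (bra_rep a h \<phi>1 \<alpha>1 \<beta>1) (ket_rep b g \<phi>2 \<alpha>2 \<beta>2) =
     (LINT x|lborel. \<phi>1 x * \<phi>2 x * D a b x + \<phi>1 x * \<alpha>2 x * D a g x + \<phi>2 x * \<alpha>1 x * D h b x
            + \<alpha>1 x * \<alpha>2 x * D h g x + of_real (pi\<^sup>2) * D h g x * \<beta>1 x * \<beta>2 x)"
proof -
  have A: "continuous_on UNIV \<phi>1" "continuous_on UNIV \<alpha>1" "lhold \<beta>1" "csupp \<beta>1"
    "continuous_on UNIV \<phi>2" "continuous_on UNIV \<alpha>2" "lhold \<beta>2" "csupp \<beta>2" using adm1 adm2 by (auto simp: admissible_def)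
  define H1 where "H1 = hil \<beta>1"
  define H2 where "H2 = hil \<beta>2"
  define HD where "HD = hil (D h g)"
  have cH: "continuous_on UNIV H1" "continuous_on UNIV H2" "continuous_on UNIV HD"
    unfolding H1_def H2_def HD_def
    by (intro hil_continuous A delta_lhold[OF h g] delta_csupp[OF h g])+
  have cD: "continuous_on UNIV (D a' b')" if "a' \<in> test_functions G" "b' \<in> test_functions G" for a' b'
    by (rule lhold_continuous[OF delta_lhold[OF that]])
  have c\<beta>: "continuous_on UNIV \<beta>1" "continuous_on UNIV \<beta>2" by (intro lhold_continuous A)+
  have i: "integrable lborel (\<lambda>x. \<phi> x * D a' b' x)"
    if "a' \<in> test_functions G" "b' \<in> test_functions G" "continuous_on UNIV \<phi>" for a' b' \<phi>
    by (intro integrable_continuous_csupp continuous_intros that(3) cD[OF that(1,2)] csupp_mult2[OF delta_csupp[OF that(1,2)]])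
  have co: "has_bochner_integral lborel (\<lambda>y. \<phi> (P y) * (cnj (a' y) * b' y)) (LINT x|lborel. \<phi> x * D a' b' x)"
    if "a' \<in> test_functions G" "b' \<in> test_functions G" "continuous_on UNIV \<phi>" for a' b' \<phi>
    using Cc_integrable[OF product_comp_Cc[OF that]] coarea_complex[OF that] by (simp add: has_bochner_integral_iff mult.commute)
  let ?p11 = "\<lambda>x. \<phi>1 x * \<phi>2 x" and ?p12 = "\<lambda>x. \<phi>1 x * (\<alpha>2 x - H2 x)" and ?p21 = "\<lambda>x. \<phi>2 x * (\<alpha>1 x - H1 x)"
    and ?p22 = "\<lambda>x. (\<alpha>1 x - H1 x) * (\<alpha>2 x - H2 x)"
  have cp: "continuous_on UNIV ?p11" "continuous_on UNIV ?p12" "continuous_on UNIV ?p21" "continuous_on UNIV ?p22"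
    by (intro continuous_intros A cH)+
  have "has_bochner_integral lborel (\<lambda>y. ?p11 (P y) * (cnj (a y) * b y) + ?p12 (P y) * (cnj (a y) * g y)
      + ?p21 (P y) * (cnj (h y) * b y) + ?p22 (P y) * (cnj (h y) * g y))
      ((LINT x|lborel. ?p11 x * D a b x) + (LINT x|lborel. ?p12 x * D a g x) + (LINT x|lborel. ?p21 x * D h b x) + (LINT x|lborel. ?p22 x * D h g x))"
    by (intro has_bochner_integral_add co[OF a b cp(1)] co[OF a g cp(2)] co[OF h b cp(3)] co[OF h g cp(4)])
  moreover have "cnj (bra_rep a h \<phi>1 \<alpha>1 \<beta>1 y) * ket_rep b g \<phi>2 \<alpha>2 \<beta>2 y = ?p11 (P y) * (cnj (a y) * b y) + ?p12 (P y) * (cnj (a y) * g y)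
      + ?p21 (P y) * (cnj (h y) * b y) + ?p22 (P y) * (cnj (h y) * g y)" for y
    by (simp add: bra_rep_def ket_rep_def H1_def H2_def algebra_simps)
  ultimately have I1: "inner_L2 G (bra_rep a h \<phi>1 \<alpha>1 \<beta>1) (ket_rep b g \<phi>2 \<alpha>2 \<beta>2)
      = (LINT x|lborel. ?p11 x * D a b x) + (LINT x|lborel. ?p12 x * D a g x) + (LINT x|lborel. ?p21 x * D h b x) + (LINT x|lborel. ?p22 x * D h g x)"
    unfolding inner_L2_Cc[OF bra_rep_Cc[OF a h adm1] ket_rep_Cc[OF b g adm2]] by (simp add: has_bochner_integral_iff)
  also have "\<dots> = (LINT x|lborel. ?p11 x * D a b x + ?p12 x * D a g x + ?p21 x * D h b x + ?p22 x * D h g x)"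
    using i[OF a b cp(1)] i[OF a g cp(2)] i[OF h b cp(3)] i[OF h g cp(4)] by simp
  finally have I2: "inner_L2 G (bra_rep a h \<phi>1 \<alpha>1 \<beta>1) (ket_rep b g \<phi>2 \<alpha>2 \<beta>2)
     = (LINT x|lborel. ?p11 x * D a b x + ?p12 x * D a g x + ?p21 x * D h b x + ?p22 x * D h g x)" .
  have iS: "integrable lborel (\<lambda>x. ?p11 x * D a b x + ?p12 x * D a g x + ?p21 x * D h b x + ?p22 x * D h g x)"
    by (intro Bochner_Integration.integrable_add i[OF a b cp(1)] i[OF a g cp(2)] i[OF h b cp(3)] i[OF h g cp(4)])
  \<comment> \<open>Both have integral 0: ?A by antisymmetry of H, ?B by the trilinear identity for
    \<open>D h g\<close>, \<beta>1 and \<beta>2.\<close>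
  let ?A = "\<lambda>x. \<beta>1 x * H2 x + \<beta>2 x * H1 x"
  let ?B = "\<lambda>x. D h g x * H1 x * H2 x + \<beta>1 x * HD x * H2 x + \<beta>2 x * HD x * H1 x - of_real (pi\<^sup>2) * D h g x * \<beta>1 x * \<beta>2 x"
  have iA': "integrable lborel (\<lambda>x. \<beta>1 x * H2 x)" "integrable lborel (\<lambda>x. \<beta>2 x * H1 x)"
    by (intro integrable_continuous_csupp continuous_intros c\<beta> cH csupp_mult1 A)+
  have iA: "integrable lborel ?A" by (intro Bochner_Integration.integrable_add iA')
  have zA: "(LINT x|lborel. ?A x) = 0"
    using iA' hil_antisymmetric[OF A(3,4) A(7,8)] by (simp add: H1_def H2_def)
  have iB: "integrable lborel ?B"
  proof (rule integrable_continuous_csupp)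
    show "continuous_on UNIV ?B" by (intro continuous_intros c\<beta> cH cD h g)
    have "csupp (\<lambda>x. D h g x * H1 x * H2 x + \<beta>1 x * HD x * H2 x + \<beta>2 x * HD x * H1 x + (- of_real (pi\<^sup>2)) * D h g x * \<beta>1 x * \<beta>2 x)"
      by (intro csupp_add csupp_mult1 csupp_mult2[OF A(8)] A delta_csupp[OF h g])
    then show "csupp ?B" by simp
  qed
  have zB: "(LINT x|lborel. ?B x) = 0"
    using hil_trilinear[OF delta_lhold[OF h g] delta_csupp[OF h g] A(3,4) A(7,8)]
    by (simp add: H1_def H2_def HD_def)
  let ?T = "\<lambda>x. \<phi>1 x * \<phi>2 x * D a b x + \<phi>1 x * \<alpha>2 x * D a g x + \<phi>2 x * \<alpha>1 x * D h b x
            + \<alpha>1 x * \<alpha>2 x * D h g x + of_real (pi\<^sup>2) * D h g x * \<beta>1 x * \<beta>2 x"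
  have e: "?p11 x * D a b x + ?p12 x * D a g x + ?p21 x * D h b x + ?p22 x * D h g x = ?T x - ?A x + ?B x" for x
  proof -
    have "?p11 x * D a b x + ?p12 x * D a g x + ?p21 x * D h b x + ?p22 x * D h g x
      = ?T x - H2 x * (\<phi>1 x * D a g x + D h g x * \<alpha>1 x) - H1 x * (\<phi>2 x * D h b x + D h g x * \<alpha>2 x)
        + D h g x * H1 x * H2 x - of_real (pi\<^sup>2) * D h g x * \<beta>1 x * \<beta>2 x"
      by (simp add: algebra_simps)
    also have "\<dots> = ?T x - ?A x + ?B x"
      \<comment> \<open>The brackets next to H2 and H1 become (1 - HD) \<beta>1 and (1 - HD)
        \<beta>2; the 1 yields the terms of ?A, HD the mixed terms of ?B.\<close>
      unfolding c1 c2 HD_def[symmetric] by (simp add: algebra_simps)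
    finally show ?thesis .
  qed
  have "integrable lborel (\<lambda>x. ?T x - ?A x + ?B x)" using iS unfolding e .
  note T = integrable_up_to_null_integrals[OF this iA iB zA zB]
  show "integrable lborel ?T" by (rule T(1))
  show "inner_L2 G (bra_rep a h \<phi>1 \<alpha>1 \<beta>1) (ket_rep b g \<phi>2 \<alpha>2 \<beta>2) = (LINT x|lborel. ?T x)"
    unfolding I2 e by (rule T(2))
qed

text \<open>The common frame of all five relations: what remains to be given are the coefficients,
  the two linear conditions and a pointwise identity for c. The countable set Z absorbs the points
  at which the functionals are not given by the coefficient formula.\<close>

lemma has_product_reps:
  assumes a: "a \<in> test_functions G" and b: "b \<in> test_functions G"
    and g: "g \<in> test_functions G" and h: "h \<in> test_functions G"
    and adm1: "admissible \<phi>1 \<alpha>1 \<beta>1" and adm2: "admissible \<phi>2 \<alpha>2 \<beta>2"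
    and c1: "\<And>x. \<phi>1 x * D a g x + D h g x * \<alpha>1 x = (1 - hil (D h g) x) * \<beta>1 x"
    and c2: "\<And>x. \<phi>2 x * D h b x + D h g x * \<alpha>2 x = (1 - hil (D h g) x) * \<beta>2 x"
    and Z: "countable Z"
    and B: "\<And>x f. x \<notin> Z \<Longrightarrow> f \<in> test_functions G \<Longrightarrow> \<psi>1 x * B x f = \<phi>1 x * D a f x + \<alpha>1 x * D h f x + \<beta>1 x * hil (D h f) x"
    and K: "\<And>x f. x \<notin> Z \<Longrightarrow> f \<in> test_functions G \<Longrightarrow> \<psi>2 x * K x f = \<phi>2 x * D f b x + \<alpha>2 x * D f g x + \<beta>2 x * hil (D f g) x"
    and c: "\<And>x. x \<notin> Z \<Longrightarrow> \<phi>1 x * \<phi>2 x * D a b x + \<phi>1 x * \<alpha>2 x * D a g x + \<phi>2 x * \<alpha>1 x * D h b x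
            + \<alpha>1 x * \<alpha>2 x * D h g x + of_real (pi\<^sup>2) * D h g x * \<beta>1 x * \<beta>2 x = c x"
  shows "integrable lborel c \<and> has_product G \<psi>1 B \<psi>2 K (LINT x|lborel. c x)"
proof -
  have dd: "has_bochner_integral lborel k' I" if "has_bochner_integral lborel k I" "\<And>x. x \<notin> Z \<Longrightarrow> k x = k' x"
    for k k' :: "real \<Rightarrow> complex" and I
  proof -
    have "integrable lborel k \<longleftrightarrow> integrable lborel k'" "integral\<^sup>L lborel k = integral\<^sup>L lborel k'"
      using that(2) Z by (intro integrable_discrete_difference[of Z] integral_discrete_difference[of Z]; simp)+
    then show ?thesis using that(1) by (simp add: has_bochner_integral_iff)
  qed
  have ic: "has_bochner_integral lborel c (inner_L2 G (bra_rep a h \<phi>1 \<alpha>1 \<beta>1) (ket_rep b g \<phi>2 \<alpha>2 \<beta>2))"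
    by (rule dd[OF _ c]) (use inner_reps[OF a b g h adm1 adm2 c1 c2] in \<open>simp_all add: has_bochner_integral_iff\<close>)
  have sB: "has_bochner_integral lborel (\<lambda>x. \<psi>1 x * B x f) (inner_L2 G (bra_rep a h \<phi>1 \<alpha>1 \<beta>1) f)" if f: "f \<in> test_functions G" for f
    by (rule dd[OF smear_bra[OF a h f adm1]]) (simp add: B f)
  have sK: "has_bochner_integral lborel (\<lambda>x. \<psi>2 x * K x f) (inner_L2 G f (ket_rep b g \<phi>2 \<alpha>2 \<beta>2))" if f: "f \<in> test_functions G" for f
    by (rule dd[OF smear_ket[OF b g f adm2]]) (simp add: K f)
  have "has_product G \<psi>1 B \<psi>2 K (LINT x|lborel. c x)"
  proof (rule has_productI[OF open_G])
    show "bra_rep a h \<phi>1 \<alpha>1 \<beta>1 \<in> L2 G" by (intro Cc_L2 open_G bra_rep_Cc a h adm1)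
    show "ket_rep b g \<phi>2 \<alpha>2 \<beta>2 \<in> L2 G" by (intro Cc_L2 open_G ket_rep_Cc b g adm2)
  qed (use sB sK ic in \<open>auto simp: smearable_def smear_def has_bochner_integral_iff\<close>)
  then show ?thesis using ic by (simp add: has_bochner_integral_iff)
qed

end

subsection \<open>Zeros of \<open>1 - C\<close> outside the support\<close>

lemma cauchy_integral_segment_holomorphic:
  assumes b: "lhold b" and U: "convex U" "\<And>z t. z \<in> U \<Longrightarrow> p \<le> t \<Longrightarrow> t \<le> q \<Longrightarrow> z \<noteq> of_real t"
  shows "(\<lambda>z. LINT t|lborel. indicator {p..q} t *\<^sub>R (b t / (z - of_real t))) holomorphic_on U"
proof -
  have cont: "continuous_on (cbox p q) (\<lambda>t. b t / (z - of_real t))" if "z \<in> U" for z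
    using U(2)[OF that] by (intro continuous_intros lhold_continuous b) auto
  have eq: "(LINT t|lborel. indicator {p..q} t *\<^sub>R (b t / (z - of_real t))) = integral (cbox p q) (\<lambda>t. b t / (z - of_real t))" if "z \<in> U" for z
  proof -
    have si: "set_integrable lborel (cbox p q) (\<lambda>t. b t / (z - of_real t))"
      unfolding set_integrable_def by (intro borel_integrable_compact cont that) auto
    then show ?thesis using set_borel_integral_eq_integral(2)[OF si] by (simp add: set_lebesgue_integral_def)
  qed
  have "(\<lambda>z. integral (cbox p q) (\<lambda>t. b t / (z - of_real t))) holomorphic_on U"
  proof (rule leibniz_rule_holomorphic[OF _ _ _ U(1)])
    show "((\<lambda>z. b t / (z - of_real t)) has_field_derivative - b t / (z - of_real t)^2) (at z within U)"
      if "z \<in> U" "t \<in> cbox p q" for z t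
    proof -
      have "z - of_real t \<noteq> 0" using U(2)[OF that(1), of t] that(2) by auto
      then show ?thesis by (auto intro!: derivative_eq_intros simp: power2_eq_square)
    qed
    show "(\<lambda>t. b t / (z - of_real t)) integrable_on cbox p q" if "z \<in> U" for z
      using that by (intro integrable_continuous cont) auto
    show "continuous_on (U \<times> cbox p q) (\<lambda>(z, t). - b t / (z - of_real t)^2)"
      unfolding case_prod_beta using U(2)
      by (intro continuous_intros continuous_on_compose2[OF lhold_continuous[OF b, of UNIV]]) auto
  qed
  then show ?thesis
    by (rule holomorphic_transform) (simp add: eq)
qed

text \<open>Around a gap the integral splits into one over [-R, x - d] and one over [x + d, R]; the
  ball meets neither segment.\<close>

lemma ctr_holomorphic_gap:
  assumes b: "lhold b" "csupp b" and d: "\<And>t. \<bar>t - x\<bar> < d \<Longrightarrow> b t = 0"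
  shows "ctr b holomorphic_on ball (of_real x) d"
proof -
  obtain R where R: "R > 0" "\<And>x. \<bar>x\<bar> > R \<Longrightarrow> b x = 0" using csuppE[OF b(2)] by metis
  have cb: "z \<noteq> of_real t" if "z \<in> ball (of_real x) d" "\<bar>t - x\<bar> \<ge> d" for z :: complex and t
  proof
    assume "z = of_real t"
    then have "dist (of_real x) z = \<bar>t - x\<bar>"
      by (simp add: dist_of_real dist_real_def abs_minus_commute)
    then show False using that by auto
  qed
  let ?I = "\<lambda>p q z. LINT t|lborel. indicator {p..q} t *\<^sub>R (b t / (z - of_real t))"
  have "(\<lambda>z. ?I (-R) (x - d) z + ?I (x + d) R z) holomorphic_on ball (of_real x) d"
    by (intro holomorphic_intros cauchy_integral_segment_holomorphic b cb convex_ball) auto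
  moreover have "?I (-R) (x - d) z + ?I (x + d) R z = ctr b z" if z: "z \<in> ball (of_real x) d" for z
  proof -
    have "0 < d" using z by (metis ball_eq_empty empty_iff not_less)
    have c: "continuous_on (cbox p q) (\<lambda>t. b t / (z - of_real t))" if "q \<le> x - d \<or> x + d \<le> p" for p q
    proof (intro continuous_intros lhold_continuous b ballI)
      fix t assume "t \<in> cbox p q"
      then have "\<bar>t - x\<bar> \<ge> d" using that by (auto simp: abs_if)
      then show "z - of_real t \<noteq> 0" using cb[OF z, of t] by auto
    qed
    have i: "integrable lborel (\<lambda>t. indicator {p..q} t *\<^sub>R (b t / (z - of_real t)))" if "q \<le> x - d \<or> x + d \<le> p" for p q
      using borel_integrable_compact[OF _ c[OF that]] by simp
    have "?I (-R) (x - d) z + ?I (x + d) R z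
       = (LINT t|lborel. indicator {-R..x - d} t *\<^sub>R (b t / (z - of_real t)) + indicator {x + d..R} t *\<^sub>R (b t / (z - of_real t)))"
      using i[of "x - d" "-R"] i[of R "x + d"] by simp
    also have "\<dots> = ctr b z"
      unfolding ctr_def
    proof (intro Bochner_Integration.integral_cong refl)
      fix t
      show "indicator {-R..x - d} t *\<^sub>R (b t / (z - of_real t)) + indicator {x + d..R} t *\<^sub>R (b t / (z - of_real t)) = b t / (z - of_real t)"
      proof (cases "b t = 0")
        case False
        then have "\<bar>t\<bar> \<le> R" "\<bar>t - x\<bar> \<ge> d" using R(2) d by (meson not_le)+
        then show ?thesis using \<open>0 < d\<close> by (auto simp: indicator_def abs_if split: if_splits)
      qed simp
    qed
    finally show ?thesis .
  qed
  ultimately show ?thesis by (rule holomorphic_transform)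
qed

text \<open>Near a point off K, ctr b is holomorphic across the real axis and its values there are
  those of hil b. The solutions of hil b = 1 are therefore zeros of a holomorphic function that is
  not identically 0; Lindelof's theorem passes from local to global countability.\<close>

lemma countable_zeros_gap:
  assumes b: "lhold b" "csupp b" and K: "closed K" and bK: "\<And>t. t \<notin> K \<Longrightarrow> b t = 0"
  shows "countable {x. x \<notin> K \<and> hil b x = 1}"
proof -
  have loc: "\<exists>V. open V \<and> x \<in> V \<and> countable {y \<in> V. hil b y = 1}" if x: "x \<notin> K" for x
  proof -
    have "open (- K)" by (rule open_Compl[OF K])
    then obtain d where d: "d > 0" "ball x d \<subseteq> - K" using x open_contains_ball by blast
    have bd: "b t = 0" if "\<bar>t - x\<bar> < d" for t
    proof (rule bK)
      have "t \<in> ball x d" using that by (simp add: dist_real_def abs_minus_commute)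
      then show "t \<notin> K" using d(2) by blast
    qed
    \<comment> \<open>The upper half plane is joined to the ball because the decay at infinity there
      excludes that 1 - ctr b vanishes identically.\<close>
    define S where "S = ball (of_real x :: complex) d \<union> {z. Im z > 0}"
    have oS: "open S" unfolding S_def by (intro open_Un open_ball open_halfspace_Im_gt)
    have hol: "ctr b holomorphic_on S"
      unfolding S_def
      by (intro holomorphic_on_Un ctr_holomorphic_gap ctr_holomorphic b bd open_ball open_halfspace_Im_gt)
    have conn: "connected S"
      unfolding S_def
    proof (rule connected_Un)
      have "Complex x (d / 2) \<in> ball (of_real x) d \<inter> {z. Im z > 0}"
        using d(1) by (simp add: dist_norm cmod_def)
      then show "ball (of_real x) d \<inter> {z. Im z > 0} \<noteq> {}" by blast
    qed (auto intro: convex_connected convex_halfspace_Im_gt)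
    have cz: "countable {z \<in> S. 1 - ctr b z = 0}"
    proof (cases "(\<lambda>z. 1 - ctr b z) constant_on S")
      case True
      obtain B R where B: "B \<ge> 0" "R > 0" "\<And>z. cmod z \<ge> R \<Longrightarrow> cmod (ctr b z) \<le> B / cmod z"
        using ctr_decay[OF b] by metis
      \<comment> \<open>At this height the decay bound is B / (R + B) < 1, so 1 - ctr b is nonzero
        at z1.\<close>
      define z1 where "z1 = Complex 0 (R + B)"
      have "cmod z1 = R + B" using B by (simp add: z1_def cmod_def)
      then have "cmod (ctr b z1) \<le> B / (R + B)" using B(3)[of z1] B by auto
      also have "\<dots> < 1" using B by (simp add: field_simps)
      finally have "1 - ctr b z1 \<noteq> 0" by auto
      moreover have "z1 \<in> S" using B by (simp add: S_def z1_def)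
      moreover obtain c where c: "\<And>z. z \<in> S \<Longrightarrow> 1 - ctr b z = c"
        using True unfolding constant_on_def by blast
      ultimately have "c \<noteq> 0" by metis
      then have "{z \<in> S. 1 - ctr b z = 0} = {}" using c by blast
      then show ?thesis by (metis countable_empty)
    next
      case False
      then show ?thesis
      proof (intro holomorphic_countable_zeros oS conn holomorphic_intros hol)
        obtain C :: "nat \<Rightarrow> complex set" where "\<And>n. compact (C n)" "\<Union>(range C) = S"
          using open_Union_compact_subsets[OF oS] by metis
        then show "fsigma S" using fsigma.intros[of C] compact_imp_closed by metis
      qed
    qed
    have eq: "hil b y = ctr b (of_real y)" if y: "\<bar>y - x\<bar> < d" for y
    proof -
      have yS: "of_real y \<in> S"
        using y by (simp add: S_def dist_of_real dist_real_def abs_minus_commute)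
      have "isCont (ctr b) (of_real y)"
        using holomorphic_on_imp_continuous_on[OF hol] oS yS by (simp add: continuous_on_eq_continuous_at)
      moreover have "((\<lambda>u. Complex y u) \<longlongrightarrow> of_real y) (at_right 0)"
        unfolding Complex_eq by (auto intro!: tendsto_eq_intros)
      ultimately have "((\<lambda>u. ctr b (Complex y u)) \<longlongrightarrow> ctr b (of_real y)) (at_right 0)"
        by (rule isCont_tendsto_compose)
      moreover have "((\<lambda>u. ctr b (Complex y u)) \<longlongrightarrow> hil b y) (at_right 0)"
        using plemelj_right[OF b, of y] bd[OF y] by simp
      ultimately show ?thesis by (intro tendsto_unique[OF trivial_limit_at_right_real])
    qed
    have "of_real ` {y \<in> ball x d. hil b y = 1} \<subseteq> {z \<in> S. 1 - ctr b z = 0}"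
      using eq by (auto simp: S_def dist_real_def abs_minus_commute)
    then have "countable (complex_of_real ` {y \<in> ball x d. hil b y = 1})" using cz countable_subset by blast
    then have "countable {y \<in> ball x d. hil b y = 1}"
      by (rule countable_image_inj_on) (simp add: inj_on_def)
    then show ?thesis using d(1) by (intro exI[of _ "ball x d"]) auto
  qed
  define \<F> where "\<F> = {V. open V \<and> countable {y \<in> V. hil b y = 1}}"
  have "open V" if "V \<in> \<F>" for V using that by (simp add: \<F>_def)
  then obtain \<F>' where F: "\<F>' \<subseteq> \<F>" "countable \<F>'" "\<Union>\<F>' = \<Union>\<F>" by (rule Lindelof)
  have "countable (\<Union>V\<in>\<F>'. {y \<in> V. hil b y = 1})"
    using F by (intro countable_UN) (auto simp: \<F>_def)
  moreover have "{x. x \<notin> K \<and> hil b x = 1} \<subseteq> (\<Union>V\<in>\<F>'. {y \<in> V. hil b y = 1})"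
  proof
    fix x assume x: "x \<in> {x. x \<notin> K \<and> hil b x = 1}"
    then obtain V where "V \<in> \<F>" "x \<in> V" using loc[of x] unfolding \<F>_def by blast
    then have "x \<in> \<Union>\<F>'" unfolding F(3) by blast
    then show "x \<in> (\<Union>V\<in>\<F>'. {y \<in> V. hil b y = 1})" using x by blast
  qed
  ultimately show ?thesis using countable_subset by blast
qed

subsection \<open>The resolvent of \<open>H\<close> and its boundary values\<close>

context level_family
begin

lemma res_kernel_continuous: "Im z \<noteq> 0 \<Longrightarrow> continuous_on UNIV (\<lambda>t. 1 / (z - complex_of_real t))"
  by (intro continuous_intros) (auto simp: complex_eq_iff)

lemma res_Omega_Cc:
  assumes b: "b \<in> test_functions G" and z: "Im z \<noteq> 0"
  shows "res_Omega P z b \<in> Cc G"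
proof -
  have "(\<lambda>y. b y * (1 / (z - complex_of_real (P y)))) \<in> Cc G"
    by (rule Cc_mult_continuous[OF test_function_Cc[OF b] open_G
       continuous_on_compose2[OF res_kernel_continuous[OF z] C1_on_continuous[OF C1P]]]) simp
  then show ?thesis by (simp add: res_Omega_def[abs_def])
qed

lemma inner_res_Omega:
  assumes a: "a \<in> test_functions G" and b: "b \<in> test_functions G" and z: "Im z \<noteq> 0"
  shows "inner_L2 G a (res_Omega P z b) = ctr (D a b) z"
proof -
  have "inner_L2 G a (res_Omega P z b) = (LINT y|lborel. (1 / (z - of_real (P y))) * (cnj (a y) * b y))"
    unfolding inner_L2_Cc[OF test_function_Cc[OF a] res_Omega_Cc[OF b z]] by (simp add: res_Omega_def)
  also have "\<dots> = ctr (D a b) z"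
    unfolding coarea_complex[OF a b res_kernel_continuous[OF z]] ctr_def by simp
  finally show ?thesis .
qed

lemma inner_L2_add: "u \<in> L2 G \<Longrightarrow> v \<in> L2 G \<Longrightarrow> w \<in> L2 G \<Longrightarrow> inner_L2 G u (\<lambda>y. v y + c * w y) = inner_L2 G u v + c * inner_L2 G u w"
  using L2_product_integrable[of u G v] L2_product_integrable[of u G w]
  unfolding inner_L2_def by (simp add: distrib_left mult.left_commute[of _ c])

text \<open>The resolvent is an arbitrary solution of (z - H) u = f2. Existence follows from the
  explicit rank one formula. Conversely any solution equals R_\<Omega>(z) f2 + S R_\<Omega>(z) g
  almost everywhere with S = <h|u>, and pairing with h determines S.\<close>

lemma inner_res_Ham:
  assumes g: "g \<in> test_functions G" and h: "h \<in> test_functions G"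
    and f1: "f1 \<in> test_functions G" and f2: "f2 \<in> test_functions G"
    and z: "Im z \<noteq> 0" and C: "1 - ctr (D h g) z \<noteq> 0"
  shows "inner_L2 G f1 (res_Ham G P g h z f2) = ctr (D f1 f2) z + ctr (D f1 g) z * ctr (D h f2) z / (1 - ctr (D h g) z)"
proof -
  define C' where "C' = 1 - ctr (D h g) z"
  let ?R = "res_Omega P z"
  have L: "f1 \<in> L2 G" "h \<in> L2 G" "?R f2 \<in> L2 G" "?R g \<in> L2 G"
    by (intro Cc_L2[OF open_G] test_function_Cc f1 h res_Omega_Cc f2 g z)+
  have comb: "inner_L2 G a (\<lambda>y. ?R f2 y + s * ?R g y) = ctr (D a f2) z + s * ctr (D a g) z" if a: "a \<in> test_functions G" for a s
    using inner_L2_add[OF Cc_L2[OF open_G test_function_Cc[OF a]] L(3,4)] inner_res_Omega[OF a f2 z] inner_res_Omega[OF a g z] by simp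
  have zP: "z - complex_of_real (P y) \<noteq> 0" for y using z by (auto simp: complex_eq_iff)
  define Q where "Q u \<longleftrightarrow> u \<in> L2 G \<and> (AE y in lebesgue_on G. z * u y - Ham G P g h u y = f2 y)" for u
  define s where "s = ctr (D h f2) z / C'"
  have "Q (\<lambda>y. ?R f2 y + s * ?R g y)"
    unfolding Q_def
  proof (intro conjI AE_I2)
    have "(\<lambda>y. ?R f2 y + s * ?R g y) \<in> Cc G"
      using Cc_add[OF res_Omega_Cc[OF f2 z] Cc_mult_continuous[OF res_Omega_Cc[OF g z] open_G, of "\<lambda>_. s"]] by (simp add: mult.commute)
    then show "(\<lambda>y. ?R f2 y + s * ?R g y) \<in> L2 G" by (rule Cc_L2[OF open_G])
    fix y
    have sC: "ctr (D h f2) z + s * ctr (D h g) z = s"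
      using C by (simp add: s_def C'_def field_simps)
    have "z * (?R f2 y + s * ?R g y) - Ham G P g h (\<lambda>y. ?R f2 y + s * ?R g y) y
       = (z - of_real (P y)) * ?R f2 y + s * ((z - of_real (P y)) * ?R g y) - g y * s"
      by (simp add: Ham_def Omega_def comb[OF h] sC algebra_simps)
    also have "\<dots> = f2 y" using zP[of y] by (simp add: res_Omega_def)
    finally show "z * (?R f2 y + s * ?R g y) - Ham G P g h (\<lambda>y. ?R f2 y + s * ?R g y) y = f2 y" .
  qed
  then have "Q (res_Ham G P g h z f2)"
    unfolding res_Ham_def Q_def[symmetric] by (rule someI[where P = Q])
  moreover define u where "u = res_Ham G P g h z f2"
  ultimately have u: "u \<in> L2 G" "AE y in lebesgue_on G. z * u y - Ham G P g h u y = f2 y" by (auto simp: Q_def)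
  define S where "S = inner_L2 G h u"
  have ae: "AE y in lebesgue_on G. u y = ?R f2 y + S * ?R g y"
    using u(2)
  proof eventually_elim
    case (elim y)
    then have "(z - of_real (P y)) * u y = f2 y + S * g y"
      by (simp add: Ham_def Omega_def S_def algebra_simps)
    then have "u y = (f2 y + S * g y) / (z - of_real (P y))"
      using zP[of y] by (metis nonzero_mult_div_cancel_left)
    then show ?case by (simp add: res_Omega_def add_divide_distrib)
  qed
  have inner: "inner_L2 G a u = ctr (D a f2) z + S * ctr (D a g) z" if a: "a \<in> test_functions G" for a
  proof -
    have aL: "a \<in> L2 G" by (rule Cc_L2[OF open_G test_function_Cc[OF a]])
    have RL: "(\<lambda>y. ?R f2 y + S * ?R g y) \<in> L2 G"
      using Cc_L2[OF open_G Cc_add[OF res_Omega_Cc[OF f2 z] Cc_mult_continuous[OF res_Omega_Cc[OF g z] open_G, of "\<lambda>_. S"]]]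
      by (simp add: mult.commute)
    have "inner_L2 G a u = inner_L2 G a (\<lambda>y. ?R f2 y + S * ?R g y)"
      unfolding inner_L2_def
    proof (rule integral_cong_AE)
      show "AE y in lebesgue_on G. cnj (a y) * u y = cnj (a y) * (?R f2 y + S * ?R g y)"
        using ae by eventually_elim simp
    qed (use L2_product_integrable[OF aL u(1)] L2_product_integrable[OF aL RL] in \<open>auto intro: borel_measurable_integrable\<close>)
    then show ?thesis using comb[OF a] by simp
  qed
  \<comment> \<open>Pairing with h gives S = <h|R_\<Omega>(z)|f2> + S <h|R_\<Omega>(z)|g>, an
    equation for S with coefficient C(z).\<close>
  have "S * C' = ctr (D h f2) z" using inner[OF h] by (simp add: S_def[symmetric] C'_def algebra_simps)
  then have "S = ctr (D h f2) z / C'" using C by (simp add: C'_def field_simps)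
  then show ?thesis using inner[OF f1] by (simp add: u_def C'_def)
qed

section \<open>Boundary values of the resolvent of H and the form \<kappa>\<close>

context
  fixes g h :: "'a \<Rightarrow> complex"
  assumes g: "g \<in> test_functions G" and h: "h \<in> test_functions G"
begin

definition C1 :: "real \<Rightarrow> complex" where "C1 x = 1 - hil (D h g) x"

abbreviation C2 :: "real \<Rightarrow> complex" where "C2 \<equiv> D h g"

lemma C1_fun_eq: "C1_fun G P g h x = C1 x"
  by (simp add: C1_fun_def C1_def pv_form_eq[OF h g])

lemma
  assumes f1: "f1 \<in> test_functions G" and f2: "f2 \<in> test_functions G"
  shows res_limit_right: "C1 x + \<i> * of_real pi * C2 x \<noteq> 0 \<Longrightarrow>
     ((\<lambda>u. inner_L2 G f1 (res_Ham G P g h (Complex x u) f2)) \<longlongrightarrow>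
       (hil (D f1 f2) x - \<i> * of_real pi * D f1 f2 x) +
       (hil (D f1 g) x - \<i> * of_real pi * D f1 g x) * (hil (D h f2) x - \<i> * of_real pi * D h f2 x)
         / (C1 x + \<i> * of_real pi * C2 x)) (at_right 0)"
    and res_limit_left: "C1 x - \<i> * of_real pi * C2 x \<noteq> 0 \<Longrightarrow>
     ((\<lambda>u. inner_L2 G f1 (res_Ham G P g h (Complex x u) f2)) \<longlongrightarrow>
       (hil (D f1 f2) x + \<i> * of_real pi * D f1 f2 x) +
       (hil (D f1 g) x + \<i> * of_real pi * D f1 g x) * (hil (D h f2) x + \<i> * of_real pi * D h f2 x)
         / (C1 x - \<i> * of_real pi * C2 x)) (at_left 0)"
proof -
  have main: "((\<lambda>u. inner_L2 G f1 (res_Ham G P g h (Complex x u) f2)) \<longlongrightarrow> r12 + r1g * rh2 / (1 - rhg)) F"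
    if lims: "((\<lambda>u. ctr (D f1 f2) (Complex x u)) \<longlongrightarrow> r12) F" "((\<lambda>u. ctr (D f1 g) (Complex x u)) \<longlongrightarrow> r1g) F"
       "((\<lambda>u. ctr (D h f2) (Complex x u)) \<longlongrightarrow> rh2) F" "((\<lambda>u. ctr (D h g) (Complex x u)) \<longlongrightarrow> rhg) F"
     and nz: "1 - rhg \<noteq> 0" and F: "\<forall>\<^sub>F u in F. u \<noteq> 0" for F r12 r1g rh2 rhg
  proof -
    have lC: "((\<lambda>u. 1 - ctr (D h g) (Complex x u)) \<longlongrightarrow> 1 - rhg) F" by (intro tendsto_intros lims)
    have "((\<lambda>u. ctr (D f1 f2) (Complex x u) + ctr (D f1 g) (Complex x u) * ctr (D h f2) (Complex x u) / (1 - ctr (D h g) (Complex x u)))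
        \<longlongrightarrow> r12 + r1g * rh2 / (1 - rhg)) F"
      by (intro tendsto_intros lims nz)
    moreover have "\<forall>\<^sub>F u in F. ctr (D f1 f2) (Complex x u) + ctr (D f1 g) (Complex x u) * ctr (D h f2) (Complex x u) / (1 - ctr (D h g) (Complex x u))
        = inner_L2 G f1 (res_Ham G P g h (Complex x u) f2)"
      using F tendsto_imp_eventually_ne[OF lC nz]
    proof eventually_elim
      case (elim u)
      then show ?case using inner_res_Ham[OF g h f1 f2, of "Complex x u"] by simp
    qed
    ultimately show ?thesis by (rule Lim_transform_eventually)
  qed
  note pr = plemelj_right[OF delta_lhold delta_csupp] and pl = plemelj_left[OF delta_lhold delta_csupp]
  have F: "\<forall>\<^sub>F u in at_right 0. u \<noteq> (0::real)" "\<forall>\<^sub>F u in at_left 0. u \<noteq> (0::real)"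
    by (simp_all add: eventually_at_filter)
  \<comment> \<open>The minus sign in C(z) reverses the sign of the \<delta>-term, so C1 + i \<pi>
    C2 belongs to the limit from above.\<close>
  have e: "1 - (hil (D h g) x - \<i> * of_real pi * D h g x) = C1 x + \<i> * of_real pi * C2 x"
    "1 - (hil (D h g) x + \<i> * of_real pi * D h g x) = C1 x - \<i> * of_real pi * C2 x"
    by (simp_all add: C1_def)
  show "C1 x + \<i> * of_real pi * C2 x \<noteq> 0 \<Longrightarrow>
     ((\<lambda>u. inner_L2 G f1 (res_Ham G P g h (Complex x u) f2)) \<longlongrightarrow>
       (hil (D f1 f2) x - \<i> * of_real pi * D f1 f2 x) +
       (hil (D f1 g) x - \<i> * of_real pi * D f1 g x) * (hil (D h f2) x - \<i> * of_real pi * D h f2 x)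
         / (C1 x + \<i> * of_real pi * C2 x)) (at_right 0)"
    by (rule main[OF pr[OF f1 f2 f1 f2] pr[OF f1 g f1 g] pr[OF h f2 h f2] pr[OF h g h g], unfolded e, OF _ F(1)])
  show "C1 x - \<i> * of_real pi * C2 x \<noteq> 0 \<Longrightarrow>
     ((\<lambda>u. inner_L2 G f1 (res_Ham G P g h (Complex x u) f2)) \<longlongrightarrow>
       (hil (D f1 f2) x + \<i> * of_real pi * D f1 f2 x) +
       (hil (D f1 g) x + \<i> * of_real pi * D f1 g x) * (hil (D h f2) x + \<i> * of_real pi * D h f2 x)
         / (C1 x - \<i> * of_real pi * C2 x)) (at_left 0)"
    by (rule main[OF pl[OF f1 f2 f1 f2] pl[OF f1 g f1 g] pl[OF h f2 h f2] pl[OF h g h g], unfolded e, OF _ F(2)])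
qed

definition \<Delta> :: "real \<Rightarrow> complex" where "\<Delta> x = (C1 x)\<^sup>2 + (of_real pi)\<^sup>2 * (C2 x)\<^sup>2"

lemma \<Delta>_factor: "\<Delta> x = (C1 x + \<i> * of_real pi * C2 x) * (C1 x - \<i> * of_real pi * C2 x)"
  by (simp add: \<Delta>_def algebra_simps power2_eq_square)

text \<open>Coefficients of \<open>\<langle>h|\<delta>\<close> and \<open>\<langle>h|\<P>\<close> in \<open>\<langle>a|\<kappa>\<close>.\<close>
definition Acoef :: "('a \<Rightarrow> complex) \<Rightarrow> real \<Rightarrow> complex" where
  "Acoef a x = (C1 x * hil (D a g) x - (of_real pi)\<^sup>2 * C2 x * D a g x) / \<Delta> x"

definition Bcoef :: "('a \<Rightarrow> complex) \<Rightarrow> real \<Rightarrow> complex" where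
  "Bcoef a x = (C1 x * D a g x + C2 x * hil (D a g) x) / \<Delta> x"

definition Acoef' :: "('a \<Rightarrow> complex) \<Rightarrow> real \<Rightarrow> complex" where
  "Acoef' b x = (C1 x * hil (D h b) x - (of_real pi)\<^sup>2 * C2 x * D h b x) / \<Delta> x"

definition Bcoef' :: "('a \<Rightarrow> complex) \<Rightarrow> real \<Rightarrow> complex" where
  "Bcoef' b x = (C1 x * D h b x + C2 x * hil (D h b) x) / \<Delta> x"

text \<open>The jump of the resolvent is bilinear in (D f1 g, H D f1 g) and (D h f2, H D h f2).
  Sorting by the second pair gives the bra coefficients, sorting by the first pair the ket
  coefficients.\<close>

lemma kappa_eq:
  assumes f1: "f1 \<in> test_functions G" and f2: "f2 \<in> test_functions G" and nz: "\<Delta> x \<noteq> 0"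
  shows "kappa G P g h x f1 f2 = D f1 f2 x + Acoef f1 x * D h f2 x + Bcoef f1 x * hil (D h f2) x"
    and "kappa G P g h x f1 f2 = D f1 f2 x + Acoef' f2 x * D f1 g x + Bcoef' f2 x * hil (D f1 g) x"
proof -
  have nz': "C1 x + \<i> * of_real pi * C2 x \<noteq> 0" "C1 x - \<i> * of_real pi * C2 x \<noteq> 0"
    using nz by (auto simp: \<Delta>_factor)
  define p where "p = complex_of_real pi"
  have p: "p \<noteq> 0" by (simp add: p_def)
  define u where "u = C1 x + \<i> * p * C2 x"
  define v where "v = C1 x - \<i> * p * C2 x"
  have uv: "u \<noteq> 0" "v \<noteq> 0" "\<Delta> x = u * v" using nz' by (auto simp: u_def v_def p_def \<Delta>_factor)
  define q1 d1 q2 d2 q d where qd: "q1 = hil (D f1 g) x" "d1 = D f1 g x" "q2 = hil (D h f2) x" "d2 = D h f2 x" "q = hil (D f1 f2) x" "d = D f1 f2 x"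
  have kp: "kappa G P g h x f1 f2 = (((q + \<i> * p * d) + (q1 + \<i> * p * d1) * (q2 + \<i> * p * d2) / v)
      - ((q - \<i> * p * d) + (q1 - \<i> * p * d1) * (q2 - \<i> * p * d2) / u)) / (2 * p * \<i>)"
    unfolding kappa_def tendsto_Lim[OF trivial_limit_at_left_real res_limit_left[OF f1 f2 nz'(2)]]
      tendsto_Lim[OF trivial_limit_at_right_real res_limit_right[OF f1 f2 nz'(1)]] qd u_def v_def p_def ..
  \<comment> \<open>The numerator after both boundary values are brought to the denominator u v =
    C1^2 + \<pi>^2 C2^2; only terms odd in i \<pi> remain.\<close>
  have num: "(q1 + \<i> * p * d1) * (q2 + \<i> * p * d2) * u - (q1 - \<i> * p * d1) * (q2 - \<i> * p * d2) * v
      = 2 * p * \<i> * (C1 x * (q1 * d2 + d1 * q2) + C2 x * (q1 * q2 - p\<^sup>2 * d1 * d2))"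
    unfolding u_def v_def by (simp add: algebra_simps power2_eq_square)
  have "(q1 + \<i> * p * d1) * (q2 + \<i> * p * d2) / v - (q1 - \<i> * p * d1) * (q2 - \<i> * p * d2) / u
      = ((q1 + \<i> * p * d1) * (q2 + \<i> * p * d2) * u - (q1 - \<i> * p * d1) * (q2 - \<i> * p * d2) * v) / (u * v)"
    using uv by (simp add: field_simps)
  also have "\<dots> = 2 * p * \<i> * ((C1 x * (q1 * d2 + d1 * q2) + C2 x * (q1 * q2 - p\<^sup>2 * d1 * d2)) / (u * v))"
    unfolding num by simp
  finally have "kappa G P g h x f1 f2 = d + (C1 x * (q1 * d2 + d1 * q2) + C2 x * (q1 * q2 - p\<^sup>2 * d1 * d2)) / (u * v)"
    unfolding kp using p by (simp add: field_simps)
  then have K: "kappa G P g h x f1 f2 = d + (C1 x * (q1 * d2 + d1 * q2) + C2 x * (q1 * q2 - p\<^sup>2 * d1 * d2)) / \<Delta> x"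
    by (simp add: uv(3))
  show "kappa G P g h x f1 f2 = D f1 f2 x + Acoef f1 x * D h f2 x + Bcoef f1 x * hil (D h f2) x"
    unfolding K Acoef_def Bcoef_def qd p_def by (simp add: add_divide_distrib diff_divide_distrib algebra_simps)
  show "kappa G P g h x f1 f2 = D f1 f2 x + Acoef' f2 x * D f1 g x + Bcoef' f2 x * hil (D f1 g) x"
    unfolding K Acoef'_def Bcoef'_def qd p_def by (simp add: add_divide_distrib diff_divide_distrib algebra_simps)
qed

end

end

subsection \<open>The orthogonality relations\<close>

lemma test_function_lhold:
  fixes \<phi> :: "real \<Rightarrow> complex"
  assumes \<phi>: "\<phi> \<in> test_functions W"
  shows "lhold \<phi>" "csupp \<phi>" "continuous_on S \<phi>"
proof -
  have lip: "lhold (\<lambda>x. complex_of_real (f x))" if f: "f \<in> Cc1 W" for f :: "real \<Rightarrow> real"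
  proof (rule lhold_lipschitz)
    fix L
    have f1: "C1_on UNIV f" using f by (simp add: Cc1_def)
    have c: "continuous_on UNIV (pd f 1)" by (rule C1_on_pd_continuous[OF f1]) simp
    have "compact (pd f 1 ` {-L..L})" by (intro compact_continuous_image continuous_on_subset[OF c]) auto
    then obtain B where B: "\<forall>t\<in>pd f 1 ` {-L..L}. norm t \<le> B" using compact_imp_bounded bounded_pos by metis
    have "\<bar>f x - f y\<bar> \<le> B * \<bar>x - y\<bar>" if xy: "\<bar>x\<bar> \<le> L" "\<bar>y\<bar> \<le> L" for x y
      unfolding real_norm_def[symmetric]
    proof (rule field_differentiable_bound[of "{-L..L}" f "pd f 1"])
      fix z :: real
      have D: "(f has_derivative frechet_derivative f (at z)) (at z)" using C1_on_has_derivative[OF f1] by simp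
      have "v * pd f 1 z = pd f v z" for v
        using linear_scale[OF has_derivative_linear[OF D], of v 1] by simp
      then show "(f has_real_derivative pd f 1 z) (at z within {-L..L})"
        using has_derivative_imp_has_field_derivative[OF D] has_field_derivative_at_within by blast
    qed (use xy B in auto)
    then have "cmod (complex_of_real (f x) - complex_of_real (f y)) \<le> B * \<bar>x - y\<bar>" if "\<bar>x\<bar> \<le> L" "\<bar>y\<bar> \<le> L" for x y
      using that by (simp flip: of_real_diff)
    then show "\<exists>C. \<forall>x y. \<bar>x\<bar> \<le> L \<longrightarrow> \<bar>y\<bar> \<le> L \<longrightarrow> cmod (complex_of_real (f x) - complex_of_real (f y)) \<le> C * \<bar>x - y\<bar>"
      by blast
  qed
  have "lhold (\<lambda>x. complex_of_real (Re (\<phi> x)) + \<i> * complex_of_real (Im (\<phi> x)))"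
    by (intro lhold_add lhold_cmult lip test_function_Cc1[OF \<phi>])
  then show lh: "lhold \<phi>" by (simp add: complex_eq[symmetric])
  show "continuous_on S \<phi>" by (rule lhold_continuous[OF lh])
  have "bounded (support \<phi>)" using \<phi> by (auto simp: test_functions_def compact_imp_bounded)
  then obtain R where "\<forall>x\<in>support \<phi>. norm x \<le> R" by (auto simp: bounded_iff)
  then have "\<phi> x = 0" if "\<bar>x\<bar> > R" for x using that by (intro not_in_support) auto
  then show "csupp \<phi>" unfolding csupp_def by blast
qed

lemma compact_norm_lower_bound:
  fixes d :: "real \<Rightarrow> complex"
  assumes "compact E" "continuous_on E d" "\<And>x. x \<in> E \<Longrightarrow> d x \<noteq> 0"
  obtains m where "m > 0" "\<And>x. x \<in> E \<Longrightarrow> m \<le> cmod (d x)"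
proof (cases "E = {}")
  case False
  have "continuous_on E (\<lambda>x. cmod (d x))" by (intro continuous_intros assms)
  then obtain y where "y \<in> E" "\<forall>x\<in>E. cmod (d y) \<le> cmod (d x)"
    using continuous_attains_inf[OF assms(1) False] by blast
  then show ?thesis using that[of "cmod (d y)"] assms(3) by auto
qed (use that[of 1] in auto)

text \<open>N is a continuous choice of a square root of 1 / d. On E it inherits the Hoelder bound
  of d through N x - N y = (N x^2 - N y^2) / (N x + N y), as long as the denominator stays away from
  0; outside E the factor \<phi> makes the product vanish.\<close>

lemma lhold_mult_root:
  assumes \<phi>: "lhold \<phi>" and E: "compact E" "\<And>x. x \<notin> E \<Longrightarrow> \<phi> x = 0"
    and N: "continuous_on E N" and d: "lhold d" and Nd: "\<And>x. x \<in> E \<Longrightarrow> (N x)\<^sup>2 * d x = 1"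
  shows "lhold (\<lambda>x. \<phi> x * N x)"
  unfolding lhold_def
proof
  fix L
  have nzd: "d x \<noteq> 0" and nzN: "N x \<noteq> 0" if "x \<in> E" for x using Nd[OF that] by auto
  obtain m where m: "m > 0" "\<And>x. x \<in> E \<Longrightarrow> m \<le> cmod (d x)"
    using compact_norm_lower_bound[OF E(1) lhold_continuous[OF d] nzd] by metis
  obtain n where n: "n > 0" "\<And>x. x \<in> E \<Longrightarrow> n \<le> cmod (N x)"
    using compact_norm_lower_bound[OF E(1) N nzN] by metis
  have "bounded (N ` E)" by (intro compact_imp_bounded compact_continuous_image N E)
  then obtain M where M: "M > 0" "\<And>x. x \<in> E \<Longrightarrow> cmod (N x) \<le> M" by (auto simp: bounded_pos)
  obtain Cd where Cd: "Cd \<ge> 0" "\<And>x y. \<bar>x\<bar> \<le> L \<Longrightarrow> \<bar>y\<bar> \<le> L \<Longrightarrow> cmod (d x - d y) \<le> Cd * sqrt \<bar>x - y\<bar>" using lholdE[OF d] by metis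
  obtain Cp where Cp: "Cp \<ge> 0" "\<And>x y. \<bar>x\<bar> \<le> L \<Longrightarrow> \<bar>y\<bar> \<le> L \<Longrightarrow> cmod (\<phi> x - \<phi> y) \<le> Cp * sqrt \<bar>x - y\<bar>" using lholdE[OF \<phi>] by metis
  obtain Mp where Mp: "Mp > 0" "\<And>x. \<bar>x\<bar> \<le> L \<Longrightarrow> cmod (\<phi> x) \<le> Mp" using lhold_bound[OF \<phi>] by metis
  have "uniformly_continuous_on E N" by (rule compact_uniformly_continuous[OF N E(1)])
  then obtain r where r: "r > 0" "\<And>x y. x \<in> E \<Longrightarrow> y \<in> E \<Longrightarrow> dist y x < r \<Longrightarrow> dist (N y) (N x) < n"
    unfolding uniformly_continuous_on_def using n(1) by meson
  \<comment> \<open>The first summand serves |x - y| < r, the second the remaining pairs, where |N x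
    - N y| \<le> 2 M and sqrt |x - y| \<ge> sqrt r.\<close>
  define CN where "CN = Cd / (m * m) / n + 2 * M / sqrt r"
  have CN: "CN \<ge> 0" using Cd m n M r by (auto simp: CN_def)
  have NN: "cmod (N x - N y) \<le> CN * sqrt \<bar>x - y\<bar>" if xy: "x \<in> E" "y \<in> E" "\<bar>x\<bar> \<le> L" "\<bar>y\<bar> \<le> L" for x y
  proof (cases "\<bar>x - y\<bar> < r")
    case True
    have "dist (N y) (N x) < n" using r(2)[OF xy(1,2)] True by (simp add: dist_real_def abs_minus_commute)
    then have "cmod (N x - N y) < n" by (simp add: dist_norm norm_minus_commute)
    moreover have "2 * cmod (N x) \<le> cmod (N x + N y) + cmod (N x - N y)"
      using norm_triangle_ineq[of "N x + N y" "N x - N y"] by (simp add: norm_mult)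
    ultimately have s: "n \<le> cmod (N x + N y)" using n(2)[OF xy(1)] by linarith
    have "(N x)\<^sup>2 = 1 / d x" "(N y)\<^sup>2 = 1 / d y" using Nd[OF xy(1)] Nd[OF xy(2)] nzd xy by (simp_all add: field_simps)
    then have "(N x - N y) * (N x + N y) = 1 / d x - 1 / d y" by (simp add: power2_eq_square algebra_simps)
    also have "\<dots> = (d y - d x) / (d x * d y)" using nzd xy by (simp add: field_simps)
    finally have "cmod (N x - N y) * cmod (N x + N y) = cmod (d y - d x) / (cmod (d x) * cmod (d y))"
      by (metis norm_divide norm_mult)
    also have "\<dots> \<le> Cd * sqrt \<bar>x - y\<bar> / (m * m)"
      using Cd(2)[OF xy(4,3)] Cd(1) m xy by (intro frac_le mult_mono) (auto simp: abs_minus_commute)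
    finally have "cmod (N x - N y) * n \<le> Cd * sqrt \<bar>x - y\<bar> / (m * m)"
      using mult_left_mono[OF s norm_ge_zero[of "N x - N y"]] by linarith
    then have "cmod (N x - N y) \<le> Cd * sqrt \<bar>x - y\<bar> / (m * m) / n" using n(1) by (simp only: pos_le_divide_eq)
    also have "\<dots> = Cd / (m * m) / n * sqrt \<bar>x - y\<bar>" by simp
    also have "\<dots> \<le> CN * sqrt \<bar>x - y\<bar>" using M r by (intro mult_right_mono) (auto simp: CN_def)
    finally show ?thesis .
  next
    case False
    have "cmod (N x - N y) \<le> 2 * M" using norm_triangle_ineq4[of "N x" "N y"] M(2)[OF xy(1)] M(2)[OF xy(2)] by linarith
    also have "\<dots> \<le> 2 * M / sqrt r * sqrt \<bar>x - y\<bar>" using False M r by (simp add: field_simps)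
    also have "\<dots> \<le> CN * sqrt \<bar>x - y\<bar>" using Cd m n by (intro mult_right_mono) (auto simp: CN_def)
    finally show ?thesis .
  qed
  define C where "C = Cp * M + Mp * CN"
  have one: "cmod (\<phi> x * N x - \<phi> y * N y) \<le> C * sqrt \<bar>x - y\<bar>" if xy: "\<bar>x\<bar> \<le> L" "\<bar>y\<bar> \<le> L" "x \<in> E" for x y
  proof (cases "y \<in> E")
    case True
    have "\<phi> x * N x - \<phi> y * N y = (\<phi> x - \<phi> y) * N x + \<phi> y * (N x - N y)" by (simp add: algebra_simps)
    then have "cmod (\<phi> x * N x - \<phi> y * N y) \<le> cmod (\<phi> x - \<phi> y) * cmod (N x) + cmod (\<phi> y) * cmod (N x - N y)"
      by (metis norm_mult norm_triangle_ineq)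
    also have "\<dots> \<le> (Cp * sqrt \<bar>x - y\<bar>) * M + Mp * (CN * sqrt \<bar>x - y\<bar>)"
      using Cp Mp M NN CN xy True by (intro add_mono mult_mono) auto
    finally show ?thesis by (simp add: C_def algebra_simps)
  next
    case False
    then have "cmod (\<phi> x * N x - \<phi> y * N y) = cmod (\<phi> x - \<phi> y) * cmod (N x)" using E(2) by (simp add: norm_mult)
    also have "\<dots> \<le> (Cp * sqrt \<bar>x - y\<bar>) * M" using Cp M xy by (intro mult_mono) auto
    also have "\<dots> \<le> C * sqrt \<bar>x - y\<bar>" using Mp CN by (simp add: C_def algebra_simps)
    finally show ?thesis .
  qed
  have "cmod (\<phi> x * N x - \<phi> y * N y) \<le> C * sqrt \<bar>x - y\<bar>" if "\<bar>x\<bar> \<le> L" "\<bar>y\<bar> \<le> L" for x y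
  proof -
    consider "x \<in> E" | "y \<in> E" | "x \<notin> E" "y \<notin> E" by blast
    then show ?thesis
    proof cases
      case 2
      then show ?thesis using one[of y x] that by (simp add: norm_minus_commute abs_minus_commute)
    next
      case 3
      have "0 \<le> C" using Cp M Mp CN by (simp add: C_def)
      then show ?thesis using 3 E(2) by simp
    qed (use one that in blast)
  qed
  then show "\<exists>C. \<forall>x y. \<bar>x\<bar> \<le> L \<longrightarrow> \<bar>y\<bar> \<le> L \<longrightarrow> cmod (\<phi> x * N x - \<phi> y * N y) \<le> C * sqrt \<bar>x - y\<bar>" by blast
qed

text \<open>A and B solve the linear system c1 A + p^2 c2 B = q, - c2 A + c1 B = d, with determinant
  c1^2 + p^2 c2^2. The second equation is the linear condition on the coefficients; both together
  collapse the product of a bra and a ket to the form of \<kappa>.\<close>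

lemma kappa_product_algebra:
  fixes c1 c2 p :: complex
  assumes \<Delta>: "c1\<^sup>2 + p\<^sup>2 * c2\<^sup>2 \<noteq> 0"
    and A: "A1 = (c1 * q1 - p\<^sup>2 * c2 * d1) / (c1\<^sup>2 + p\<^sup>2 * c2\<^sup>2)" "A2 = (c1 * q2 - p\<^sup>2 * c2 * d2) / (c1\<^sup>2 + p\<^sup>2 * c2\<^sup>2)"
    and B: "B1 = (c1 * d1 + c2 * q1) / (c1\<^sup>2 + p\<^sup>2 * c2\<^sup>2)" "B2 = (c1 * d2 + c2 * q2) / (c1\<^sup>2 + p\<^sup>2 * c2\<^sup>2)"
  shows "d1 + c2 * A1 = c1 * B1" "d2 + c2 * A2 = c1 * B2"
    and "d1 * A2 + d2 * A1 + c2 * A1 * A2 + p\<^sup>2 * c2 * B1 * B2 = A1 * d2 + B1 * q2"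
proof -
  have 1: "d + c2 * ((c1 * q - p\<^sup>2 * c2 * d) / (c1\<^sup>2 + p\<^sup>2 * c2\<^sup>2)) = c1 * ((c1 * d + c2 * q) / (c1\<^sup>2 + p\<^sup>2 * c2\<^sup>2))" for d q
  proof -
    have "d + c2 * ((c1 * q - p\<^sup>2 * c2 * d) / (c1\<^sup>2 + p\<^sup>2 * c2\<^sup>2)) = (d * (c1\<^sup>2 + p\<^sup>2 * c2\<^sup>2) + c2 * (c1 * q - p\<^sup>2 * c2 * d)) / (c1\<^sup>2 + p\<^sup>2 * c2\<^sup>2)"
      using \<Delta> by (simp add: add_divide_distrib)
    also have "d * (c1\<^sup>2 + p\<^sup>2 * c2\<^sup>2) + c2 * (c1 * q - p\<^sup>2 * c2 * d) = c1 * (c1 * d + c2 * q)"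
      by (simp add: algebra_simps power2_eq_square)
    finally show ?thesis by simp
  qed
  show e1: "d1 + c2 * A1 = c1 * B1" "d2 + c2 * A2 = c1 * B2" unfolding A B by (rule 1)+
  have "c1 * A2 + p\<^sup>2 * c2 * B2 = (c1 * (c1 * q2 - p\<^sup>2 * c2 * d2) + p\<^sup>2 * c2 * (c1 * d2 + c2 * q2)) / (c1\<^sup>2 + p\<^sup>2 * c2\<^sup>2)"
    unfolding A B by (simp only: times_divide_eq_right add_divide_distrib[symmetric])
  also have "c1 * (c1 * q2 - p\<^sup>2 * c2 * d2) + p\<^sup>2 * c2 * (c1 * d2 + c2 * q2) = q2 * (c1\<^sup>2 + p\<^sup>2 * c2\<^sup>2)"
    by (simp add: algebra_simps power2_eq_square)
  finally have e2: "c1 * A2 + p\<^sup>2 * c2 * B2 = q2" using \<Delta> by simp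
  have "d1 * A2 + d2 * A1 + c2 * A1 * A2 + p\<^sup>2 * c2 * B1 * B2 = (d1 + c2 * A1) * A2 + d2 * A1 + p\<^sup>2 * c2 * B1 * B2"
    by (simp add: algebra_simps)
  also have "\<dots> = B1 * (c1 * A2 + p\<^sup>2 * c2 * B2) + d2 * A1" unfolding e1 by (simp add: algebra_simps)
  finally show "d1 * A2 + d2 * A1 + c2 * A1 * A2 + p\<^sup>2 * c2 * B1 * B2 = A1 * d2 + B1 * q2" unfolding e2 by (simp add: mult.commute)
qed

section \<open>The relation for \<kappa>\<close>

locale rank_one = level_family G P for G :: "'a::euclidean_space set" and P +
  fixes g h :: "'a \<Rightarrow> complex" and K :: "'a set" and G1 :: "real set"
  assumes g: "g \<in> test_functions G" and h: "h \<in> test_functions G"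
    and K: "compact K" "K \<subseteq> G" "support g \<subseteq> K" "support h \<subseteq> K"
    and G1: "open G1" "P ` K \<subseteq> G1"
    and C_right_nz: "\<And>x. x \<in> G1 \<Longrightarrow> C1_fun G P g h x + \<i> * of_real pi * C2_fun G P g h x \<noteq> 0"
    and C_left_nz: "\<And>x. x \<in> G1 \<Longrightarrow> C1_fun G P g h x - \<i> * of_real pi * C2_fun G P g h x \<noteq> 0"
begin

abbreviation c1 where "c1 \<equiv> C1 g h"
abbreviation c2 where "c2 \<equiv> D h g"
abbreviation dl where "dl \<equiv> \<Delta> g h"

lemma c1_eq: "c1 x = 1 - hil (D h g) x"
  by (rule C1_def[OF g h])

lemma dl_eq: "dl x = (c1 x)\<^sup>2 + (of_real pi)\<^sup>2 * (c2 x)\<^sup>2"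
  by (rule \<Delta>_def[OF g h])

lemma C2_fun_eq: "C2_fun G P g h = c2"
  by (simp add: C2_fun_def fun_eq_iff)

lemma dl_nz: "x \<in> G1 \<Longrightarrow> dl x \<noteq> 0"
  using C_right_nz[of x] C_left_nz[of x] \<Delta>_factor[OF g h, of x]
  by (simp add: C1_fun_eq[OF g h] C2_fun_eq)

lemma compact_PK: "compact (P ` K)"
  using K C1_on_continuous[OF C1P] by (intro compact_continuous_image) (auto intro: continuous_on_subset)

lemma zero_off_K: "x \<notin> P ` K \<Longrightarrow> D a g x = 0" "x \<notin> P ` K \<Longrightarrow> D h b x = 0"
  if "a \<in> test_functions G" "b \<in> test_functions G"
  using K delta_zero[OF that(1) g, of x] delta_zero[OF h that(2), of x] by blast+

text \<open>Off P(K) the density C2 vanishes, so C1^2 + \<pi>^2 C2^2 reduces to C1^2 and is 0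
  exactly here.\<close>

definition Z :: "real set" where "Z = {x. x \<notin> P ` K \<and> hil (D h g) x = 1}"

lemma countable_Z: "countable Z"
  unfolding Z_def
  by (rule countable_zeros_gap[OF delta_lhold[OF h g] delta_csupp[OF h g] compact_imp_closed[OF compact_PK]])
     (rule zero_off_K(2)[OF g g])

lemma dl_nz_off_Z: "x \<notin> Z \<Longrightarrow> dl x \<noteq> 0"
proof (cases "x \<in> P ` K")
  case False
  assume "x \<notin> Z"
  then have "c1 x \<noteq> 0" "c2 x = 0" using False zero_off_K[OF h g] by (auto simp: Z_def c1_eq)
  then show ?thesis by (simp add: dl_eq)
qed (use dl_nz G1 in blast)

lemma lhold_c1: "lhold c1"
  unfolding c1_eq by (intro lhold_diff lhold_const hil_delta_lhold h g)

lemma lhold_c2: "lhold c2"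
  by (rule delta_lhold[OF h g])

lemma lhold_dl: "lhold dl"
  unfolding dl_eq by (intro lhold_add lhold_mult lhold_power lhold_const lhold_c1 lhold_c2)

lemma cutoff: obtains \<eta> :: "real \<Rightarrow> complex" where "continuous_on UNIV \<eta>" "support \<eta> \<subseteq> G1" "\<And>x. x \<in> P ` K \<Longrightarrow> \<eta> x = 1"
proof -
  obtain e :: "real \<Rightarrow> real" where e: "e \<in> Cc1 G1" "\<And>x. x \<in> P ` K \<Longrightarrow> e x \<ge> 1"
    using cutoff_exists[OF compact_PK G1(2,1)] by metis
  show ?thesis
  proof
    show "continuous_on UNIV (\<lambda>x. complex_of_real (min 1 (e x)))"
      using e(1) by (intro continuous_intros) (auto simp: Cc1_def C1_on_continuous)
    have "support (\<lambda>x. complex_of_real (min 1 (e x))) \<subseteq> support e" by (rule support_mono) simp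
    then show "support (\<lambda>x. complex_of_real (min 1 (e x))) \<subseteq> G1" using e(1) by (auto simp: Cc1_def)
    show "complex_of_real (min 1 (e x)) = 1" if "x \<in> P ` K" for x using e(2)[OF that] by simp
  qed
qed

text \<open>The first quotient is continuous on G1 only. It always multiplies a density that
  vanishes off P(K), so the cutoff \<eta>, equal to 1 on P(K), changes nothing and makes it
  continuous everywhere. The numerator of the second quotient already vanishes off P(K), as d and C2
  do.\<close>

lemma admissible_kappa:
  assumes \<phi>: "\<phi> \<in> test_functions W" and \<eta>: "continuous_on UNIV \<eta>" "support \<eta> \<subseteq> G1"
    and d: "lhold d" "\<And>x. x \<notin> P ` K \<Longrightarrow> d x = 0" and q: "lhold q"
  shows "admissible \<phi> (\<lambda>x. \<phi> x * (\<eta> x * ((c1 x * q x - (of_real pi)\<^sup>2 * c2 x * d x) / dl x)))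
     (\<lambda>x. \<phi> x * ((c1 x * d x + c2 x * q x) / dl x))"
  unfolding admissible_def
proof (intro conjI)
  note \<phi>' = test_function_lhold[OF \<phi>]
  show "continuous_on UNIV \<phi>" by (rule \<phi>')
  have "continuous_on G1 (\<lambda>x. (c1 x * q x - (of_real pi)\<^sup>2 * c2 x * d x) / dl x)"
    using dl_nz by (intro continuous_intros lhold_continuous lhold_c1 lhold_c2 lhold_dl d q) auto
  then show "continuous_on UNIV (\<lambda>x. \<phi> x * (\<eta> x * ((c1 x * q x - (of_real pi)\<^sup>2 * c2 x * d x) / dl x)))"
    by (intro continuous_on_mult \<phi>' continuous_mult_supported[OF \<eta> G1(1)])
  obtain m where m: "m > 0" "\<And>x. x \<in> P ` K \<Longrightarrow> m \<le> cmod (dl x)"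
    using compact_norm_lower_bound[OF compact_PK lhold_continuous[OF lhold_dl]] dl_nz G1(2) by (metis subsetD)
  have "lhold (\<lambda>x. (c1 x * d x + c2 x * q x) / dl x)"
  proof (rule lhold_divide[OF _ lhold_dl m])
    show "c1 x * d x + c2 x * q x = 0" if "x \<notin> P ` K" for x using d(2)[OF that] zero_off_K(1)[OF h g that] by simp
  qed (intro lhold_add lhold_mult lhold_c1 lhold_c2 d q)
  then show "lhold (\<lambda>x. \<phi> x * ((c1 x * d x + c2 x * q x) / dl x))" by (intro lhold_mult \<phi>')
  show "csupp (\<lambda>x. \<phi> x * ((c1 x * d x + c2 x * q x) / dl x))" by (intro csupp_mult1 \<phi>')
qed

text \<open>On P(K) this is \<open>kappa_product_algebra\<close> multiplied by the test functions.
  Off P(K) and off Z all densities involving g or h vanish and \<kappa> reduces to \<delta>(x -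
  \<Omega>).\<close>

lemma kappa_relation:
  assumes f1: "f1 \<in> test_functions G" and f2: "f2 \<in> test_functions G"
    and \<phi>1: "\<phi>1 \<in> test_functions W" and \<phi>2: "\<phi>2 \<in> test_functions W"
  shows "integrable lborel (\<lambda>x. \<phi>1 x * \<phi>2 x * kappa G P g h x f1 f2) \<and>
        has_product G \<phi>1 (\<lambda>x f. kappa G P g h x f1 f) \<phi>2 (\<lambda>x f. kappa G P g h x f f2)
          (LINT x|lborel. \<phi>1 x * \<phi>2 x * kappa G P g h x f1 f2)"
proof -
  obtain \<eta> :: "real \<Rightarrow> complex" where \<eta>: "continuous_on UNIV \<eta>" "support \<eta> \<subseteq> G1" "\<And>x. x \<in> P ` K \<Longrightarrow> \<eta> x = 1"
    using cutoff by metis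
  let ?A1 = "\<lambda>x. (c1 x * hil (D f1 g) x - (of_real pi)\<^sup>2 * c2 x * D f1 g x) / dl x"
  let ?B1 = "\<lambda>x. (c1 x * D f1 g x + c2 x * hil (D f1 g) x) / dl x"
  let ?A2 = "\<lambda>x. (c1 x * hil (D h f2) x - (of_real pi)\<^sup>2 * c2 x * D h f2 x) / dl x"
  let ?B2 = "\<lambda>x. (c1 x * D h f2 x + c2 x * hil (D h f2) x) / dl x"
  have adm1: "admissible \<phi>1 (\<lambda>x. \<phi>1 x * (\<eta> x * ?A1 x)) (\<lambda>x. \<phi>1 x * ?B1 x)"
    by (rule admissible_kappa[OF \<phi>1 \<eta>(1,2) delta_lhold[OF f1 g] zero_off_K(1)[OF f1 g] hil_delta_lhold[OF f1 g]])
  have adm2: "admissible \<phi>2 (\<lambda>x. \<phi>2 x * (\<eta> x * ?A2 x)) (\<lambda>x. \<phi>2 x * ?B2 x)"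
    by (rule admissible_kappa[OF \<phi>2 \<eta>(1,2) delta_lhold[OF h f2] zero_off_K(2)[OF g f2] hil_delta_lhold[OF h f2]])
  note alg = kappa_product_algebra[OF dl_nz[unfolded dl_eq] refl refl refl refl, folded dl_eq]
  have off: "D f1 g x = 0" "D h f2 x = 0" "c2 x = 0" "D h f x = 0" "D f g x = 0"
    if "x \<notin> P ` K" "f \<in> test_functions G" for x f
    using zero_off_K[OF f1 f2 that(1)] zero_off_K[OF h g that(1)] zero_off_K[OF that(2,2,1)] by auto
  have k1: "kappa G P g h x f1 f = D f1 f x + ?A1 x * D h f x + ?B1 x * hil (D h f) x"
    if "x \<notin> Z" "f \<in> test_functions G" for x f
    using kappa_eq(1)[OF g h f1 that(2) dl_nz_off_Z[OF that(1)]] by (simp add: Acoef_def[OF g h] Bcoef_def[OF g h])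
  have k2: "kappa G P g h x f f2 = D f f2 x + ?A2 x * D f g x + ?B2 x * hil (D f g) x"
    if "x \<notin> Z" "f \<in> test_functions G" for x f
    using kappa_eq(2)[OF g h that(2) f2 dl_nz_off_Z[OF that(1)]] by (simp add: Acoef'_def[OF g h] Bcoef'_def[OF g h])
  show ?thesis
  proof (rule has_product_reps[OF f1 f2 g h adm1 adm2 _ _ countable_Z])
    show "\<phi>1 x * D f1 g x + c2 x * (\<phi>1 x * (\<eta> x * ?A1 x)) = (1 - hil c2 x) * (\<phi>1 x * ?B1 x)" for x
    proof (cases "x \<in> P ` K")
      case True
      then have "D f1 g x + c2 x * ?A1 x = c1 x * ?B1 x" using alg(1) G1(2) by blast
      then have "\<phi>1 x * (D f1 g x + c2 x * ?A1 x) = \<phi>1 x * (c1 x * ?B1 x)" by (rule arg_cong)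
      then show ?thesis using \<eta>(3)[OF True] unfolding c1_eq[symmetric] by (simp add: distrib_left mult.left_commute)
    qed (simp add: off[OF _ f1])
    show "\<phi>2 x * D h f2 x + c2 x * (\<phi>2 x * (\<eta> x * ?A2 x)) = (1 - hil c2 x) * (\<phi>2 x * ?B2 x)" for x
    proof (cases "x \<in> P ` K")
      case True
      then have "D h f2 x + c2 x * ?A2 x = c1 x * ?B2 x" using alg(2) G1(2) by blast
      then have "\<phi>2 x * (D h f2 x + c2 x * ?A2 x) = \<phi>2 x * (c1 x * ?B2 x)" by (rule arg_cong)
      then show ?thesis using \<eta>(3)[OF True] unfolding c1_eq[symmetric] by (simp add: distrib_left mult.left_commute)
    qed (simp add: off[OF _ f1])
    show "\<phi>1 x * kappa G P g h x f1 f = \<phi>1 x * D f1 f x + \<phi>1 x * (\<eta> x * ?A1 x) * D h f x + \<phi>1 x * ?B1 x * hil (D h f) x"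
      if x: "x \<notin> Z" and f: "f \<in> test_functions G" for x f
    proof (cases "x \<in> P ` K")
      case True
      then show ?thesis unfolding k1[OF x f] \<eta>(3)[OF True] by (simp only: distrib_left mult.assoc mult_1)
    next
      case False
      then show ?thesis unfolding k1[OF x f] by (simp add: off[OF False f])
    qed
    show "\<phi>2 x * kappa G P g h x f f2 = \<phi>2 x * D f f2 x + \<phi>2 x * (\<eta> x * ?A2 x) * D f g x + \<phi>2 x * ?B2 x * hil (D f g) x"
      if x: "x \<notin> Z" and f: "f \<in> test_functions G" for x f
    proof (cases "x \<in> P ` K")
      case True
      then show ?thesis unfolding k2[OF x f] \<eta>(3)[OF True] by (simp only: distrib_left mult.assoc mult_1)
    next
      case False
      then show ?thesis unfolding k2[OF x f] by (simp add: off[OF False f])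
    qed
    show "\<phi>1 x * \<phi>2 x * D f1 f2 x + \<phi>1 x * (\<phi>2 x * (\<eta> x * ?A2 x)) * D f1 g x + \<phi>2 x * (\<phi>1 x * (\<eta> x * ?A1 x)) * D h f2 x
        + \<phi>1 x * (\<eta> x * ?A1 x) * (\<phi>2 x * (\<eta> x * ?A2 x)) * c2 x + of_real (pi\<^sup>2) * c2 x * (\<phi>1 x * ?B1 x) * (\<phi>2 x * ?B2 x)
      = \<phi>1 x * \<phi>2 x * kappa G P g h x f1 f2" if x: "x \<notin> Z" for x
    proof (cases "x \<in> P ` K")
      case True
      define A1 A2 B1 B2 where AB: "A1 = ?A1 x" "A2 = ?A2 x" "B1 = ?B1 x" "B2 = ?B2 x"
      have "D f1 g x * A2 + D h f2 x * A1 + c2 x * A1 * A2 + (of_real pi)\<^sup>2 * c2 x * B1 * B2 = A1 * D h f2 x + B1 * hil (D h f2) x"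
        unfolding AB using True G1(2) by (intro alg(3)) auto
      then have "\<phi>1 x * \<phi>2 x * (D f1 f2 x + (D f1 g x * A2 + D h f2 x * A1 + c2 x * A1 * A2 + (of_real pi)\<^sup>2 * c2 x * B1 * B2))
          = \<phi>1 x * \<phi>2 x * (D f1 f2 x + A1 * D h f2 x + B1 * hil (D h f2) x)" by simp
      then show ?thesis
        unfolding k1[OF x f2] AB[symmetric] \<eta>(3)[OF True] by (simp add: algebra_simps)
    next
      case False
      then show ?thesis unfolding k1[OF x f2] by (simp add: off[OF False f2])
    qed
  qed
qed

section \<open>The relations for p, \<alpha> and \<alpha>'\<close>

context
  fixes \<phi> :: "real \<Rightarrow> complex"
  assumes \<phi>: "\<phi> \<in> test_functions {x \<in> P ` G. c2 x \<noteq> 0}"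
begin

lemma \<phi>_zero: "c2 x = 0 \<Longrightarrow> \<phi> x = 0"
  using \<phi> by (auto simp: test_functions_def intro: not_in_support)

text \<open>The test function is supported where C2 is nonzero; this makes division by C2 harmless
  and fits N, which is continuous only there.\<close>

lemma \<phi>_quotient_continuous:
  assumes "continuous_on {x. c2 x \<noteq> 0} q" shows "continuous_on UNIV (\<lambda>x. \<phi> x * q x)"
proof (rule continuous_mult_supported[OF test_function_lhold(3)[OF \<phi>] _ _ assms])
  show "support \<phi> \<subseteq> {x. c2 x \<noteq> 0}" using \<phi> by (auto simp: test_functions_def)
  show "open {x. c2 x \<noteq> 0}" by (intro open_Collect_neq continuous_on_const lhold_continuous lhold_c2)
qed

text \<open>p has no principal value part, so \<beta> = 0, and the linear condition says that p
  annihilates g from the right and h from the left.\<close>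

lemma admissible_p:
  assumes d: "lhold d"
  shows "admissible \<phi> (\<lambda>x. \<phi> x * (- d x / c2 x)) (\<lambda>x. 0)"
  unfolding admissible_def
  by (intro conjI test_function_lhold(3)[OF \<phi>] \<phi>_quotient_continuous continuous_intros lhold_continuous d lhold_c2 lhold_const csupp_zero) auto

text \<open>\<beta> contains N and has to be Hoelder continuous, although N is only assumed
  continuous; \<open>lhold_mult_root\<close> with d = (C1^2 + \<pi>^2 C2^2) C2 closes this
  gap.\<close>

lemma admissible_alpha:
  assumes N: "continuous_on {x. c2 x \<noteq> 0} N" "\<And>x. c2 x \<noteq> 0 \<Longrightarrow> (N x)\<^sup>2 = 1 / (dl x * c2 x)"
  shows "admissible (\<lambda>x. 0) (\<lambda>x. \<phi> x * (N x * c1 x)) (\<lambda>x. \<phi> x * N x * c2 x)"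
  unfolding admissible_def
proof (intro conjI)
  show "continuous_on UNIV (\<lambda>x. \<phi> x * (N x * c1 x))"
    by (intro \<phi>_quotient_continuous continuous_intros N lhold_continuous lhold_c1)
  have s: "support \<phi> \<subseteq> {x. c2 x \<noteq> 0}" "compact (support \<phi>)" using \<phi> by (auto simp: test_functions_def)
  have "lhold (\<lambda>x. \<phi> x * N x)"
  proof (rule lhold_mult_root[where E = "support \<phi>" and N = N and \<phi> = \<phi>, OF test_function_lhold(1)[OF \<phi>] s(2) _ continuous_on_subset[OF N(1) s(1)]])
    show "\<phi> x = 0" if "x \<notin> support \<phi>" for x using that by (rule not_in_support)
    show "lhold (\<lambda>x. dl x * c2 x)" by (intro lhold_mult lhold_dl lhold_c2)
    fix x assume "x \<in> support \<phi>"
    then have c: "c2 x \<noteq> 0" using s(1) by auto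
    \<comment> \<open>C2 vanishes off P(K), so a point with C2 x \<noteq> 0 lies in G1, where the
      denominator is nonzero.\<close>
    then have "x \<in> G1" using zero_off_K(1)[OF h g, of x] G1(2) by blast
    then show "(N x)\<^sup>2 * (dl x * c2 x) = 1" using N(2)[OF c] c dl_nz by simp
  qed
  then show "lhold (\<lambda>x. \<phi> x * N x * c2 x)" by (rule lhold_mult[OF _ lhold_c2])
  show "csupp (\<lambda>x. \<phi> x * N x * c2 x)" by (intro csupp_mult1 test_function_lhold[OF \<phi>])
qed simp

end

text \<open>With \<beta> = 0, the terms \<phi> \<alpha> contribute - 2 D f1 g D h f2 / C2 and the
  term \<alpha>1 \<alpha>2 gives one of these back. Where C2 = 0 the test functions vanish, so there
  is no exceptional set.\<close>

lemma p_relation: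
  assumes f1: "f1 \<in> test_functions G" and f2: "f2 \<in> test_functions G"
    and \<phi>1: "\<phi>1 \<in> test_functions {x \<in> P ` G. c2 x \<noteq> 0}" and \<phi>2: "\<phi>2 \<in> test_functions {x \<in> P ` G. c2 x \<noteq> 0}"
  shows "integrable lborel (\<lambda>x. \<phi>1 x * \<phi>2 x * p_form G P g h x f1 f2) \<and>
        has_product G \<phi>1 (\<lambda>x f. p_form G P g h x f1 f) \<phi>2 (\<lambda>x f. p_form G P g h x f f2)
          (LINT x|lborel. \<phi>1 x * \<phi>2 x * p_form G P g h x f1 f2)"
proof (rule has_product_reps[OF f1 f2 g h admissible_p[OF \<phi>1 delta_lhold[OF f1 g]] admissible_p[OF \<phi>2 delta_lhold[OF h f2]] _ _ countable_empty])
  note z = \<phi>_zero[OF \<phi>1] \<phi>_zero[OF \<phi>2]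
  show "\<phi>1 x * D f1 g x + c2 x * (\<phi>1 x * (- D f1 g x / c2 x)) = (1 - hil c2 x) * 0" for x
    using z[of x] by (cases "c2 x = 0") auto
  show "\<phi>2 x * D h f2 x + c2 x * (\<phi>2 x * (- D h f2 x / c2 x)) = (1 - hil c2 x) * 0" for x
    using z[of x] by (cases "c2 x = 0") auto
  show "\<phi>1 x * p_form G P g h x f1 f = \<phi>1 x * D f1 f x + \<phi>1 x * (- D f1 g x / c2 x) * D h f x + 0 * hil (D h f) x" for x f
    by (simp add: p_form_def algebra_simps)
  show "\<phi>2 x * p_form G P g h x f f2 = \<phi>2 x * D f f2 x + \<phi>2 x * (- D h f2 x / c2 x) * D f g x + 0 * hil (D f g) x" for x f
    by (simp add: p_form_def algebra_simps)
  show "\<phi>1 x * \<phi>2 x * D f1 f2 x + \<phi>1 x * (\<phi>2 x * (- D h f2 x / c2 x)) * D f1 g x + \<phi>2 x * (\<phi>1 x * (- D f1 g x / c2 x)) * D h f2 x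
      + \<phi>1 x * (- D f1 g x / c2 x) * (\<phi>2 x * (- D h f2 x / c2 x)) * c2 x + of_real (pi\<^sup>2) * c2 x * 0 * 0
     = \<phi>1 x * \<phi>2 x * p_form G P g h x f1 f2" for x
    using z[of x] by (cases "c2 x = 0") (auto simp: p_form_def algebra_simps)
qed

context
  fixes N :: "real \<Rightarrow> complex"
  assumes N: "continuous_on {x. c2 x \<noteq> 0} N" "\<And>x. c2 x \<noteq> 0 \<Longrightarrow> (N x)\<^sup>2 = 1 / (dl x * c2 x)"
begin

lemma alpha_ket_eq: "f \<in> test_functions G \<Longrightarrow> \<phi> x * alpha_ket G P g h N x f
    = 0 * D f g x + \<phi> x * (N x * c1 x) * D f g x + \<phi> x * N x * c2 x * hil (D f g) x"
  by (simp add: alpha_ket_def C1_fun_eq[OF g h] C2_fun_def pv_form_eq[OF _ g] algebra_simps)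

lemma alpha_bra_eq: "f \<in> test_functions G \<Longrightarrow> \<phi> x * alpha_bra G P g h N x f
    = 0 * D h f x + \<phi> x * (N x * c1 x) * D h f x + \<phi> x * N x * c2 x * hil (D h f) x"
  by (simp add: alpha_bra_def C1_fun_eq[OF g h] C2_fun_def pv_form_eq[OF h] algebra_simps)

lemma alpha_condition: "0 * d + c2 x * (\<phi> x * (N x * c1 x)) = (1 - hil c2 x) * (\<phi> x * N x * c2 x)"
  by (simp add: c1_eq)

lemma admissible_alpha_N:
  assumes "\<phi> \<in> test_functions {x \<in> P ` G. c2 x \<noteq> 0}"
  shows "admissible (\<lambda>x. 0) (\<lambda>x. \<phi> x * (N x * c1 x)) (\<lambda>x. \<phi> x * N x * c2 x)"
  by (rule admissible_alpha[OF assms N(1)]) (rule N(2))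

text \<open>The ket of \<alpha> consists of \<delta>(x - \<Omega>)|g> and its principal value
  counterpart, so the slot of a free ket is filled with g under the coefficient 0. Since \<beta> = 0
  on the side of p, the linear condition for p alone makes the integrand vanish.\<close>

lemma p_alpha_relation:
  assumes f1: "f1 \<in> test_functions G"
    and \<phi>1: "\<phi>1 \<in> test_functions {x \<in> P ` G. c2 x \<noteq> 0}" and \<phi>2: "\<phi>2 \<in> test_functions {x \<in> P ` G. c2 x \<noteq> 0}"
  shows "has_product G \<phi>1 (\<lambda>x f. p_form G P g h x f1 f) \<phi>2 (alpha_ket G P g h N) 0"
proof -
  have "integrable lborel (\<lambda>x::real. 0::complex) \<and> has_product G \<phi>1 (\<lambda>x f. p_form G P g h x f1 f) \<phi>2 (alpha_ket G P g h N) (LINT x::real|lborel. 0)"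
  proof (rule has_product_reps[OF f1 g g h admissible_p[OF \<phi>1 delta_lhold[OF f1 g]] admissible_alpha_N[OF \<phi>2] _ _ countable_empty])
    show "0 * D h g x + c2 x * (\<phi>2 x * (N x * c1 x)) = (1 - hil c2 x) * (\<phi>2 x * N x * c2 x)" for x
      by (rule alpha_condition)
    show "\<phi>1 x * D f1 g x + c2 x * (\<phi>1 x * (- D f1 g x / c2 x)) = (1 - hil c2 x) * 0" for x
      using \<phi>_zero[OF \<phi>1, of x] by (cases "c2 x = 0") auto
    show "\<phi>1 x * p_form G P g h x f1 f = \<phi>1 x * D f1 f x + \<phi>1 x * (- D f1 g x / c2 x) * D h f x + 0 * hil (D h f) x" for x f
      by (simp add: p_form_def algebra_simps)
    show "\<phi>1 x * 0 * D f1 g x + \<phi>1 x * (\<phi>2 x * (N x * c1 x)) * D f1 g x + 0 * (\<phi>1 x * (- D f1 g x / c2 x)) * D h g x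
        + \<phi>1 x * (- D f1 g x / c2 x) * (\<phi>2 x * (N x * c1 x)) * c2 x + of_real (pi\<^sup>2) * c2 x * 0 * (\<phi>2 x * N x * c2 x) = 0" for x
      using \<phi>_zero[OF \<phi>1, of x] by (cases "c2 x = 0") (auto simp: algebra_simps)
  qed (rule alpha_ket_eq)
  then show ?thesis by simp
qed

lemma alpha_p_relation:
  assumes f2: "f2 \<in> test_functions G"
    and \<phi>1: "\<phi>1 \<in> test_functions {x \<in> P ` G. c2 x \<noteq> 0}" and \<phi>2: "\<phi>2 \<in> test_functions {x \<in> P ` G. c2 x \<noteq> 0}"
  shows "has_product G \<phi>1 (alpha_bra G P g h N) \<phi>2 (\<lambda>x f. p_form G P g h x f f2) 0"
proof -
  have "integrable lborel (\<lambda>x::real. 0::complex) \<and> has_product G \<phi>1 (alpha_bra G P g h N) \<phi>2 (\<lambda>x f. p_form G P g h x f f2) (LINT x::real|lborel. 0)"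
  proof (rule has_product_reps[OF h f2 g h admissible_alpha_N[OF \<phi>1] admissible_p[OF \<phi>2 delta_lhold[OF h f2]] _ _ countable_empty])
    show "0 * D h g x + c2 x * (\<phi>1 x * (N x * c1 x)) = (1 - hil c2 x) * (\<phi>1 x * N x * c2 x)" for x
      by (rule alpha_condition)
    show "\<phi>2 x * D h f2 x + c2 x * (\<phi>2 x * (- D h f2 x / c2 x)) = (1 - hil c2 x) * 0" for x
      using \<phi>_zero[OF \<phi>2, of x] by (cases "c2 x = 0") auto
    show "\<phi>2 x * p_form G P g h x f f2 = \<phi>2 x * D f f2 x + \<phi>2 x * (- D h f2 x / c2 x) * D f g x + 0 * hil (D f g) x" for x f
      by (simp add: p_form_def algebra_simps)
    show "0 * \<phi>2 x * D h f2 x + 0 * (\<phi>2 x * (- D h f2 x / c2 x)) * D h g x + \<phi>2 x * (\<phi>1 x * (N x * c1 x)) * D h f2 x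
        + \<phi>1 x * (N x * c1 x) * (\<phi>2 x * (- D h f2 x / c2 x)) * c2 x + of_real (pi\<^sup>2) * c2 x * (\<phi>1 x * N x * c2 x) * 0 = 0" for x
      using \<phi>_zero[OF \<phi>2, of x] by (cases "c2 x = 0") (auto simp: algebra_simps)
  qed (rule alpha_bra_eq)
  then show ?thesis by simp
qed

text \<open>The \<alpha>-terms and the \<beta>-terms add up to N^2 (C1^2 + \<pi>^2 C2^2) C2, which
  the normalization sets equal to 1.\<close>

lemma alpha_alpha_relation:
  assumes \<phi>1: "\<phi>1 \<in> test_functions {x \<in> P ` G. c2 x \<noteq> 0}" and \<phi>2: "\<phi>2 \<in> test_functions {x \<in> P ` G. c2 x \<noteq> 0}"
  shows "has_product G \<phi>1 (alpha_bra G P g h N) \<phi>2 (alpha_ket G P g h N) (LINT x|lborel. \<phi>1 x * \<phi>2 x)"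
proof -
  have "integrable lborel (\<lambda>x. \<phi>1 x * \<phi>2 x) \<and> has_product G \<phi>1 (alpha_bra G P g h N) \<phi>2 (alpha_ket G P g h N) (LINT x|lborel. \<phi>1 x * \<phi>2 x)"
  proof (rule has_product_reps[OF h g g h admissible_alpha_N[OF \<phi>1] admissible_alpha_N[OF \<phi>2] _ _ countable_empty])
    show "0 * D h g x + c2 x * (\<phi>1 x * (N x * c1 x)) = (1 - hil c2 x) * (\<phi>1 x * N x * c2 x)" for x
      by (rule alpha_condition)
    show "0 * D h g x + c2 x * (\<phi>2 x * (N x * c1 x)) = (1 - hil c2 x) * (\<phi>2 x * N x * c2 x)" for x
      by (rule alpha_condition)
    show "0 * 0 * D h g x + 0 * (\<phi>2 x * (N x * c1 x)) * D h g x + 0 * (\<phi>1 x * (N x * c1 x)) * D h g x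
        + \<phi>1 x * (N x * c1 x) * (\<phi>2 x * (N x * c1 x)) * c2 x + of_real (pi\<^sup>2) * c2 x * (\<phi>1 x * N x * c2 x) * (\<phi>2 x * N x * c2 x)
       = \<phi>1 x * \<phi>2 x" for x
    proof (cases "c2 x = 0")
      case False
      have "x \<in> G1" using False zero_off_K(1)[OF h g, of x] G1(2) by blast
      then have one: "(N x)\<^sup>2 * (dl x * c2 x) = 1" using N(2)[OF False] False dl_nz by simp
      have "\<phi>1 x * (N x * c1 x) * (\<phi>2 x * (N x * c1 x)) * c2 x + of_real (pi\<^sup>2) * c2 x * (\<phi>1 x * N x * c2 x) * (\<phi>2 x * N x * c2 x)
         = \<phi>1 x * \<phi>2 x * ((N x)\<^sup>2 * (dl x * c2 x))"
        by (simp add: dl_eq power2_eq_square algebra_simps)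
      then show ?thesis unfolding one by simp
    qed (simp add: \<phi>_zero[OF \<phi>1])
  qed (rule alpha_bra_eq alpha_ket_eq; assumption)+
  then show ?thesis by simp
qed

end

lemma res_limits:
  assumes f1: "f1 \<in> test_functions G" and f2: "f2 \<in> test_functions G" and F: "F \<in> {at_left 0, at_right 0}" and x: "x \<notin> Z"
  shows "\<exists>l. ((\<lambda>u. inner_L2 G f1 (res_Ham G P g h (Complex x u) f2)) \<longlongrightarrow> l) F"
proof -
  have "c1 x + \<i> * of_real pi * c2 x \<noteq> 0" "c1 x - \<i> * of_real pi * c2 x \<noteq> 0"
    using dl_nz_off_Z[OF x] by (auto simp: \<Delta>_factor[OF g h])
  then show ?thesis using res_limit_left[OF g h f1 f2, of x] res_limit_right[OF g h f1 f2, of x] F by blast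
qed

lemma res_limits_G1:
  assumes f1: "f1 \<in> test_functions G" and f2: "f2 \<in> test_functions G" and F: "F \<in> {at_left 0, at_right 0}" and x: "x \<in> G1"
  shows "\<exists>l. ((\<lambda>u. inner_L2 G f1 (res_Ham G P g h (Complex x u) f2)) \<longlongrightarrow> l) F"
proof -
  have "c1 x + \<i> * of_real pi * c2 x \<noteq> 0" "c1 x - \<i> * of_real pi * c2 x \<noteq> 0"
    using dl_nz[OF x] by (auto simp: \<Delta>_factor[OF g h])
  then show ?thesis using res_limit_left[OF g h f1 f2, of x] res_limit_right[OF g h f1 f2, of x] F by blast
qed

end

theorem proposition8:
  fixes G K :: "'a::euclidean_space set" and P :: "'a \<Rightarrow> real"
    and g h :: "'a \<Rightarrow> complex" and G1 I :: "real set" and N :: "real \<Rightarrow> complex"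
  assumes "open G" and "bounded G"
    and "smooth_on G P"
    and "\<And>bs. bs \<in> lists Basis \<Longrightarrow> bounded (iter_pderiv bs P ` G)"
    and "\<And>y. y \<in> G \<Longrightarrow> grad P y \<noteq> 0"
    and "g \<in> test_functions G" and "\<And>y. g y \<in> \<real>"
    and "h \<in> test_functions G" and "\<And>y. h y \<in> \<real>"
    and "compact K" and "K \<subseteq> G" and "support g \<subseteq> K" and "support h \<subseteq> K"
    and "open G1" and "P ` K \<subseteq> G1"
    and "open I" and "is_interval I" and "0 \<in> I"
    and "C_fun G P g h holomorphic_on ({z. Re z \<in> G1 \<and> Im z \<in> I} - of_real ` P ` K)"
    and "\<And>z. z \<in> {z. Re z \<in> G1 \<and> Im z \<in> I} - of_real ` P ` K \<Longrightarrow> C_fun G P g h z \<noteq> 0"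
    and "\<And>x. x \<in> G1 \<Longrightarrow>
           ((\<lambda>u. C_fun G P g h (Complex x u))
              \<longlongrightarrow> C1_fun G P g h x + \<i> * of_real pi * C2_fun G P g h x) (at_right 0)"
    and "\<And>x. x \<in> G1 \<Longrightarrow>
           ((\<lambda>u. C_fun G P g h (Complex x u))
              \<longlongrightarrow> C1_fun G P g h x - \<i> * of_real pi * C2_fun G P g h x) (at_left 0)"
    and "\<And>x. x \<in> G1 \<Longrightarrow> C1_fun G P g h x + \<i> * of_real pi * C2_fun G P g h x \<noteq> 0"
    and "\<And>x. x \<in> G1 \<Longrightarrow> C1_fun G P g h x - \<i> * of_real pi * C2_fun G P g h x \<noteq> 0"
    and "\<And>x f. x \<in> G1 \<Longrightarrow> C2_fun G P g h x = 0 \<Longrightarrow> f \<in> test_functions G \<Longrightarrow>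
           delta_form G P x f g = 0 \<and> delta_form G P x h f = 0"
    and "continuous_on {x. C2_fun G P g h x \<noteq> 0} N"
    and "\<And>x. C2_fun G P g h x \<noteq> 0 \<Longrightarrow>
           (N x)\<^sup>2 = 1 / (((C1_fun G P g h x)\<^sup>2 + (of_real pi)\<^sup>2 * (C2_fun G P g h x)\<^sup>2)
                          * C2_fun G P g h x)"
  shows
    "\<comment> \<open>the surface integrals, the principal values and the boundary values defining \<open>\<kappa>\<close>
        make sense\<close>
     (\<forall>x. \<exists>!\<sigma>. is_surface_measure (level_set G P x) \<sigma>) \<and>
     (\<forall>f1\<in>test_functions G. \<forall>f2\<in>test_functions G.
        (\<forall>x. integrable (surface_measure (level_set G P x))
                (\<lambda>y. cnj (f1 y) * f2 y / of_real (norm (grad P y)))) \<and>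
        (\<forall>x. \<exists>l. (pv_truncated (\<lambda>\<omega>. delta_form G P \<omega> f1 f2) x \<longlongrightarrow> l) (at_right 0)) \<and>
        (\<forall>F\<in>{at_left 0, at_right 0}.
           (\<forall>x\<in>G1. \<exists>l. ((\<lambda>u. inner_L2 G f1 (res_Ham G P g h (Complex x u) f2)) \<longlongrightarrow> l) F) \<and>
           (AE x in lborel. x \<in> P ` G \<longrightarrow>
              (\<exists>l. ((\<lambda>u. inner_L2 G f1 (res_Ham G P g h (Complex x u) f2)) \<longlongrightarrow> l) F)))) \<and>
     \<comment> \<open>\<open>\<kappa>(x) \<kappa>(x') = \<delta>(x - x') \<kappa>(x)\<close>\<close>
     (\<forall>f1\<in>test_functions G. \<forall>f2\<in>test_functions G.
      \<forall>\<phi>1\<in>test_functions (P ` G). \<forall>\<phi>2\<in>test_functions (P ` G).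
        integrable lborel (\<lambda>x. \<phi>1 x * \<phi>2 x * kappa G P g h x f1 f2) \<and>
        has_product G \<phi>1 (\<lambda>x f. kappa G P g h x f1 f) \<phi>2 (\<lambda>x f. kappa G P g h x f f2)
          (LINT x|lborel. \<phi>1 x * \<phi>2 x * kappa G P g h x f1 f2)) \<and>
     \<comment> \<open>\<open>p(x) p(x') = \<delta>(x - x') p(x)\<close>\<close>
     (\<forall>f1\<in>test_functions G. \<forall>f2\<in>test_functions G.
      \<forall>\<phi>1\<in>test_functions {x \<in> P ` G. C2_fun G P g h x \<noteq> 0}.
      \<forall>\<phi>2\<in>test_functions {x \<in> P ` G. C2_fun G P g h x \<noteq> 0}.
        integrable lborel (\<lambda>x. \<phi>1 x * \<phi>2 x * p_form G P g h x f1 f2) \<and>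
        has_product G \<phi>1 (\<lambda>x f. p_form G P g h x f1 f) \<phi>2 (\<lambda>x f. p_form G P g h x f f2)
          (LINT x|lborel. \<phi>1 x * \<phi>2 x * p_form G P g h x f1 f2)) \<and>
     \<comment> \<open>\<open>p(x) |\<alpha>(x')\<rangle> = 0\<close>\<close>
     (\<forall>f1\<in>test_functions G.
      \<forall>\<phi>1\<in>test_functions {x \<in> P ` G. C2_fun G P g h x \<noteq> 0}.
      \<forall>\<phi>2\<in>test_functions {x \<in> P ` G. C2_fun G P g h x \<noteq> 0}.
        has_product G \<phi>1 (\<lambda>x f. p_form G P g h x f1 f) \<phi>2 (alpha_ket G P g h N) 0) \<and>
     \<comment> \<open>\<open>\<langle>\<alpha>'(x)| p(x') = 0\<close>\<close>
     (\<forall>f2\<in>test_functions G.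
      \<forall>\<phi>1\<in>test_functions {x \<in> P ` G. C2_fun G P g h x \<noteq> 0}.
      \<forall>\<phi>2\<in>test_functions {x \<in> P ` G. C2_fun G P g h x \<noteq> 0}.
        has_product G \<phi>1 (alpha_bra G P g h N) \<phi>2 (\<lambda>x f. p_form G P g h x f f2) 0) \<and>
     \<comment> \<open>\<open>\<langle>\<alpha>'(x)|\<alpha>(x')\<rangle> = \<delta>(x - x')\<close>\<close>
     (\<forall>\<phi>1\<in>test_functions {x \<in> P ` G. C2_fun G P g h x \<noteq> 0}.
      \<forall>\<phi>2\<in>test_functions {x \<in> P ` G. C2_fun G P g h x \<noteq> 0}.
        has_product G \<phi>1 (alpha_bra G P g h N) \<phi>2 (alpha_ket G P g h N)
          (LINT x|lborel. \<phi>1 x * \<phi>2 x))"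
proof -
  interpret rank_one G P g h K G1
  proof
    show "C1_on G P" by (rule smooth_on_C1(1)[OF assms(3,1)])
    show "C1_on G (pd P b)" if "b \<in> Basis" for b by (rule smooth_on_C1(2)[OF assms(3,1) that])
  qed (fact assms)+
  have N: "continuous_on {x. c2 x \<noteq> 0} N" "\<And>x. c2 x \<noteq> 0 \<Longrightarrow> (N x)\<^sup>2 = 1 / (dl x * c2 x)"
    using assms(26,27) by (simp_all only: C2_fun_eq C1_fun_eq[OF g h] dl_eq)
  \<comment> \<open>Off the countable set Z both boundary values of C are nonzero, so the resolvent
    of H has boundary values almost everywhere, also outside G1.\<close>
  have "AE x in lborel. x \<notin> Z"
    by (rule AE_I'[OF countable_imp_null_set_lborel[OF countable_Z]]) auto
  then have AE: "AE x in lborel. x \<in> P ` G \<longrightarrow>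
      (\<exists>l. ((\<lambda>u. inner_L2 G f1 (res_Ham G P g h (Complex x u) f2)) \<longlongrightarrow> l) F)"
    if "f1 \<in> test_functions G" "f2 \<in> test_functions G" "F \<in> {at_left 0, at_right 0}" for f1 f2 F
    by (rule AE_mp) (use res_limits[OF that] in \<open>auto intro!: AE_I2\<close>)
  have pv: "\<exists>l. (pv_truncated (\<lambda>\<omega>. delta_form G P \<omega> f1 f2) x \<longlongrightarrow> l) (at_right 0)"
    if "f1 \<in> test_functions G" "f2 \<in> test_functions G" for f1 f2 x
    using pv_tendsto[OF that] by blast
  show ?thesis
    unfolding C2_fun_eq
    by (intro conjI ballI allI ex1_is_surface_measure delta_integrable pv AE res_limits_G1
        kappa_relation[THEN conjunct1] kappa_relation[THEN conjunct2]
        p_relation[THEN conjunct1] p_relation[THEN conjunct2]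
        p_alpha_relation[OF N] alpha_p_relation[OF N] alpha_alpha_relation[OF N])
qed

end
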